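(* Under the assumption $2\alpha+\gamma>1$, the system $\{\mu_n^{-1/2}\phi_n\}_{n=1}^\infty$ (and also $\{\|\phi_n\|_V^{-1}\phi_n\}_{n=1}^\infty$) is a Riesz basis in $V$.
   Context: $H$ is a separable infinite-dimensional complex Hilbert space with inner product $(\cdot,\cdot)$ and norm $\|\cdot\|$. $a$ is a closed, densely defined, Hermitian, positive-definite sesquilinear form with domain $V\subset H$, and $A$ is the associated self-adjoint operator: $V=D(A^{1/2})$, $a(u,v)=(A^{1/2}u,A^{1/2}v)=:(u,v)_V$, $\|u\|_V=\|A^{1/2}u\|$. $A$ has compact resolvent, with eigenvalues $0<\mu_1\le\mu_2\le\dots$ (with multiplicity) and an orthonormal basis of eigenvectors $\psi_k$ of $H$. $b$ is a sesquilinear form on $V$ (continuous in the $V$-norm, hence determined by the values $b(\psi_m,\psi_n)$). Standing assumptions: there are $\gamma>0$, $\kappa>0$, $N_0>0$ with $\mu_{k+1}-\mu_k\ge\kappa k^{\gamma-1}$ for all $k\ge N_0$; and there are $\alpha\in\mathbb R$ with $2\alpha+\gamma>1$ and $M_b>0$ with $|b(\psi_m,\psi_n)|\le M_bm^{-\alpha}n^{-\alpha}$ for all $m,n\in\mathbb N$. Then $t=a+b$ is a closed sectorial form on $V$ and $T$ denotes the associated m-sectorial operator; $T$ has compact resolvent. For all sufficiently large $n$, $n>N$, $T$ has exactly one eigenvalue $\lambda_n$ inside the positively oriented contour $\Gamma_n=\partial\Pi_n$, $\Pi_n=\{z\in\mathbb C:\mu_n-\frac\kappa2(n-1)^{\gamma-1}<\operatorname{Re}z<\mu_n+\frac\kappa2n^{\gamma-1},\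 |\operatorname{Im}z|<\frac\kappa2n^{\gamma-1}\}$; it is algebraically simple, and $\phi_n=\frac1{2\pi i}\int_{\Gamma_n}(z-T)^{-1}\psi_n\,dz$ is a corresponding eigenvector. For $n\le N$ the $\phi_n$ are root vectors (generalized eigenvectors) forming a basis of the ($N$-dimensional) direct sum of the root subspaces of $T$ for the remaining eigenvalues. *)

theory Defs
  imports "HOL-Complex_Analysis.Complex_Analysis"
begin

text \<open>
  Complex Hilbert spaces. Inner products and sesquilinear forms are linear in the first and
  conjugate-linear in the second argument.
\<close>

class complex_hilbert = banach +
  fixes scaleC :: "complex \<Rightarrow> 'a \<Rightarrow> 'a" (infixr \<open>*\<^sub>C\<close> 75)
    and cinner :: "'a \<Rightarrow> 'a \<Rightarrow> complex"
  assumes scaleC_add_right: "c *\<^sub>C (x + y) = c *\<^sub>C x + c *\<^sub>C y"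
    and scaleC_add_left: "(c + d) *\<^sub>C x = c *\<^sub>C x + d *\<^sub>C x"
    and scaleC_scaleC: "c *\<^sub>C d *\<^sub>C x = (c * d) *\<^sub>C x"
    and scaleC_of_real: "complex_of_real r *\<^sub>C x = r *\<^sub>R x"
    and cinner_commute: "cinner x y = cnj (cinner y x)"
    and cinner_add_left: "cinner (x + y) z = cinner x z + cinner y z"
    and cinner_scaleC_left: "cinner (c *\<^sub>C x) y = c * cinner x y"
    and cinner_self: "cinner x x = complex_of_real ((norm x)\<^sup>2)"

global_interpretation complex_vector:
  vector_space "scaleC :: complex \<Rightarrow> 'a \<Rightarrow> 'a :: complex_hilbert"
proof
  fix x :: 'a
  show "1 *\<^sub>C x = x"
    using scaleC_of_real[of 1 x] by simp
qed (simp_all add: scaleC_add_right scaleC_add_left scaleC_scaleC)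


section \<open>Sesquilinear forms\<close>

type_synonym 'a form = "'a \<Rightarrow> 'a \<Rightarrow> complex"

text \<open>A form with domain \<open>V\<close> is a function whose values outside \<open>V\<close> are irrelevant.\<close>

definition sesquilinear_on :: "'a::complex_hilbert set \<Rightarrow> 'a form \<Rightarrow> bool" where
  "sesquilinear_on V s \<longleftrightarrow>
     (\<forall>u\<in>V. \<forall>v\<in>V. \<forall>w\<in>V. s (u + v) w = s u w + s v w \<and> s w (u + v) = s w u + s w v) \<and>
     (\<forall>c. \<forall>u\<in>V. \<forall>v\<in>V. s (c *\<^sub>C u) v = c * s u v \<and> s u (c *\<^sub>C v) = cnj c * s u v)"

definition hermitian_on :: "'a::complex_hilbert set \<Rightarrow> 'a form \<Rightarrow> bool" where
  "hermitian_on V s \<longleftrightarrow> (\<forall>u\<in>V. \<forall>v\<in>V. s u v = cnj (s v u))"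

definition positive_definite_on :: "'a::complex_hilbert set \<Rightarrow> 'a form \<Rightarrow> bool" where
  "positive_definite_on V s \<longleftrightarrow> (\<forall>u\<in>V. u \<noteq> 0 \<longrightarrow> s u u \<in> \<real> \<and> 0 < Re (s u u))"

text \<open>Kato's notion: limits of form-convergent sequences stay in the domain.\<close>

definition closed_form_on :: "'a::complex_hilbert set \<Rightarrow> 'a form \<Rightarrow> bool" where
  "closed_form_on V s \<longleftrightarrow>
     (\<forall>x u. (\<forall>n::nat. x n \<in> V) \<longrightarrow> x \<longlonglongrightarrow> u \<longrightarrow>
        (\<forall>e>0. \<exists>M. \<forall>m\<ge>M. \<forall>n\<ge>M. cmod (s (x m - x n) (x m - x n)) < e) \<longrightarrow>
        u \<in> V \<and> (\<lambda>n. s (x n - u) (x n - u)) \<longlonglongrightarrow> 0)"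

definition form_norm :: "'a::complex_hilbert form \<Rightarrow> 'a \<Rightarrow> real" where
  "form_norm s u = sqrt (Re (s u u))"


section \<open>Orthonormal and Riesz bases of a subspace with its own inner product\<close>

definition orthonormal_basis_on ::
    "'a::complex_hilbert set \<Rightarrow> 'a form \<Rightarrow> 'i set \<Rightarrow> ('i \<Rightarrow> 'a) \<Rightarrow> bool" where
  "orthonormal_basis_on V s I e \<longleftrightarrow>
     (\<forall>i\<in>I. e i \<in> V) \<and>
     (\<forall>i\<in>I. \<forall>j\<in>I. s (e i) (e j) = of_bool (i = j)) \<and>
     (\<forall>v\<in>V. \<forall>\<epsilon>>0. \<exists>x\<in>complex_vector.span (e ` I). form_norm s (v - x) < \<epsilon>)"

text \<open>
  A Riesz basis is the image of an orthonormal basis under a bounded linear bijection with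
  bounded inverse, boundedness being with respect to the norm of the given inner product.
\<close>

definition riesz_basis_on ::
    "'a::complex_hilbert set \<Rightarrow> 'a form \<Rightarrow> 'i set \<Rightarrow> ('i \<Rightarrow> 'a) \<Rightarrow> bool" where
  "riesz_basis_on V s I f \<longleftrightarrow>
     (\<exists>e S. orthonormal_basis_on V s I e \<and>
        (\<forall>u\<in>V. \<forall>v\<in>V. S (u + v) = S u + S v) \<and> (\<forall>c. \<forall>u\<in>V. S (c *\<^sub>C u) = c *\<^sub>C S u) \<and>
        bij_betw S V V \<and>
        (\<exists>c>0. \<exists>C. \<forall>u\<in>V. c * form_norm s u \<le> form_norm s (S u) \<and>
                          form_norm s (S u) \<le> C * form_norm s u) \<and>
        (\<forall>i\<in>I. f i = S (e i)))"


section \<open>Unbounded operators, represented by their graphs\<close>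

type_synonym 'a operator = "('a \<times> 'a) set"

text \<open>
  The operator associated with a densely defined form by the representation theorem:
  \<open>u\<close> is in its domain and mapped to \<open>f\<close> iff \<open>s(u,v) = (f,v)\<close> for all \<open>v \<in> V\<close>.
\<close>

definition form_operator :: "'a::complex_hilbert set \<Rightarrow> 'a form \<Rightarrow> 'a operator" where
  "form_operator V s = {(u, f). u \<in> V \<and> (\<forall>v\<in>V. s u v = cinner f v)}"

definition eigenvalue :: "'a::complex_hilbert operator \<Rightarrow> complex \<Rightarrow> bool" where
  "eigenvalue T z \<longleftrightarrow> (\<exists>u. u \<noteq> 0 \<and> (u, z *\<^sub>C u) \<in> T)"

text \<open>The graph of \<open>T - z\<close>.\<close>

definition op_shift :: "'a::complex_hilbert operator \<Rightarrow> complex \<Rightarrow> 'a operator" where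
  "op_shift T z = {(u, f - z *\<^sub>C u) | u f. (u, f) \<in> T}"

text \<open>The union of the kernels of the powers of \<open>T - z\<close>.\<close>

definition root_subspace :: "'a::complex_hilbert operator \<Rightarrow> complex \<Rightarrow> 'a set" where
  "root_subspace T z = {u. \<exists>k. (u, 0) \<in> op_shift T z ^^ k}"

text \<open>Linearity over the complex numbers of the inverse \<open>R\<close> of \<open>z - T\<close> is inherited from \<open>T\<close>.\<close>

definition is_resolvent ::
    "'a::complex_hilbert operator \<Rightarrow> complex \<Rightarrow> ('a \<Rightarrow> 'a) \<Rightarrow> bool" where
  "is_resolvent T z R \<longleftrightarrow>
     bounded_linear R \<and>
     (\<forall>f. (R f, z *\<^sub>C R f - f) \<in> T) \<and>
     (\<forall>(u, g)\<in>T. R (z *\<^sub>C u - g) = u)"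

definition resolvent_set :: "'a::complex_hilbert operator \<Rightarrow> complex set" where
  "resolvent_set T = {z. \<exists>R. is_resolvent T z R}"

definition resolvent :: "'a::complex_hilbert operator \<Rightarrow> complex \<Rightarrow> 'a \<Rightarrow> 'a" where
  "resolvent T z = (THE R. is_resolvent T z R)"

definition has_compact_resolvent :: "'a::complex_hilbert operator \<Rightarrow> bool" where
  "has_compact_resolvent T \<longleftrightarrow>
     resolvent_set T \<noteq> {} \<and>
     (\<forall>z\<in>resolvent_set T. compact (closure (resolvent T z ` cball 0 1)))"


section \<open>Localisation of the spectrum and the system of root vectors\<close>

text \<open>The library's \<^const>\<open>contour_integral\<close>, for functions with values in a Hilbert space.\<close>

definition vec_contour_integral ::
    "(real \<Rightarrow> complex) \<Rightarrow> (complex \<Rightarrow> 'a::complex_hilbert) \<Rightarrow> 'a" where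
  "vec_contour_integral g F =
     integral {0..1} (\<lambda>t. vector_derivative g (at t within {0..1}) *\<^sub>C F (g t))"

text \<open>Lower left and upper right corners of the rectangle \<open>\<Pi>\<^sub>n\<close>.\<close>

definition corner_ll :: "real \<Rightarrow> real \<Rightarrow> (nat \<Rightarrow> real) \<Rightarrow> nat \<Rightarrow> complex" where
  "corner_ll \<kappa> \<gamma> \<mu> n =
     Complex (\<mu> n - \<kappa> / 2 * (real n - 1) powr (\<gamma> - 1)) (- (\<kappa> / 2 * real n powr (\<gamma> - 1)))"

definition corner_ur :: "real \<Rightarrow> real \<Rightarrow> (nat \<Rightarrow> real) \<Rightarrow> nat \<Rightarrow> complex" where
  "corner_ur \<kappa> \<gamma> \<mu> n =
     Complex (\<mu> n + \<kappa> / 2 * real n powr (\<gamma> - 1)) (\<kappa> / 2 * real n powr (\<gamma> - 1))"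

definition Pi_rect :: "real \<Rightarrow> real \<Rightarrow> (nat \<Rightarrow> real) \<Rightarrow> nat \<Rightarrow> complex set" where
  "Pi_rect \<kappa> \<gamma> \<mu> n = box (corner_ll \<kappa> \<gamma> \<mu> n) (corner_ur \<kappa> \<gamma> \<mu> n)"

definition Gamma_contour :: "real \<Rightarrow> real \<Rightarrow> (nat \<Rightarrow> real) \<Rightarrow> nat \<Rightarrow> real \<Rightarrow> complex" where
  "Gamma_contour \<kappa> \<gamma> \<mu> n = rectpath (corner_ll \<kappa> \<gamma> \<mu> n) (corner_ur \<kappa> \<gamma> \<mu> n)"

text \<open>
  \<open>\<phi>\<close> (used for indices \<open>n \<ge> 1\<close> only) is a system as constructed from the Riesz projections:
  for \<open>n > N\<close> the operator \<open>T\<close> has exactly one eigenvalue in \<open>\<Pi>\<^sub>n\<close> and none on its boundary, this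
  eigenvalue is algebraically simple and \<open>\<phi> n\<close> is the eigenvector
  \<open>(2\<pi>i)\<^sup>-\<^sup>1 \<integral> (z - T)\<^sup>-\<^sup>1 \<psi>\<^sub>n dz\<close>, while \<open>\<phi> 1, \<dots>, \<phi> N\<close> are root vectors forming a basis of the sum
  of the root subspaces of all other eigenvalues (which thus has dimension \<open>N\<close>).
\<close>

definition root_system ::
    "'a::complex_hilbert operator \<Rightarrow> real \<Rightarrow> real \<Rightarrow> (nat \<Rightarrow> real) \<Rightarrow> (nat \<Rightarrow> 'a) \<Rightarrow>
     nat \<Rightarrow> (nat \<Rightarrow> 'a) \<Rightarrow> bool" where
  "root_system T \<kappa> \<gamma> \<mu> \<psi> N \<phi> \<longleftrightarrow>
     (\<forall>n>N.
        path_image (Gamma_contour \<kappa> \<gamma> \<mu> n) \<subseteq> resolvent_set T \<and>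
        \<phi> n = (1 / (2 * pi * \<i>)) *\<^sub>C
                vec_contour_integral (Gamma_contour \<kappa> \<gamma> \<mu> n) (\<lambda>z. resolvent T z (\<psi> n)) \<and>
        (\<exists>l. {z \<in> Pi_rect \<kappa> \<gamma> \<mu> n. eigenvalue T z} = {l} \<and>
             complex_vector.dim (root_subspace T l) = 1 \<and>
             \<phi> n \<noteq> 0 \<and> (\<phi> n, l *\<^sub>C \<phi> n) \<in> T)) \<and>
     (let \<Lambda> = {z. eigenvalue T z \<and> (\<forall>n>N. z \<notin> Pi_rect \<kappa> \<gamma> \<mu> n)} in
        (\<forall>n\<in>{1..N}. \<exists>l\<in>\<Lambda>. \<phi> n \<in> root_subspace T l) \<and>
        inj_on \<phi> {1..N} \<and>
        complex_vector.independent (\<phi> ` {1..N}) \<and>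
        complex_vector.span (\<phi> ` {1..N}) = complex_vector.span (\<Union>l\<in>\<Lambda>. root_subspace T l))"

end

theory Submission
  imports Defs "HOL-Computational_Algebra.Fundamental_Theorem_Algebra"
begin

text \<open>
  The proof works with the coordinates of a vector in the basis \<open>\<psi>\<close>. There \<open>T\<close> is the diagonal matrix
  of the \<open>\<mu>\<^sub>m\<close> plus the matrix \<open>b(\<psi>\<^sub>k, \<psi>\<^sub>m)\<close>, whose entries are dominated by \<open>w\<^sub>k w\<^sub>m\<close> with
  \<open>w\<^sub>k\<close> a multiple of \<open>k\<^sup>-\<^sup>\<alpha>\<close>. Such a matrix behaves like a rank one matrix: equations with it can be solved by
  contraction in the weighted norm \<open>\<Sum> w\<^sub>k |u\<^sub>k|\<close> as soon as \<open>\<Sum> w\<^sub>k\<^sup>2 / |z - \<mu>\<^sub>k| \<le> 1/2\<close>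
  (\<open>solves_exists\<close>, \<open>solves_wnorm_le\<close>). The gap condition and \<open>2\<alpha> + \<gamma> > 1\<close> provide this bound, with the
  term \<open>k = n\<close> left out, on the whole rectangle \<open>\<Pi>\<^sub>n\<close> once \<open>n\<close> is large, and with all terms on its
  boundary (\<open>eventually_good\<close>, \<open>good_small\<close>).

  Eliminating all coordinates but the \<open>n\<close>-th turns the eigenvalue equation in \<open>\<Pi>\<^sub>n\<close> into a scalar
  equation \<open>d(z) = 0\<close> for the Schur complement \<open>d\<close>, with eigenvector \<open>g(z)\<close>, \<open>g\<^sub>n = 1\<close>. If \<open>q\<close> denotes the
  corresponding vector for the transposed matrix, then Green's identity gives
  \<open>d(z) - d(z') = (z - z') \<Sum> g\<^sub>m(z) q\<^sub>m(z')\<close> (\<open>schur_difference\<close>), and the sum is close to \<open>1\<close>. So \<open>d\<close> has at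
  most one zero, it is simple, and Brouwer's theorem supplies one (\<open>schur_zero\<close>). Since
  \<open>(z - T)\<^sup>-\<^sup>1 \<psi>\<^sub>n = g(z) / d(z)\<close>, Cauchy's formula identifies the contour integral \<open>\<phi>\<^sub>n\<close> with a multiple of
  \<open>g\<close> at the zero (\<open>hat_Phi\<close>). The vectors \<open>q\<close> are left eigenvectors and yield functionals \<open>lpair\<close>
  biorthogonal to the \<open>\<phi>\<^sub>n\<close>; they also show that the eigenvalue has a one-dimensional root subspace
  (\<open>root_subspace_lev\<close>).

  In the orthonormal basis \<open>\<mu>\<^sub>n\<^sup>-\<^sup>1\<^sup>/\<^sup>2 \<psi>\<^sub>n\<close> of \<open>V\<close> the off-diagonal coordinates of the scaled vectors \<open>\<phi>\<^sub>n\<close>,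
  and likewise of the functionals, are bounded by a multiple of
  \<open>max(n,m)\<^sup>-\<^sup>\<eta> (max(n,m) / min(n,m))\<^sup>1\<^sup>/\<^sup>2 / |n - m|\<close>. By Schur's test this kernel is bounded on \<open>l\<^sup>2\<close>, and its
  part with one index beyond \<open>K\<close> has small norm (\<open>hilbert_kernel_Schur\<close>, \<open>eventually_far\<close>). Hence the
  subspace \<open>Y K\<close> of \<open>V\<close> on which all functionals with \<open>n > K\<close> vanish has dimension \<open>K\<close> (\<open>dim_Y\<close>). It is
  invariant under \<open>T\<close> and therefore spanned by generalized eigenvectors; it is exactly the span of the
  root subspaces of the remaining eigenvalues (\<open>span_root_subspaces\<close>).

  The map \<open>\<psi>\<^sub>n \<mapsto> \<mu>\<^sub>n\<^sup>-\<^sup>1\<^sup>/\<^sup>2 \<phi>\<^sub>n\<close> then extends to a bounded bijection: its inverse reads off the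
  coordinates beyond \<open>K\<close> by the functionals and the others in the finite-dimensional space \<open>Y K\<close>
  (\<open>Riesz_basis_sys\<close>). A root system for an arbitrary \<open>N\<close> is reduced to a large \<open>K \<ge> N\<close> by counting
  dimensions (\<open>root_system_shift\<close>).
\<close>

section \<open>Unconditional sums and bounded sequences\<close>

lemma summable_le:
  fixes f g :: "nat \<Rightarrow> real"
  assumes "g summable_on J" "\<And>k. k \<in> J \<Longrightarrow> 0 \<le> f k" "\<And>k. k \<in> J \<Longrightarrow> f k \<le> C * g k"
  shows "f summable_on J" "infsum f J \<le> C * infsum g J"
proof -
  have *: "(\<lambda>k. C * g k) summable_on J"
    by (intro summable_on_cmult_right assms)
  show **: "f summable_on J"
    by (rule summable_on_comparison_test[OF *]) (use assms in auto)
  have "infsum f J \<le> (\<Sum>\<^sub>\<infinity>k\<in>J. C * g k)"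
    by (rule infsum_mono[OF ** *]) (use assms in auto)
  then show "infsum f J \<le> C * infsum g J"
    by (simp add: infsum_cmult_right')
qed

lemma summable_norm_le:
  fixes f :: "nat \<Rightarrow> complex" and g :: "nat \<Rightarrow> real"
  assumes "g summable_on J" "\<And>k. k \<in> J \<Longrightarrow> cmod (f k) \<le> C * g k"
  shows "f summable_on J" "cmod (infsum f J) \<le> C * infsum g J"
proof -
  note 1 = summable_le[OF assms(1), of "\<lambda>k. cmod (f k)" C]
  have "(\<lambda>k. cmod (f k)) summable_on J"
    using 1(1) assms(2) by simp
  then show "f summable_on J"
    by (rule abs_summable_summable)
  have "cmod (infsum f J) \<le> (\<Sum>\<^sub>\<infinity>k\<in>J. cmod (f k))"
    by (rule norm_infsum_bound) fact
  also have "\<dots> \<le> C * infsum g J"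
    using 1(2) assms(2) by simp
  finally show "cmod (infsum f J) \<le> C * infsum g J" .
qed

lemma summable_on_diffI:
  fixes f g :: "nat \<Rightarrow> 'a::real_normed_vector"
  assumes "f summable_on A" "g summable_on A"
  shows "(\<lambda>x. f x - g x) summable_on A" "infsum (\<lambda>x. f x - g x) A = infsum f A - infsum g A"
proof -
  have 1: "(\<lambda>x. - g x) summable_on A"
    using assms by (simp add: summable_on_uminus)
  show "(\<lambda>x. f x - g x) summable_on A"
    using summable_on_add[OF assms(1) 1] by simp
  show "infsum (\<lambda>x. f x - g x) A = infsum f A - infsum g A"
    using infsum_add[OF assms(1) 1] by (simp add: infsum_uminus)
qed

text \<open>
  Bounded sequences are the bounded continuous functions on the discrete space of natural numbers; this
  is the space in which linear systems will be solved by Banach's fixed point theorem.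
\<close>

lemma complete_bounded_sequences: "complete (UNIV :: (nat \<Rightarrow>\<^sub>C complex) set)"
proof (rule completeI)
  fix f :: "nat \<Rightarrow> nat \<Rightarrow>\<^sub>C complex"
  assume "Cauchy f"
  then have "uniformly_Cauchy_on UNIV (\<lambda>n. apply_bcontfun (f n))"
    unfolding uniformly_Cauchy_on_def Cauchy_def
    by (meson dist_fun_lt_imp_dist_val_lt)
  then obtain l where l: "uniform_limit UNIV (\<lambda>n. apply_bcontfun (f n)) l sequentially"
    using Cauchy_uniformly_convergent uniformly_convergent_on_def by blast
  then obtain L where "l = apply_bcontfun L"
    using uniform_limit_bcontfunE[OF l sequentially_bot] by metis
  then show "\<exists>l\<in>UNIV. f \<longlonglongrightarrow> l"
    using uniform_limit_tendsto_bcontfun l by blast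
qed

section \<open>Diagonal matrices with a dominated perturbation\<close>

text \<open>
  The matrix under study is \<open>diag \<mu> + b\<close> with \<open>|b k m| \<le> w k * w m\<close>, where \<open>b k m\<close> is the coefficient
  with which coordinate \<open>k\<close> enters row \<open>m\<close>. It is applied to sequences with finite weighted norm
  \<open>\<Sum> w k |u k|\<close>, indexed by a set \<open>J\<close>; removing one index from \<open>J\<close> will later eliminate one coordinate.
\<close>

locale weighted_diagonal =
  fixes w \<mu> :: "nat \<Rightarrow> real"
  assumes w_pos: "\<And>k. w k > 0"
begin

definition dominated :: "(nat \<Rightarrow> nat \<Rightarrow> complex) \<Rightarrow> bool" where
  "dominated b \<longleftrightarrow> (\<forall>k m. cmod (b k m) \<le> w k * w m)"

definition admissible :: "nat set \<Rightarrow> (nat \<Rightarrow> complex) \<Rightarrow> bool" where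
  "admissible J u \<longleftrightarrow> (\<lambda>k. w k * cmod (u k)) summable_on J"

definition wnorm :: "nat set \<Rightarrow> (nat \<Rightarrow> complex) \<Rightarrow> real" where
  "wnorm J u = (\<Sum>\<^sub>\<infinity>k\<in>J. w k * cmod (u k))"

definition act :: "(nat \<Rightarrow> nat \<Rightarrow> complex) \<Rightarrow> nat set \<Rightarrow> (nat \<Rightarrow> complex) \<Rightarrow> nat \<Rightarrow> complex" where
  "act b J u m = (\<Sum>\<^sub>\<infinity>k\<in>J. b k m * u k)"

definition source :: "nat set \<Rightarrow> complex \<Rightarrow> (nat \<Rightarrow> complex) \<Rightarrow> bool" where
  "source J z f \<longleftrightarrow> (\<lambda>k. w k * cmod (f k) / cmod (z - \<mu> k)) summable_on J"

text \<open>The weighted norm of \<open>(z - diag \<mu>)\<^sup>-\<^sup>1 f\<close>.\<close>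

definition snorm :: "nat set \<Rightarrow> complex \<Rightarrow> (nat \<Rightarrow> complex) \<Rightarrow> real" where
  "snorm J z f = (\<Sum>\<^sub>\<infinity>k\<in>J. w k * cmod (f k) / cmod (z - \<mu> k))"

text \<open>
  The condition under which \<open>(z - diag \<mu>)\<^sup>-\<^sup>1 b\<close> has norm at most \<open>1/2\<close> in the weighted norm.
\<close>

definition small :: "nat set \<Rightarrow> complex \<Rightarrow> bool" where
  "small J z \<longleftrightarrow> (\<forall>k\<in>J. z \<noteq> \<mu> k) \<and> (\<lambda>k. (w k)\<^sup>2 / cmod (z - \<mu> k)) summable_on J \<and>
     (\<Sum>\<^sub>\<infinity>k\<in>J. (w k)\<^sup>2 / cmod (z - \<mu> k)) \<le> 1/2"

text \<open>
  The equation \<open>(z - diag \<mu> - b) u = f\<close> compressed to the index set \<open>J\<close>.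
\<close>

definition solves ::
  "(nat \<Rightarrow> nat \<Rightarrow> complex) \<Rightarrow> nat set \<Rightarrow> complex \<Rightarrow> (nat \<Rightarrow> complex) \<Rightarrow> (nat \<Rightarrow> complex) \<Rightarrow> bool" where
  "solves b J z f u \<longleftrightarrow> admissible J u \<and> (\<forall>m. m \<notin> J \<longrightarrow> u m = 0) \<and>
     (\<forall>m\<in>J. (z - \<mu> m) * u m = f m + act b J u m)"

lemma w_nonneg: "0 \<le> w k"
  using w_pos[of k] by simp

lemma dominated_transpose: "dominated b \<Longrightarrow> dominated (\<lambda>k m. b m k)"
  unfolding dominated_def by (subst mult.commute) blast

lemma wnorm_nonneg: "0 \<le> wnorm J u"
  unfolding wnorm_def by (intro infsum_nonneg mult_nonneg_nonneg w_nonneg) auto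

lemma functional_bound:
  assumes "admissible J u" "\<And>k. k \<in> J \<Longrightarrow> cmod (\<xi> k) \<le> C * w k"
  shows "(\<lambda>k. \<xi> k * u k) summable_on J" "cmod (\<Sum>\<^sub>\<infinity>k\<in>J. \<xi> k * u k) \<le> C * wnorm J u"
proof -
  have *: "cmod (\<xi> k * u k) \<le> C * (w k * cmod (u k))" if "k \<in> J" for k
    using mult_right_mono[OF assms(2)[OF that], of "cmod (u k)"] by (simp add: norm_mult mult_ac)
  show "(\<lambda>k. \<xi> k * u k) summable_on J" "cmod (\<Sum>\<^sub>\<infinity>k\<in>J. \<xi> k * u k) \<le> C * wnorm J u"
    using summable_norm_le[OF assms(1)[unfolded admissible_def] *] by (auto simp: wnorm_def)
qed

lemma act_bound:
  assumes "dominated b" "admissible J u"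
  shows "(\<lambda>k. b k m * u k) summable_on J" "cmod (act b J u m) \<le> w m * wnorm J u"
proof -
  have "cmod (b k m) \<le> w m * w k" for k
    using assms(1) by (auto simp: dominated_def mult.commute)
  then show "(\<lambda>k. b k m * u k) summable_on J" "cmod (act b J u m) \<le> w m * wnorm J u"
    using functional_bound[OF assms(2), of "\<lambda>k. b k m" "w m"] by (auto simp: act_def)
qed

lemma admissible_add: "admissible J u \<Longrightarrow> admissible J v \<Longrightarrow> admissible J (\<lambda>k. u k + v k)"
  unfolding admissible_def
proof (rule summable_on_comparison_test)
  assume "(\<lambda>k. w k * cmod (u k)) summable_on J" "(\<lambda>k. w k * cmod (v k)) summable_on J"
  then show "(\<lambda>k. w k * cmod (u k) + w k * cmod (v k)) summable_on J"
    by (rule summable_on_add)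
  show "w k * cmod (u k + v k) \<le> w k * cmod (u k) + w k * cmod (v k)" for k
    using mult_left_mono[OF norm_triangle_ineq[of "u k" "v k"] w_nonneg[of k]] by (simp add: distrib_left)
qed (simp add: w_nonneg)

lemma admissible_cmult: "admissible J u \<Longrightarrow> admissible J (\<lambda>k. c * u k)"
  unfolding admissible_def norm_mult
  using summable_on_cmult_right[of "\<lambda>k. w k * cmod (u k)" J "cmod c"] by (simp add: mult_ac)

lemma act_add:
  assumes "dominated b" "admissible J u" "admissible J v"
  shows "act b J (\<lambda>k. u k + v k) m = act b J u m + act b J v m"
  unfolding act_def distrib_left using act_bound(1)[OF assms(1)] assms by (simp add: infsum_add)

lemma act_cmult: "act b J (\<lambda>k. c * u k) m = c * act b J u m"
proof -
  have "act b J (\<lambda>k. c * u k) m = (\<Sum>\<^sub>\<infinity>k\<in>J. c * (b k m * u k))"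
    unfolding act_def by (rule infsum_cong) (rule mult.left_commute)
  then show ?thesis by (simp add: act_def infsum_cmult_right')
qed

lemma admissible_diff: "admissible J u \<Longrightarrow> admissible J v \<Longrightarrow> admissible J (\<lambda>k. u k - v k)"
  using admissible_add[OF _ admissible_cmult[of J v "-1"], of u] by simp

lemma act_diff:
  assumes "dominated b" "admissible J u" "admissible J v"
  shows "act b J (\<lambda>k. u k - v k) m = act b J u m - act b J v m"
  using act_add[OF assms(1,2) admissible_cmult[OF assms(3), of "-1"]] act_cmult[of b J "-1" v m] by simp

lemma solves_add:
  assumes "dominated b" "solves b J z f u" "solves b J z g v"
  shows "solves b J z (\<lambda>m. f m + g m) (\<lambda>m. u m + v m)"
  using assms by (auto simp: solves_def admissible_add act_add distrib_left)

lemma solves_diff: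
  assumes "dominated b" "solves b J z f u" "solves b J z g v"
  shows "solves b J z (\<lambda>m. f m - g m) (\<lambda>m. u m - v m)"
  using assms by (auto simp: solves_def admissible_diff act_diff right_diff_distrib)

lemma solves_cmult:
  assumes "solves b J z f u"
  shows "solves b J z (\<lambda>m. c * f m) (\<lambda>m. c * u m)"
proof -
  have "(z - \<mu> m) * (c * u m) = c * f m + act b J (\<lambda>m. c * u m) m" if "m \<in> J" for m
  proof -
    have "(z - \<mu> m) * (c * u m) = c * ((z - \<mu> m) * u m)"
      by (rule mult.left_commute)
    also have "\<dots> = c * (f m + act b J u m)"
      using assms that by (simp add: solves_def)
    finally show ?thesis by (simp add: act_cmult distrib_left)
  qed
  then show ?thesis
    using assms by (simp add: solves_def admissible_cmult)
qed

lemma solves_cong: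
  assumes "\<And>m. m \<in> J \<Longrightarrow> f m = g m" "solves b J z f u"
  shows "solves b J z g u"
  using assms by (simp add: solves_def)

lemma solves_pointwise:
  assumes "dominated b" "small J z" "solves b J z f u" "m \<in> J"
  shows "cmod (u m) \<le> (cmod (f m) + w m * wnorm J u) / cmod (z - \<mu> m)"
proof -
  have "z - \<mu> m \<noteq> 0"
    using assms by (auto simp: small_def)
  moreover have "cmod ((z - \<mu> m) * u m) \<le> cmod (f m) + w m * wnorm J u"
    using assms(3,4) act_bound(2)[OF assms(1), of J u m]
    by (auto simp: solves_def intro: norm_triangle_le)
  ultimately show ?thesis
    by (simp add: norm_mult pos_le_divide_eq mult.commute)
qed

text \<open>
  Summing the pointwise estimate with weight \<open>w\<close> bounds the norm of \<open>u\<close> by that of the source plus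
  one half of itself.
\<close>

lemma solves_wnorm_le:
  assumes b: "dominated b" and z: "small J z" and f: "source J z f" and u: "solves b J z f u"
  shows "wnorm J u \<le> 2 * snorm J z f"
proof -
  have 1: "(\<lambda>k. w k * cmod (f k) / cmod (z - \<mu> k)) summable_on J"
    using f by (simp add: source_def)
  have 2: "(\<lambda>k. wnorm J u * ((w k)\<^sup>2 / cmod (z - \<mu> k))) summable_on J"
    using z by (intro summable_on_cmult_right) (simp add: small_def)
  have "wnorm J u \<le> (\<Sum>\<^sub>\<infinity>k\<in>J. w k * cmod (f k) / cmod (z - \<mu> k) + wnorm J u * ((w k)\<^sup>2 / cmod (z - \<mu> k)))"
    unfolding wnorm_def[of J u]
  proof (rule infsum_mono)
    show "(\<lambda>k. w k * cmod (u k)) summable_on J"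
      using u by (simp add: solves_def admissible_def)
    show "(\<lambda>k. w k * cmod (f k) / cmod (z - \<mu> k) + (\<Sum>\<^sub>\<infinity>k\<in>J. w k * cmod (u k)) * ((w k)\<^sup>2 / cmod (z - \<mu> k))) summable_on J"
      using summable_on_add[OF 1 2] by (simp add: wnorm_def)
    fix k assume k: "k \<in> J"
    show "w k * cmod (u k) \<le> w k * cmod (f k) / cmod (z - \<mu> k) + (\<Sum>\<^sub>\<infinity>k\<in>J. w k * cmod (u k)) * ((w k)\<^sup>2 / cmod (z - \<mu> k))"
      using mult_left_mono[OF solves_pointwise[OF b z u k] w_nonneg[of k]]
      by (simp add: wnorm_def add_divide_distrib distrib_left power2_eq_square mult_ac)
  qed
  also have "\<dots> = snorm J z f + wnorm J u * (\<Sum>\<^sub>\<infinity>k\<in>J. (w k)\<^sup>2 / cmod (z - \<mu> k))"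
    by (subst infsum_add[OF 1 2]) (simp only: snorm_def infsum_cmult_right')
  also have "\<dots> \<le> snorm J z f + wnorm J u * (1/2)"
    using z by (intro add_left_mono mult_left_mono wnorm_nonneg) (simp add: small_def)
  finally show ?thesis by simp
qed

lemma solves_unique:
  assumes b: "dominated b" and z: "small J z" and u: "solves b J z f u" and v: "solves b J z f v"
  shows "u = v"
proof -
  have D: "solves b J z (\<lambda>m. f m - f m) (\<lambda>m. u m - v m)"
    by (rule solves_diff[OF b u v])
  have "source J z (\<lambda>m. f m - f m)" "snorm J z (\<lambda>m. f m - f m) = 0"
    by (simp_all add: source_def snorm_def)
  then have "wnorm J (\<lambda>m. u m - v m) \<le> 0"
    using solves_wnorm_le[OF b z _ D] by simp
  then have 0: "wnorm J (\<lambda>m. u m - v m) = 0"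
    using wnorm_nonneg[of J "\<lambda>m. u m - v m"] by linarith
  have "u m - v m = 0" for m
  proof (cases "m \<in> J")
    case True
    then show ?thesis
      using solves_pointwise[OF b z D True] unfolding 0 by simp
  next
    case False
    then show ?thesis using u v by (simp add: solves_def)
  qed
  then show ?thesis by (auto simp: fun_eq_iff)
qed

text \<open>
  The substitution \<open>u = (f + w x) / (z - \<mu>)\<close> turns the equation into a fixed point problem for bounded
  sequences \<open>x\<close>, the entries \<open>x m = (b u) m / w m\<close> being bounded by the weighted norm of \<open>u\<close>. Smallness
  makes the iteration a contraction by \<open>1/2\<close>.
\<close>

lemma solves_exists:
  assumes b: "dominated b" and z: "small J z" and f: "source J z f"
  shows "\<exists>u. solves b J z f u"
proof -
  define lift where "lift x k = (if k \<in> J then (f k + w k * x k) / (z - \<mu> k) else 0)" for x :: "nat \<Rightarrow> complex" and k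
  define step where "step x m = act b J (lift x) m / w m" for x :: "nat \<Rightarrow> complex" and m
  note zs = z[unfolded small_def]
  have adm: "admissible J (lift x)" if x: "\<And>k. cmod (x k) \<le> B" for x B
  proof -
    have 1: "(\<lambda>k. w k * cmod (f k) / cmod (z - \<mu> k) + B * ((w k)\<^sup>2 / cmod (z - \<mu> k))) summable_on J"
      using f zs by (intro summable_on_add summable_on_cmult_right) (auto simp: source_def)
    show ?thesis
      unfolding admissible_def
    proof (rule summable_on_comparison_test[OF 1])
      fix k assume k: "k \<in> J"
      have "cmod (f k + w k * x k) \<le> cmod (f k) + w k * B"
        using x[of k] w_pos[of k] by (intro norm_triangle_le add_mono) (auto simp: norm_mult)
      then have "w k * (cmod (f k + w k * x k) / cmod (z - \<mu> k)) \<le> w k * ((cmod (f k) + w k * B) / cmod (z - \<mu> k))"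
        by (intro mult_left_mono divide_right_mono w_nonneg) auto
      then show "w k * cmod (lift x k) \<le> w k * cmod (f k) / cmod (z - \<mu> k) + B * ((w k)\<^sup>2 / cmod (z - \<mu> k))"
        using k by (simp add: lift_def norm_divide add_divide_distrib[of "cmod (f k)"] distrib_left power2_eq_square mult_ac)
    qed (auto simp: w_nonneg)
  qed
  have step_bound: "cmod (step x m) \<le> wnorm J (lift x)" if x: "\<And>k. cmod (x k) \<le> B" for x m B
    using act_bound(2)[OF b adm[OF x], where m=m] w_pos[of m]
    by (simp add: step_def norm_divide field_simps)
  have step_diff: "cmod (step x m - step y m) \<le> 1/2 * B"
    if xy: "\<And>k. cmod (x k - y k) \<le> B" and x: "\<And>k. cmod (x k) \<le> C" and y: "\<And>k. cmod (y k) \<le> D"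
    for x y m B C D
  proof -
    define e where "e k = (if k \<in> J then w k * (x k - y k) / (z - \<mu> k) else 0)" for k
    have e: "e = (\<lambda>k. lift x k - lift y k)"
    proof
      fix k
      have "w k * (x k - y k) = (f k + w k * x k) - (f k + w k * y k)"
        by (simp add: right_diff_distrib)
      then show "e k = lift x k - lift y k"
        by (simp only: e_def lift_def diff_divide_distrib) simp
    qed
    have ade: "admissible J e"
      unfolding e by (intro admissible_diff adm[OF x] adm[OF y])
    have B: "0 \<le> B" using xy[of 0] norm_ge_zero order_trans by blast
    have "wnorm J e \<le> B * (\<Sum>\<^sub>\<infinity>k\<in>J. (w k)\<^sup>2 / cmod (z - \<mu> k))"
      unfolding wnorm_def
    proof (rule summable_le(2))
      fix k assume k: "k \<in> J"
      have "(w k)\<^sup>2 * cmod (x k - y k) / cmod (z - \<mu> k) \<le> (w k)\<^sup>2 * B / cmod (z - \<mu> k)"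
        by (intro divide_right_mono mult_left_mono xy) auto
      then show "w k * cmod (e k) \<le> B * ((w k)\<^sup>2 / cmod (z - \<mu> k))"
        using k w_pos[of k] by (simp add: e_def norm_mult norm_divide power2_eq_square mult_ac)
    qed (use zs w_nonneg in auto)
    also have "\<dots> \<le> B * (1/2)"
      using zs B by (intro mult_left_mono) auto
    finally have we: "wnorm J e \<le> 1/2 * B" by simp
    have "step x m - step y m = act b J e m / w m"
      unfolding e by (simp add: act_diff[OF b adm[OF x] adm[OF y]] step_def diff_divide_distrib)
    also have "cmod \<dots> \<le> wnorm J e"
      using act_bound(2)[OF b ade, of m] w_pos[of m] by (simp add: norm_divide field_simps)
    finally show ?thesis using we by simp
  qed
  define \<Phi> where "\<Phi> X = Bcontfun (step (apply_bcontfun X))" for X :: "nat \<Rightarrow>\<^sub>C complex"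
  have bnd: "cmod (apply_bcontfun X k) \<le> norm X" for X :: "nat \<Rightarrow>\<^sub>C complex" and k
    by (rule norm_bounded)
  have \<Phi>: "apply_bcontfun (\<Phi> X) = step (apply_bcontfun X)" for X
    unfolding \<Phi>_def
  proof (rule Bcontfun_inverse)
    have "bounded (range (step (apply_bcontfun X)))"
      unfolding bounded_iff using step_bound[of "apply_bcontfun X" "norm X", OF bnd] by auto
    then show "step (apply_bcontfun X) \<in> bcontfun"
      by (simp add: bcontfun_def continuous_on_discrete)
  qed
  have "dist (\<Phi> X) (\<Phi> Y) \<le> 1/2 * dist X Y" for X Y
  proof (rule dist_bound)
    fix m
    have "cmod (apply_bcontfun X k - apply_bcontfun Y k) \<le> dist X Y" for k
      using dist_bounded[of X k Y] by (simp add: dist_norm)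
    then show "dist (apply_bcontfun (\<Phi> X) m) (apply_bcontfun (\<Phi> Y) m) \<le> 1/2 * dist X Y"
      using step_diff[of "apply_bcontfun X" "apply_bcontfun Y", OF _ bnd bnd, of "dist X Y" m] by (simp add: \<Phi> dist_norm)
  qed
  then obtain X where X: "\<Phi> X = X"
    using Banach_fix[OF complete_bounded_sequences _ _ _ subset_UNIV, of "1/2" \<Phi>] by auto
  define u where "u = lift (apply_bcontfun X)"
  have "solves b J z f u"
    unfolding solves_def
  proof (intro conjI ballI allI impI)
    show "admissible J u"
      unfolding u_def by (rule adm[OF bnd])
    show "u m = 0" if "m \<notin> J" for m
      using that by (simp add: u_def lift_def)
    fix m assume m: "m \<in> J"
    have "apply_bcontfun X m = act b J u m / w m"
      using \<Phi>[of X] by (simp add: X step_def u_def fun_eq_iff)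
    then have "w m * apply_bcontfun X m = act b J u m"
      using w_pos[of m] by simp
    then show "(z - \<mu> m) * u m = f m + act b J u m"
      using m zs by (simp add: u_def lift_def)
  qed
  then show ?thesis by blast
qed

definition solution :: "(nat \<Rightarrow> nat \<Rightarrow> complex) \<Rightarrow> nat set \<Rightarrow> complex \<Rightarrow> (nat \<Rightarrow> complex) \<Rightarrow> nat \<Rightarrow> complex" where
  "solution b J z f = (THE u. solves b J z f u)"

lemma solves_solution:
  assumes b: "dominated b" and z: "small J z" and f: "source J z f"
  shows "solves b J z f (solution b J z f)"
  unfolding solution_def
  by (rule theI'[of "solves b J z f"]) (use solves_exists[OF b z f] solves_unique[OF b z] in blast)

lemma source_admissible:
  fixes z :: complex
  assumes u: "admissible J u" and \<delta>: "\<delta> > 0" "\<And>k. k \<in> J \<Longrightarrow> \<delta> \<le> cmod (z - \<mu> k)"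
  shows "source J z u" "snorm J z u \<le> wnorm J u / \<delta>"
proof -
  have *: "w k * cmod (u k) / cmod (z - \<mu> k) \<le> 1 / \<delta> * (w k * cmod (u k))" if "k \<in> J" for k
  proof -
    have "0 < cmod (z - \<mu> k)" using \<delta>(1) \<delta>(2)[OF that] by linarith
    then show ?thesis
      using divide_left_mono[OF \<delta>(2)[OF that], of "w k * cmod (u k)"] \<delta>(1) w_pos[of k] by simp
  qed
  show "source J z u" "snorm J z u \<le> wnorm J u / \<delta>"
    using summable_le[OF u[unfolded admissible_def] _ *] w_nonneg
    by (auto simp: source_def snorm_def wnorm_def)
qed

text \<open>
  The resolvent identity: the difference of solutions at \<open>z\<close> and \<open>z'\<close> again solves an equation at \<open>z\<close>,
  with a source of order \<open>z - z'\<close>.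
\<close>

lemma solves_difference:
  assumes b: "dominated b" and u: "solves b J z f u" and v: "solves b J z' f v"
  shows "solves b J z (\<lambda>m. (z' - z) * v m) (\<lambda>m. u m - v m)"
proof -
  have "(z - \<mu> m) * (u m - v m) = (z' - z) * v m + act b J (\<lambda>m. u m - v m) m" if m: "m \<in> J" for m
  proof -
    have "(z - \<mu> m) * (u m - v m) = (z - \<mu> m) * u m - (z' - \<mu> m) * v m + (z' - z) * v m"
      by (simp add: algebra_simps)
    also have "\<dots> = (z' - z) * v m + act b J (\<lambda>m. u m - v m) m"
      using u v m act_diff[OF b, of J u v m] by (simp add: solves_def)
    finally show ?thesis .
  qed
  then show ?thesis
    using u v by (simp add: solves_def admissible_diff)
qed

lemma wnorm_cmult: "wnorm J (\<lambda>k. c * u k) = cmod c * wnorm J u"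
proof -
  have "wnorm J (\<lambda>k. c * u k) = (\<Sum>\<^sub>\<infinity>k\<in>J. cmod c * (w k * cmod (u k)))"
    unfolding wnorm_def by (rule infsum_cong) (simp add: norm_mult)
  then show ?thesis by (simp add: wnorm_def infsum_cmult_right')
qed

text \<open>
  Applying the resolvent identity twice gives a Taylor expansion of first order, with derivative
  \<open>-(z - diag \<mu> - b)\<^sup>-\<^sup>1 u(z)\<close> and a remainder of order \<open>(z - z0)\<^sup>2\<close> in the weighted norm.
\<close>

lemma solution_functional_holomorphic:
  assumes b: "dominated b" and S: "\<And>z. z \<in> S \<Longrightarrow> small J z"
    and \<delta>: "\<delta> > 0" "\<And>z k. z \<in> S \<Longrightarrow> k \<in> J \<Longrightarrow> \<delta> \<le> cmod (z - \<mu> k)"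
    and u: "\<And>z. z \<in> S \<Longrightarrow> solves b J z f (u z)"
    and \<xi>: "\<And>k. k \<in> J \<Longrightarrow> cmod (\<xi> k) \<le> C * w k"
  shows "(\<lambda>z. \<Sum>\<^sub>\<infinity>k\<in>J. \<xi> k * u z k) holomorphic_on S"
  unfolding holomorphic_on_def
proof
  fix z0 assume z0: "z0 \<in> S"
  let ?F = "\<lambda>z. \<Sum>\<^sub>\<infinity>k\<in>J. \<xi> k * u z k"
  have adm: "admissible J (u z)" if "z \<in> S" for z
    using u[OF that] by (simp add: solves_def)
  have "source J z0 (\<lambda>m. (-1) * u z0 m)"
    by (rule source_admissible(1)[OF admissible_cmult[OF adm[OF z0]] \<delta>(1) \<delta>(2)[OF z0]])
  \<comment> \<open>the candidate for the derivative of \<open>u\<close> at \<open>z0\<close>\<close>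
  then obtain v where v: "solves b J z0 (\<lambda>m. (-1) * u z0 m) v"
    using solves_exists[OF b S[OF z0]] by blast
  then have adv: "admissible J v" by (simp add: solves_def)
  let ?D = "\<Sum>\<^sub>\<infinity>k\<in>J. \<xi> k * v k"
  define K where "K = \<bar>C\<bar> * (2 * (wnorm J v / \<delta>))"
  have K: "cmod (?F z - ?F z0 - (z - z0) * ?D) \<le> K * (cmod (z - z0))\<^sup>2" if z: "z \<in> S" for z
  proof -
    define e where "e = (\<lambda>k. u z k - u z0 k)"
    define E where "E = (\<lambda>k. (z - z0) * v k)"
    have e: "solves b J z (\<lambda>m. (z0 - z) * u z0 m) e"
      unfolding e_def by (rule solves_difference[OF b u[OF z] u[OF z0]])
    have E: "solves b J z0 (\<lambda>m. (z0 - z) * u z0 m) E"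
      unfolding E_def by (rule solves_cong[OF _ solves_cmult[OF v]]) (simp add: algebra_simps)
    have eE: "solves b J z (\<lambda>m. (z0 - z) * E m) (\<lambda>m. e m - E m)"
      by (rule solves_difference[OF b e E])
    have ade: "admissible J e" and adE: "admissible J E"
      using e E by (auto simp: solves_def)
    have adE': "admissible J (\<lambda>m. (z0 - z) * E m)"
      by (rule admissible_cmult[OF adE])
    have "wnorm J (\<lambda>m. e m - E m) \<le> 2 * snorm J z (\<lambda>m. (z0 - z) * E m)"
      by (rule solves_wnorm_le[OF b S[OF z] source_admissible(1)[OF adE' \<delta>(1) \<delta>(2)[OF z]] eE])
    also have "\<dots> \<le> 2 * (wnorm J (\<lambda>m. (z0 - z) * E m) / \<delta>)"
      using source_admissible(2)[OF adE' \<delta>(1) \<delta>(2)[OF z]] by simp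
    also have "\<dots> = 2 * (wnorm J v / \<delta>) * (cmod (z - z0))\<^sup>2"
      by (simp add: wnorm_cmult E_def power2_eq_square norm_minus_commute)
    finally have 1: "wnorm J (\<lambda>m. e m - E m) \<le> 2 * (wnorm J v / \<delta>) * (cmod (z - z0))\<^sup>2" .
    have sm: "(\<lambda>k. \<xi> k * y k) summable_on J" if "admissible J y" for y
      by (rule functional_bound(1)[OF that \<xi>])
    have "(\<Sum>\<^sub>\<infinity>k\<in>J. \<xi> k * (e k - E k)) = (\<Sum>\<^sub>\<infinity>k\<in>J. (\<xi> k * u z k - \<xi> k * u z0 k) - (z - z0) * (\<xi> k * v k))"
      by (rule infsum_cong) (simp add: e_def E_def algebra_simps)
    also have "\<dots> = ?F z - ?F z0 - (z - z0) * ?D"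
      using sm[OF adm[OF z]] sm[OF adm[OF z0]] sm[OF adv]
      by (simp add: summable_on_diffI summable_on_cmult_right infsum_cmult_right')
    finally have 2: "?F z - ?F z0 - (z - z0) * ?D = (\<Sum>\<^sub>\<infinity>k\<in>J. \<xi> k * (e k - E k))" by simp
    have "cmod (\<Sum>\<^sub>\<infinity>k\<in>J. \<xi> k * (e k - E k)) \<le> C * wnorm J (\<lambda>m. e m - E m)"
      by (rule functional_bound(2)[OF admissible_diff[OF ade adE] \<xi>])
    also have "\<dots> \<le> \<bar>C\<bar> * wnorm J (\<lambda>m. e m - E m)"
      by (intro mult_right_mono wnorm_nonneg) simp
    also have "\<dots> \<le> \<bar>C\<bar> * (2 * (wnorm J v / \<delta>) * (cmod (z - z0))\<^sup>2)"
      by (intro mult_left_mono 1) simp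
    finally show ?thesis unfolding 2 K_def by (simp add: mult_ac)
  qed
  have "((\<lambda>z. (?F z - ?F z0) / (z - z0) - ?D) \<longlongrightarrow> 0) (at z0 within S)"
  proof (rule Lim_null_comparison)
    show "\<forall>\<^sub>F z in at z0 within S. norm ((?F z - ?F z0) / (z - z0) - ?D) \<le> K * cmod (z - z0)"
      unfolding eventually_at_filter
    proof (rule always_eventually, intro allI impI)
      fix z assume z: "z \<noteq> z0" "z \<in> S"
      have "(?F z - ?F z0) / (z - z0) - ?D = (?F z - ?F z0 - (z - z0) * ?D) / (z - z0)"
        using z(1) by (simp add: diff_divide_distrib)
      then show "norm ((?F z - ?F z0) / (z - z0) - ?D) \<le> K * cmod (z - z0)"
        using K[OF z(2)] z(1) by (simp add: norm_divide pos_divide_le_eq power2_eq_square mult_ac)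
    qed
    have "((\<lambda>z. K * cmod (z - z0)) \<longlongrightarrow> K * cmod (z0 - z0)) (at z0 within S)"
      by (intro tendsto_intros)
    then show "((\<lambda>z. K * cmod (z - z0)) \<longlongrightarrow> 0) (at z0 within S)" by simp
  qed
  then have "((\<lambda>z. (?F z - ?F z0) / (z - z0)) \<longlongrightarrow> ?D) (at z0 within S)"
    by (rule LIM_zero_cancel)
  then have "(?F has_field_derivative ?D) (at z0 within S)"
    by (simp add: has_field_derivative_iff)
  then show "?F field_differentiable at z0 within S"
    unfolding field_differentiable_def by blast
qed

text \<open>Domination by \<open>w k * w m\<close> makes the double series absolutely convergent.\<close>

lemma act_transpose:
  assumes b: "dominated b" and u: "admissible I u" and q: "admissible I q"
  shows "(\<lambda>m. act b I u m * q m) summable_on I"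
    "(\<Sum>\<^sub>\<infinity>m\<in>I. act b I u m * q m) = (\<Sum>\<^sub>\<infinity>m\<in>I. act (\<lambda>k m. b m k) I q m * u m)"
proof -
  show "(\<lambda>m. act b I u m * q m) summable_on I"
    by (rule functional_bound(1)[OF q, of _ "wnorm I u"]) (use act_bound(2)[OF b u] in \<open>simp add: mult.commute\<close>)
  have 1: "(\<lambda>(m, k). (w m * cmod (q m)) * (w k * cmod (u k))) summable_on I \<times> I"
  proof (rule summable_on_SigmaI)
    show "((\<lambda>k. case (m, k) of (m, k) \<Rightarrow> (w m * cmod (q m)) * (w k * cmod (u k))) has_sum (w m * cmod (q m)) * wnorm I u) I" for m
      using u by (auto simp: wnorm_def admissible_def intro: has_sum_cmult_right)
    show "(\<lambda>m. (w m * cmod (q m)) * wnorm I u) summable_on I"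
      using q by (intro summable_on_cmult_left) (simp add: admissible_def)
  qed (auto simp: w_nonneg)
  have "(\<lambda>x. norm (case x of (m, k) \<Rightarrow> b k m * u k * q m)) summable_on I \<times> I"
  proof (rule summable_on_comparison_test[OF 1])
    fix x assume "x \<in> I \<times> I"
    obtain m k where x: "x = (m, k)" by (cases x)
    have "cmod (b k m) * (cmod (u k) * cmod (q m)) \<le> (w k * w m) * (cmod (u k) * cmod (q m))"
      using b by (intro mult_right_mono) (auto simp: dominated_def)
    then show "norm (case x of (m, k) \<Rightarrow> b k m * u k * q m) \<le> (case x of (m, k) \<Rightarrow> (w m * cmod (q m)) * (w k * cmod (u k)))"
      by (simp add: x norm_mult mult_ac)
  qed auto
  then have s: "(\<lambda>(m, k). b k m * u k * q m) summable_on I \<times> I"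
    by (rule abs_summable_summable)
  have "(\<Sum>\<^sub>\<infinity>m\<in>I. act b I u m * q m) = (\<Sum>\<^sub>\<infinity>m\<in>I. \<Sum>\<^sub>\<infinity>k\<in>I. b k m * u k * q m)"
    by (simp add: act_def infsum_cmult_left')
  also have "\<dots> = (\<Sum>\<^sub>\<infinity>k\<in>I. \<Sum>\<^sub>\<infinity>m\<in>I. b k m * u k * q m)"
    by (rule infsum_swap_banach[OF s])
  also have "\<dots> = (\<Sum>\<^sub>\<infinity>k\<in>I. \<Sum>\<^sub>\<infinity>m\<in>I. b k m * q m * u k)"
    by (intro infsum_cong) (simp add: mult_ac)
  finally show "(\<Sum>\<^sub>\<infinity>m\<in>I. act b I u m * q m) = (\<Sum>\<^sub>\<infinity>m\<in>I. act (\<lambda>k m. b m k) I q m * u m)"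
    by (simp add: act_def infsum_cmult_left')
qed

text \<open>
  Pairing the equation of \<open>u\<close> with \<open>q\<close> and the transposed equation of \<open>q\<close> with \<open>u\<close>, the terms with \<open>b\<close>
  and with \<open>\<mu>\<close> cancel.
\<close>

lemma green_identity:
  fixes u q :: "nat \<Rightarrow> complex" and z z' :: complex
  assumes b: "dominated b" and u: "admissible I u" and q: "admissible I q"
    and uq: "(\<lambda>m. u m * q m) summable_on I"
    and r: "\<And>m. m \<in> I \<Longrightarrow> (z - \<mu> m) * u m = r m + act b I u m"
    and \<rho>: "\<And>m. m \<in> I \<Longrightarrow> (z' - \<mu> m) * q m = \<rho> m + act (\<lambda>k m. b m k) I q m"
  shows "((\<lambda>m. r m * q m - \<rho> m * u m) has_sum (z - z') * (\<Sum>\<^sub>\<infinity>m\<in>I. u m * q m)) I"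
proof -
  let ?X = "\<lambda>m. act b I u m * q m" and ?Y = "\<lambda>m. act (\<lambda>k m. b m k) I q m * u m"
  have X: "?X summable_on I" and XY: "infsum ?X I = infsum ?Y I"
    using act_transpose[OF b u q] by auto
  have Y: "?Y summable_on I"
    by (rule act_transpose(1)[OF dominated_transpose[OF b] q u])
  have s: "(\<lambda>m. (z - z') * (u m * q m)) summable_on I"
    by (intro summable_on_cmult_right uq)
  have XY': "(\<lambda>m. ?X m - ?Y m) summable_on I" "infsum (\<lambda>m. ?X m - ?Y m) I = 0"
    using summable_on_diffI[OF X Y] XY by auto
  have "((\<lambda>m. (z - z') * (u m * q m) - (?X m - ?Y m)) has_sum (z - z') * (\<Sum>\<^sub>\<infinity>m\<in>I. u m * q m)) I"
    using summable_on_diffI[OF s XY'(1)] XY'(2) by (simp add: has_sum_iff infsum_cmult_right')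
  moreover have eq: "r m * q m - \<rho> m * u m = (z - z') * (u m * q m) - (?X m - ?Y m)" if "m \<in> I" for m
  proof -
    have rm: "r m = (z - \<mu> m) * u m - act b I u m" "\<rho> m = (z' - \<mu> m) * q m - act (\<lambda>k m. b m k) I q m"
      using r[OF that] \<rho>[OF that] by (simp_all add: eq_diff_eq)
    show ?thesis unfolding rm by (simp add: algebra_simps)
  qed
  ultimately show ?thesis
    by (subst has_sum_cong[OF eq])
qed

subsection \<open>Eliminating all coordinates but one\<close>

text \<open>
  With the \<open>n\<close>-th coordinate prescribed as \<open>1\<close>, the remaining ones are the solution \<open>tail_vec\<close> on
  \<open>J\<close> with source \<open>b n\<close>. What is left over in equation \<open>n\<close> is the Schur complement \<open>schur\<close>.
\<close>

definition tail_vec :: "(nat \<Rightarrow> nat \<Rightarrow> complex) \<Rightarrow> nat \<Rightarrow> nat set \<Rightarrow> complex \<Rightarrow> nat \<Rightarrow> complex" where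
  "tail_vec b n J z = solution b J z (b n)"

definition local_vec :: "(nat \<Rightarrow> nat \<Rightarrow> complex) \<Rightarrow> nat \<Rightarrow> nat set \<Rightarrow> complex \<Rightarrow> nat \<Rightarrow> complex" where
  "local_vec b n J z = (tail_vec b n J z)(n := 1)"

definition schur :: "(nat \<Rightarrow> nat \<Rightarrow> complex) \<Rightarrow> nat \<Rightarrow> nat set \<Rightarrow> complex \<Rightarrow> complex" where
  "schur b n J z = z - \<mu> n - b n n - (\<Sum>\<^sub>\<infinity>k\<in>J. b k n * tail_vec b n J z k)"

lemma source_row:
  assumes "dominated b" "small J z"
  shows "source J z (b n)" "snorm J z (b n) \<le> w n / 2"
proof -
  have *: "w k * cmod (b n k) / cmod (z - \<mu> k) \<le> w n * ((w k)\<^sup>2 / cmod (z - \<mu> k))" for k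
  proof -
    have "w k * cmod (b n k) / cmod (z - \<mu> k) \<le> w k * (w n * w k) / cmod (z - \<mu> k)"
      using assms(1) by (intro divide_right_mono mult_left_mono w_nonneg) (auto simp: dominated_def)
    then show ?thesis by (simp add: power2_eq_square mult_ac)
  qed
  have s: "(\<lambda>k. (w k)\<^sup>2 / cmod (z - \<mu> k)) summable_on J" and le: "(\<Sum>\<^sub>\<infinity>k\<in>J. (w k)\<^sup>2 / cmod (z - \<mu> k)) \<le> 1/2"
    using assms(2) by (auto simp: small_def)
  have 1: "(\<lambda>k. w k * cmod (b n k) / cmod (z - \<mu> k)) summable_on J"
    "(\<Sum>\<^sub>\<infinity>k\<in>J. w k * cmod (b n k) / cmod (z - \<mu> k)) \<le> w n * (\<Sum>\<^sub>\<infinity>k\<in>J. (w k)\<^sup>2 / cmod (z - \<mu> k))"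
    by (rule summable_le[OF s _ *]; simp add: w_nonneg)+
  show "source J z (b n)" using 1(1) by (simp add: source_def)
  show "snorm J z (b n) \<le> w n / 2"
    unfolding snorm_def using 1(2) mult_left_mono[OF le w_nonneg[of n]] by simp
qed

lemma tail_vec:
  assumes "dominated b" "small J z"
  shows "solves b J z (b n) (tail_vec b n J z)" "wnorm J (tail_vec b n J z) \<le> w n"
    "m \<in> J \<Longrightarrow> cmod (tail_vec b n J z m) \<le> 2 * w n * w m / cmod (z - \<mu> m)"
proof -
  show s: "solves b J z (b n) (tail_vec b n J z)"
    unfolding tail_vec_def by (rule solves_solution[OF assms source_row(1)[OF assms]])
  show le: "wnorm J (tail_vec b n J z) \<le> w n"
    using solves_wnorm_le[OF assms source_row(1)[OF assms] s] source_row(2)[OF assms, of n] by simp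
  assume m: "m \<in> J"
  have "cmod (b n m) + w m * wnorm J (tail_vec b n J z) \<le> w n * w m + w m * w n"
    using assms(1) by (intro add_mono mult_left_mono le w_nonneg) (auto simp: dominated_def)
  then have "(cmod (b n m) + w m * wnorm J (tail_vec b n J z)) / cmod (z - \<mu> m) \<le> 2 * w n * w m / cmod (z - \<mu> m)"
    by (intro divide_right_mono) (auto simp: mult_ac)
  then show "cmod (tail_vec b n J z m) \<le> 2 * w n * w m / cmod (z - \<mu> m)"
    using solves_pointwise[OF assms s m] by simp
qed

lemma act_insert:
  assumes "dominated b" "admissible J u" "n \<notin> J"
  shows "act b (insert n J) u m = b n m * u n + act b J u m"
  unfolding act_def by (rule infsum_insert[OF act_bound(1)[OF assms(1,2)] assms(3)])

lemma admissible_insert: "admissible J u \<Longrightarrow> admissible (insert n J) u"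
  by (simp add: admissible_def summable_on_insert_iff)

lemma restrict_upd: "n \<notin> J \<Longrightarrow> admissible J (u(n := c)) \<longleftrightarrow> admissible J u"
  "n \<notin> J \<Longrightarrow> act b J (u(n := c)) m = act b J u m"
  unfolding admissible_def act_def by (auto intro!: summable_on_cong infsum_cong)

lemma local_vec_equation:
  assumes b: "dominated b" and z: "small J z" and n: "n \<notin> J"
  shows "admissible (insert n J) (local_vec b n J z)"
    "m \<in> insert n J \<Longrightarrow> (z - \<mu> m) * local_vec b n J z m =
       (if m = n then schur b n J z else 0) + act b (insert n J) (local_vec b n J z) m"
    "m \<notin> insert n J \<Longrightarrow> local_vec b n J z m = 0" "local_vec b n J z n = 1"
proof -
  note h = tail_vec(1)[OF b z, of n, unfolded solves_def]
  have ad: "admissible J (local_vec b n J z)"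
    unfolding local_vec_def using h n by (simp add: restrict_upd)
  then show "admissible (insert n J) (local_vec b n J z)"
    by (rule admissible_insert)
  have act: "act b (insert n J) (local_vec b n J z) m = b n m + act b J (tail_vec b n J z) m" for m
    unfolding act_insert[OF b ad n] by (simp add: local_vec_def restrict_upd n)
  show "(z - \<mu> m) * local_vec b n J z m =
       (if m = n then schur b n J z else 0) + act b (insert n J) (local_vec b n J z) m" if "m \<in> insert n J"
    using that h n unfolding act by (auto simp: local_vec_def schur_def act_def)
  show "m \<notin> insert n J \<Longrightarrow> local_vec b n J z m = 0" "local_vec b n J z n = 1"
    using h by (auto simp: local_vec_def)
qed

text \<open>
  Hence a solution of all equations except the \<open>n\<close>-th is determined by its \<open>n\<close>-th coordinate, and the
  \<open>n\<close>-th equation is a scalar equation for the Schur complement.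
\<close>

lemma local_vec_unique:
  assumes b: "dominated b" and z: "small J z" and n: "n \<notin> J"
    and u: "admissible J u" "\<And>m. m \<notin> insert n J \<Longrightarrow> u m = 0"
      "\<And>m. m \<in> J \<Longrightarrow> (z - \<mu> m) * u m = act b (insert n J) u m"
  shows "u = (\<lambda>m. u n * local_vec b n J z m)"
    "(z - \<mu> n) * u n - act b (insert n J) u n = u n * schur b n J z"
proof -
  have "solves b J z (\<lambda>m. u n * b n m) (u(n := 0))"
    using u n by (auto simp: solves_def restrict_upd act_insert[OF b u(1) n] mult.commute)
  moreover have "solves b J z (\<lambda>m. u n * b n m) (\<lambda>m. u n * tail_vec b n J z m)"
    by (rule solves_cmult[OF tail_vec(1)[OF b z]])
  ultimately have eq: "u(n := 0) = (\<lambda>m. u n * tail_vec b n J z m)"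
    by (rule solves_unique[OF b z])
  show 1: "u = (\<lambda>m. u n * local_vec b n J z m)"
  proof
    fix m show "u m = u n * local_vec b n J z m"
      using fun_cong[OF eq, of m] by (auto simp: local_vec_def split: if_splits)
  qed
  have "act b (insert n J) u n = u n * act b (insert n J) (local_vec b n J z) n"
    by (subst 1) (rule act_cmult)
  moreover have "act b (insert n J) (local_vec b n J z) n = z - \<mu> n - schur b n J z"
    using local_vec_equation(2)[OF b z n, of n] local_vec_equation(4)[OF b z n] by (simp add: algebra_simps)
  ultimately show "(z - \<mu> n) * u n - act b (insert n J) u n = u n * schur b n J z"
    by (simp add: algebra_simps)
qed

lemma local_vec_bound:
  assumes b: "dominated b" and z: "small J z" and n: "n \<notin> J"
    and \<delta>: "\<delta> > 0" "\<And>k. k \<in> J \<Longrightarrow> \<delta> \<le> cmod (z - \<mu> k)"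
  shows "m \<in> insert n J \<Longrightarrow> cmod (local_vec b n J z m) \<le> max (1 / w n) (2 * w n / \<delta>) * w m"
    "m \<in> J \<Longrightarrow> cmod (local_vec b n J z m) \<le> 2 * w n / \<delta> * w m"
proof -
  have *: "cmod (local_vec b n J z m) \<le> 2 * w n / \<delta> * w m" if m: "m \<in> J" for m
  proof -
    have pos: "0 < cmod (z - \<mu> m)" using \<delta>(1) \<delta>(2)[OF m] by linarith
    have "cmod (local_vec b n J z m) \<le> 2 * w n * w m / cmod (z - \<mu> m)"
      using tail_vec(3)[OF b z m, of n] m n by (auto simp: local_vec_def)
    also have "\<dots> \<le> 2 * w n * w m / \<delta>"
      using \<delta>(2)[OF m] \<delta>(1) pos by (intro divide_left_mono) (auto simp: w_nonneg)
    finally show ?thesis by simp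
  qed
  then show "m \<in> J \<Longrightarrow> cmod (local_vec b n J z m) \<le> 2 * w n / \<delta> * w m" .
  assume m: "m \<in> insert n J"
  show "cmod (local_vec b n J z m) \<le> max (1 / w n) (2 * w n / \<delta>) * w m"
  proof (cases "m = n")
    case True
    then have "cmod (local_vec b n J z m) = 1 / w n * w n"
      using local_vec_equation(4)[OF b z n] w_pos[of n] by simp
    then show ?thesis
      using True mult_right_mono[of "1 / w n" "max (1 / w n) (2 * w n / \<delta>)" "w n"] w_nonneg[of n] by auto
  next
    case False
    then show ?thesis
      using m order_trans[OF *] mult_right_mono[of "2 * w n / \<delta>" "max (1 / w n) (2 * w n / \<delta>)" "w m"] w_nonneg[of m]
      by auto
  qed
qed

definition pairing :: "(nat \<Rightarrow> nat \<Rightarrow> complex) \<Rightarrow> nat \<Rightarrow> nat set \<Rightarrow> complex \<Rightarrow> complex \<Rightarrow> complex" where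
  "pairing b n J z z' = (\<Sum>\<^sub>\<infinity>m\<in>insert n J. local_vec b n J z m * local_vec (\<lambda>k m. b m k) n J z' m)"

text \<open>
  Green's identity for \<open>local_vec\<close> and its transposed counterpart: each has a source in the single
  coordinate \<open>n\<close>, where both vectors equal \<open>1\<close>.
\<close>

lemma schur_difference:
  assumes b: "dominated b" and n: "n \<notin> J" and z: "small J z" and z': "small J z'"
    and \<delta>: "\<delta> > 0" "\<And>k. k \<in> J \<Longrightarrow> \<delta> \<le> cmod (z' - \<mu> k)"
  shows "schur b n J z - schur (\<lambda>k m. b m k) n J z' = (z - z') * pairing b n J z z'"
proof -
  let ?u = "local_vec b n J z" and ?q = "local_vec (\<lambda>k m. b m k) n J z'"
  note b' = dominated_transpose[OF b]
  note eu = local_vec_equation[OF b z n] and eq = local_vec_equation[OF b' z' n]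
  have "(\<lambda>m. ?q m * ?u m) summable_on insert n J"
    by (rule functional_bound(1)[OF eu(1) local_vec_bound(1)[OF b' z' n \<delta>]])
  then have s: "(\<lambda>m. ?u m * ?q m) summable_on insert n J"
    by (simp add: mult.commute)
  note G = green_identity[OF b eu(1) eq(1) s eu(2) eq(2)]
  let ?R = "\<lambda>m. (if m = n then schur b n J z else 0) * ?q m - (if m = n then schur (\<lambda>k m. b m k) n J z' else 0) * ?u m"
  have "(?R has_sum ?R n) {n}"
    by (rule has_sum_finiteI) auto
  then have "(?R has_sum ?R n) (insert n J)"
    by (subst has_sum_cong_neutral[where T = "{n}" and g = ?R]) auto
  then have "?R n = (z - z') * (\<Sum>\<^sub>\<infinity>m\<in>insert n J. ?u m * ?q m)"
    using G has_sum_unique by blast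
  then show ?thesis
    by (simp add: pairing_def eu(4) eq(4))
qed

lemma schur_transpose:
  assumes b: "dominated b" and n: "n \<notin> J" and z: "small J z"
    and \<delta>: "\<delta> > 0" "\<And>k. k \<in> J \<Longrightarrow> \<delta> \<le> cmod (z - \<mu> k)"
  shows "schur (\<lambda>k m. b m k) n J z = schur b n J z"
  using schur_difference[OF b n z z \<delta>] by simp

text \<open>
  The term \<open>m = n\<close> of the pairing is \<open>1\<close>, the rest is \<open>O(w n\<^sup>2 / \<delta>)\<close>.
\<close>

lemma pairing_near_1:
  assumes b: "dominated b" and n: "n \<notin> J" and z: "small J z" and z': "small J z'"
    and \<delta>: "\<delta> > 0" "\<And>k. k \<in> J \<Longrightarrow> \<delta> \<le> cmod (z' - \<mu> k)"
    and w\<delta>: "4 * (w n)\<^sup>2 \<le> \<delta>"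
  shows "cmod (pairing b n J z z' - 1) \<le> 1/2"
    "pairing b n J z z' = 1 + (\<Sum>\<^sub>\<infinity>m\<in>J. local_vec (\<lambda>k m. b m k) n J z' m * tail_vec b n J z m)"
proof -
  let ?u = "local_vec b n J z" and ?q = "local_vec (\<lambda>k m. b m k) n J z'"
  note b' = dominated_transpose[OF b]
  note eu = local_vec_equation[OF b z n] and eq = local_vec_equation[OF b' z' n]
  note h = tail_vec(1)[OF b z, of n, unfolded solves_def]
  have q: "cmod (?q m) \<le> 2 * w n / \<delta> * w m" if "m \<in> J" for m
    by (rule local_vec_bound(2)[OF b' z' n \<delta> that])
  have s: "(\<lambda>m. ?q m * tail_vec b n J z m) summable_on J"
    "cmod (\<Sum>\<^sub>\<infinity>m\<in>J. ?q m * tail_vec b n J z m) \<le> 2 * w n / \<delta> * wnorm J (tail_vec b n J z)"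
    using functional_bound[of J "tail_vec b n J z" ?q "2 * w n / \<delta>"] h q by auto
  have eqJ: "?u m * ?q m = ?q m * tail_vec b n J z m" if "m \<in> J" for m
    using that n by (auto simp: local_vec_def)
  have s': "(\<lambda>m. ?u m * ?q m) summable_on J"
    using s(1) by (subst summable_on_cong[OF eqJ])
  show 1: "pairing b n J z z' = 1 + (\<Sum>\<^sub>\<infinity>m\<in>J. ?q m * tail_vec b n J z m)"
    unfolding pairing_def infsum_insert[OF s' n] using infsum_cong[OF eqJ] by (simp add: eu(4) eq(4))
  have "2 * w n / \<delta> * wnorm J (tail_vec b n J z) \<le> 2 * w n / \<delta> * w n"
    using tail_vec(2)[OF b z] \<delta>(1) w_nonneg by (intro mult_left_mono) auto
  also have "\<dots> \<le> 1/2"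
    using w\<delta> \<delta>(1) by (simp add: field_simps power2_eq_square)
  finally show "cmod (pairing b n J z z' - 1) \<le> 1/2"
    using s(2) by (simp add: 1)
qed

lemma local_vec_holomorphic:
  assumes b: "dominated b" and n: "n \<notin> J" and S: "\<And>z. z \<in> S \<Longrightarrow> small J z"
    and \<delta>: "\<delta> > 0" "\<And>z k. z \<in> S \<Longrightarrow> k \<in> J \<Longrightarrow> \<delta> \<le> cmod (z - \<mu> k)"
  shows "(\<lambda>z. local_vec b n J z m) holomorphic_on S"
proof (cases "m \<in> J")
  case True
  have "(\<lambda>z. \<Sum>\<^sub>\<infinity>k\<in>J. of_bool (k = m) * tail_vec b n J z k) holomorphic_on S"
    by (rule solution_functional_holomorphic[OF b S \<delta>, where f = "b n" and C = "1 / w m"])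
       (use tail_vec(1)[OF b S] w_pos w_nonneg in \<open>auto simp: less_imp_neq[symmetric]\<close>)
  moreover have "(\<Sum>\<^sub>\<infinity>k\<in>J. of_bool (k = m) * y k) = y m" for y :: "nat \<Rightarrow> complex"
    by (subst infsum_cong_neutral[where T = "{m}" and g = y]) (use True in auto)
  ultimately show ?thesis
    using True n by (cases "m = n") (auto simp: local_vec_def)
next
  case False
  have "local_vec b n J z m = (if m = n then 1 else 0)" if "z \<in> S" for z
    using local_vec_equation(3,4)[OF b S[OF that] n] False by auto
  then show ?thesis
    by (subst holomorphic_cong[OF refl]) auto
qed

text \<open>
  A zero of the Schur complement is a fixed point of
  \<open>z \<mapsto> \<mu> n + b n n + \<Sum> b k n * tail_vec z k\<close>, which maps the disc of radius \<open>2 (w n)\<^sup>2\<close> into itself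
  because each of the last two terms is bounded by \<open>(w n)\<^sup>2\<close>. Brouwer's theorem provides it; its
  uniqueness will follow from \<open>schur_difference\<close>.
\<close>

lemma schur_zero:
  assumes b: "dominated b" and n: "n \<notin> J" and S: "\<And>z. z \<in> S \<Longrightarrow> small J z"
    and \<delta>: "\<delta> > 0" "\<And>z k. z \<in> S \<Longrightarrow> k \<in> J \<Longrightarrow> \<delta> \<le> cmod (z - \<mu> k)"
    and ball: "cball (complex_of_real (\<mu> n)) (2 * (w n)\<^sup>2) \<subseteq> S"
  obtains l where "l \<in> cball (complex_of_real (\<mu> n)) (2 * (w n)\<^sup>2)" "schur b n J l = 0"
proof -
  let ?B = "cball (complex_of_real (\<mu> n)) (2 * (w n)\<^sup>2)"
  define F where "F z = \<mu> n + b n n + (\<Sum>\<^sub>\<infinity>k\<in>J. b k n * tail_vec b n J z k)" for z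
  have hol: "(\<lambda>z. \<Sum>\<^sub>\<infinity>k\<in>J. b k n * tail_vec b n J z k) holomorphic_on ?B"
  proof (rule solution_functional_holomorphic[OF b _ \<delta>(1), where f = "b n" and C = "w n"])
    show "cmod (b k n) \<le> w n * w k" for k
      using dominated_transpose[OF b] by (auto simp: dominated_def)
  qed (use ball S \<delta>(2) tail_vec(1)[OF b S] in auto)
  have "continuous_on ?B F"
    unfolding F_def by (intro continuous_intros holomorphic_on_imp_continuous_on[OF hol])
  moreover have "F z \<in> ?B" if "z \<in> ?B" for z
  proof -
    have z: "small J z" using that ball S by auto
    have "cmod (act b J (tail_vec b n J z) n) \<le> w n * wnorm J (tail_vec b n J z)"
      using tail_vec(1)[OF b z] by (intro act_bound(2)[OF b]) (auto simp: solves_def)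
    also have "\<dots> \<le> w n * w n"
      by (intro mult_left_mono tail_vec(2)[OF b z] w_nonneg)
    finally have "cmod (b n n + act b J (tail_vec b n J z) n) \<le> w n * w n + w n * w n"
      using b by (intro norm_triangle_le add_mono) (auto simp: dominated_def)
    moreover have "dist (complex_of_real (\<mu> n)) (F z) = cmod (b n n + act b J (tail_vec b n J z) n)"
      by (subst dist_commute) (simp add: F_def act_def dist_norm)
    ultimately show ?thesis
      by (simp add: power2_eq_square)
  qed
  moreover have "?B \<noteq> {}" by simp
  ultimately obtain l where "l \<in> ?B" "F l = l"
    using brouwer[of ?B F] by (auto simp: Pi_iff)
  then show thesis
    using that[of l] by (auto simp: F_def schur_def algebra_simps)
qed

end

section \<open>Schur's test\<close>

lemma infsum_Cauchy_Schwarz: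
  fixes f g :: "nat \<Rightarrow> real"
  assumes f: "(\<lambda>n. (f n)\<^sup>2) summable_on A" and g: "(\<lambda>n. (g n)\<^sup>2) summable_on A"
  shows "(\<lambda>n. \<bar>f n * g n\<bar>) summable_on A"
    "(\<Sum>\<^sub>\<infinity>n\<in>A. \<bar>f n * g n\<bar>)\<^sup>2 \<le> (\<Sum>\<^sub>\<infinity>n\<in>A. (f n)\<^sup>2) * (\<Sum>\<^sub>\<infinity>n\<in>A. (g n)\<^sup>2)"
proof -
  let ?F = "\<Sum>\<^sub>\<infinity>n\<in>A. (f n)\<^sup>2" and ?G = "\<Sum>\<^sub>\<infinity>n\<in>A. (g n)\<^sup>2"
  show s: "(\<lambda>n. \<bar>f n * g n\<bar>) summable_on A"
  proof (rule summable_on_comparison_test[OF summable_on_add[OF f g]])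
    fix n
    have "0 \<le> (\<bar>f n\<bar> - \<bar>g n\<bar>)\<^sup>2" by simp
    then have "2 * (\<bar>f n\<bar> * \<bar>g n\<bar>) \<le> (f n)\<^sup>2 + (g n)\<^sup>2"
      by (simp add: power2_diff)
    moreover have "0 \<le> \<bar>f n\<bar> * \<bar>g n\<bar>" by simp
    ultimately show "\<bar>f n * g n\<bar> \<le> (f n)\<^sup>2 + (g n)\<^sup>2"
      unfolding abs_mult by linarith
  qed simp
  have F: "0 \<le> ?F" and G: "0 \<le> ?G"
    by (auto intro: infsum_nonneg)
  have "(\<Sum>\<^sub>\<infinity>n\<in>A. \<bar>f n * g n\<bar>) \<le> sqrt (?F * ?G)"
  proof (rule infsum_le_finite_sums[OF s])
    fix H assume H: "finite H" "H \<subseteq> A"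
    have "(\<Sum>n\<in>H. \<bar>f n\<bar> * \<bar>g n\<bar>)\<^sup>2 \<le> (\<Sum>n\<in>H. \<bar>f n\<bar>\<^sup>2) * (\<Sum>n\<in>H. \<bar>g n\<bar>\<^sup>2)"
      by (rule Cauchy_Schwarz_ineq_sum)
    also have "\<dots> \<le> ?F * ?G"
      using finite_sum_le_infsum[OF f H] finite_sum_le_infsum[OF g H] F
      by (intro mult_mono) (auto intro: sum_nonneg)
    finally show "(\<Sum>n\<in>H. \<bar>f n * g n\<bar>) \<le> sqrt (?F * ?G)"
      by (intro real_le_rsqrt) (simp add: abs_mult)
  qed
  then have "(\<Sum>\<^sub>\<infinity>n\<in>A. \<bar>f n * g n\<bar>)\<^sup>2 \<le> (sqrt (?F * ?G))\<^sup>2"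
    by (intro power_mono infsum_nonneg) auto
  then show "(\<Sum>\<^sub>\<infinity>n\<in>A. \<bar>f n * g n\<bar>)\<^sup>2 \<le> ?F * ?G"
    using F G by simp
qed

text \<open>
  Schur's test with a positive weight \<open>p\<close>: write \<open>K n m = (K n m p n)\<^sup>1\<^sup>/\<^sup>2 (K n m / p n)\<^sup>1\<^sup>/\<^sup>2\<close>, apply the
  Cauchy-Schwarz inequality in \<open>n\<close>, and sum over \<open>m\<close>.
\<close>

lemma Schur_test:
  fixes K :: "nat \<Rightarrow> nat \<Rightarrow> real" and D :: "nat \<Rightarrow> nat \<Rightarrow> complex" and x :: "nat \<Rightarrow> complex"
  assumes p: "\<And>n. n \<in> A \<union> B \<Longrightarrow> 0 < p n"
    and K: "\<And>n m. n \<in> A \<Longrightarrow> m \<in> B \<Longrightarrow> 0 \<le> K n m"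
    and rows: "\<And>n. n \<in> A \<Longrightarrow> (\<lambda>m. K n m * p m) summable_on B"
      "\<And>n. n \<in> A \<Longrightarrow> (\<Sum>\<^sub>\<infinity>m\<in>B. K n m * p m) \<le> \<alpha> * p n"
    and cols: "\<And>m. m \<in> B \<Longrightarrow> (\<lambda>n. K n m * p n) summable_on A"
      "\<And>m. m \<in> B \<Longrightarrow> (\<Sum>\<^sub>\<infinity>n\<in>A. K n m * p n) \<le> \<beta> * p m"
    and D: "\<And>n m. n \<in> A \<Longrightarrow> m \<in> B \<Longrightarrow> cmod (D n m) \<le> K n m"
    and x: "(\<lambda>n. (cmod (x n))\<^sup>2) summable_on A"
    and \<alpha>\<beta>: "0 \<le> \<alpha>" "0 \<le> \<beta>"
  shows "\<And>m. m \<in> B \<Longrightarrow> (\<lambda>n. x n * D n m) summable_on A"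
    "(\<lambda>m. (cmod (\<Sum>\<^sub>\<infinity>n\<in>A. x n * D n m))\<^sup>2) summable_on B"
    "(\<Sum>\<^sub>\<infinity>m\<in>B. (cmod (\<Sum>\<^sub>\<infinity>n\<in>A. x n * D n m))\<^sup>2) \<le> \<alpha> * \<beta> * (\<Sum>\<^sub>\<infinity>n\<in>A. (cmod (x n))\<^sup>2)"
proof -
  define t where "t n m = (cmod (x n))\<^sup>2 * K n m / p n" for n m
  define R where "R n = (\<Sum>\<^sub>\<infinity>m\<in>B. K n m * p m)" for n
  have t0: "0 \<le> t n m" if "n \<in> A" "m \<in> B" for n m
    using K[OF that] p[of n] that by (simp add: t_def)
  have tsum: "(\<lambda>n. t n m) summable_on A" if m: "m \<in> B" for m
  proof (rule summable_le(1)[OF x])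
    fix n assume n: "n \<in> A"
    show "0 \<le> t n m" by (rule t0[OF n m])
    have "K n m * p m = (\<Sum>m\<in>{m}. K n m * p m)" by simp
    also have "\<dots> \<le> (\<Sum>\<^sub>\<infinity>m\<in>B. K n m * p m)"
      using m K n p by (intro finite_sum_le_infsum[OF rows(1)[OF n]]) (auto intro!: mult_nonneg_nonneg simp: less_imp_le)
    also have "\<dots> \<le> \<alpha> * p n" by (rule rows(2)[OF n])
    finally have "K n m / p n \<le> \<alpha> / p m"
      using p[of n] p[of m] n m by (simp add: field_simps)
    then have "(cmod (x n))\<^sup>2 * (K n m / p n) \<le> (cmod (x n))\<^sup>2 * (\<alpha> / p m)"
      by (rule mult_left_mono) simp
    then show "t n m \<le> \<alpha> / p m * (cmod (x n))\<^sup>2"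
      by (simp add: t_def mult_ac)
  qed
  have pointwise: "(\<lambda>n. x n * D n m) summable_on A"
    "(cmod (\<Sum>\<^sub>\<infinity>n\<in>A. x n * D n m))\<^sup>2 \<le> \<beta> * (p m * (\<Sum>\<^sub>\<infinity>n\<in>A. t n m))" if m: "m \<in> B" for m
  proof -
    let ?f = "\<lambda>n. sqrt (K n m * p n)" and ?g = "\<lambda>n. sqrt (t n m)"
    have f2: "(?f n)\<^sup>2 = K n m * p n" and g2: "(?g n)\<^sup>2 = t n m" if "n \<in> A" for n
      using K[OF that m] p[of n] that t0[OF that m] by auto
    have fs: "(\<lambda>n. (?f n)\<^sup>2) summable_on A"
      using cols(1)[OF m] by (subst summable_on_cong[OF f2])
    have gs: "(\<lambda>n. (?g n)\<^sup>2) summable_on A"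
      using tsum[OF m] by (subst summable_on_cong[OF g2])
    have fg: "cmod (x n * D n m) \<le> 1 * \<bar>?f n * ?g n\<bar>" if n: "n \<in> A" for n
    proof -
      have "(K n m * p n) * t n m = (cmod (x n) * K n m)\<^sup>2"
        using p[of n] n by (simp add: t_def power2_eq_square)
      then have "?f n * ?g n = sqrt ((cmod (x n) * K n m)\<^sup>2)"
        by (simp only: real_sqrt_mult[symmetric])
      also have "\<dots> = cmod (x n) * K n m"
        using K[OF n m] by simp
      finally have "?f n * ?g n = cmod (x n) * K n m" .
      then show ?thesis
        using D[OF n m] K[OF n m] by (simp add: norm_mult mult_left_mono)
    qed
    note CS = infsum_Cauchy_Schwarz[OF fs gs]
    show "(\<lambda>n. x n * D n m) summable_on A"
      by (rule summable_norm_le(1)[OF CS(1) fg])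
    have "cmod (\<Sum>\<^sub>\<infinity>n\<in>A. x n * D n m) \<le> (\<Sum>\<^sub>\<infinity>n\<in>A. \<bar>?f n * ?g n\<bar>)"
      by (rule summable_norm_le(2)[OF CS(1) fg, unfolded mult_1])
    then have "(cmod (\<Sum>\<^sub>\<infinity>n\<in>A. x n * D n m))\<^sup>2 \<le> (\<Sum>\<^sub>\<infinity>n\<in>A. \<bar>?f n * ?g n\<bar>)\<^sup>2"
      by (rule power_mono) (rule norm_ge_zero)
    also note CS(2)
    also have "(\<Sum>\<^sub>\<infinity>n\<in>A. (?f n)\<^sup>2) = (\<Sum>\<^sub>\<infinity>n\<in>A. K n m * p n)"
      by (rule infsum_cong[OF f2])
    also have "(\<Sum>\<^sub>\<infinity>n\<in>A. (?g n)\<^sup>2) = (\<Sum>\<^sub>\<infinity>n\<in>A. t n m)"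
      by (rule infsum_cong[OF g2])
    also have "(\<Sum>\<^sub>\<infinity>n\<in>A. K n m * p n) * (\<Sum>\<^sub>\<infinity>n\<in>A. t n m) \<le> (\<beta> * p m) * (\<Sum>\<^sub>\<infinity>n\<in>A. t n m)"
      using t0 m by (intro mult_right_mono cols(2) infsum_nonneg) auto
    finally show "(cmod (\<Sum>\<^sub>\<infinity>n\<in>A. x n * D n m))\<^sup>2 \<le> \<beta> * (p m * (\<Sum>\<^sub>\<infinity>n\<in>A. t n m))"
      by (simp add: mult_ac)
  qed
  then show "\<And>m. m \<in> B \<Longrightarrow> (\<lambda>n. x n * D n m) summable_on A" by blast
  have RR: "((\<lambda>m. t n m * p m) has_sum (cmod (x n))\<^sup>2 / p n * R n) B" if "n \<in> A" for n
    using has_sum_cmult_right[OF has_sum_infsum[OF rows(1)[OF that]], of "(cmod (x n))\<^sup>2 / p n"]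
    by (simp add: t_def R_def mult_ac)
  have Rle: "(cmod (x n))\<^sup>2 / p n * R n \<le> \<alpha> * (cmod (x n))\<^sup>2" and R0: "0 \<le> (cmod (x n))\<^sup>2 / p n * R n" if n: "n \<in> A" for n
  proof -
    have "(cmod (x n))\<^sup>2 / p n * R n \<le> (cmod (x n))\<^sup>2 / p n * (\<alpha> * p n)"
      unfolding R_def using p[of n] n by (intro mult_left_mono rows(2)) auto
    then show "(cmod (x n))\<^sup>2 / p n * R n \<le> \<alpha> * (cmod (x n))\<^sup>2"
      using p[of n] n by (simp add: mult_ac)
    show "0 \<le> (cmod (x n))\<^sup>2 / p n * R n"
      using RR[OF n] by (rule has_sum_nonneg) (use t0 n p in \<open>auto intro!: mult_nonneg_nonneg simp: less_imp_le\<close>)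
  qed
  note Rsum = summable_le[OF x R0 Rle]
  have ts: "(\<lambda>(n, m). t n m * p m) summable_on A \<times> B"
    by (rule summable_on_SigmaI[OF _ Rsum(1)])
       (use RR t0 p in \<open>auto intro!: mult_nonneg_nonneg simp: less_imp_le\<close>)
  then have ts': "(\<lambda>(m, n). t n m * p m) summable_on B \<times> A"
    by (subst (asm) summable_on_swap) simp
  have inner: "((\<lambda>n. t n m * p m) has_sum p m * (\<Sum>\<^sub>\<infinity>n\<in>A. t n m)) A" if "m \<in> B" for m
    using has_sum_cmult_left[OF has_sum_infsum[OF tsum[OF that]], of "p m"] by (simp add: mult_ac)
  have gs: "((\<lambda>m. p m * (\<Sum>\<^sub>\<infinity>n\<in>A. t n m)) has_sum infsum (\<lambda>(m, n). t n m * p m) (B \<times> A)) B"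
    by (rule has_sum_SigmaD[OF has_sum_infsum[OF ts']]) (use inner in auto)
  have "infsum (\<lambda>(m, n). t n m * p m) (B \<times> A) = (\<Sum>\<^sub>\<infinity>m\<in>B. \<Sum>\<^sub>\<infinity>n\<in>A. t n m * p m)"
    using infsum_Sigma_banach[OF ts'] by simp
  also have "\<dots> = (\<Sum>\<^sub>\<infinity>n\<in>A. \<Sum>\<^sub>\<infinity>m\<in>B. t n m * p m)"
    by (rule infsum_swap_banach[where f = "\<lambda>m n. t n m * p m", OF ts'])
  also have "\<dots> = (\<Sum>\<^sub>\<infinity>n\<in>A. (cmod (x n))\<^sup>2 / p n * R n)"
    by (intro infsum_cong infsumI RR)
  also have "\<dots> \<le> \<alpha> * (\<Sum>\<^sub>\<infinity>n\<in>A. (cmod (x n))\<^sup>2)"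
    by (rule Rsum(2))
  finally have total: "(\<Sum>\<^sub>\<infinity>m\<in>B. p m * (\<Sum>\<^sub>\<infinity>n\<in>A. t n m)) \<le> \<alpha> * (\<Sum>\<^sub>\<infinity>n\<in>A. (cmod (x n))\<^sup>2)"
    using infsumI[OF gs] by simp
  note fin = summable_le[OF has_sum_imp_summable[OF gs] _ pointwise(2)]
  show "(\<lambda>m. (cmod (\<Sum>\<^sub>\<infinity>n\<in>A. x n * D n m))\<^sup>2) summable_on B"
    by (rule fin(1)) auto
  have "(\<Sum>\<^sub>\<infinity>m\<in>B. (cmod (\<Sum>\<^sub>\<infinity>n\<in>A. x n * D n m))\<^sup>2) \<le> \<beta> * (\<Sum>\<^sub>\<infinity>m\<in>B. p m * (\<Sum>\<^sub>\<infinity>n\<in>A. t n m))"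
    by (rule fin(2)) auto
  also have "\<dots> \<le> \<beta> * (\<alpha> * (\<Sum>\<^sub>\<infinity>n\<in>A. (cmod (x n))\<^sup>2))"
    by (intro mult_left_mono total \<alpha>\<beta>)
  finally show "(\<Sum>\<^sub>\<infinity>m\<in>B. (cmod (\<Sum>\<^sub>\<infinity>n\<in>A. x n * D n m))\<^sup>2) \<le> \<alpha> * \<beta> * (\<Sum>\<^sub>\<infinity>n\<in>A. (cmod (x n))\<^sup>2)"
    by (simp add: mult_ac)
qed

section \<open>The discrete Hilbert kernel\<close>

text \<open>The zeta value \<open>\<zeta>(1 + \<eta>)\<close>.\<close>

definition zeta1 :: "real \<Rightarrow> real" where
  "zeta1 \<eta> = (\<Sum>\<^sub>\<infinity>j\<in>{1..}. real j powr (-1 - \<eta>))"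

text \<open>
  The factor \<open>max\<^sup>-\<^sup>\<eta>\<close> compensates the logarithmic divergence of the row sums of \<open>1 / |n - m|\<close>; the square
  root is the growth that the weight \<open>n\<^sup>-\<^sup>1\<^sup>/\<^sup>2\<close> in Schur's test can absorb.
\<close>

definition hilbert_kernel :: "real \<Rightarrow> nat \<Rightarrow> nat \<Rightarrow> real" where
  "hilbert_kernel \<eta> n m =
     real (max n m) powr (- \<eta>) * sqrt (real (max n m) / real (min n m)) / \<bar>real n - real m\<bar>"

lemma hilbert_kernel_sym: "hilbert_kernel \<eta> n m = hilbert_kernel \<eta> m n"
  by (simp add: hilbert_kernel_def max.commute min.commute abs_minus_commute)

lemma hilbert_kernel_nonneg: "0 \<le> hilbert_kernel \<eta> n m"
  by (simp add: hilbert_kernel_def)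

lemma powr_summable:
  assumes "\<eta> > 0"
  shows "(\<lambda>j. real j powr (-1 - \<eta>)) summable_on A"
proof -
  have "summable (\<lambda>j. real j powr (-1 - \<eta>))"
    using assms by (simp add: summable_real_powr_iff)
  then have "(\<lambda>j. real j powr (-1 - \<eta>)) summable_on UNIV"
    by (subst summable_on_UNIV_nonneg_real_iff) auto
  then show ?thesis
    by (rule summable_on_subset_banach) auto
qed

lemma zeta1_nonneg: "0 \<le> zeta1 \<eta>"
  unfolding zeta1_def by (rule infsum_nonneg) auto

text \<open>
  For \<open>m < n\<close> the left side is \<open>n\<^sup>-\<^sup>\<eta> (1/m + 1/(n - m))\<close> by partial fractions; for \<open>m > n\<close> it is
  \<open>m\<^sup>-\<^sup>\<eta> / (m - n)\<close>.
\<close>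

lemma hilbert_kernel_weighted:
  assumes \<eta>: "\<eta> > 0" and n: "n \<ge> 1" and m: "m \<ge> 1" and nm: "m \<noteq> n"
  shows "hilbert_kernel \<eta> n m * sqrt (real n / real m) \<le>
           real m powr (-1 - \<eta>) + \<bar>real n - real m\<bar> powr (-1 - \<eta>)"
proof (cases "m < n")
  case True
  have mono: "real n powr (- \<eta>) / t \<le> t powr (-1 - \<eta>)" if "0 < t" "t \<le> real n" for t :: real
  proof -
    have "real n powr (- \<eta>) \<le> t powr (- \<eta>)"
      using that \<eta> by (intro powr_mono2') auto
    then have "real n powr (- \<eta>) / t \<le> t powr (- \<eta>) / t"
      using that by (simp add: divide_right_mono)
    also have "\<dots> = t powr (- \<eta> - 1)"
      using that by (simp add: powr_diff)
    finally show ?thesis by (simp only: minus_diff_commute[of \<eta> 1])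
  qed
  have sq: "sqrt (real n / real m) * sqrt (real n / real m) = real n / real m"
    by simp
  have "hilbert_kernel \<eta> n m * sqrt (real n / real m) =
      real n powr (- \<eta>) * sqrt (real n / real m) * sqrt (real n / real m) / (real n - real m)"
    using True by (simp add: hilbert_kernel_def max_def min_def)
  then have "hilbert_kernel \<eta> n m * sqrt (real n / real m) = real n powr (- \<eta>) * (real n / real m) / (real n - real m)"
    by (simp only: sq mult.assoc)
  also have "\<dots> = real n powr (- \<eta>) / m + real n powr (- \<eta>) / (real n - real m)"
    using True m by (simp add: field_simps)
  also have "\<dots> \<le> real m powr (-1 - \<eta>) + (real n - real m) powr (-1 - \<eta>)"
    using True m by (intro add_mono mono) auto
  finally show ?thesis using True by simp
next
  case False
  with nm have nm: "n < m" by simp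
  let ?t = "real m - real n"
  have "sqrt (real m / real n) * sqrt (real n / real m) = 1"
    using n m by (simp add: real_sqrt_mult[symmetric])
  moreover have "hilbert_kernel \<eta> n m * sqrt (real n / real m) =
      real m powr (- \<eta>) * (sqrt (real m / real n) * sqrt (real n / real m)) / ?t"
    using nm by (simp add: hilbert_kernel_def max_def min_def)
  ultimately have "hilbert_kernel \<eta> n m * sqrt (real n / real m) = real m powr (- \<eta>) / ?t"
    by simp
  also have "\<dots> \<le> ?t powr (- \<eta>) / ?t"
    using nm n \<eta> by (intro divide_right_mono powr_mono2') auto
  also have "\<dots> = ?t powr (- \<eta> - 1)"
    using nm by (simp add: powr_diff)
  finally have "hilbert_kernel \<eta> n m * sqrt (real n / real m) \<le> ?t powr (-1 - \<eta>)"
    by (simp only: minus_diff_commute[of \<eta> 1])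
  then show ?thesis using nm by (simp add: add_increasing)
qed

lemma hilbert_kernel_row:
  assumes \<eta>: "\<eta> > 0" and n: "n \<ge> 1"
  shows "(\<lambda>m. hilbert_kernel \<eta> n m * sqrt (real n / real m)) summable_on {1..} - {n}"
    "(\<Sum>\<^sub>\<infinity>m\<in>{1..} - {n}. hilbert_kernel \<eta> n m * sqrt (real n / real m)) \<le> 3 * zeta1 \<eta>"
proof -
  let ?f = "\<lambda>m. \<bar>real n - real m\<bar> powr (-1 - \<eta>)" and ?g = "\<lambda>j. real j powr (-1 - \<eta>)"
  have 1: "(?f has_sum zeta1 \<eta>) {n + 1..}"
  proof -
    have bij: "bij_betw (\<lambda>j. j + n) {1..} {n + 1..}"
      by (rule bij_betw_byWitness[where f' = "\<lambda>m. m - n"]) auto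
    have "((\<lambda>j. ?f (j + n)) has_sum zeta1 \<eta>) {1..}"
      unfolding zeta1_def using has_sum_infsum[OF powr_summable[OF \<eta>, of "{1..}"]] by simp
    then show ?thesis
      by (subst (asm) has_sum_reindex_bij_betw[OF bij])
  qed
  have 2: "(?f has_sum sum ?f {1..<n}) {1..<n}" "sum ?f {1..<n} \<le> zeta1 \<eta>"
  proof -
    have "sum ?f {1..<n} = sum ?g {1..<n}"
      by (rule sum.reindex_bij_witness[where i = "\<lambda>m. n - m" and j = "\<lambda>m. n - m"]) (auto simp: of_nat_diff)
    also have "\<dots> \<le> zeta1 \<eta>"
      unfolding zeta1_def by (rule finite_sum_le_infsum[OF powr_summable[OF \<eta>]]) auto
    finally show "sum ?f {1..<n} \<le> zeta1 \<eta>" .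
  qed (rule has_sum_finite, simp)
  have U: "{1..} - {n} = {n + 1..} \<union> {1..<n}" using n by auto
  have 3: "(?f has_sum zeta1 \<eta> + sum ?f {1..<n}) ({1..} - {n})"
    unfolding U by (rule has_sum_Un_disjoint[OF 1 2(1)]) auto
  have 4: "(?g has_sum infsum ?g ({1..} - {n})) ({1..} - {n})"
    by (rule has_sum_infsum[OF powr_summable[OF \<eta>]])
  have 5: "infsum ?g ({1..} - {n}) \<le> zeta1 \<eta>"
    unfolding zeta1_def by (rule infsum_mono2[OF powr_summable[OF \<eta>] powr_summable[OF \<eta>]]) auto
  note 6 = has_sum_add[OF 4 3]
  have le: "hilbert_kernel \<eta> n m * sqrt (real n / real m) \<le> 1 * (?g m + ?f m)" if "m \<in> {1..} - {n}" for m
    unfolding mult_1 by (rule hilbert_kernel_weighted[OF \<eta> n]) (use that in auto)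
  have ge: "0 \<le> hilbert_kernel \<eta> n m * sqrt (real n / real m)" for m
    by (simp add: hilbert_kernel_nonneg)
  note 7 = summable_le[OF has_sum_imp_summable[OF 6] ge le, unfolded mult_1]
  show "(\<lambda>m. hilbert_kernel \<eta> n m * sqrt (real n / real m)) summable_on {1..} - {n}"
    by (rule 7(1))
  have "(\<Sum>\<^sub>\<infinity>m\<in>{1..} - {n}. hilbert_kernel \<eta> n m * sqrt (real n / real m)) \<le> infsum ?g ({1..} - {n}) + (zeta1 \<eta> + sum ?f {1..<n})"
    using 7(2) unfolding infsumI[OF 6] .
  then show "(\<Sum>\<^sub>\<infinity>m\<in>{1..} - {n}. hilbert_kernel \<eta> n m * sqrt (real n / real m)) \<le> 3 * zeta1 \<eta>"
    using 5 2(2) by linarith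
qed

text \<open>
  Half of the exponent is traded for a factor that tends to zero with the truncation index.
\<close>

lemma hilbert_kernel_tail:
  assumes "\<eta> > 0" "M \<ge> 1" "n \<ge> M"
  shows "hilbert_kernel \<eta> n m \<le> real M powr (- (\<eta> / 2)) * hilbert_kernel (\<eta> / 2) n m"
proof -
  let ?t = "real (max n m)"
  have "?t powr (- \<eta>) = ?t powr (- (\<eta> / 2)) * ?t powr (- (\<eta> / 2))"
    by (simp add: powr_add[symmetric])
  also have "\<dots> \<le> real M powr (- (\<eta> / 2)) * ?t powr (- (\<eta> / 2))"
    using assms by (intro mult_right_mono powr_mono2') auto
  finally have "?t powr (- \<eta>) * (sqrt (?t / real (min n m)) / \<bar>real n - real m\<bar>) \<le>
    (real M powr (- (\<eta> / 2)) * ?t powr (- (\<eta> / 2))) * (sqrt (?t / real (min n m)) / \<bar>real n - real m\<bar>)"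
    by (rule mult_right_mono) simp
  then show ?thesis
    by (simp add: hilbert_kernel_def mult_ac)
qed

lemma hilbert_kernel_Schur:
  fixes D :: "nat \<Rightarrow> nat \<Rightarrow> complex" and x :: "nat \<Rightarrow> complex"
  assumes \<eta>: "\<eta> > 0" and AB: "A \<subseteq> {1..}" "B \<subseteq> {1..}" and C: "0 \<le> C" "0 \<le> d"
    and D: "\<And>n m. n \<in> A \<Longrightarrow> m \<in> B \<Longrightarrow> n \<noteq> m \<Longrightarrow> cmod (D n m) \<le> C * hilbert_kernel \<eta> n m"
      "\<And>n. n \<in> A \<Longrightarrow> n \<in> B \<Longrightarrow> cmod (D n n) \<le> d"
    and x: "(\<lambda>n. (cmod (x n))\<^sup>2) summable_on A"
  shows "\<And>m. m \<in> B \<Longrightarrow> (\<lambda>n. x n * D n m) summable_on A"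
    "(\<lambda>m. (cmod (\<Sum>\<^sub>\<infinity>n\<in>A. x n * D n m))\<^sup>2) summable_on B"
    "(\<Sum>\<^sub>\<infinity>m\<in>B. (cmod (\<Sum>\<^sub>\<infinity>n\<in>A. x n * D n m))\<^sup>2) \<le> (d + C * (3 * zeta1 \<eta>))\<^sup>2 * (\<Sum>\<^sub>\<infinity>n\<in>A. (cmod (x n))\<^sup>2)"
proof -
  define K where "K n m = (if n = m then d else C * hilbert_kernel \<eta> n m)" for n m
  define p where "p n = 1 / sqrt (real n)" for n
  let ?c = "d + C * (3 * zeta1 \<eta>)"
  have p: "0 < p n" if "n \<in> A \<union> B" for n
    using that AB by (auto simp: p_def)
  have K0: "0 \<le> K n m" for n m
    using C by (simp add: K_def hilbert_kernel_nonneg)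
  have Ksym: "K n m = K m n" for n m
    by (simp add: K_def hilbert_kernel_sym)
  have row: "(\<lambda>m. K n m * p m) summable_on {1..}" "(\<Sum>\<^sub>\<infinity>m\<in>{1..}. K n m * p m) \<le> ?c * p n" if n: "n \<ge> 1" for n
  proof -
    have eq: "K n m * p m = (C * p n) * (hilbert_kernel \<eta> n m * sqrt (real n / real m))" if "m \<in> {1..} - {n}" for m
      using that n by (auto simp: K_def p_def real_sqrt_divide)
    note h = hilbert_kernel_row[OF \<eta> n]
    have s: "(\<lambda>m. K n m * p m) summable_on {1..} - {n}"
      by (subst summable_on_cong[OF eq], assumption, rule summable_on_cmult_right, rule h(1))
    have I: "{1..} = insert n ({1..} - {n})" using n by auto
    show "(\<lambda>m. K n m * p m) summable_on {1..}"
      using s by (subst I) (simp add: summable_on_insert_iff del: insert_Diff_single)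
    have "(\<Sum>\<^sub>\<infinity>m\<in>{1..}. K n m * p m) = K n n * p n + (\<Sum>\<^sub>\<infinity>m\<in>{1..} - {n}. K n m * p m)"
      by (subst I, rule infsum_insert[OF s]) simp
    also have "(\<Sum>\<^sub>\<infinity>m\<in>{1..} - {n}. K n m * p m) = (C * p n) * (\<Sum>\<^sub>\<infinity>m\<in>{1..} - {n}. hilbert_kernel \<eta> n m * sqrt (real n / real m))"
      by (subst infsum_cong[OF eq], assumption, rule infsum_cmult_right')
    also have "\<dots> \<le> (C * p n) * (3 * zeta1 \<eta>)"
      using C by (intro mult_left_mono h(2)) (auto simp: p_def)
    finally show "(\<Sum>\<^sub>\<infinity>m\<in>{1..}. K n m * p m) \<le> ?c * p n" by (simp add: K_def algebra_simps)
  qed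
  have rows: "(\<lambda>m. K n m * p m) summable_on S" "(\<Sum>\<^sub>\<infinity>m\<in>S. K n m * p m) \<le> ?c * p n" if n: "n \<ge> 1" and S: "S \<subseteq> {1..}" for n S
  proof -
    show s: "(\<lambda>m. K n m * p m) summable_on S"
      by (rule summable_on_subset_banach[OF row(1)[OF n] S])
    have "(\<Sum>\<^sub>\<infinity>m\<in>S. K n m * p m) \<le> (\<Sum>\<^sub>\<infinity>m\<in>{1..}. K n m * p m)"
      by (rule infsum_mono2[OF s row(1)[OF n] S]) (use K0 in \<open>auto simp: p_def\<close>)
    then show "(\<Sum>\<^sub>\<infinity>m\<in>S. K n m * p m) \<le> ?c * p n"
      using row(2)[OF n] by simp
  qed
  have DK: "cmod (D n m) \<le> K n m" if "n \<in> A" "m \<in> B" for n m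
    using D that by (auto simp: K_def)
  have c0: "0 \<le> ?c" using C zeta1_nonneg[of \<eta>] by simp
  have ge: "\<And>n. n \<in> A \<Longrightarrow> n \<ge> 1" "\<And>n. n \<in> B \<Longrightarrow> n \<ge> 1" using AB by auto
  have cols: "(\<lambda>n. K n m * p n) summable_on A" "(\<Sum>\<^sub>\<infinity>n\<in>A. K n m * p n) \<le> ?c * p m" if "m \<in> B" for m
    using rows[OF ge(2)[OF that] AB(1)] unfolding Ksym[of m] by auto
  note S = Schur_test[OF p K0 rows(1)[OF ge(1) AB(2)] rows(2)[OF ge(1) AB(2)] cols DK x c0 c0]
  show "\<And>m. m \<in> B \<Longrightarrow> (\<lambda>n. x n * D n m) summable_on A"
    by (rule S(1))
  show "(\<lambda>m. (cmod (\<Sum>\<^sub>\<infinity>n\<in>A. x n * D n m))\<^sup>2) summable_on B"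
    by (rule S(2))
  show "(\<Sum>\<^sub>\<infinity>m\<in>B. (cmod (\<Sum>\<^sub>\<infinity>n\<in>A. x n * D n m))\<^sup>2) \<le> ?c\<^sup>2 * (\<Sum>\<^sub>\<infinity>n\<in>A. (cmod (x n))\<^sup>2)"
    using S(3) by (simp add: power2_eq_square)
qed

section \<open>Eigenvalue gaps\<close>

text \<open>
  The assumption \<open>\<alpha> \<le> 1/2\<close> is no restriction, since lowering \<open>\<alpha>\<close> to \<open>1/2\<close> weakens the domination of \<open>b\<close>
  and keeps \<open>2\<alpha> + \<gamma> > 1\<close>. It bounds the powers \<open>(max(n,m) / min(n,m))\<^sup>\<alpha>\<close> by the square root in the Hilbert kernel.
\<close>

locale spectral_gap =
  fixes \<mu> :: "nat \<Rightarrow> real" and \<gamma> \<kappa> \<alpha> M :: real and N\<^sub>0 :: nat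
  assumes mu_1: "0 < \<mu> 1" and mu_Suc: "\<And>k. k \<ge> 1 \<Longrightarrow> \<mu> k \<le> \<mu> (Suc k)"
    and \<kappa>: "\<kappa> > 0" and \<gamma>: "\<gamma> > 0"
    and gap: "\<And>k. k \<ge> N\<^sub>0 \<Longrightarrow> \<mu> (Suc k) - \<mu> k \<ge> \<kappa> * real k powr (\<gamma> - 1)"
    and \<alpha>\<gamma>: "2 * \<alpha> + \<gamma> > 1" and \<alpha>: "\<alpha> \<le> 1/2" and M: "M > 0"
begin

definition w :: "nat \<Rightarrow> real" where
  "w k = (if k = 0 then 1 else sqrt M * real k powr (- \<alpha>))"

text \<open>
  The number \<open>eps\<close> is the room left in \<open>2\<alpha> + \<gamma> > 1\<close>. From the index \<open>N\<^sub>1\<close> on the gap condition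
  controls half of the indices below \<open>n\<close>, and \<open>\<rho> n\<close> is a distance that points of the \<open>n\<close>-th rectangle
  keep from all other \<open>\<mu> m\<close>, and points of its boundary also from \<open>\<mu> n\<close>.
\<close>

definition eps :: real where "eps = 2 * \<alpha> + \<gamma> - 1"

definition c\<^sub>\<gamma> :: real where "c\<^sub>\<gamma> = min 1 (2 powr (1 - \<gamma>))"

definition N\<^sub>1 :: nat where "N\<^sub>1 = 2 * N\<^sub>0 + 2"

definition c\<^sub>1 :: real where "c\<^sub>1 = \<kappa> * c\<^sub>\<gamma> / 2"

definition \<rho> :: "nat \<Rightarrow> real" where "\<rho> n = c\<^sub>1 * real n powr (\<gamma> - 1)"

definition \<sigma> :: "nat \<Rightarrow> real" where
  "\<sigma> n = (\<Sum>\<^sub>\<infinity>k\<in>{1..} - {n}. (w k)\<^sup>2 / \<bar>\<mu> n - \<mu> k\<bar>)"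

text \<open>
  The thresholds \<open>1/4\<close> and \<open>1/8\<close> are such that the sums over \<open>m \<noteq> n\<close>, whose denominators are at least
  half of \<open>|\<mu> n - \<mu> m|\<close> on the rectangle, stay below \<open>1/4\<close>, and the term \<open>m = n\<close> adds at most another
  \<open>1/4\<close> on its boundary.
\<close>

definition good :: "nat \<Rightarrow> bool" where
  "good n \<longleftrightarrow> n \<ge> N\<^sub>1 \<and> 4 * (w n)\<^sup>2 \<le> \<rho> n \<and> \<sigma> n \<le> 1/8"

text \<open>The closed rectangle bounded by the contour.\<close>

definition R :: "nat \<Rightarrow> complex set" where
  "R n = cbox (corner_ll \<kappa> \<gamma> \<mu> n) (corner_ur \<kappa> \<gamma> \<mu> n)"

lemma eps: "eps > 0" and c\<^sub>\<gamma>: "0 < c\<^sub>\<gamma>" "c\<^sub>\<gamma> \<le> 1" and c\<^sub>1: "0 < c\<^sub>1"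
  using \<alpha>\<gamma> \<kappa> by (auto simp: eps_def c\<^sub>\<gamma>_def c\<^sub>1_def)

lemma w_gt_0: "w k > 0"
  using M by (simp add: w_def)

sublocale weighted_diagonal w \<mu>
  by unfold_locales (rule w_gt_0)

lemma w_square: "k \<ge> 1 \<Longrightarrow> (w k)\<^sup>2 = M * real k powr (- 2 * \<alpha>)"
proof -
  assume k: "k \<ge> 1"
  have "(real k powr (- \<alpha>))\<^sup>2 = real k powr (- 2 * \<alpha>)"
    by (simp add: power2_eq_square powr_add[symmetric])
  then show ?thesis
    using k M by (simp add: w_def power_mult_distrib)
qed

lemma w_mult: "n \<ge> 1 \<Longrightarrow> m \<ge> 1 \<Longrightarrow> w n * w m = M * (real n powr (- \<alpha>) * real m powr (- \<alpha>))"
  using M by (simp add: w_def mult_ac)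

lemma mu_mono: "1 \<le> i \<Longrightarrow> i \<le> j \<Longrightarrow> \<mu> i \<le> \<mu> j"
proof (induction j)
  case (Suc j)
  show ?case
  proof (cases "i \<le> j")
    case True
    then show ?thesis using Suc mu_Suc[of j] by auto
  next
    case False
    then show ?thesis using Suc.prems by (simp add: le_Suc_eq)
  qed
qed simp

lemma mu_pos: "1 \<le> k \<Longrightarrow> 0 < \<mu> k"
  using mu_mono[of 1 k] mu_1 by simp

text \<open>
  On dyadic blocks \<open>k\<^sup>\<gamma>\<^sup>-\<^sup>1\<close> is comparable with \<open>n\<^sup>\<gamma>\<^sup>-\<^sup>1\<close>, whatever the sign of \<open>\<gamma> - 1\<close>.
\<close>

lemma powr_comparable:
  assumes "1 \<le> k" "k \<le> n" "n \<le> 2 * k"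
  shows "c\<^sub>\<gamma> * real n powr (\<gamma> - 1) \<le> real k powr (\<gamma> - 1)"
proof (cases "\<gamma> \<le> 1")
  case True
  have "real n powr (\<gamma> - 1) \<le> real k powr (\<gamma> - 1)"
    using assms True by (intro powr_mono2') auto
  then show ?thesis
    using mult_right_mono[OF c\<^sub>\<gamma>(2), of "real n powr (\<gamma> - 1)"] by simp
next
  case False
  have "real n powr (\<gamma> - 1) \<le> (2 * real k) powr (\<gamma> - 1)"
    using assms False by (intro powr_mono2) auto
  also have "\<dots> = 2 powr (\<gamma> - 1) * real k powr (\<gamma> - 1)"
    by (simp add: powr_mult)
  finally have "2 powr (1 - \<gamma>) * real n powr (\<gamma> - 1) \<le> 2 powr (1 - \<gamma>) * (2 powr (\<gamma> - 1) * real k powr (\<gamma> - 1))"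
    by (rule mult_left_mono) simp
  also have "\<dots> = real k powr (\<gamma> - 1)"
    by (simp add: mult.assoc[symmetric] powr_add[symmetric])
  finally have "2 powr (1 - \<gamma>) * real n powr (\<gamma> - 1) \<le> real k powr (\<gamma> - 1)" .
  moreover have "c\<^sub>\<gamma> * real n powr (\<gamma> - 1) \<le> 2 powr (1 - \<gamma>) * real n powr (\<gamma> - 1)"
    by (intro mult_right_mono) (auto simp: c\<^sub>\<gamma>_def)
  ultimately show ?thesis by simp
qed

lemma gap_sum:
  assumes j: "N\<^sub>0 \<le> j" "1 \<le> j" and n: "n \<le> 2 * j" and i: "j \<le> i" "i \<le> n"
  shows "\<kappa> * c\<^sub>\<gamma> * real n powr (\<gamma> - 1) * (real i - real j) \<le> \<mu> i - \<mu> j"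
  using i
proof (induction i)
  case 0
  then show ?case using j by simp
next
  case (Suc i)
  show ?case
  proof (cases "j \<le> i")
    case True
    have "\<kappa> * (c\<^sub>\<gamma> * real n powr (\<gamma> - 1)) \<le> \<kappa> * real i powr (\<gamma> - 1)"
      using \<kappa> True Suc.prems j n by (intro mult_left_mono powr_comparable) auto
    also have "\<dots> \<le> \<mu> (Suc i) - \<mu> i"
      using gap[of i] True j by simp
    finally show ?thesis
      using Suc True by (simp add: algebra_simps)
  next
    case False
    then have "j = Suc i" using Suc.prems by simp
    then show ?thesis by simp
  qed
qed

text \<open>
  When \<open>m\<close> lies below \<open>n/2\<close>, only the gaps between \<open>n/2\<close> and \<open>n\<close> are summed; they already account for half of
  \<open>n - m\<close>.
\<close>

lemma gap_lower:
  assumes "1 \<le> m" "m < n" "N\<^sub>1 \<le> n"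
  shows "c\<^sub>1 * (real n - real m) * real n powr (\<gamma> - 1) \<le> \<mu> n - \<mu> m"
proof -
  define j where "j = max m ((n + 1) div 2)"
  have j: "N\<^sub>0 \<le> j" "1 \<le> j" "n \<le> 2 * j" "j \<le> n" "m \<le> j"
    using assms by (auto simp: j_def N\<^sub>1_def)
  have "real n - real m \<le> 2 * (real n - real j)"
  proof (cases "(n + 1) div 2 \<le> m")
    case True
    then show ?thesis using assms by (simp add: j_def max_def)
  next
    case False
    then have "j = (n + 1) div 2" by (simp add: j_def)
    then have "2 * j \<le> n + m" using assms by simp
    then have "real (2 * j) \<le> real (n + m)" by (simp only: of_nat_le_iff)
    then show ?thesis by simp
  qed
  then have "c\<^sub>1 * (real n - real m) * real n powr (\<gamma> - 1) \<le> c\<^sub>1 * (2 * (real n - real j)) * real n powr (\<gamma> - 1)"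
    using c\<^sub>1 by (intro mult_right_mono mult_left_mono) auto
  also have "\<dots> = \<kappa> * c\<^sub>\<gamma> * real n powr (\<gamma> - 1) * (real n - real j)"
    by (simp add: c\<^sub>1_def)
  also have "\<dots> \<le> \<mu> n - \<mu> j"
    by (rule gap_sum) (use j in auto)
  also have "\<dots> \<le> \<mu> n - \<mu> m"
    using mu_mono[of m j] assms j by simp
  finally show ?thesis .
qed

lemma separation:
  assumes "1 \<le> n" "1 \<le> m" "n \<noteq> m" "N\<^sub>1 \<le> max n m"
  shows "c\<^sub>1 * \<bar>real n - real m\<bar> * real (max n m) powr (\<gamma> - 1) \<le> \<bar>\<mu> n - \<mu> m\<bar>"
    "0 < \<bar>\<mu> n - \<mu> m\<bar>"
proof -
  show 1: "c\<^sub>1 * \<bar>real n - real m\<bar> * real (max n m) powr (\<gamma> - 1) \<le> \<bar>\<mu> n - \<mu> m\<bar>"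
  proof (cases "m < n")
    case True
    then show ?thesis using gap_lower[of m n] assms by (simp add: max_def)
  next
    case False
    then show ?thesis using gap_lower[of n m] assms by (simp add: max_def)
  qed
  have "0 < c\<^sub>1 * \<bar>real n - real m\<bar> * real (max n m) powr (\<gamma> - 1)"
    using c\<^sub>1 assms by (intro mult_pos_pos) auto
  then show "0 < \<bar>\<mu> n - \<mu> m\<bar>" using 1 by linarith
qed

text \<open>Summation of the gaps; finitely many indices are absorbed in the constant.\<close>

lemma growth: obtains c where "c > 0" "\<And>m. m \<ge> 1 \<Longrightarrow> c * real m powr \<gamma> \<le> \<mu> m"
proof -
  define c where "c = min (c\<^sub>1 / 2) (\<mu> 1 / real N\<^sub>1 powr \<gamma>)"
  have c: "c > 0" using c\<^sub>1 mu_1 by (auto simp: c_def N\<^sub>1_def)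
  have "c * real m powr \<gamma> \<le> \<mu> m" if m: "m \<ge> 1" for m
  proof (cases "N\<^sub>1 \<le> m")
    case True
    then have m2: "m \<ge> 2" by (simp add: N\<^sub>1_def)
    have "c * real m powr \<gamma> \<le> c\<^sub>1 / 2 * real m powr \<gamma>"
      unfolding c_def by (intro mult_right_mono min.cobounded1) simp
    also have "\<dots> = c\<^sub>1 * (real m / 2) * real m powr (\<gamma> - 1)"
      using m by (simp add: powr_diff)
    also have "\<dots> \<le> c\<^sub>1 * (real m - real 1) * real m powr (\<gamma> - 1)"
      using m2 c\<^sub>1 by (intro mult_right_mono mult_left_mono) auto
    also have "\<dots> \<le> \<mu> m - \<mu> 1"
      using m2 True by (intro gap_lower) auto
    finally show ?thesis using mu_1 by simp
  next
    case False
    have "c * real m powr \<gamma> \<le> \<mu> 1 / real N\<^sub>1 powr \<gamma> * real N\<^sub>1 powr \<gamma>"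
      using False \<gamma> mu_1 by (intro mult_mono powr_mono2) (auto simp: c_def)
    also have "\<dots> = \<mu> 1" by (simp add: N\<^sub>1_def)
    also have "\<dots> \<le> \<mu> m" using mu_mono[of 1 m] m by simp
    finally show ?thesis .
  qed
  then show thesis using that c by blast
qed

lemma w_over_mu: "(\<lambda>k. (w k)\<^sup>2 / \<mu> k) summable_on {1..}"
proof -
  obtain c where c: "c > 0" "\<And>m. m \<ge> 1 \<Longrightarrow> c * real m powr \<gamma> \<le> \<mu> m"
    using growth by blast
  show ?thesis
  proof (rule summable_le(1)[OF powr_summable[OF eps]])
    fix k :: nat assume "k \<in> {1..}"
    then have k: "k \<ge> 1" by simp
    show "0 \<le> (w k)\<^sup>2 / \<mu> k" using mu_pos[OF k] by simp
    have "(w k)\<^sup>2 / \<mu> k \<le> M * real k powr (- 2 * \<alpha>) / (c * real k powr \<gamma>)"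
      unfolding w_square[OF k] using M c k mu_pos[OF k] by (intro divide_left_mono c(2)) auto
    also have "\<dots> = M / c * (real k powr (- 2 * \<alpha>) / real k powr \<gamma>)"
      by simp
    also have "real k powr (- 2 * \<alpha>) / real k powr \<gamma> = real k powr (-1 - eps)"
      by (simp add: eps_def powr_diff[symmetric])
    finally show "(w k)\<^sup>2 / \<mu> k \<le> M / c * real k powr (-1 - eps)" .
  qed
qed

lemma max_powr:
  assumes "1 \<le> n" "1 \<le> m"
  shows "1 / real (max n m) powr (\<gamma> - 1) = real (max n m) powr (2 * \<alpha>) * real (max n m) powr (- eps)"
  by (simp add: powr_minus_divide[symmetric] powr_add[symmetric] eps_def)

lemma kernel_offdiagonal:
  assumes nm: "1 \<le> n" "1 \<le> m" "n \<noteq> m" "N\<^sub>1 \<le> max n m"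
  shows "w n * w m / \<bar>\<mu> n - \<mu> m\<bar> \<le> M / c\<^sub>1 * hilbert_kernel eps n m"
proof -
  let ?a = "real (max n m)" and ?b = "real (min n m)" and ?d = "\<bar>real n - real m\<bar>"
  have ab: "1 \<le> ?b" "?b \<le> ?a" "real n * real m = ?a * ?b"
    using nm by (auto simp: max_def min_def)
  have ab': "real n powr (- \<alpha>) * real m powr (- \<alpha>) = ?a powr (- \<alpha>) * ?b powr (- \<alpha>)"
    by (auto simp: max_def min_def)
  have ratio: "?a powr \<alpha> * ?b powr (- \<alpha>) \<le> sqrt (?a / ?b)"
  proof -
    have "?a powr \<alpha> * ?b powr (- \<alpha>) = (?a / ?b) powr \<alpha>"
      using ab by (simp add: powr_divide powr_minus_divide)
    also have "\<dots> \<le> (?a / ?b) powr (1/2)"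
      using ab \<alpha> by (intro powr_mono) auto
    also have "\<dots> = sqrt (?a / ?b)"
      using ab by (simp add: powr_half_sqrt)
    finally show ?thesis .
  qed
  have "w n * w m / \<bar>\<mu> n - \<mu> m\<bar> \<le> w n * w m / (c\<^sub>1 * ?d * ?a powr (\<gamma> - 1))"
    using separation[OF nm] c\<^sub>1 nm ab w_gt_0[of n] w_gt_0[of m]
    by (intro divide_left_mono mult_pos_pos) auto
  also have "\<dots> = M / c\<^sub>1 * (?a powr (- \<alpha>) * ?b powr (- \<alpha>)) * (1 / ?a powr (\<gamma> - 1)) / ?d"
    unfolding w_mult[OF nm(1,2)] ab' by simp
  also have "\<dots> = M / c\<^sub>1 * ((?a powr (- \<alpha>) * ?a powr (2 * \<alpha>)) * ?b powr (- \<alpha>)) * ?a powr (- eps) / ?d"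
    unfolding max_powr[OF nm(1,2)] by (simp only: mult_ac)
  also have "?a powr (- \<alpha>) * ?a powr (2 * \<alpha>) = ?a powr \<alpha>"
    by (simp add: powr_add[symmetric])
  also have "M / c\<^sub>1 * (?a powr \<alpha> * ?b powr (- \<alpha>)) * ?a powr (- eps) / ?d \<le>
      M / c\<^sub>1 * sqrt (?a / ?b) * ?a powr (- eps) / ?d"
    using M c\<^sub>1 by (intro divide_right_mono mult_right_mono mult_left_mono ratio) auto
  also have "\<dots> = M / c\<^sub>1 * hilbert_kernel eps n m"
    by (simp add: hilbert_kernel_def)
  finally show ?thesis .
qed

lemma kernel_row_term:
  assumes nm: "1 \<le> n" "1 \<le> m" "n \<noteq> m" "N\<^sub>1 \<le> max n m"
  shows "(w m)\<^sup>2 / \<bar>\<mu> n - \<mu> m\<bar> \<le> M / c\<^sub>1 * (hilbert_kernel eps n m * sqrt (real n / real m))"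
proof -
  let ?a = "real (max n m)" and ?b = "real (min n m)" and ?d = "\<bar>real n - real m\<bar>"
  have ab: "1 \<le> ?b" "?b \<le> ?a" "1 \<le> ?a" "real m \<le> ?a"
    using nm by (auto simp: max_def min_def)
  have ratio: "real m powr (- 2 * \<alpha>) * ?a powr (2 * \<alpha>) \<le> sqrt (?a / ?b) * sqrt (real n / real m)"
  proof -
    have "real m powr (- 2 * \<alpha>) * ?a powr (2 * \<alpha>) = (?a / real m) powr (2 * \<alpha>)"
      using ab nm by (simp add: powr_divide powr_minus_divide)
    also have "\<dots> \<le> (?a / real m) powr 1"
      using ab \<alpha> nm by (intro powr_mono) auto
    also have "\<dots> = ?a / real m" using nm by simp
    also have "\<dots> = sqrt (?a / ?b) * sqrt (real n / real m)"
    proof (cases "m < n")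
      case True
      then show ?thesis by (simp add: max_def min_def)
    next
      case False
      then have "?a = real m" "?b = real n" by auto
      then have "sqrt (?a / ?b) * sqrt (real n / real m) = sqrt ((real m / real n) * (real n / real m))"
        by (simp only: real_sqrt_mult)
      also have "(real m / real n) * (real n / real m) = 1" using nm by simp
      finally show ?thesis using False nm by (simp add: max_def)
    qed
    finally show ?thesis .
  qed
  have "(w m)\<^sup>2 / \<bar>\<mu> n - \<mu> m\<bar> \<le> (w m)\<^sup>2 / (c\<^sub>1 * ?d * ?a powr (\<gamma> - 1))"
    using separation[OF nm] c\<^sub>1 nm ab
    by (intro divide_left_mono mult_pos_pos) auto
  also have "\<dots> = M / c\<^sub>1 * real m powr (- 2 * \<alpha>) * (1 / ?a powr (\<gamma> - 1)) / ?d"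
    unfolding w_square[OF nm(2)] by simp
  also have "\<dots> = M / c\<^sub>1 * (real m powr (- 2 * \<alpha>) * ?a powr (2 * \<alpha>)) * ?a powr (- eps) / ?d"
    unfolding max_powr[OF nm(1,2)] by (simp only: mult_ac)
  also have "\<dots> \<le> M / c\<^sub>1 * (sqrt (?a / ?b) * sqrt (real n / real m)) * ?a powr (- eps) / ?d"
    using M c\<^sub>1 by (intro divide_right_mono mult_right_mono mult_left_mono ratio) auto
  also have "\<dots> = M / c\<^sub>1 * (hilbert_kernel eps n m * sqrt (real n / real m))"
    by (simp add: hilbert_kernel_def)
  finally show ?thesis .
qed

lemma \<sigma>_bound:
  assumes n: "N\<^sub>1 \<le> n"
  shows "(\<lambda>k. (w k)\<^sup>2 / \<bar>\<mu> n - \<mu> k\<bar>) summable_on {1..} - {n}"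
    "\<sigma> n \<le> M / c\<^sub>1 * (3 * zeta1 (eps / 2)) * real n powr (- (eps / 2))"
proof -
  have n1: "1 \<le> n" using n by (simp add: N\<^sub>1_def)
  have e2: "eps / 2 > 0" using eps by simp
  note h = hilbert_kernel_row[OF e2 n1]
  have le: "(w k)\<^sup>2 / \<bar>\<mu> n - \<mu> k\<bar> \<le> (M / c\<^sub>1 * real n powr (- (eps / 2))) * (hilbert_kernel (eps / 2) n k * sqrt (real n / real k))"
    if k: "k \<in> {1..} - {n}" for k
  proof -
    have "(w k)\<^sup>2 / \<bar>\<mu> n - \<mu> k\<bar> \<le> M / c\<^sub>1 * (hilbert_kernel eps n k * sqrt (real n / real k))"
      using k n1 n by (intro kernel_row_term) auto
    also have "\<dots> \<le> M / c\<^sub>1 * ((real n powr (- (eps / 2)) * hilbert_kernel (eps / 2) n k) * sqrt (real n / real k))"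
      using M c\<^sub>1 n1 by (intro mult_left_mono mult_right_mono hilbert_kernel_tail eps) auto
    finally show ?thesis by (simp add: mult_ac)
  qed
  note s = summable_le[OF h(1) _ le]
  show "(\<lambda>k. (w k)\<^sup>2 / \<bar>\<mu> n - \<mu> k\<bar>) summable_on {1..} - {n}"
    by (rule s(1)) auto
  have "\<sigma> n \<le> (M / c\<^sub>1 * real n powr (- (eps / 2))) * (\<Sum>\<^sub>\<infinity>k\<in>{1..} - {n}. hilbert_kernel (eps / 2) n k * sqrt (real n / real k))"
    unfolding \<sigma>_def by (rule s(2)) auto
  also have "\<dots> \<le> (M / c\<^sub>1 * real n powr (- (eps / 2))) * (3 * zeta1 (eps / 2))"
    using M c\<^sub>1 by (intro mult_left_mono h(2)) auto
  finally show "\<sigma> n \<le> M / c\<^sub>1 * (3 * zeta1 (eps / 2)) * real n powr (- (eps / 2))"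
    by (simp add: mult_ac)
qed

lemma powr_decay: "\<eta> > 0 \<Longrightarrow> e > 0 \<Longrightarrow> \<forall>\<^sub>F n in sequentially. C * real n powr (- \<eta>) \<le> e"
proof -
  assume \<eta>: "\<eta> > 0" and e: "e > 0"
  have "(\<lambda>n. C * real n powr (- \<eta>)) \<longlonglongrightarrow> C * 0"
    using \<eta> by (intro tendsto_mult tendsto_const tendsto_neg_powr filterlim_real_sequentially) auto
  then have "(\<lambda>n. C * real n powr (- \<eta>)) \<longlonglongrightarrow> 0" by simp
  then have "\<forall>\<^sub>F n in sequentially. C * real n powr (- \<eta>) < e"
    using e by (rule order_tendstoD(2))
  then show ?thesis by eventually_elim simp
qed

lemma eventually_good: "\<forall>\<^sub>F n in sequentially. good n"
proof -
  have e2: "eps / 2 > 0" using eps by simp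
  have 1: "\<forall>\<^sub>F n in sequentially. (M / c\<^sub>1 * (3 * zeta1 (eps / 2))) * real n powr (- (eps / 2)) \<le> 1/8"
    by (rule powr_decay[OF e2]) simp
  have 2: "\<forall>\<^sub>F n in sequentially. (4 * M) * real n powr (- eps) \<le> c\<^sub>1"
    by (rule powr_decay[OF eps c\<^sub>1])
  have 3: "\<forall>\<^sub>F n in sequentially. n \<ge> N\<^sub>1" by (rule eventually_ge_at_top)
  show ?thesis
    using 1 2 3
  proof eventually_elim
    case (elim n)
    have n1: "n \<ge> 1" using elim(3) by (simp add: N\<^sub>1_def)
    have "4 * (w n)\<^sup>2 = ((4 * M) * real n powr (- eps)) * real n powr (\<gamma> - 1)"
      unfolding w_square[OF n1] by (simp add: powr_add[symmetric] eps_def mult.assoc)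
    also have "\<dots> \<le> \<rho> n"
      unfolding \<rho>_def by (intro mult_right_mono elim) simp
    finally show ?case
      using elim \<sigma>_bound(2)[of n] by (simp add: good_def)
  qed
qed

text \<open>
  The factor \<open>(\<mu> m / \<mu> n)\<^sup>1\<^sup>/\<^sup>2\<close> passes from the norm of \<open>H\<close> to the norm of \<open>V\<close>. It exceeds \<open>1\<close> only for \<open>m > n\<close>,
  and there is at most \<open>2\<close> as long as \<open>\<mu> m \<le> 4 \<mu> n\<close>. Otherwise \<open>\<mu> m - \<mu> n\<close> is comparable with \<open>\<mu> m\<close>, and the
  left side with \<open>w n w m / (\<mu> n \<mu> m)\<^sup>1\<^sup>/\<^sup>2\<close>, which \<open>growth\<close> bounds by a product of powers of \<open>n\<close> and \<open>m\<close>.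
\<close>

lemma kernel_ratio:
  obtains C where "C \<ge> 0"
    "\<And>n m. 1 \<le> n \<Longrightarrow> 1 \<le> m \<Longrightarrow> n \<noteq> m \<Longrightarrow> N\<^sub>1 \<le> max n m \<Longrightarrow>
       sqrt (\<mu> m / \<mu> n) * (w n * w m / \<bar>\<mu> n - \<mu> m\<bar>) \<le> C * hilbert_kernel (eps / 2) n m"
proof -
  obtain c where c: "c > 0" "\<And>m. m \<ge> 1 \<Longrightarrow> c * real m powr \<gamma> \<le> \<mu> m"
    using growth by blast
  define C where "C = max (2 * (M / c\<^sub>1)) (4 / 3 * (M / c))"
  have C: "C \<ge> 0" using M c\<^sub>1 by (simp add: C_def le_max_iff_disj)
  have "sqrt (\<mu> m / \<mu> n) * (w n * w m / \<bar>\<mu> n - \<mu> m\<bar>) \<le> C * hilbert_kernel (eps / 2) n m"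
    if nm: "1 \<le> n" "1 \<le> m" "n \<noteq> m" "N\<^sub>1 \<le> max n m" for n m
  proof (cases "\<mu> m \<le> 4 * \<mu> n")
    case True
    have "sqrt (\<mu> m / \<mu> n) \<le> sqrt 4"
      using True mu_pos[OF nm(1)] by (intro real_sqrt_le_mono) (simp add: pos_divide_le_eq)
    then have "sqrt (\<mu> m / \<mu> n) * (w n * w m / \<bar>\<mu> n - \<mu> m\<bar>) \<le> 2 * (M / c\<^sub>1 * hilbert_kernel eps n m)"
      using w_gt_0[of n] w_gt_0[of m] by (intro mult_mono kernel_offdiagonal nm) auto
    also have "\<dots> \<le> 2 * (M / c\<^sub>1 * hilbert_kernel (eps / 2) n m)"
    proof -
      have "real (max n m) powr (- eps) \<le> real (max n m) powr (- (eps / 2))"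
        using eps nm by (intro powr_mono) auto
      then have "hilbert_kernel eps n m \<le> hilbert_kernel (eps / 2) n m"
        unfolding hilbert_kernel_def by (intro divide_right_mono mult_right_mono) auto
      then show ?thesis
        using M c\<^sub>1 by (intro mult_left_mono) auto
    qed
    also have "\<dots> = 2 * (M / c\<^sub>1) * hilbert_kernel (eps / 2) n m" by simp
    also have "\<dots> \<le> C * hilbert_kernel (eps / 2) n m"
      by (intro mult_right_mono hilbert_kernel_nonneg) (simp add: C_def)
    finally show ?thesis .
  next
    case False
    note mn = mu_pos[OF nm(1)] and mm = mu_pos[OF nm(2)]
    have lt: "n < m"
      using False mu_mono[of m n] nm mn by (cases "n < m") auto
    have "3 / 4 * \<mu> m \<le> \<bar>\<mu> n - \<mu> m\<bar>" using False mn by simp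
    then have "w n * w m / \<bar>\<mu> n - \<mu> m\<bar> \<le> w n * w m / (3 / 4 * \<mu> m)"
      using mm w_gt_0[of n] w_gt_0[of m] mn by (intro divide_left_mono mult_pos_pos) auto
    then have "sqrt (\<mu> m / \<mu> n) * (w n * w m / \<bar>\<mu> n - \<mu> m\<bar>) \<le> sqrt (\<mu> m / \<mu> n) * (w n * w m / (3 / 4 * \<mu> m))"
      using mm mn by (intro mult_left_mono) auto
    also have "\<dots> = 4 / 3 * (w n * w m) / (sqrt (\<mu> n) * sqrt (\<mu> m))"
    proof -
      have "\<mu> m = sqrt (\<mu> m) * sqrt (\<mu> m)" using mm by simp
      then have "sqrt (\<mu> m / \<mu> n) / \<mu> m = 1 / (sqrt (\<mu> n) * sqrt (\<mu> m))"
        using mm mn by (simp add: real_sqrt_divide field_simps)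
      moreover have "sqrt (\<mu> m / \<mu> n) * (w n * w m / (3 / 4 * \<mu> m)) = 4 / 3 * (w n * w m) * (sqrt (\<mu> m / \<mu> n) / \<mu> m)"
        by simp
      ultimately show ?thesis by simp
    qed
    also have "\<dots> \<le> 4 / 3 * (w n * w m) / (sqrt (c * real n powr \<gamma>) * sqrt (c * real m powr \<gamma>))"
      using c nm w_gt_0[of n] w_gt_0[of m] mn mm
      by (intro divide_left_mono mult_mono mult_pos_pos) auto
    also have "\<dots> = 4 / 3 * (M / c) * ((real n powr (- \<alpha>) / real n powr (\<gamma> / 2)) * (real m powr (- \<alpha>) / real m powr (\<gamma> / 2)))"
    proof -
      have "sqrt (c * real n powr \<gamma>) * sqrt (c * real m powr \<gamma>) = (sqrt c * sqrt c) * (sqrt (real n powr \<gamma>) * sqrt (real m powr \<gamma>))"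
        by (simp only: real_sqrt_mult mult_ac)
      also have "sqrt c * sqrt c = c" using c by simp
      also have "sqrt (real n powr \<gamma>) = real n powr (\<gamma> / 2)"
        by (simp add: powr_half_sqrt[symmetric] powr_powr)
      also have "sqrt (real m powr \<gamma>) = real m powr (\<gamma> / 2)"
        by (simp add: powr_half_sqrt[symmetric] powr_powr)
      finally show ?thesis
        unfolding w_mult[OF nm(1,2)] by (simp add: field_simps)
    qed
    also have "(real n powr (- \<alpha>) / real n powr (\<gamma> / 2)) * (real m powr (- \<alpha>) / real m powr (\<gamma> / 2)) =
        real n powr (- (1/2) - eps / 2) * real m powr (- (1/2) - eps / 2)"
    proof -
      have "- (1/2) - eps / 2 = - \<alpha> - \<gamma> / 2" by (simp add: eps_def field_simps)
      then show ?thesis by (simp only: powr_diff)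
    qed
    also have "\<dots> \<le> real n powr (- (1/2)) * real m powr (- (1/2) - eps / 2)"
      using eps nm by (intro mult_right_mono powr_mono) auto
    also have "\<dots> = real m powr (- (eps / 2)) * (real m powr (1/2) / real n powr (1/2)) / real m"
    proof -
      have "real m powr (- (1/2) - eps / 2) = real m powr (- (eps / 2) + 1/2 - 1)"
        by (rule arg_cong[where f = "\<lambda>t. real m powr t"]) simp
      also have "\<dots> = real m powr (- (eps / 2)) * real m powr (1/2) / real m"
        using nm by (simp only: powr_diff powr_add) simp
      finally show ?thesis by (simp add: powr_minus_divide)
    qed
    also have "\<dots> \<le> hilbert_kernel (eps / 2) n m"
    proof -
      have "real m powr (- (eps / 2)) * (real m powr (1/2) / real n powr (1/2)) / real m \<le>
          real m powr (- (eps / 2)) * (real m powr (1/2) / real n powr (1/2)) / (real m - real n)"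
        using lt nm by (intro divide_left_mono mult_pos_pos) auto
      then show ?thesis
        using lt nm by (simp add: hilbert_kernel_def max_def min_def powr_half_sqrt real_sqrt_divide)
    qed
    finally have "sqrt (\<mu> m / \<mu> n) * (w n * w m / \<bar>\<mu> n - \<mu> m\<bar>) \<le> 4 / 3 * (M / c) * hilbert_kernel (eps / 2) n m"
      using M c by (simp add: mult_left_mono divide_right_mono)
    also have "\<dots> \<le> C * hilbert_kernel (eps / 2) n m"
      by (intro mult_right_mono hilbert_kernel_nonneg) (simp add: C_def)
    finally show ?thesis .
  qed
  then show thesis using that C by blast
qed

subsection \<open>Geometry of the rectangles\<close>

lemma mem_R: "z \<in> R n \<longleftrightarrow> \<mu> n - \<kappa> / 2 * (real n - 1) powr (\<gamma> - 1) \<le> Re z \<and> Re z \<le> \<mu> n + \<kappa> / 2 * real n powr (\<gamma> - 1) \<and>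
    - (\<kappa> / 2 * real n powr (\<gamma> - 1)) \<le> Im z \<and> Im z \<le> \<kappa> / 2 * real n powr (\<gamma> - 1)"
  by (auto simp: R_def in_cbox_complex_iff corner_ll_def corner_ur_def)

lemma mem_Pi: "z \<in> Pi_rect \<kappa> \<gamma> \<mu> n \<longleftrightarrow> \<mu> n - \<kappa> / 2 * (real n - 1) powr (\<gamma> - 1) < Re z \<and> Re z < \<mu> n + \<kappa> / 2 * real n powr (\<gamma> - 1) \<and>
    - (\<kappa> / 2 * real n powr (\<gamma> - 1)) < Im z \<and> Im z < \<kappa> / 2 * real n powr (\<gamma> - 1)"
  by (auto simp: Pi_rect_def in_box_complex_iff corner_ll_def corner_ur_def)

lemma rect_subset: "Pi_rect \<kappa> \<gamma> \<mu> n \<subseteq> R n"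
  unfolding R_def Pi_rect_def by (rule box_subset_cbox)

lemma radii:
  assumes "N\<^sub>1 \<le> n"
  shows "0 < \<rho> n" "\<rho> n \<le> \<kappa> / 2 * real n powr (\<gamma> - 1)" "\<rho> n \<le> \<kappa> / 2 * (real n - 1) powr (\<gamma> - 1)"
proof -
  have n: "n \<ge> 2" using assms by (simp add: N\<^sub>1_def)
  show "0 < \<rho> n" using c\<^sub>1 n by (simp add: \<rho>_def)
  have "c\<^sub>\<gamma> * real n powr (\<gamma> - 1) \<le> real n powr (\<gamma> - 1)"
    by (rule powr_comparable) (use n in auto)
  then show "\<rho> n \<le> \<kappa> / 2 * real n powr (\<gamma> - 1)"
    using \<kappa> by (simp add: \<rho>_def c\<^sub>1_def mult.assoc)
  have "c\<^sub>\<gamma> * real n powr (\<gamma> - 1) \<le> real (n - 1) powr (\<gamma> - 1)"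
    by (rule powr_comparable) (use n in auto)
  then show "\<rho> n \<le> \<kappa> / 2 * (real n - 1) powr (\<gamma> - 1)"
    using \<kappa> n by (simp add: \<rho>_def c\<^sub>1_def mult.assoc of_nat_diff)
qed

lemma R_distance:
  assumes n: "N\<^sub>1 \<le> n" and z: "z \<in> R n" and m: "1 \<le> m" "m \<noteq> n"
  shows "\<bar>\<mu> n - \<mu> m\<bar> / 2 \<le> cmod (z - \<mu> m)" "\<rho> n \<le> cmod (z - \<mu> m)"
proof -
  have n2: "n \<ge> 2" and nN: "n \<ge> N\<^sub>0" "n - 1 \<ge> N\<^sub>0" using n by (auto simp: N\<^sub>1_def)
  have z1: "\<mu> n - \<kappa> / 2 * (real n - 1) powr (\<gamma> - 1) \<le> Re z" and z2: "Re z \<le> \<mu> n + \<kappa> / 2 * real n powr (\<gamma> - 1)"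
    using z by (auto simp: mem_R)
  have "\<bar>\<mu> n - \<mu> m\<bar> / 2 \<le> \<bar>Re z - \<mu> m\<bar> \<and> \<rho> n \<le> \<bar>Re z - \<mu> m\<bar>"
  proof (cases "m < n")
    case True
    have "\<mu> m \<le> \<mu> (n - 1)" using True m by (intro mu_mono) auto
    moreover have "\<kappa> * (real n - 1) powr (\<gamma> - 1) \<le> \<mu> n - \<mu> (n - 1)"
      using gap[OF nN(2)] n2 by (simp add: of_nat_diff)
    ultimately have "(\<mu> n - \<mu> m) / 2 \<le> Re z - \<mu> m" "\<rho> n \<le> Re z - \<mu> m" "0 \<le> \<mu> n - \<mu> m"
      using z1 radii(3)[OF n] radii(1)[OF n] by (simp_all add: field_simps)
    moreover from this have "\<bar>\<mu> n - \<mu> m\<bar> = \<mu> n - \<mu> m" "\<bar>Re z - \<mu> m\<bar> = Re z - \<mu> m"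
      by (auto intro!: abs_of_nonneg)
    ultimately show ?thesis by simp
  next
    case False
    then have "\<mu> (Suc n) \<le> \<mu> m" using m n2 by (intro mu_mono) auto
    moreover have "\<kappa> * real n powr (\<gamma> - 1) \<le> \<mu> (Suc n) - \<mu> n"
      using gap[OF nN(1)] .
    ultimately have "(\<mu> m - \<mu> n) / 2 \<le> \<mu> m - Re z" "\<rho> n \<le> \<mu> m - Re z" "0 \<le> \<mu> m - \<mu> n"
      using z2 radii(2)[OF n] radii(1)[OF n] by (simp_all add: field_simps)
    moreover from this have "\<bar>\<mu> n - \<mu> m\<bar> = \<mu> m - \<mu> n" "\<bar>Re z - \<mu> m\<bar> = \<mu> m - Re z"
      using radii(1)[OF n] by (auto simp: abs_if)
    ultimately show ?thesis by simp
  qed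
  moreover have "\<bar>Re z - \<mu> m\<bar> \<le> cmod (z - \<mu> m)"
    using abs_Re_le_cmod[of "z - \<mu> m"] by simp
  ultimately show "\<bar>\<mu> n - \<mu> m\<bar> / 2 \<le> cmod (z - \<mu> m)" "\<rho> n \<le> cmod (z - \<mu> m)"
    by linarith+
qed

lemma boundary_distance:
  assumes n: "N\<^sub>1 \<le> n" and z: "z \<in> R n - Pi_rect \<kappa> \<gamma> \<mu> n"
  shows "\<rho> n \<le> cmod (z - \<mu> n)"
proof -
  have "\<rho> n \<le> \<bar>Re (z - \<mu> n)\<bar> \<or> \<rho> n \<le> \<bar>Im (z - \<mu> n)\<bar>"
    using z radii[OF n] unfolding Diff_iff mem_R mem_Pi by (simp add: not_less) linarith
  then show ?thesis
    using abs_Re_le_cmod[of "z - \<mu> n"] abs_Im_le_cmod[of "z - \<mu> n"] by linarith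
qed

lemma ball_in_rect:
  assumes n: "N\<^sub>1 \<le> n" and r: "r < \<rho> n"
  shows "cball (complex_of_real (\<mu> n)) r \<subseteq> Pi_rect \<kappa> \<gamma> \<mu> n"
proof
  fix z assume "z \<in> cball (complex_of_real (\<mu> n)) r"
  then have "cmod (z - \<mu> n) < \<rho> n"
    using r by (simp add: dist_norm norm_minus_commute)
  then have "\<bar>Re z - \<mu> n\<bar> < \<rho> n" "\<bar>Im z\<bar> < \<rho> n"
    using abs_Re_le_cmod[of "z - \<mu> n"] abs_Im_le_cmod[of "z - \<mu> n"] by auto
  then show "z \<in> Pi_rect \<kappa> \<gamma> \<mu> n"
    using radii[OF n] unfolding mem_Pi by linarith
qed

lemma good_small:
  assumes g: "good n" and z: "z \<in> R n"
  shows "small ({1..} - {n}) z" "z \<notin> Pi_rect \<kappa> \<gamma> \<mu> n \<Longrightarrow> small {1..} z"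
proof -
  have n: "N\<^sub>1 \<le> n" "\<sigma> n \<le> 1/8" "4 * (w n)\<^sup>2 \<le> \<rho> n" using g by (auto simp: good_def)
  have n1: "1 \<le> n" using n by (simp add: N\<^sub>1_def)
  have le: "(w k)\<^sup>2 / cmod (z - \<mu> k) \<le> 2 * ((w k)\<^sup>2 / \<bar>\<mu> n - \<mu> k\<bar>)" if k: "k \<in> {1..} - {n}" for k
  proof -
    have "0 < \<bar>\<mu> n - \<mu> k\<bar>" using separation(2)[of n k] k n n1 by auto
    then have "(w k)\<^sup>2 / cmod (z - \<mu> k) \<le> (w k)\<^sup>2 / (\<bar>\<mu> n - \<mu> k\<bar> / 2)"
      using R_distance(1)[OF n(1) z, of k] k by (intro divide_left_mono mult_pos_pos) auto
    then show ?thesis by (simp add: mult.commute)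
  qed
  note s = summable_le[OF \<sigma>_bound(1)[OF n(1)] _ le]
  have s1: "(\<lambda>k. (w k)\<^sup>2 / cmod (z - \<mu> k)) summable_on {1..} - {n}"
    by (rule s(1)) auto
  have s2: "(\<Sum>\<^sub>\<infinity>k\<in>{1..} - {n}. (w k)\<^sup>2 / cmod (z - \<mu> k)) \<le> 1/4"
  proof -
    have "(\<Sum>\<^sub>\<infinity>k\<in>{1..} - {n}. (w k)\<^sup>2 / cmod (z - \<mu> k)) \<le> 2 * \<sigma> n"
      unfolding \<sigma>_def by (rule s(2)) auto
    then show ?thesis using n by simp
  qed
  have ne: "z \<noteq> \<mu> k" if "k \<in> {1..} - {n}" for k
    using R_distance(2)[OF n(1) z, of k] radii(1)[OF n(1)] that by auto
  show "small ({1..} - {n}) z"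
    unfolding small_def using s1 s2 ne by auto
  assume z': "z \<notin> Pi_rect \<kappa> \<gamma> \<mu> n"
  have d: "\<rho> n \<le> cmod (z - \<mu> n)"
    by (rule boundary_distance[OF n(1)]) (use z z' in auto)
  have I: "{1..} = insert n ({1..} - {n})" using n1 by auto
  have s3: "(\<lambda>k. (w k)\<^sup>2 / cmod (z - \<mu> k)) summable_on {1..}"
    using s1 by (subst I) (simp add: summable_on_insert_iff del: insert_Diff_single)
  have "(\<Sum>\<^sub>\<infinity>k\<in>{1..}. (w k)\<^sup>2 / cmod (z - \<mu> k)) = (w n)\<^sup>2 / cmod (z - \<mu> n) + (\<Sum>\<^sub>\<infinity>k\<in>{1..} - {n}. (w k)\<^sup>2 / cmod (z - \<mu> k))"
    by (subst I, rule infsum_insert[OF s1]) simp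
  also have "(w n)\<^sup>2 / cmod (z - \<mu> n) \<le> 1/4"
  proof -
    have "0 < cmod (z - \<mu> n)" "4 * (w n)\<^sup>2 \<le> cmod (z - \<mu> n)"
      using d n(3) radii(1)[OF n(1)] by linarith+
    then show ?thesis by (simp add: pos_divide_le_eq)
  qed
  finally have s4: "(\<Sum>\<^sub>\<infinity>k\<in>{1..}. (w k)\<^sup>2 / cmod (z - \<mu> k)) \<le> 1/2"
    using s2 by simp
  have "z \<noteq> \<mu> n" using d radii(1)[OF n(1)] by auto
  with ne have "z \<noteq> \<mu> k" if "k \<in> {1..}" for k
    using that by (cases "k = n") auto
  then show "small {1..} z"
    unfolding small_def using s3 s4 by auto
qed

abbreviation off :: "nat \<Rightarrow> nat set" where "off n \<equiv> {1..} - {n}"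

text \<open>
  \<open>lev\<close> is the eigenvalue in the \<open>n\<close>-th rectangle, \<open>eigv\<close> its eigenvector and \<open>coeigv\<close> the eigenvector
  of the transposed matrix, both with \<open>n\<close>-th coordinate \<open>1\<close>. By the difference formula \<open>pair\<close> is the
  quotient of the Schur complement by \<open>z - lev\<close>.
\<close>

definition lev :: "(nat \<Rightarrow> nat \<Rightarrow> complex) \<Rightarrow> nat \<Rightarrow> complex" where
  "lev b n = (SOME l. l \<in> cball (complex_of_real (\<mu> n)) (2 * (w n)\<^sup>2) \<and> schur b n (off n) l = 0)"

definition eigv :: "(nat \<Rightarrow> nat \<Rightarrow> complex) \<Rightarrow> nat \<Rightarrow> nat \<Rightarrow> complex" where
  "eigv b n = local_vec b n (off n) (lev b n)"

definition coeigv :: "(nat \<Rightarrow> nat \<Rightarrow> complex) \<Rightarrow> nat \<Rightarrow> nat \<Rightarrow> complex" where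
  "coeigv b n = local_vec (\<lambda>k m. b m k) n (off n) (lev b n)"

definition pair :: "(nat \<Rightarrow> nat \<Rightarrow> complex) \<Rightarrow> nat \<Rightarrow> complex \<Rightarrow> complex" where
  "pair b n z = pairing b n (off n) z (lev b n)"

text \<open>
  Sequences that satisfy the pointwise resolvent estimate lie in the form domain: \<open>|z - \<mu> m|\<close> is bounded
  below by a multiple of \<open>\<mu> m\<close>, and both \<open>f\<close> and \<open>w \<mu>\<^sup>-\<^sup>1\<^sup>/\<^sup>2\<close> are square summable.
\<close>

lemma weighted_summable:
  fixes z :: complex
  assumes J: "J \<subseteq> {1..}" and \<delta>: "\<delta> > 0" "\<And>m. m \<in> J \<Longrightarrow> \<delta> \<le> cmod (z - \<mu> m)"
    and u: "\<And>m. m \<in> J \<Longrightarrow> cmod (u m) \<le> (cmod (f m) + K * w m) / cmod (z - \<mu> m)"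
    and f: "(\<lambda>m. (cmod (f m))\<^sup>2) summable_on J"
  shows "(\<lambda>m. \<mu> m * (cmod (u m))\<^sup>2) summable_on J"
proof -
  \<comment> \<open>the two bounds serve \<open>\<mu> m \<ge> 2 |z|\<close> and \<open>\<mu> m < 2 |z|\<close>\<close>
  define c where "c = min (1/2) (\<delta> / (2 * cmod z + 1))"
  have c: "c > 0" using \<delta>(1) by (simp add: c_def add_nonneg_pos)
  have cm: "c * \<mu> m \<le> cmod (z - \<mu> m)" if m: "m \<in> J" for m
  proof (cases "2 * cmod z \<le> \<mu> m")
    case True
    have "\<mu> m - cmod z \<le> cmod (z - \<mu> m)"
      using norm_triangle_ineq2[of "complex_of_real (\<mu> m)" z] by (simp add: norm_minus_commute)
    moreover have "c * \<mu> m \<le> 1/2 * \<mu> m"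
      using mu_pos[of m] m J unfolding c_def by (intro mult_right_mono min.cobounded1) auto
    ultimately show ?thesis using True by simp
  next
    case False
    have "c * \<mu> m \<le> \<delta> / (2 * cmod z + 1) * \<mu> m"
      using mu_pos[of m] m J unfolding c_def by (intro mult_right_mono min.cobounded2) auto
    also have "\<dots> \<le> \<delta> / (2 * cmod z + 1) * (2 * cmod z + 1)"
      using False \<delta>(1) by (intro mult_left_mono divide_nonneg_nonneg) auto
    also have "\<dots> = \<delta>"
      using norm_ge_zero[of z] by (simp add: add_nonneg_eq_0_iff del: norm_ge_zero)
    finally show ?thesis using \<delta>(2)[OF m] by simp
  qed
  have s: "(\<lambda>m. (cmod (f m))\<^sup>2 / \<mu> 1 + K\<^sup>2 * ((w m)\<^sup>2 / \<mu> m)) summable_on J"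
    using summable_on_cmult_left[OF f, of "1 / \<mu> 1"]
    by (intro summable_on_add summable_on_cmult_right summable_on_subset_banach[OF w_over_mu J]) auto
  show ?thesis
  proof (rule summable_le(1)[OF s])
    fix m assume m: "m \<in> J"
    then have m1: "1 \<le> m" using J by auto
    note mp = mu_pos[OF m1]
    show "0 \<le> \<mu> m * (cmod (u m))\<^sup>2" using mp by simp
    have "cmod (u m) \<le> \<bar>cmod (f m) + K * w m\<bar> / cmod (z - \<mu> m)"
      using u[OF m] by (rule order_trans) (intro divide_right_mono abs_ge_self norm_ge_zero)
    also have "\<dots> \<le> \<bar>cmod (f m) + K * w m\<bar> / (c * \<mu> m)"
      using cm[OF m] c mp \<delta>(2)[OF m] \<delta>(1) by (intro divide_left_mono mult_pos_pos) auto
    finally have "(cmod (u m))\<^sup>2 \<le> (\<bar>cmod (f m) + K * w m\<bar> / (c * \<mu> m))\<^sup>2"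
      by (rule power_mono) simp
    also have "\<dots> = (cmod (f m) + K * w m)\<^sup>2 / (c\<^sup>2 * (\<mu> m)\<^sup>2)"
      by (simp add: power_divide power_mult_distrib)
    also have "\<dots> \<le> (2 * ((cmod (f m))\<^sup>2 + K\<^sup>2 * (w m)\<^sup>2)) / (c\<^sup>2 * (\<mu> m)\<^sup>2)"
    proof (rule divide_right_mono)
      have "0 \<le> (cmod (f m) - K * w m)\<^sup>2" by simp
      then show "(cmod (f m) + K * w m)\<^sup>2 \<le> 2 * ((cmod (f m))\<^sup>2 + K\<^sup>2 * (w m)\<^sup>2)"
        by (simp add: power2_sum power2_diff power_mult_distrib)
    qed simp
    finally have "\<mu> m * (cmod (u m))\<^sup>2 \<le> \<mu> m * ((2 * ((cmod (f m))\<^sup>2 + K\<^sup>2 * (w m)\<^sup>2)) / (c\<^sup>2 * (\<mu> m)\<^sup>2))"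
      using mp by (intro mult_left_mono) auto
    also have "\<dots> = 2 / c\<^sup>2 * ((cmod (f m))\<^sup>2 / \<mu> m + K\<^sup>2 * ((w m)\<^sup>2 / \<mu> m))"
      using mp c by (simp add: field_simps power2_eq_square)
    also have "\<dots> \<le> 2 / c\<^sup>2 * ((cmod (f m))\<^sup>2 / \<mu> 1 + K\<^sup>2 * ((w m)\<^sup>2 / \<mu> m))"
      using mu_mono[of 1 m] m1 mu_1 mp c
      by (intro mult_left_mono add_right_mono divide_left_mono) auto
    finally show "\<mu> m * (cmod (u m))\<^sup>2 \<le> 2 / c\<^sup>2 * ((cmod (f m))\<^sup>2 / \<mu> 1 + K\<^sup>2 * ((w m)\<^sup>2 / \<mu> m))" .
  qed
qed

lemma square_summable_of_weighted:
  assumes "(\<lambda>m. \<mu> m * (cmod (u m))\<^sup>2) summable_on J" "J \<subseteq> {1..}"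
  shows "(\<lambda>m. (cmod (u m))\<^sup>2) summable_on J"
proof (rule summable_le(1)[OF assms(1)])
  fix m assume "m \<in> J"
  then have "\<mu> 1 \<le> \<mu> m" using mu_mono[of 1 m] assms(2) by auto
  then have "\<mu> 1 * (cmod (u m))\<^sup>2 \<le> \<mu> m * (cmod (u m))\<^sup>2"
    by (rule mult_right_mono) simp
  then show "(cmod (u m))\<^sup>2 \<le> 1 / \<mu> 1 * (\<mu> m * (cmod (u m))\<^sup>2)"
    using mu_1 by (simp add: field_simps)
qed simp

text \<open>
  Cauchy-Schwarz against \<open>w \<mu>\<^sup>-\<^sup>1\<^sup>/\<^sup>2\<close>: the form norm controls the weighted norm.
\<close>

lemma admissible_of_weighted:
  assumes "(\<lambda>m. \<mu> m * (cmod (u m))\<^sup>2) summable_on {1..}"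
  shows "admissible {1..} u"
  unfolding admissible_def
proof (rule summable_le(1)[OF summable_on_add[OF w_over_mu assms]])
  fix k :: nat assume "k \<in> {1..}"
  then have mk: "0 < \<mu> k" using mu_pos by simp
  show "0 \<le> w k * cmod (u k)" by (simp add: w_nonneg)
  have eq: "w k * cmod (u k) = (w k / sqrt (\<mu> k)) * (sqrt (\<mu> k) * cmod (u k))" using mk by simp
  have "0 \<le> (w k / sqrt (\<mu> k) - sqrt (\<mu> k) * cmod (u k))\<^sup>2" by simp
  then have "2 * (w k * cmod (u k)) \<le> (w k)\<^sup>2 / \<mu> k + \<mu> k * (cmod (u k))\<^sup>2"
    using mk by (simp add: power2_diff power_divide power_mult_distrib)
  then show "w k * cmod (u k) \<le> 1 * ((w k)\<^sup>2 / \<mu> k + \<mu> k * (cmod (u k))\<^sup>2)"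
    using mult_nonneg_nonneg[OF w_nonneg[of k] norm_ge_zero[of "u k"]] unfolding mult_1 by linarith
qed

context
  fixes b n
  assumes b: "dominated b" and g: "good n"
begin

lemma n_props: "N\<^sub>1 \<le> n" "1 \<le> n" "n \<notin> off n" "insert n (off n) = {1..}" "4 * (w n)\<^sup>2 \<le> \<rho> n" "0 < \<rho> n"
  using g radii(1)[of n] by (auto simp: good_def N\<^sub>1_def)

lemma off_small: "z \<in> R n \<Longrightarrow> small (off n) z"
  by (rule good_small(1)[OF g])

lemma off_distance: "z \<in> R n \<Longrightarrow> k \<in> off n \<Longrightarrow> \<rho> n \<le> cmod (z - \<mu> k)"
  using R_distance(2)[OF n_props(1)] by auto

lemma lev: "lev b n \<in> Pi_rect \<kappa> \<gamma> \<mu> n" "lev b n \<in> R n" "schur b n (off n) (lev b n) = 0"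
proof -
  have "2 * (w n)\<^sup>2 < \<rho> n"
    using n_props(5) zero_less_power[OF w_pos[of n], of 2] by linarith
  then have sub: "cball (complex_of_real (\<mu> n)) (2 * (w n)\<^sup>2) \<subseteq> Pi_rect \<kappa> \<gamma> \<mu> n"
    by (rule ball_in_rect[OF n_props(1)])
  then have "cball (complex_of_real (\<mu> n)) (2 * (w n)\<^sup>2) \<subseteq> R n"
    using rect_subset by blast
  then obtain l where "l \<in> cball (complex_of_real (\<mu> n)) (2 * (w n)\<^sup>2)" "schur b n (off n) l = 0"
    using schur_zero[OF b n_props(3) off_small n_props(6) off_distance] by blast
  then have "lev b n \<in> cball (complex_of_real (\<mu> n)) (2 * (w n)\<^sup>2) \<and> schur b n (off n) (lev b n) = 0"
    unfolding lev_def by (intro someI[where P = "\<lambda>l. l \<in> _ \<and> _ l"] conjI)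
  then show "lev b n \<in> Pi_rect \<kappa> \<gamma> \<mu> n" "schur b n (off n) (lev b n) = 0"
    using sub by auto
  then show "lev b n \<in> R n" using rect_subset by blast
qed

lemma eigv:
  "admissible {1..} (eigv b n)" "m \<ge> 1 \<Longrightarrow> (lev b n - \<mu> m) * eigv b n m = act b {1..} (eigv b n) m"
  "eigv b n n = 1" "eigv b n 0 = 0"
  using local_vec_equation[OF b off_small[OF lev(2)] n_props(3)] lev(3) n_props(2)
  unfolding n_props(4) eigv_def by auto

lemma coeigv:
  "admissible {1..} (coeigv b n)" "m \<ge> 1 \<Longrightarrow> (lev b n - \<mu> m) * coeigv b n m = act (\<lambda>k m. b m k) {1..} (coeigv b n) m"
  "coeigv b n n = 1" "coeigv b n 0 = 0"
  using local_vec_equation[OF dominated_transpose[OF b] off_small[OF lev(2)] n_props(3)] lev(3) n_props(2)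
    schur_transpose[OF b n_props(3) off_small[OF lev(2)] n_props(6) off_distance[OF lev(2)]]
  unfolding n_props(4) coeigv_def by auto

lemma coeigv_le: "m \<ge> 1 \<Longrightarrow> cmod (coeigv b n m) \<le> max (1 / w n) (2 * w n / \<rho> n) * w m"
  unfolding coeigv_def
  by (rule local_vec_bound(1)[OF dominated_transpose[OF b] off_small[OF lev(2)] n_props(3) n_props(6) off_distance[OF lev(2)]])
    (simp_all only: n_props(4) atLeast_iff)

lemma local_vec_offdiagonal:
  assumes b': "dominated b'" and z: "z \<in> R n" and m: "m \<ge> 1" "m \<noteq> n"
  shows "cmod (local_vec b' n (off n) z m) \<le> 4 * (w n * w m / \<bar>\<mu> n - \<mu> m\<bar>)"
    "cmod (local_vec b' n (off n) z m) \<le> (2 * w n) * w m / cmod (z - \<mu> m)"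
proof -
  have 0: "0 < \<bar>\<mu> n - \<mu> m\<bar>"
    using separation(2)[of n m] n_props m by auto
  show 1: "cmod (local_vec b' n (off n) z m) \<le> (2 * w n) * w m / cmod (z - \<mu> m)"
    using tail_vec(3)[OF b' off_small[OF z], of m n] m by (simp add: local_vec_def)
  also have "\<dots> \<le> (2 * w n) * w m / (\<bar>\<mu> n - \<mu> m\<bar> / 2)"
    using R_distance(1)[OF n_props(1) z m] 0 w_pos[of n] w_pos[of m]
    by (intro divide_left_mono mult_pos_pos) auto
  finally show "cmod (local_vec b' n (off n) z m) \<le> 4 * (w n * w m / \<bar>\<mu> n - \<mu> m\<bar>)" by simp
qed

lemma eigv_offdiagonal: "m \<ge> 1 \<Longrightarrow> m \<noteq> n \<Longrightarrow> cmod (eigv b n m) \<le> 4 * (w n * w m / \<bar>\<mu> n - \<mu> m\<bar>)"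
  unfolding eigv_def by (rule local_vec_offdiagonal(1)[OF b lev(2)])

lemma coeigv_offdiagonal: "m \<ge> 1 \<Longrightarrow> m \<noteq> n \<Longrightarrow> cmod (coeigv b n m) \<le> 4 * (w n * w m / \<bar>\<mu> n - \<mu> m\<bar>)"
  unfolding coeigv_def by (rule local_vec_offdiagonal(1)[OF dominated_transpose[OF b] lev(2)])

lemma local_vec_weighted:
  assumes b': "dominated b'" and z: "z \<in> R n"
  shows "(\<lambda>m. \<mu> m * (cmod (local_vec b' n (off n) z m))\<^sup>2) summable_on {1..}"
proof -
  have "(\<lambda>m. \<mu> m * (cmod (local_vec b' n (off n) z m))\<^sup>2) summable_on off n"
    by (rule weighted_summable[OF _ n_props(6) off_distance[OF z], where f = "\<lambda>_. 0" and K = "2 * w n"])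
       (use local_vec_offdiagonal(2)[OF b' z] in auto)
  then have "(\<lambda>m. \<mu> m * (cmod (local_vec b' n (off n) z m))\<^sup>2) summable_on insert n (off n)"
    by (simp add: summable_on_insert_iff del: insert_Diff_single)
  then show ?thesis by (simp only: n_props(4))
qed

lemma eigv_weighted: "(\<lambda>m. \<mu> m * (cmod (eigv b n m))\<^sup>2) summable_on {1..}"
  unfolding eigv_def by (rule local_vec_weighted[OF b lev(2)])

lemma coeigv_weighted: "(\<lambda>m. \<mu> m * (cmod (coeigv b n m))\<^sup>2) summable_on {1..}"
  unfolding coeigv_def by (rule local_vec_weighted[OF dominated_transpose[OF b] lev(2)])

lemma schur_factor: "z \<in> R n \<Longrightarrow> schur b n (off n) z = (z - lev b n) * pair b n z"
  using schur_difference[OF b n_props(3) off_small off_small[OF lev(2)] n_props(6) off_distance[OF lev(2)]]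
    schur_transpose[OF b n_props(3) off_small[OF lev(2)] n_props(6) off_distance[OF lev(2)]] lev(3)
  by (simp add: pair_def)

lemma pair_near_1: "z \<in> R n \<Longrightarrow> cmod (pair b n z - 1) \<le> 1/2"
  unfolding pair_def
  by (rule pairing_near_1(1)[OF b n_props(3) off_small off_small[OF lev(2)] n_props(6) off_distance[OF lev(2)] n_props(5)])

lemma pair_ge: "z \<in> R n \<Longrightarrow> 1/2 \<le> cmod (pair b n z)"
  using pair_near_1[of z] norm_triangle_ineq2[of 1 "1 - pair b n z"] by (simp add: norm_minus_commute)

lemma pair_nonzero: "z \<in> R n \<Longrightarrow> pair b n z \<noteq> 0"
  using pair_ge[of z] by auto

lemma pair_lev: "pair b n (lev b n) = (\<Sum>\<^sub>\<infinity>m\<in>{1..}. eigv b n m * coeigv b n m)"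
  unfolding pair_def pairing_def eigv_def coeigv_def n_props(4) by (rule refl)

lemma pair_holomorphic: "pair b n holomorphic_on R n"
proof -
  have "(\<lambda>z. \<Sum>\<^sub>\<infinity>m\<in>off n. coeigv b n m * tail_vec b n (off n) z m) holomorphic_on R n"
  proof (rule solution_functional_holomorphic[OF b off_small n_props(6) off_distance])
    show "solves b (off n) z (b n) (tail_vec b n (off n) z)" if "z \<in> R n" for z
      by (rule tail_vec(1)[OF b off_small[OF that]])
    show "cmod (coeigv b n k) \<le> max (1 / w n) (2 * w n / \<rho> n) * w k" if "k \<in> off n" for k
      using coeigv_le[of k] that by simp
  qed
  then have "(\<lambda>z. 1 + (\<Sum>\<^sub>\<infinity>m\<in>off n. coeigv b n m * tail_vec b n (off n) z m)) holomorphic_on R n"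
    by (intro holomorphic_intros)
  then show ?thesis
    by (rule holomorphic_transform)
       (unfold pair_def coeigv_def, rule pairing_near_1(2)[OF b n_props(3) off_small off_small[OF lev(2)] n_props(6) off_distance[OF lev(2)] n_props(5), symmetric])
qed

text \<open>
  The \<open>n\<close>-th coordinate of an eigenvector cannot vanish, so the Schur complement does; it has no zero
  other than \<open>lev\<close> because \<open>pair\<close> does not vanish.
\<close>

lemma eigen_unique:
  assumes z: "z \<in> R n" and u: "admissible {1..} u" "u 0 = 0" "u \<noteq> (\<lambda>_. 0)"
    and eq: "\<And>m. m \<ge> 1 \<Longrightarrow> (z - \<mu> m) * u m = act b {1..} u m"
  shows "z = lev b n" "u = (\<lambda>m. u n * eigv b n m)"
proof -
  have ad: "admissible (off n) u"
    using u(1) unfolding admissible_def by (rule summable_on_subset_banach) auto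
  have eq': "(z - \<mu> m) * u m = act b (insert n (off n)) u m" if "m \<in> off n" for m
    using eq[of m] that unfolding n_props(4) by simp
  have u0: "u m = 0" if "m \<notin> insert n (off n)" for m
    using that u(2) unfolding n_props(4) by (simp add: not_le)
  note U = local_vec_unique[OF b off_small[OF z] n_props(3) ad u0 eq']
  have un: "u n \<noteq> 0"
    using U(1) u(3) by (metis (no_types, lifting) mult_zero_left)
  have "u n * schur b n (off n) z = 0"
    using U(2) eq[OF n_props(2)] unfolding n_props(4) by simp
  then have "schur b n (off n) z = 0" using un by simp
  then show "z = lev b n"
    using schur_factor[OF z] pair_nonzero[OF z] by simp
  then show "u = (\<lambda>m. u n * eigv b n m)"
    using U(1) by (simp add: eigv_def)
qed

lemma resolvent_coordinates:
  assumes z: "z \<in> R n" and ne: "z \<noteq> lev b n"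
    and u: "admissible {1..} u" "u 0 = 0"
    and eq: "\<And>m. m \<ge> 1 \<Longrightarrow> (z - \<mu> m) * u m = of_bool (m = n) + act b {1..} u m"
  shows "u m = local_vec b n (off n) z m / pair b n z / (z - lev b n)"
proof -
  have ad: "admissible (off n) u"
    using u(1) unfolding admissible_def by (rule summable_on_subset_banach) auto
  have eq': "(z - \<mu> m) * u m = act b (insert n (off n)) u m" if "m \<in> off n" for m
    using eq[of m] that unfolding n_props(4) by simp
  have u0: "u m = 0" if "m \<notin> insert n (off n)" for m
    using that u(2) unfolding n_props(4) by (simp add: not_le)
  note U = local_vec_unique[OF b off_small[OF z] n_props(3) ad u0 eq']
  have "u n * ((z - lev b n) * pair b n z) = 1"
    using U(2) eq[OF n_props(2)] schur_factor[OF z] unfolding n_props(4) by simp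
  then have "u n = 1 / (pair b n z * (z - lev b n))"
    using ne pair_nonzero[OF z] by (simp add: field_simps)
  then show ?thesis
    using fun_cong[OF U(1), of m] by (simp add: mult.commute)
qed

lemma contour_in_R: "path_image (Gamma_contour \<kappa> \<gamma> \<mu> n) = R n - Pi_rect \<kappa> \<gamma> \<mu> n"
  unfolding Gamma_contour_def R_def Pi_rect_def
proof (rule path_image_rectpath_cbox_minus_box)
  have "0 \<le> \<kappa> * real n powr (\<gamma> - 1)" "0 \<le> \<kappa> * (real n - 1) powr (\<gamma> - 1)"
    using \<kappa> by auto
  then show "Re (corner_ll \<kappa> \<gamma> \<mu> n) \<le> Re (corner_ur \<kappa> \<gamma> \<mu> n)" "Im (corner_ll \<kappa> \<gamma> \<mu> n) \<le> Im (corner_ur \<kappa> \<gamma> \<mu> n)"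
    unfolding corner_ll_def corner_ur_def complex.sel by linarith+
qed

text \<open>
  The integrand has a simple pole at \<open>lev\<close> and is otherwise holomorphic on the closed rectangle, so this is
  Cauchy's integral formula.
\<close>

lemma contour_integral_resolvent:
  "((\<lambda>z. local_vec b n (off n) z m / pair b n z / (z - lev b n)) has_contour_integral
      2 * pi * \<i> * (eigv b n m / pair b n (lev b n))) (Gamma_contour \<kappa> \<gamma> \<mu> n)"
proof -
  have "((\<lambda>z. local_vec b n (off n) z m / pair b n z / (z - lev b n)) has_contour_integral
      2 * pi * \<i> * winding_number (Gamma_contour \<kappa> \<gamma> \<mu> n) (lev b n) *
        (local_vec b n (off n) (lev b n) m / pair b n (lev b n))) (Gamma_contour \<kappa> \<gamma> \<mu> n)"
  proof (rule Cauchy_integral_formula_convex_simple)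
    show "convex (R n)" by (simp add: R_def convex_box)
    show "(\<lambda>z. local_vec b n (off n) z m / pair b n z) holomorphic_on R n"
      by (intro holomorphic_intros pair_holomorphic pair_nonzero
          local_vec_holomorphic[OF b n_props(3) off_small n_props(6) off_distance])
    show "lev b n \<in> interior (R n)"
      using lev(1) by (simp add: R_def interior_cbox Pi_rect_def)
    show "path_image (Gamma_contour \<kappa> \<gamma> \<mu> n) \<subseteq> R n - {lev b n}"
      using contour_in_R lev(1) by auto
  qed (auto simp: Gamma_contour_def)
  moreover have "winding_number (Gamma_contour \<kappa> \<gamma> \<mu> n) (lev b n) = 1"
    unfolding Gamma_contour_def using lev(1) by (intro winding_number_rectpath) (simp add: Pi_rect_def)
  ultimately show ?thesis by (simp add: eigv_def)
qed

end

end

section \<open>Forms and orthonormal bases of Hilbert spaces\<close>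

lemma cinner_add_right: "cinner x (y + z) = cinner x y + cinner x (z :: 'a::complex_hilbert)"
proof -
  have "cinner x (y + z) = cnj (cinner y x + cinner z x)"
    by (subst cinner_commute) (simp only: cinner_add_left)
  then show ?thesis using cinner_commute[of x y] cinner_commute[of x z] by simp
qed

lemma cinner_scaleC_right: "cinner x (c *\<^sub>C y) = cnj c * cinner x (y :: 'a::complex_hilbert)"
proof -
  have "cinner x (c *\<^sub>C y) = cnj (c * cinner y x)"
    by (subst cinner_commute) (simp only: cinner_scaleC_left)
  then show ?thesis using cinner_commute[of x y] by simp
qed

lemma sesquilinear_cinner: "sesquilinear_on UNIV (cinner :: 'a::complex_hilbert \<Rightarrow> _)"
  by (simp add: sesquilinear_on_def cinner_add_left cinner_add_right cinner_scaleC_left cinner_scaleC_right)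

lemma hermitian_cinner: "hermitian_on UNIV (cinner :: 'a::complex_hilbert \<Rightarrow> _)"
  unfolding hermitian_on_def by (intro ballI cinner_commute)

lemma positive_cinner: "positive_definite_on UNIV (cinner :: 'a::complex_hilbert \<Rightarrow> _)"
  by (simp add: positive_definite_on_def cinner_self)

lemma form_norm_cinner: "form_norm cinner (u :: 'a::complex_hilbert) = norm u"
  by (simp add: form_norm_def cinner_self)

context
  fixes V :: "'a::complex_hilbert set" and s :: "'a \<Rightarrow> 'a \<Rightarrow> complex"
  assumes V: "complex_vector.subspace V" and s: "sesquilinear_on V s"
begin

lemma V_closed:
  "0 \<in> V" "u \<in> V \<Longrightarrow> v \<in> V \<Longrightarrow> u + v \<in> V" "u \<in> V \<Longrightarrow> c *\<^sub>C u \<in> V" "u \<in> V \<Longrightarrow> v \<in> V \<Longrightarrow> u - v \<in> V"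
  "(\<And>k. k \<in> F \<Longrightarrow> f k \<in> V) \<Longrightarrow> sum f F \<in> V"
  using V by (auto intro: complex_vector.subspace_0 complex_vector.subspace_add complex_vector.subspace_scale
    complex_vector.subspace_diff complex_vector.subspace_sum)

lemma form_simps:
  assumes "u \<in> V" "v \<in> V" "x \<in> V"
  shows "s (u + v) x = s u x + s v x" "s x (u + v) = s x u + s x v"
    "s (c *\<^sub>C u) v = c * s u v" "s u (c *\<^sub>C v) = cnj c * s u v"
    "s 0 u = 0" "s u 0 = 0" "s (u - v) x = s u x - s v x" "s x (u - v) = s x u - s x v"
proof -
  show 1: "s (u + v) x = s u x + s v x" "s x (u + v) = s x u + s x v"
      "s (c *\<^sub>C u) v = c * s u v" "s u (c *\<^sub>C v) = cnj c * s u v"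
    using s assms by (auto simp: sesquilinear_on_def)
  have 2: "s (c *\<^sub>C u) v = c * s u v" "s u (c *\<^sub>C v) = cnj c * s u v" if "u \<in> V" "v \<in> V" for u v c
    using s that by (auto simp: sesquilinear_on_def)
  show "s 0 u = 0" "s u 0 = 0"
    using 2[of u u 0] assms by (simp_all add: complex_vector.scale_zero_left)
  have uv: "u - v \<in> V" using assms V_closed(4) by blast
  have "s ((u - v) + v) x = s (u - v) x + s v x" "s x ((u - v) + v) = s x (u - v) + s x v"
    using s assms uv unfolding sesquilinear_on_def by blast+
  then show "s (u - v) x = s u x - s v x" "s x (u - v) = s x u - s x v"
    by simp_all
qed

lemma form_sum:
  assumes "finite F" "\<And>k. k \<in> F \<Longrightarrow> f k \<in> V" "x \<in> V"
  shows "s (\<Sum>k\<in>F. c k *\<^sub>C f k) x = (\<Sum>k\<in>F. c k * s (f k) x)"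
    "s x (\<Sum>k\<in>F. c k *\<^sub>C f k) = (\<Sum>k\<in>F. cnj (c k) * s x (f k))"
proof -
  have "s (\<Sum>k\<in>F. c k *\<^sub>C f k) x = (\<Sum>k\<in>F. c k * s (f k) x) \<and>
        s x (\<Sum>k\<in>F. c k *\<^sub>C f k) = (\<Sum>k\<in>F. cnj (c k) * s x (f k))"
    using assms(1,2)
  proof (induction F)
    case empty
    then show ?case using form_simps(5,6)[OF assms(3) assms(3) assms(3)] by simp
  next
    case (insert j F)
    have j: "f j \<in> V" "c j *\<^sub>C f j \<in> V" "(\<Sum>k\<in>F. c k *\<^sub>C f k) \<in> V"
      using insert by (auto intro!: V_closed)
    show ?case
      using insert j form_simps(1,2)[OF j(2,3) assms(3)] form_simps(3)[OF j(1) assms(3) assms(3)]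
        form_simps(4)[OF assms(3) j(1) assms(3)]
      by simp
  qed
  then show "s (\<Sum>k\<in>F. c k *\<^sub>C f k) x = (\<Sum>k\<in>F. c k * s (f k) x)"
    "s x (\<Sum>k\<in>F. c k *\<^sub>C f k) = (\<Sum>k\<in>F. cnj (c k) * s x (f k))" by auto
qed

text \<open>
  The weights \<open>\<mu>\<close> let the identity serve both the inner product of the Hilbert space (\<open>\<mu> = 1\<close>) and the
  form, for which the same vectors are orthogonal with \<open>a(\<psi>\<^sub>k, \<psi>\<^sub>k) = \<mu>\<^sub>k\<close>.
\<close>

lemma form_Bessel:
  assumes F: "finite F" "\<And>k. k \<in> F \<Longrightarrow> f k \<in> V" and u: "u \<in> V"
    and orth: "\<And>k j. k \<in> F \<Longrightarrow> j \<in> F \<Longrightarrow> s (f k) (f j) = of_real (\<mu> k) * of_bool (k = j)"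
    and c: "\<And>k. k \<in> F \<Longrightarrow> s u (f k) = of_real (\<mu> k) * c k" "\<And>k. k \<in> F \<Longrightarrow> s (f k) u = of_real (\<mu> k) * cnj (c k)"
  shows "s (\<Sum>k\<in>F. c k *\<^sub>C f k) (\<Sum>k\<in>F. c k *\<^sub>C f k) = of_real (\<Sum>k\<in>F. \<mu> k * (cmod (c k))\<^sup>2)"
    "s (u - (\<Sum>k\<in>F. c k *\<^sub>C f k)) (u - (\<Sum>k\<in>F. c k *\<^sub>C f k)) = s u u - of_real (\<Sum>k\<in>F. \<mu> k * (cmod (c k))\<^sup>2)"
proof -
  let ?P = "\<Sum>k\<in>F. c k *\<^sub>C f k" and ?S = "of_real (\<Sum>k\<in>F. \<mu> k * (cmod (c k))\<^sup>2) :: complex"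
  have P: "?P \<in> V" using F by (intro V_closed) auto
  have S: "?S = (\<Sum>k\<in>F. cnj (c k) * (of_real (\<mu> k) * c k))" "?S = (\<Sum>k\<in>F. c k * (of_real (\<mu> k) * cnj (c k)))"
    unfolding of_real_sum of_real_mult complex_norm_square by (auto simp: mult_ac intro!: sum.cong)
  have sP: "s ?P (f k) = of_real (\<mu> k) * c k" if k: "k \<in> F" for k
  proof -
    have "s ?P (f k) = (\<Sum>j\<in>F. c j * (of_real (\<mu> j) * of_bool (j = k)))"
      using k orth by (simp add: form_sum(1)[OF F F(2)[OF k]])
    also have "\<dots> = (\<Sum>j\<in>F. if j = k then of_real (\<mu> j) * c j else 0)"
      by (rule sum.cong) auto
    also have "\<dots> = of_real (\<mu> k) * c k" using k F by simp
    finally show ?thesis .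
  qed
  show 1: "s ?P ?P = ?S"
  proof -
    have "s ?P ?P = (\<Sum>k\<in>F. cnj (c k) * s ?P (f k))" by (rule form_sum(2)[OF F P])
    also have "\<dots> = (\<Sum>k\<in>F. cnj (c k) * (of_real (\<mu> k) * c k))" by (rule sum.cong) (auto simp: sP)
    finally show ?thesis using S(1) by simp
  qed
  have 2: "s u ?P = ?S"
  proof -
    have "s u ?P = (\<Sum>k\<in>F. cnj (c k) * s u (f k))" by (rule form_sum(2)[OF F u])
    also have "\<dots> = (\<Sum>k\<in>F. cnj (c k) * (of_real (\<mu> k) * c k))" by (rule sum.cong) (auto simp: c)
    finally show ?thesis using S(1) by simp
  qed
  have 3: "s ?P u = ?S"
  proof -
    have "s ?P u = (\<Sum>k\<in>F. c k * s (f k) u)" by (rule form_sum(1)[OF F u])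
    also have "\<dots> = (\<Sum>k\<in>F. c k * (of_real (\<mu> k) * cnj (c k)))" by (rule sum.cong) (auto simp: c)
    finally show ?thesis using S(2) by simp
  qed
  have uP: "u - ?P \<in> V" using u P V_closed by blast
  show "s (u - ?P) (u - ?P) = s u u - ?S"
    using form_simps(7)[OF u P uP] form_simps(8)[OF u P u] form_simps(8)[OF u P P] 1 2 3 by simp
qed

context
  assumes herm: "hermitian_on V s" and pos: "positive_definite_on V s"
begin

lemma form_nonneg: "u \<in> V \<Longrightarrow> 0 \<le> Re (s u u)" "u \<in> V \<Longrightarrow> s u u = of_real (Re (s u u))"
  "u \<in> V \<Longrightarrow> Re (s u u) = 0 \<Longrightarrow> u = 0"
proof -
  assume u: "u \<in> V"
  have *: "u \<noteq> 0 \<Longrightarrow> s u u \<in> \<real> \<and> 0 < Re (s u u)" "s 0 0 = 0"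
    using pos u form_simps(5)[OF V_closed(1) V_closed(1) V_closed(1)] by (auto simp: positive_definite_on_def)
  show "0 \<le> Re (s u u)" "s u u = of_real (Re (s u u))"
    using * by (cases "u = 0"; auto simp: complex_is_Real_iff complex_eq_iff)+
  show "Re (s u u) = 0 \<Longrightarrow> u = 0" using * by (cases "u = 0") auto
qed

lemma form_Cauchy_Schwarz:
  assumes u: "u \<in> V" and v: "v \<in> V"
  shows "cmod (s u v) \<le> form_norm s u * form_norm s v"
proof (cases "v = 0")
  case True
  then have "s u v = 0" using form_simps(6)[OF u u u] by simp
  moreover have "0 \<le> form_norm s u * form_norm s v"
    unfolding form_norm_def using form_nonneg(1)[OF u] form_nonneg(1)[OF v] by (intro mult_nonneg_nonneg real_sqrt_ge_zero)
  ultimately show ?thesis by simp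
next
  case False
  define B where "B = Re (s v v)"
  have "Re (s v v) \<noteq> 0" using form_nonneg(3)[OF v] False by blast
  then have B1: "B > 0"
    unfolding B_def using form_nonneg(1)[OF v] by linarith
  have B2: "s v v = of_real B"
    unfolding B_def by (rule form_nonneg(2)[OF v])
  note B = B1 B2
  have vu: "s v u = cnj (s u v)" using herm u v unfolding hermitian_on_def by blast
  let ?c = "s u v / of_real B"
  have cv: "?c *\<^sub>C v \<in> V" and ucv: "u - ?c *\<^sub>C v \<in> V"
    using u v by (auto intro!: V_closed)
  have "s (u - ?c *\<^sub>C v) (u - ?c *\<^sub>C v) = s u u - cnj ?c * s u v - ?c * s v u + ?c * (cnj ?c * s v v)"
    using form_simps(7)[OF u cv ucv] form_simps(8)[OF u cv u] form_simps(8)[OF u cv cv]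
      form_simps(4)[OF u v v] form_simps(3)[OF v u u] form_simps(3)[OF v cv v] form_simps(4)[OF v v v]
    by simp
  also have "\<dots> = s u u - (s u v * cnj (s u v)) / of_real B"
    using B by (simp add: vu field_simps)
  also have "s u v * cnj (s u v) = of_real ((cmod (s u v))\<^sup>2)"
    by (rule complex_norm_square[symmetric])
  finally have "0 \<le> Re (s u u - of_real ((cmod (s u v))\<^sup>2) / of_real B)"
    using form_nonneg(1)[OF ucv] by simp
  then have "(cmod (s u v))\<^sup>2 / B \<le> Re (s u u)"
    by (simp flip: of_real_divide of_real_power)
  then have "(cmod (s u v))\<^sup>2 \<le> Re (s u u) * B"
    using B by (simp add: pos_divide_le_eq)
  then show ?thesis
    unfolding form_norm_def B_def[symmetric] real_sqrt_mult[symmetric] by (rule real_le_rsqrt)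
qed

end

end

lemma norm_scaleC: "norm (c *\<^sub>C x) = cmod c * norm (x :: 'a::complex_hilbert)"
proof -
  have "cinner (c *\<^sub>C x) (c *\<^sub>C x) = of_real ((cmod c)\<^sup>2 * (norm x)\<^sup>2)"
  proof -
    have "cinner (c *\<^sub>C x) (c *\<^sub>C x) = c * (cnj c * cinner x x)"
      by (subst cinner_scaleC_left, subst cinner_scaleC_right) (rule refl)
    then show ?thesis
      by (simp only: cinner_self of_real_mult complex_norm_square mult.assoc)
  qed
  then have "of_real ((norm (c *\<^sub>C x))\<^sup>2) = (of_real ((cmod c * norm x)\<^sup>2) :: complex)"
    by (simp add: cinner_self power_mult_distrib)
  then have "(norm (c *\<^sub>C x))\<^sup>2 = (cmod c * norm x)\<^sup>2"
    by (simp only: of_real_eq_iff)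
  then show ?thesis
    by (simp add: power2_eq_iff_nonneg)
qed

lemma cinner_Cauchy_Schwarz: "cmod (cinner x y) \<le> norm x * norm (y :: 'a::complex_hilbert)"
  using form_Cauchy_Schwarz[OF complex_vector.subspace_UNIV sesquilinear_cinner hermitian_cinner positive_cinner, of x y]
  by (simp add: form_norm_cinner)

lemma bounded_linear_cinner: "bounded_linear (\<lambda>x. cinner x (y :: 'a::complex_hilbert))"
proof (rule bounded_linear_intro)
  show "cinner (r *\<^sub>R x) y = r *\<^sub>R cinner x y" for r and x :: 'a
    by (simp add: cinner_scaleC_left scaleC_of_real[symmetric] scaleR_conv_of_real)
  show "norm (cinner x y) \<le> norm x * norm y" for x :: 'a
    by (rule cinner_Cauchy_Schwarz)
qed (rule cinner_add_left)

lemma bounded_linear_scaleC_right: "bounded_linear (\<lambda>x. c *\<^sub>C (x :: 'a::complex_hilbert))"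
proof (rule bounded_linear_intro)
  show "c *\<^sub>C (r *\<^sub>R x) = r *\<^sub>R (c *\<^sub>C x)" for r and x :: 'a
    by (simp add: scaleC_of_real[symmetric] scaleC_scaleC mult.commute)
  show "norm (c *\<^sub>C x) \<le> norm x * cmod c" for x :: 'a
    by (simp add: norm_scaleC mult.commute)
qed (rule scaleC_add_right)

lemma has_sum_partial_sums:
  fixes f :: "nat \<Rightarrow> 'a::real_normed_vector"
  assumes "(f has_sum S) {1..}"
  shows "(\<lambda>n. \<Sum>k\<in>{1..n}. f k) \<longlonglongrightarrow> S"
proof -
  have "filterlim (\<lambda>n::nat. {1..n}) (finite_subsets_at_top {1..}) sequentially"
    unfolding filterlim_finite_subsets_at_top
  proof (intro allI impI)
    fix X :: "nat set" assume X: "finite X \<and> X \<subseteq> {1..}"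
    show "\<forall>\<^sub>F n in sequentially. finite {1..n} \<and> X \<subseteq> {1..n} \<and> {1..n} \<subseteq> {1..}"
      using eventually_ge_at_top[of "Max (insert 0 X)"]
    proof eventually_elim
      case (elim n)
      have "x \<le> n" if "x \<in> X" for x
        using Max_ge[of "insert 0 X" x] X that elim by auto
      then show ?case using X by auto
    qed
  qed
  with assms show ?thesis
    unfolding has_sum_def by (rule filterlim_compose)
qed

locale hilbert_basis =
  fixes \<psi> :: "nat \<Rightarrow> 'h::complex_hilbert"
  assumes basis: "orthonormal_basis_on UNIV cinner {1..} \<psi>"
begin

text \<open>The basis starts at \<open>\<psi> 1\<close>; zero at \<open>0\<close> makes coordinates functions on all natural numbers.\<close>

definition hat :: "'h \<Rightarrow> nat \<Rightarrow> complex" where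
  "hat u k = (if k = 0 then 0 else cinner u (\<psi> k))"

lemma psi_orth: "1 \<le> i \<Longrightarrow> 1 \<le> j \<Longrightarrow> cinner (\<psi> i) (\<psi> j) = of_bool (i = j)"
  using basis by (auto simp: orthonormal_basis_on_def)

lemma hat_0: "hat u 0 = 0" "hat 0 k = 0"
  using cinner_scaleC_left[of 0 0 "\<psi> k"] by (auto simp: hat_def complex_vector.scale_zero_left)

lemma hat_linear: "hat (u + v) k = hat u k + hat v k" "hat (c *\<^sub>C u) k = c * hat u k"
  "hat (u - v) k = hat u k - hat v k" "hat (r *\<^sub>R u) k = of_real r * hat u k"
proof -
  show 1: "hat (u + v) k = hat u k + hat v k" for u v by (simp add: hat_def cinner_add_left)
  show 2: "hat (c *\<^sub>C u) k = c * hat u k" for c u by (simp add: hat_def cinner_scaleC_left)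
  show "hat (u - v) k = hat u k - hat v k" using 1[of "u - v" v] by simp
  show "hat (r *\<^sub>R u) k = of_real r * hat u k" using 2[of "of_real r" u] by (simp add: scaleC_of_real)
qed

lemma hat_sum: "hat (sum f F) k = (\<Sum>i\<in>F. hat (f i) k)"
  by (induction F rule: infinite_finite_induct) (simp_all add: hat_0 hat_linear)

lemma hat_psi: "1 \<le> j \<Longrightarrow> hat (\<psi> j) k = of_bool (k = j)"
  by (auto simp: hat_def psi_orth)

definition proj :: "nat set \<Rightarrow> 'h \<Rightarrow> 'h" where
  "proj F u = (\<Sum>k\<in>F. hat u k *\<^sub>C \<psi> k)"

lemma proj_norm:
  assumes F: "finite F" "F \<subseteq> {1..}"
  shows "(norm (proj F u))\<^sup>2 = (\<Sum>k\<in>F. (cmod (hat u k))\<^sup>2)"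
    "(norm (u - proj F u))\<^sup>2 = (norm u)\<^sup>2 - (\<Sum>k\<in>F. (cmod (hat u k))\<^sup>2)"
proof -
  have k: "k \<ge> 1" if "k \<in> F" for k using that F by auto
  have comm: "cinner (\<psi> k) u = cnj (cinner u (\<psi> k))" for k by (rule cinner_commute)
  have "cinner (proj F u) (proj F u) = of_real (\<Sum>k\<in>F. 1 * (cmod (hat u k))\<^sup>2)"
    "cinner (u - proj F u) (u - proj F u) = cinner u u - of_real (\<Sum>k\<in>F. 1 * (cmod (hat u k))\<^sup>2)"
    unfolding proj_def
    by (rule form_Bessel[OF complex_vector.subspace_UNIV sesquilinear_cinner F(1)];
        use k psi_orth comm in \<open>auto simp: hat_def\<close>)+
  then have "of_real ((norm (proj F u))\<^sup>2) = (of_real (\<Sum>k\<in>F. (cmod (hat u k))\<^sup>2) :: complex)"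
    "of_real ((norm (u - proj F u))\<^sup>2) = (of_real ((norm u)\<^sup>2 - (\<Sum>k\<in>F. (cmod (hat u k))\<^sup>2)) :: complex)"
    by (simp_all add: cinner_self)
  then show "(norm (proj F u))\<^sup>2 = (\<Sum>k\<in>F. (cmod (hat u k))\<^sup>2)"
    "(norm (u - proj F u))\<^sup>2 = (norm u)\<^sup>2 - (\<Sum>k\<in>F. (cmod (hat u k))\<^sup>2)"
    by (simp_all only: of_real_eq_iff)
qed

lemma expansion: "((\<lambda>k. hat u k *\<^sub>C \<psi> k) has_sum u) {1..}"
proof -
  have fin: "\<exists>F0. finite F0 \<and> F0 \<subseteq> {1..} \<and> (\<forall>F. finite F \<longrightarrow> F0 \<subseteq> F \<longrightarrow> F \<subseteq> {1..} \<longrightarrow> proj F x = x)"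
    if "x \<in> complex_vector.span (\<psi> ` {1..})" for x
    using that
  proof (induction x rule: complex_vector.span_induct_alt)
    case base
    show ?case by (intro exI[of _ "{}"]) (simp add: proj_def hat_0 complex_vector.scale_zero_left)
  next
    case (step c x y)
    then obtain j where j: "j \<ge> 1" "x = \<psi> j" by auto
    obtain F0 where F0: "finite F0" "F0 \<subseteq> {1..}" "\<And>F. finite F \<Longrightarrow> F0 \<subseteq> F \<Longrightarrow> F \<subseteq> {1..} \<Longrightarrow> proj F y = y"
      using step by blast
    have "proj F (c *\<^sub>C x + y) = c *\<^sub>C x + y" if F: "finite F" "insert j F0 \<subseteq> F" "F \<subseteq> {1..}" for F
    proof -
      have "proj F (c *\<^sub>C x + y) = (\<Sum>k\<in>F. (if k = j then c *\<^sub>C \<psi> j else 0)) + proj F y"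
        unfolding proj_def sum.distrib[symmetric] using j
        by (intro sum.cong) (auto simp: hat_linear hat_psi complex_vector.scale_left_distrib complex_vector.scale_zero_left)
      then show ?thesis using F F0(3)[of F] j by simp
    qed
    then show ?case using F0 j by (intro exI[of _ "insert j F0"]) auto
  qed
  have dense: "\<forall>v. \<forall>\<epsilon>>0. \<exists>x\<in>complex_vector.span (\<psi> ` {1..}). norm (v - x) < \<epsilon>"
    using basis by (simp add: orthonormal_basis_on_def form_norm_cinner)
  show ?thesis
    unfolding has_sum_def
  proof (rule tendstoI)
    fix e :: real assume "e > 0"
    then obtain x where x: "x \<in> complex_vector.span (\<psi> ` {1..})" "norm (u - x) < e"
      using dense by blast
    obtain F0 where F0: "finite F0" "F0 \<subseteq> {1..}" "\<And>F. finite F \<Longrightarrow> F0 \<subseteq> F \<Longrightarrow> F \<subseteq> {1..} \<Longrightarrow> proj F x = x"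
      using fin[OF x(1)] by blast
    have "dist (proj F u) u < e" if F: "finite F" "F0 \<subseteq> F" "F \<subseteq> {1..}" for F
    proof -
      have "proj F (u - x) = proj F u - proj F x"
        by (simp add: proj_def hat_linear complex_vector.scale_left_diff_distrib sum_subtractf)
      then have eq: "u - proj F u = (u - x) - proj F (u - x)"
        using F0(3)[OF F] by simp
      have "(norm ((u - x) - proj F (u - x)))\<^sup>2 \<le> (norm (u - x))\<^sup>2"
        using proj_norm(2)[OF F(1,3), of "u - x"] sum_nonneg[of F "\<lambda>k. (cmod (hat (u - x) k))\<^sup>2"] by simp
      then have "norm (u - proj F u) \<le> norm (u - x)"
        unfolding eq by (rule power2_le_imp_le) simp
      then show ?thesis
        using x(2) unfolding dist_norm by (subst norm_minus_commute) linarith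
    qed
    then show "\<forall>\<^sub>F F in finite_subsets_at_top {1..}. dist (\<Sum>k\<in>F. hat u k *\<^sub>C \<psi> k) u < e"
      unfolding eventually_finite_subsets_at_top proj_def[symmetric] using F0 by blast
  qed
qed

lemma Parseval: "((\<lambda>k. (cmod (hat u k))\<^sup>2) has_sum (norm u)\<^sup>2) {1..}"
proof -
  have "((\<lambda>F. (norm (\<Sum>k\<in>F. hat u k *\<^sub>C \<psi> k))\<^sup>2) \<longlongrightarrow> (norm u)\<^sup>2) (finite_subsets_at_top {1..})"
    by (intro tendsto_intros expansion[unfolded has_sum_def])
  moreover have "\<forall>\<^sub>F F in finite_subsets_at_top {1..}. (norm (\<Sum>k\<in>F. hat u k *\<^sub>C \<psi> k))\<^sup>2 = (\<Sum>k\<in>F. (cmod (hat u k))\<^sup>2)"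
    unfolding eventually_finite_subsets_at_top
    by (intro exI[of _ "{}"]) (use proj_norm(1) in \<open>auto simp: proj_def\<close>)
  ultimately show ?thesis
    unfolding has_sum_def using tendsto_cong by force
qed

lemma hat_square_summable: "(\<lambda>k. (cmod (hat u k))\<^sup>2) summable_on {1..}"
  using Parseval has_sum_imp_summable by blast

lemma norm_hat: "(norm u)\<^sup>2 = (\<Sum>\<^sub>\<infinity>k\<in>{1..}. (cmod (hat u k))\<^sup>2)"
  using infsumI[OF Parseval] by simp

lemma hat_inject: "(\<And>m. m \<ge> 1 \<Longrightarrow> hat u m = hat v m) \<Longrightarrow> u = v"
proof -
  assume eq: "\<And>m. m \<ge> 1 \<Longrightarrow> hat u m = hat v m"
  have "(norm (u - v))\<^sup>2 = (\<Sum>\<^sub>\<infinity>k\<in>{1::nat..}. 0)"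
    unfolding norm_hat by (rule infsum_cong) (simp add: hat_linear eq)
  then show ?thesis by simp
qed

text \<open>Riesz-Fischer: the partial sums are Cauchy by orthonormality.\<close>

lemma synthesis:
  assumes c: "(\<lambda>k. (cmod (c k))\<^sup>2) summable_on {1..}"
  obtains u where "\<And>k. k \<ge> 1 \<Longrightarrow> hat u k = c k"
proof -
  define S where "S n = (\<Sum>k\<in>{1..n}. c k *\<^sub>C \<psi> k)" for n :: nat
  have hatS: "hat (S n) k = (if k \<in> {1..n} then c k else 0)" for n k
  proof -
    have "hat (S n) k = (\<Sum>j\<in>{1..n}. if j = k then c j else 0)"
      unfolding S_def hat_sum by (rule sum.cong) (auto simp: hat_linear hat_psi)
    then show ?thesis by simp
  qed
  have pS: "proj {1..n} (S m) = (if n \<le> m then S n else S m)" for n m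
  proof (cases "n \<le> m")
    case True
    then show ?thesis by (simp add: proj_def S_def[of n] hatS)
  next
    case False
    have "proj {1..n} (S m) = (\<Sum>k\<in>{1..n}. if k \<in> {1..m} then c k *\<^sub>C \<psi> k else 0)"
      unfolding proj_def by (intro sum.cong) (auto simp: hatS complex_vector.scale_zero_left)
    also have "\<dots> = S m"
      unfolding S_def using False by (subst sum.inter_restrict[symmetric]) (auto intro!: sum.cong)
    finally show ?thesis using False by simp
  qed
  have norm_diff: "(norm (S m - S n))\<^sup>2 = (\<Sum>k\<in>{1..m}. (cmod (c k))\<^sup>2) - (\<Sum>k\<in>{1..n}. (cmod (c k))\<^sup>2)" if "n \<le> m" for n m
  proof -
    have "(norm (S m))\<^sup>2 = (\<Sum>k\<in>{1..m}. (cmod (c k))\<^sup>2)" for m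
      using proj_norm(1)[of "{1..m}" "S m"] pS[of m m] by (simp add: hatS)
    then show ?thesis
      using proj_norm(2)[of "{1..n}" "S m"] pS[of n m] that by (simp add: hatS)
  qed
  have "(\<lambda>n. \<Sum>k\<in>{1..n}. (cmod (c k))\<^sup>2) \<longlonglongrightarrow> (\<Sum>\<^sub>\<infinity>k\<in>{1..}. (cmod (c k))\<^sup>2)"
    by (intro has_sum_partial_sums has_sum_infsum c)
  then have C: "Cauchy (\<lambda>n. \<Sum>k\<in>{1..n}. (cmod (c k))\<^sup>2)"
    using LIMSEQ_imp_Cauchy by blast
  have "Cauchy S"
  proof (rule CauchyI')
    fix e :: real assume e: "e > 0"
    obtain K where K: "\<And>m n. m \<ge> K \<Longrightarrow> n \<ge> K \<Longrightarrow> dist (\<Sum>k\<in>{1..m}. (cmod (c k))\<^sup>2) (\<Sum>k\<in>{1..n}. (cmod (c k))\<^sup>2) < e\<^sup>2"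
      using C e unfolding Cauchy_def by (metis zero_less_power)
    have "dist (S m) (S n) < e" if "m \<ge> K" "m < n" for m n
    proof -
      have "(norm (S n - S m))\<^sup>2 < e\<^sup>2"
        using K[of n m] that by (simp add: norm_diff dist_real_def)
      then show ?thesis
        using e by (simp add: dist_norm norm_minus_commute power_less_imp_less_base)
    qed
    then show "\<exists>M. \<forall>m\<ge>M. \<forall>n>m. dist (S m) (S n) < e" by blast
  qed
  then obtain u where u: "S \<longlonglongrightarrow> u"
    using Cauchy_convergent convergent_def by blast
  have "hat u k = c k" if k: "k \<ge> 1" for k
  proof -
    have "(\<lambda>n. cinner (S n) (\<psi> k)) \<longlonglongrightarrow> cinner u (\<psi> k)"
      by (rule bounded_linear.tendsto[OF bounded_linear_cinner u])
    then have "(\<lambda>n. hat (S n) k) \<longlonglongrightarrow> hat u k"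
      using k by (simp add: hat_def)
    moreover have "\<forall>\<^sub>F n in sequentially. hat (S n) k = c k"
      using eventually_ge_at_top[of k] by eventually_elim (use k in \<open>simp add: hatS\<close>)
    then have "(\<lambda>n. hat (S n) k) \<longlonglongrightarrow> c k"
      by (rule tendsto_eventually)
    ultimately show ?thesis
      using LIMSEQ_unique by blast
  qed
  then show thesis using that by blast
qed

end

section \<open>The perturbed form\<close>

lemma square_sum_le: "(x + y)\<^sup>2 \<le> 2 * (x\<^sup>2 + y\<^sup>2)" for x y :: real
proof -
  have "0 \<le> (x - y)\<^sup>2" by simp
  then show ?thesis by (simp add: power2_sum power2_diff)
qed

locale perturbed_form =
  spectral_gap \<mu> \<gamma> \<kappa> \<alpha> M N\<^sub>0 + hilbert_basis \<psi>
  for \<mu> :: "nat \<Rightarrow> real" and \<gamma> \<kappa> \<alpha> M :: real and N\<^sub>0 :: nat and \<psi> :: "nat \<Rightarrow> 'h::complex_hilbert" +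
  fixes V :: "'h set" and a b :: "'h \<Rightarrow> 'h \<Rightarrow> complex"
  assumes V: "complex_vector.subspace V"
    and a: "sesquilinear_on V a" "hermitian_on V a" "positive_definite_on V a" "closed_form_on V a"
    and eigen: "\<And>k. k \<ge> 1 \<Longrightarrow> (\<psi> k, \<mu> k *\<^sub>R \<psi> k) \<in> form_operator V a"
    and b: "sesquilinear_on V b"
      "\<exists>C. \<forall>u\<in>V. \<forall>v\<in>V. cmod (b u v) \<le> C * form_norm a u * form_norm a v"
    and b_entries: "\<And>m n. m \<ge> 1 \<Longrightarrow> n \<ge> 1 \<Longrightarrow>
         cmod (b (\<psi> m) (\<psi> n)) \<le> M * real m powr (- \<alpha>) * real n powr (- \<alpha>)"
begin

definition T :: "'h operator" where
  "T = form_operator V (\<lambda>u v. a u v + b u v)"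

definition bm :: "nat \<Rightarrow> nat \<Rightarrow> complex" where
  "bm k m = (if k = 0 \<or> m = 0 then 0 else b (\<psi> k) (\<psi> m))"

lemma bm: "dominated bm"
  unfolding dominated_def
proof (intro allI)
  fix k m show "cmod (bm k m) \<le> w k * w m"
    using b_entries[of k m] w_mult[of k m] w_nonneg[of k] w_nonneg[of m]
    by (auto simp: bm_def Suc_le_eq mult.assoc)
qed

lemmas V_cl = V_closed[OF V a(1)]

lemma psi_V: "k \<ge> 1 \<Longrightarrow> \<psi> k \<in> V"
  using eigen[of k] by (auto simp: form_operator_def)

lemma a_psi: "k \<ge> 1 \<Longrightarrow> v \<in> V \<Longrightarrow> a (\<psi> k) v = of_real (\<mu> k) * cnj (hat v k)"
  "k \<ge> 1 \<Longrightarrow> v \<in> V \<Longrightarrow> a v (\<psi> k) = of_real (\<mu> k) * hat v k"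
proof -
  assume k: "k \<ge> 1" and v: "v \<in> V"
  have "a (\<psi> k) v = cinner (\<mu> k *\<^sub>R \<psi> k) v"
    using eigen[OF k] v by (auto simp: form_operator_def)
  also have "\<dots> = of_real (\<mu> k) * cinner (\<psi> k) v"
    by (simp add: scaleC_of_real[symmetric] cinner_scaleC_left)
  also have "cinner (\<psi> k) v = cnj (hat v k)"
    using k cinner_commute[of "\<psi> k" v] by (simp add: hat_def)
  finally show 1: "a (\<psi> k) v = of_real (\<mu> k) * cnj (hat v k)" .
  have "a v (\<psi> k) = cnj (a (\<psi> k) v)"
    using a(2) v psi_V[OF k] unfolding hermitian_on_def by blast
  then show "a v (\<psi> k) = of_real (\<mu> k) * hat v k" by (simp add: 1)
qed

lemma proj_V: "F \<subseteq> {1..} \<Longrightarrow> proj F u \<in> V"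
  unfolding proj_def by (intro V_cl psi_V) auto

lemma hat_proj: "finite F \<Longrightarrow> F \<subseteq> {1..} \<Longrightarrow> hat (proj F u) k = (if k \<in> F then hat u k else 0)"
proof -
  assume F: "finite F" "F \<subseteq> {1..}"
  have "hat (proj F u) k = (\<Sum>j\<in>F. if j = k then hat u j else 0)"
    unfolding proj_def hat_sum using F by (intro sum.cong) (auto simp: hat_linear hat_psi)
  then show ?thesis using F by simp
qed

lemma a_proj:
  assumes F: "finite F" "F \<subseteq> {1..}"
  shows "a (proj F u) (proj F u) = of_real (\<Sum>k\<in>F. \<mu> k * (cmod (hat u k))\<^sup>2)"
    "u \<in> V \<Longrightarrow> a (u - proj F u) (u - proj F u) = a u u - of_real (\<Sum>k\<in>F. \<mu> k * (cmod (hat u k))\<^sup>2)"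
proof -
  have k: "k \<ge> 1" if "k \<in> F" for k using that F by auto
  note P = proj_V[OF F(2), of u]
  have orth: "a (\<psi> k) (\<psi> j) = of_real (\<mu> k) * of_bool (k = j)" if "k \<in> F" "j \<in> F" for k j
    using k that a_psi(1)[of k "\<psi> j"] psi_V[of j] hat_psi[of j k] by (auto split: if_splits)
  have "a (\<Sum>k\<in>F. hat (proj F u) k *\<^sub>C \<psi> k) (\<Sum>k\<in>F. hat (proj F u) k *\<^sub>C \<psi> k) = of_real (\<Sum>k\<in>F. \<mu> k * (cmod (hat (proj F u) k))\<^sup>2)"
    by (rule form_Bessel(1)[OF V a(1) F(1) psi_V[OF k] P orth a_psi(2)[OF k P] a_psi(1)[OF k P]])
  moreover have "(\<Sum>k\<in>F. hat (proj F u) k *\<^sub>C \<psi> k) = proj F u"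
  proof -
    have "(\<Sum>k\<in>F. hat (proj F u) k *\<^sub>C \<psi> k) = (\<Sum>k\<in>F. hat u k *\<^sub>C \<psi> k)"
      by (rule sum.cong) (simp_all add: hat_proj[OF F])
    also have "\<dots> = proj F u" by (rule proj_def[symmetric])
    finally show ?thesis .
  qed
  moreover have "(\<Sum>k\<in>F. \<mu> k * (cmod (hat (proj F u) k))\<^sup>2) = (\<Sum>k\<in>F. \<mu> k * (cmod (hat u k))\<^sup>2)"
    by (intro sum.cong) (auto simp: hat_proj[OF F])
  ultimately show "a (proj F u) (proj F u) = of_real (\<Sum>k\<in>F. \<mu> k * (cmod (hat u k))\<^sup>2)" by simp
  assume u: "u \<in> V"
  show "a (u - proj F u) (u - proj F u) = a u u - of_real (\<Sum>k\<in>F. \<mu> k * (cmod (hat u k))\<^sup>2)"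
    unfolding proj_def
    by (rule form_Bessel(2)[OF V a(1) F(1) psi_V[OF k] u orth a_psi(2)[OF k u] a_psi(1)[OF k u]])
qed

lemma form_norm_a: "u \<in> V \<Longrightarrow> (form_norm a u)\<^sup>2 = Re (a u u)" "0 \<le> form_norm a u \<longleftrightarrow> 0 \<le> Re (a u u)"
  using form_nonneg(1)[OF V a(1,2,3)] by (auto simp: form_norm_def)

text \<open>
  The partial sums of the expansion converge to \<open>u\<close> in the Hilbert space and are Cauchy for the form, so this is
  the closedness of the form.
\<close>

lemma V_if_weighted:
  assumes s: "(\<lambda>k. \<mu> k * (cmod (hat u k))\<^sup>2) summable_on {1..}"
  shows "u \<in> V" "(\<lambda>n. a (proj {1..n} u - u) (proj {1..n} u - u)) \<longlonglongrightarrow> 0"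
proof -
  let ?x = "\<lambda>n::nat. proj {1..n} u"
  have xV: "?x n \<in> V" for n by (rule proj_V) auto
  have x: "?x \<longlonglongrightarrow> u"
    unfolding proj_def by (rule has_sum_partial_sums[OF expansion])
  let ?S = "\<lambda>n. \<Sum>k\<in>{1..n}. \<mu> k * (cmod (hat u k))\<^sup>2"
  have "?S \<longlonglongrightarrow> (\<Sum>\<^sub>\<infinity>k\<in>{1..}. \<mu> k * (cmod (hat u k))\<^sup>2)"
    by (intro has_sum_partial_sums has_sum_infsum s)
  then have C: "Cauchy ?S" using LIMSEQ_imp_Cauchy by blast
  have diff: "a (?x m - ?x n) (?x m - ?x n) = of_real (?S m - ?S n)" if "n \<le> m" for m n
  proof -
    have "proj {1..n} (?x m) = ?x n"
      unfolding proj_def[of "{1..n}"] using that by (intro sum.cong refl) (simp add: hat_proj)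
    moreover have "(\<Sum>k\<in>{1..n}. \<mu> k * (cmod (hat (?x m) k))\<^sup>2) = ?S n"
      using that by (intro sum.cong) (auto simp: hat_proj)
    ultimately show ?thesis
      using a_proj(2)[of "{1..n}" "?x m"] a_proj(1)[of "{1..m}" u] xV[of m] by simp
  qed
  have Cau: "\<exists>K. \<forall>m\<ge>K. \<forall>n\<ge>K. cmod (a (?x m - ?x n) (?x m - ?x n)) < e" if e: "e > 0" for e
  proof -
    obtain K where K: "\<And>m n. m \<ge> K \<Longrightarrow> n \<ge> K \<Longrightarrow> dist (?S m) (?S n) < e"
      using C e unfolding Cauchy_def by blast
    have "cmod (a (?x m - ?x n) (?x m - ?x n)) < e" if mn: "m \<ge> K" "n \<ge> K" for m n
    proof (cases "n \<le> m")
      case True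
      show ?thesis
        using K[OF mn] unfolding diff[OF True] norm_of_real dist_real_def .
    next
      case False
      then have nm: "m \<le> n" by simp
      have V': "?x n - ?x m \<in> V" using xV by (intro V_cl)
      have "?x m - ?x n = (-1) *\<^sub>C (?x n - ?x m)" by simp
      then have "a (?x m - ?x n) (?x m - ?x n) = a (?x n - ?x m) (?x n - ?x m)"
        using form_simps(3)[OF V a(1) V' V_cl(3)[OF V'] V', of "-1" "-1"] form_simps(4)[OF V a(1) V' V' V', of "-1"]
        by simp
      then show ?thesis
        using K[OF mn(2,1)] unfolding dist_real_def by (simp only: diff[OF nm] norm_of_real)
    qed
    then show ?thesis by blast
  qed
  have "u \<in> V \<and> (\<lambda>n. a (?x n - u) (?x n - u)) \<longlonglongrightarrow> 0"
    by (rule a(4)[unfolded closed_form_on_def, rule_format, OF xV x Cau])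
  then show "u \<in> V" "(\<lambda>n. a (proj {1..n} u - u) (proj {1..n} u - u)) \<longlonglongrightarrow> 0" by auto
qed

lemma weighted_if_V:
  assumes u: "u \<in> V"
  shows "(\<lambda>k. \<mu> k * (cmod (hat u k))\<^sup>2) summable_on {1..}"
proof (rule nonneg_bdd_above_summable_on)
  show "bdd_above (sum (\<lambda>k. \<mu> k * (cmod (hat u k))\<^sup>2) ` {F. F \<subseteq> {1..} \<and> finite F})"
  proof (rule bdd_aboveI2)
    fix F assume F: "F \<in> {F :: nat set. F \<subseteq> {1..} \<and> finite F}"
    have "u - proj F u \<in> V" using F u by (auto intro!: V_cl proj_V)
    then have "0 \<le> Re (a (u - proj F u) (u - proj F u))"
      by (rule form_nonneg(1)[OF V a(1,2,3)])
    then show "(\<Sum>k\<in>F. \<mu> k * (cmod (hat u k))\<^sup>2) \<le> Re (a u u)"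
      using a_proj(2)[of F u] F u by simp
  qed
qed (use mu_pos in \<open>auto simp: less_imp_le\<close>)

lemma V_iff: "u \<in> V \<longleftrightarrow> (\<lambda>k. \<mu> k * (cmod (hat u k))\<^sup>2) summable_on {1..}"
  using V_if_weighted(1) weighted_if_V by blast

lemma approx:
  assumes u: "u \<in> V"
  shows "(\<lambda>n. form_norm a (u - proj {1..n} u)) \<longlonglongrightarrow> 0" "(\<lambda>n. norm (u - proj {1..n} u)) \<longlonglongrightarrow> 0"
proof -
  let ?x = "\<lambda>n::nat. proj {1..n} u"
  have neg: "a (u - ?x n) (u - ?x n) = a (?x n - u) (?x n - u)" for n
  proof -
    have V': "?x n - u \<in> V" using u by (intro V_cl proj_V) auto
    have "u - ?x n = (-1) *\<^sub>C (?x n - u)" by simp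
    then show ?thesis
      using form_simps(3)[OF V a(1) V' V_cl(3)[OF V'] V', of "-1" "-1"] form_simps(4)[OF V a(1) V' V' V', of "-1"]
      by simp
  qed
  have "(\<lambda>n. sqrt (Re (a (?x n - u) (?x n - u)))) \<longlonglongrightarrow> sqrt (Re 0)"
    by (intro tendsto_intros V_if_weighted(2) weighted_if_V u)
  then show "(\<lambda>n. form_norm a (u - ?x n)) \<longlonglongrightarrow> 0"
    unfolding form_norm_def neg by simp
  have "?x \<longlonglongrightarrow> u"
    unfolding proj_def by (rule has_sum_partial_sums[OF expansion])
  then have "(\<lambda>n. norm (u - ?x n)) \<longlonglongrightarrow> norm (u - u)"
    by (intro tendsto_intros)
  then show "(\<lambda>n. norm (u - ?x n)) \<longlonglongrightarrow> 0" by simp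
qed

lemma form_norm_hat:
  assumes u: "u \<in> V"
  shows "(form_norm a u)\<^sup>2 = (\<Sum>\<^sub>\<infinity>k\<in>{1..}. \<mu> k * (cmod (hat u k))\<^sup>2)"
proof -
  let ?S = "\<lambda>n. \<Sum>k\<in>{1..n}. \<mu> k * (cmod (hat u k))\<^sup>2"
  have "?S \<longlonglongrightarrow> (\<Sum>\<^sub>\<infinity>k\<in>{1..}. \<mu> k * (cmod (hat u k))\<^sup>2)"
    by (intro has_sum_partial_sums has_sum_infsum weighted_if_V u)
  moreover have "?S \<longlonglongrightarrow> (form_norm a u)\<^sup>2"
  proof -
    have "(\<lambda>n. (form_norm a u)\<^sup>2 - (form_norm a (u - proj {1..n} u))\<^sup>2) \<longlonglongrightarrow> (form_norm a u)\<^sup>2 - 0\<^sup>2"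
      by (intro tendsto_intros approx u)
    moreover have "(form_norm a u)\<^sup>2 - (form_norm a (u - proj {1..n} u))\<^sup>2 = ?S n" for n
    proof -
      have "u - proj {1..n} u \<in> V" using u by (intro V_cl proj_V) auto
      then show ?thesis
        using a_proj(2)[of "{1..n}" u] u by (simp add: form_norm_a)
    qed
    ultimately show ?thesis by simp
  qed
  ultimately show ?thesis using LIMSEQ_unique by blast
qed

lemma admissible_hat: "u \<in> V \<Longrightarrow> admissible {1..} (hat u)"
  by (intro admissible_of_weighted weighted_if_V)

text \<open>
  Continuity of \<open>b\<close> in the form norm allows the expansion of \<open>u\<close> to be inserted term by term; the series
  converges absolutely because \<open>hat u\<close> has finite weighted norm.
\<close>

lemma act_hat:
  assumes u: "u \<in> V" and m: "m \<ge> 1"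
  shows "b u (\<psi> m) = act bm {1..} (hat u) m"
proof -
  let ?x = "\<lambda>n::nat. proj {1..n} u"
  have xV: "?x n \<in> V" for n by (rule proj_V) auto
  obtain C where C: "\<And>u v. u \<in> V \<Longrightarrow> v \<in> V \<Longrightarrow> cmod (b u v) \<le> C * form_norm a u * form_norm a v"
    using b(2) by blast
  have bx: "b (?x n) (\<psi> m) = (\<Sum>k\<in>{1..n}. bm k m * hat u k)" for n
    unfolding proj_def using form_sum(1)[OF V b(1), of "{1..n}" \<psi> "\<psi> m" "hat u"] psi_V m
    by (auto simp: bm_def mult.commute intro!: sum.cong)
  have "(\<lambda>n. b (?x n) (\<psi> m)) \<longlonglongrightarrow> act bm {1..} (hat u) m"
    unfolding bx act_def
    by (intro has_sum_partial_sums has_sum_infsum act_bound(1)[OF bm admissible_hat[OF u]])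
  moreover have "(\<lambda>n. b (?x n) (\<psi> m)) \<longlonglongrightarrow> b u (\<psi> m)"
  proof (rule LIM_zero_cancel, rule Lim_null_comparison)
    show "\<forall>\<^sub>F n in sequentially. norm (b (?x n) (\<psi> m) - b u (\<psi> m)) \<le> C * form_norm a (u - ?x n) * form_norm a (\<psi> m)"
    proof (rule always_eventually, rule allI)
      fix n
      have "b (u - ?x n) (\<psi> m) = b u (\<psi> m) - b (?x n) (\<psi> m)"
        by (rule form_simps(7)[OF V b(1) u xV psi_V[OF m]])
      then show "norm (b (?x n) (\<psi> m) - b u (\<psi> m)) \<le> C * form_norm a (u - ?x n) * form_norm a (\<psi> m)"
        using C[of "u - ?x n" "\<psi> m"] u xV psi_V[OF m] V_cl(4) by (simp add: norm_minus_commute)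
    qed
    have "(\<lambda>n. C * form_norm a (u - ?x n) * form_norm a (\<psi> m)) \<longlonglongrightarrow> C * 0 * form_norm a (\<psi> m)"
      by (intro tendsto_intros approx u)
    then show "(\<lambda>n. C * form_norm a (u - ?x n) * form_norm a (\<psi> m)) \<longlonglongrightarrow> 0" by simp
  qed
  ultimately show ?thesis using LIMSEQ_unique by blast
qed

text \<open>
  Testing with the basis vectors suffices: linear combinations of them are dense in the form norm, and
  both sides are continuous in it.
\<close>

lemma T_iff:
  "(u, f) \<in> T \<longleftrightarrow> u \<in> V \<and> (\<forall>m\<ge>1. of_real (\<mu> m) * hat u m + act bm {1..} (hat u) m = hat f m)"
proof (intro iffI conjI allI impI)
  assume T: "(u, f) \<in> T"
  then show u: "u \<in> V" by (simp add: T_def form_operator_def)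
  fix m :: nat assume m: "m \<ge> 1"
  have "a u (\<psi> m) + b u (\<psi> m) = cinner f (\<psi> m)"
    using T psi_V[OF m] by (simp add: T_def form_operator_def)
  then show "of_real (\<mu> m) * hat u m + act bm {1..} (hat u) m = hat f m"
    using m a_psi(2)[OF m u] act_hat[OF u m] by (simp add: hat_def)
next
  assume "u \<in> V \<and> (\<forall>m\<ge>1. of_real (\<mu> m) * hat u m + act bm {1..} (hat u) m = hat f m)"
  then have u: "u \<in> V" and eq: "\<And>m. m \<ge> 1 \<Longrightarrow> of_real (\<mu> m) * hat u m + act bm {1..} (hat u) m = hat f m" by auto
  obtain C where C: "\<And>u v. u \<in> V \<Longrightarrow> v \<in> V \<Longrightarrow> cmod (b u v) \<le> C * form_norm a u * form_norm a v"
    using b(2) by blast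
  have "a u v + b u v = cinner f v" if v: "v \<in> V" for v
  proof -
    let ?x = "\<lambda>n::nat. proj {1..n} v"
    have xV: "?x n \<in> V" for n by (rule proj_V) auto
    have on_basis: "a u (\<psi> k) + b u (\<psi> k) = cinner f (\<psi> k)" if k: "k \<ge> 1" for k
      using eq[OF k] k a_psi(2)[OF k u] act_hat[OF u k] by (simp add: hat_def)
    have zero: "a u (?x n) + b u (?x n) = cinner f (?x n)" for n
    proof -
      have F: "finite {1..n}" "\<And>k. k \<in> {1..n} \<Longrightarrow> \<psi> k \<in> V" using psi_V by auto
      have 1: "a u (?x n) = (\<Sum>k\<in>{1..n}. cnj (hat v k) * a u (\<psi> k))"
        unfolding proj_def by (rule form_sum(2)[OF V a(1) F u])
      have 2: "b u (?x n) = (\<Sum>k\<in>{1..n}. cnj (hat v k) * b u (\<psi> k))"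
        unfolding proj_def by (rule form_sum(2)[OF V b(1) F u])
      have 3: "cinner f (?x n) = (\<Sum>k\<in>{1..n}. cnj (hat v k) * cinner f (\<psi> k))"
        unfolding proj_def by (rule form_sum(2)[OF complex_vector.subspace_UNIV sesquilinear_cinner F(1) UNIV_I UNIV_I])
      show ?thesis
        unfolding 1 2 3 sum.distrib[symmetric] distrib_left[symmetric]
        by (rule sum.cong) (use on_basis in auto)
    qed
    have "(\<lambda>n. a u v + b u v - cinner f v) \<longlonglongrightarrow> 0"
    proof (rule Lim_null_comparison)
      show "\<forall>\<^sub>F n in sequentially. norm (a u v + b u v - cinner f v) \<le>
          (form_norm a u + C * form_norm a u) * form_norm a (v - ?x n) + norm f * norm (v - ?x n)"
      proof (rule always_eventually, rule allI)
        fix n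
        have vx: "v - ?x n \<in> V" using v xV by (rule V_cl(4))
        have "a u v + b u v - cinner f v = a u (v - ?x n) + b u (v - ?x n) - cinner f (v - ?x n)"
        proof -
          have A: "a u (v - ?x n) = a u v - a u (?x n)" by (rule form_simps(8)[OF V a(1) v xV u])
          have B: "b u (v - ?x n) = b u v - b u (?x n)" by (rule form_simps(8)[OF V b(1) v xV u])
          have C: "cinner f (v - ?x n) = cinner f v - cinner f (?x n)"
            by (rule form_simps(8)[OF complex_vector.subspace_UNIV sesquilinear_cinner UNIV_I UNIV_I UNIV_I])
          show ?thesis unfolding A B C zero[of n, symmetric] by simp
        qed
        also have "norm \<dots> \<le> cmod (a u (v - ?x n)) + cmod (b u (v - ?x n)) + cmod (cinner f (v - ?x n))"
          by (intro order_trans[OF norm_triangle_ineq4] add_mono norm_triangle_ineq order_refl)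
        also have "\<dots> \<le> form_norm a u * form_norm a (v - ?x n) + C * form_norm a u * form_norm a (v - ?x n) + norm f * norm (v - ?x n)"
          by (intro add_mono form_Cauchy_Schwarz[OF V a(1) a(2) a(3)] C cinner_Cauchy_Schwarz u vx)
        finally show "norm (a u v + b u v - cinner f v) \<le>
          (form_norm a u + C * form_norm a u) * form_norm a (v - ?x n) + norm f * norm (v - ?x n)"
          by (simp add: algebra_simps)
      qed
      have "(\<lambda>n. (form_norm a u + C * form_norm a u) * form_norm a (v - ?x n) + norm f * norm (v - ?x n)) \<longlonglongrightarrow>
          (form_norm a u + C * form_norm a u) * 0 + norm f * 0"
        by (intro tendsto_intros approx v)
      then show "(\<lambda>n. (form_norm a u + C * form_norm a u) * form_norm a (v - ?x n) + norm f * norm (v - ?x n)) \<longlonglongrightarrow> 0"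
        by simp
    qed
    then show ?thesis by (simp add: LIMSEQ_const_iff)
  qed
  then show "(u, f) \<in> T" using u by (simp add: T_def form_operator_def)
qed

lemma T_shift_iff:
  "(u, z *\<^sub>C u - f) \<in> T \<longleftrightarrow> u \<in> V \<and> (\<forall>m\<ge>1. (z - \<mu> m) * hat u m = hat f m + act bm {1..} (hat u) m)"
  unfolding T_iff hat_linear by (auto simp: algebra_simps)

lemma V_synthesis:
  assumes "(\<lambda>m. \<mu> m * (cmod (c m))\<^sup>2) summable_on {1..}" "c 0 = 0"
  obtains u where "u \<in> V" "hat u = c"
proof -
  obtain u where u: "\<And>k. k \<ge> 1 \<Longrightarrow> hat u k = c k"
    using synthesis[OF square_summable_of_weighted[OF assms(1)]] by auto
  have eq: "hat u = c"
  proof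
    fix k show "hat u k = c k" using u[of k] assms(2) by (cases "k = 0") (auto simp: hat_0)
  qed
  then have "u \<in> V" using assms(1) by (simp add: V_iff)
  then show thesis using eq that by blast
qed

subsection \<open>The resolvent\<close>

context
  fixes \<delta> :: real and z :: complex
  assumes \<delta>: "\<delta> > 0" "\<And>k. k \<ge> 1 \<Longrightarrow> \<delta> \<le> cmod (z - \<mu> k)" and z: "small {1..} z"
begin

text \<open>
  Cauchy-Schwarz, using \<open>(w k / |z - \<mu> k|)\<^sup>2 \<le> w k\<^sup>2 / (\<delta> |z - \<mu> k|)\<close> and the smallness of the latter sum.
\<close>

lemma source_hat: "source {1..} z (hat f)" "snorm {1..} z (hat f) \<le> sqrt (1 / (2 * \<delta>)) * norm f"
  and omega: "(\<lambda>k. (w k / cmod (z - \<mu> k))\<^sup>2) summable_on {1..}"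
    "(\<Sum>\<^sub>\<infinity>k\<in>{1..}. (w k / cmod (z - \<mu> k))\<^sup>2) \<le> 1 / (2 * \<delta>)"
proof -
  have le: "(w k / cmod (z - \<mu> k))\<^sup>2 \<le> 1 / \<delta> * ((w k)\<^sup>2 / cmod (z - \<mu> k))" if "k \<in> {1..}" for k
  proof -
    have d: "\<delta> \<le> cmod (z - \<mu> k)" using \<delta>(2)[of k] that by simp
    then have "(w k)\<^sup>2 / cmod (z - \<mu> k) / cmod (z - \<mu> k) \<le> (w k)\<^sup>2 / cmod (z - \<mu> k) / \<delta>"
      using \<delta>(1) by (intro divide_left_mono mult_pos_pos) auto
    then show ?thesis by (simp add: power2_eq_square mult.commute)
  qed
  have s: "(\<lambda>k. (w k)\<^sup>2 / cmod (z - \<mu> k)) summable_on {1..}" "(\<Sum>\<^sub>\<infinity>k\<in>{1..}. (w k)\<^sup>2 / cmod (z - \<mu> k)) \<le> 1/2"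
    using z by (auto simp: small_def)
  note o = summable_le[OF s(1) zero_le_power2 le]
  show o1: "(\<lambda>k. (w k / cmod (z - \<mu> k))\<^sup>2) summable_on {1..}" by (rule o(1))
  have "1 / \<delta> * (\<Sum>\<^sub>\<infinity>k\<in>{1..}. (w k)\<^sup>2 / cmod (z - \<mu> k)) \<le> 1 / \<delta> * (1 / 2)"
    using \<delta>(1) by (intro mult_left_mono s(2)) auto
  then show o2: "(\<Sum>\<^sub>\<infinity>k\<in>{1..}. (w k / cmod (z - \<mu> k))\<^sup>2) \<le> 1 / (2 * \<delta>)"
    using o(2) by simp
  note CS = infsum_Cauchy_Schwarz[OF o1 hat_square_summable[of f]]
  have eq: "\<bar>w k / cmod (z - \<mu> k) * cmod (hat f k)\<bar> = w k * cmod (hat f k) / cmod (z - \<mu> k)" for k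
    by (simp add: w_nonneg abs_mult)
  show "source {1..} z (hat f)"
    unfolding source_def using CS(1) unfolding eq .
  have "(snorm {1..} z (hat f))\<^sup>2 \<le> (1 / (2 * \<delta>)) * (norm f)\<^sup>2"
    using CS(2) mult_right_mono[OF o2, of "(norm f)\<^sup>2"] unfolding eq snorm_def norm_hat[symmetric] by simp
  then have "snorm {1..} z (hat f) \<le> sqrt ((1 / (2 * \<delta>)) * (norm f)\<^sup>2)"
    by (rule real_le_rsqrt)
  then show "snorm {1..} z (hat f) \<le> sqrt (1 / (2 * \<delta>)) * norm f"
    unfolding real_sqrt_mult by simp
qed

text \<open>
  The constant \<open>2 / \<delta>\<close> depends on \<open>z\<close> only through its distance to the \<open>\<mu> k\<close>. So the bound is uniform on each
  contour.
\<close>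

lemma resolvent_vector:
  obtains u where "u \<in> V" "hat u = solution bm {1..} z (hat f)"
    "norm u \<le> 2 / \<delta> * norm f" "solves bm {1..} z (hat f) (hat u)"
proof -
  let ?c = "solution bm {1..} z (hat f)"
  note s = solves_solution[OF bm z source_hat(1)[of f]]
  have pw: "cmod (?c m) \<le> (cmod (hat f m) + wnorm {1..} ?c * w m) / cmod (z - \<mu> m)" if "m \<in> {1..}" for m
    using solves_pointwise[OF bm z s that] by (simp add: mult.commute)
  have "(\<lambda>m. \<mu> m * (cmod (?c m))\<^sup>2) summable_on {1..}"
    by (rule weighted_summable[OF order_refl \<delta>(1) _ pw hat_square_summable]) (use \<delta>(2) in auto)
  moreover have "?c 0 = 0" using s by (simp add: solves_def)
  ultimately obtain u where u: "u \<in> V" "hat u = ?c"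
    using V_synthesis by blast
  define W where "W = wnorm {1..} ?c"
  have W: "0 \<le> W" "W \<le> 2 * (sqrt (1 / (2 * \<delta>)) * norm f)"
    using solves_wnorm_le[OF bm z source_hat(1) s] source_hat(2)[of f] wnorm_nonneg unfolding W_def by force+
  have W2: "W\<^sup>2 \<le> 2 / \<delta> * (norm f)\<^sup>2"
  proof -
    have "W\<^sup>2 \<le> (2 * (sqrt (1 / (2 * \<delta>)) * norm f))\<^sup>2"
      by (rule power_mono[OF W(2,1)])
    also have "\<dots> = 4 * (sqrt (1 / (2 * \<delta>)))\<^sup>2 * (norm f)\<^sup>2"
      by (simp only: power_mult_distrib) simp
    also have "(sqrt (1 / (2 * \<delta>)))\<^sup>2 = 1 / (2 * \<delta>)" using \<delta>(1) by simp
    finally show ?thesis by simp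
  qed
  have le: "(cmod (hat u m))\<^sup>2 \<le> 1 * (2 / \<delta>\<^sup>2 * (cmod (hat f m))\<^sup>2 + 2 * W\<^sup>2 * (w m / cmod (z - \<mu> m))\<^sup>2)" if m: "m \<in> {1..}" for m
  proof -
    have d: "\<delta> \<le> cmod (z - \<mu> m)" using \<delta>(2) m by simp
    have "cmod (hat u m) \<le> cmod (hat f m) / cmod (z - \<mu> m) + W * (w m / cmod (z - \<mu> m))"
      using pw[OF m] unfolding u W_def by (simp add: add_divide_distrib)
    also have "\<dots> \<le> cmod (hat f m) / \<delta> + W * (w m / cmod (z - \<mu> m))"
      using d \<delta>(1) by (intro add_right_mono divide_left_mono mult_pos_pos) auto
    finally have "(cmod (hat u m))\<^sup>2 \<le> (cmod (hat f m) / \<delta> + W * (w m / cmod (z - \<mu> m)))\<^sup>2"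
      by (rule power_mono) simp
    also have "\<dots> \<le> 2 * ((cmod (hat f m) / \<delta>)\<^sup>2 + (W * (w m / cmod (z - \<mu> m)))\<^sup>2)"
      by (rule square_sum_le)
    finally show ?thesis by (simp add: power_divide power_mult_distrib algebra_simps)
  qed
  have s1: "(\<lambda>m. 2 / \<delta>\<^sup>2 * (cmod (hat f m))\<^sup>2) summable_on {1..}"
    by (intro summable_on_cmult_right hat_square_summable)
  have s2: "(\<lambda>m. 2 * W\<^sup>2 * (w m / cmod (z - \<mu> m))\<^sup>2) summable_on {1..}"
    by (intro summable_on_cmult_right omega)
  have "(norm u)\<^sup>2 \<le> (\<Sum>\<^sub>\<infinity>m\<in>{1..}. 2 / \<delta>\<^sup>2 * (cmod (hat f m))\<^sup>2 + 2 * W\<^sup>2 * (w m / cmod (z - \<mu> m))\<^sup>2)"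
    using summable_le(2)[OF summable_on_add[OF s1 s2] zero_le_power2 le] unfolding norm_hat by (simp only: mult_1)
  also have "\<dots> = 2 / \<delta>\<^sup>2 * (norm f)\<^sup>2 + 2 * W\<^sup>2 * (\<Sum>\<^sub>\<infinity>m\<in>{1..}. (w m / cmod (z - \<mu> m))\<^sup>2)"
    unfolding infsum_add[OF s1 s2] norm_hat by (simp only: infsum_cmult_right')
  also have "\<dots> \<le> 2 / \<delta>\<^sup>2 * (norm f)\<^sup>2 + 2 * (2 / \<delta> * (norm f)\<^sup>2) * (1 / (2 * \<delta>))"
  proof (rule add_left_mono, rule mult_mono)
    show "2 * W\<^sup>2 \<le> 2 * (2 / \<delta> * (norm f)\<^sup>2)" using W2 by simp
    show "0 \<le> (\<Sum>\<^sub>\<infinity>m\<in>{1..}. (w m / cmod (z - \<mu> m))\<^sup>2)" by (rule infsum_nonneg) (rule zero_le_power2)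
    show "0 \<le> 2 * (2 / \<delta> * (norm f)\<^sup>2)" using \<delta>(1) by simp
  qed (rule omega(2))
  also have "\<dots> = (2 / \<delta> * norm f)\<^sup>2"
    using \<delta>(1) by (simp add: power2_eq_square field_simps)
  finally have "norm u \<le> 2 / \<delta> * norm f"
    by (rule power2_le_imp_le) (use \<delta>(1) in auto)
  then show thesis
    using that[of u] u s by simp
qed

lemma is_resolvent_exists: "\<exists>R. is_resolvent T z R \<and> (\<forall>f. norm (R f) \<le> 2 / \<delta> * norm f)"
proof -
  have "\<forall>f. \<exists>u. u \<in> V \<and> norm u \<le> 2 / \<delta> * norm f \<and> solves bm {1..} z (hat f) (hat u)"
    using resolvent_vector by metis
  then obtain R where R: "\<And>f. R f \<in> V" "\<And>f. norm (R f) \<le> 2 / \<delta> * norm f" "\<And>f. solves bm {1..} z (hat f) (hat (R f))"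
    by metis
  have uniq: "R f = u" if "u \<in> V" "\<And>m. m \<ge> 1 \<Longrightarrow> (z - \<mu> m) * hat u m = hat f m + act bm {1..} (hat u) m" for f u
  proof -
    have "solves bm {1..} z (hat f) (hat u)"
      using that admissible_hat[of u] by (auto simp: solves_def hat_0 not_le)
    then have "hat (R f) = hat u"
      using solves_unique[OF bm z R(3)[of f]] by blast
    then show ?thesis by (intro hat_inject) simp
  qed
  have inT: "(R f, z *\<^sub>C R f - f) \<in> T" for f
    unfolding T_shift_iff using R(1,3)[of f] by (auto simp: solves_def)
  have "bounded_linear R"
  proof (rule bounded_linear_intro)
    fix f g :: 'h and r :: real
    show "R (f + g) = R f + R g"
    proof (rule uniq)
      show "R f + R g \<in> V" by (intro V_cl R)
      show "(z - \<mu> m) * hat (R f + R g) m = hat (f + g) m + act bm {1..} (hat (R f + R g)) m" if "m \<ge> 1" for m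
      proof -
        have eq: "hat (R f + R g) = (\<lambda>k. hat (R f) k + hat (R g) k)"
          by (auto simp: hat_linear)
        show ?thesis
          using solves_add[OF bm R(3)[of f] R(3)[of g]] that unfolding eq hat_linear by (simp add: solves_def)
      qed
    qed
    show "R (r *\<^sub>R f) = r *\<^sub>R R f"
    proof (rule uniq)
      show "r *\<^sub>R R f \<in> V" unfolding scaleC_of_real[symmetric] by (intro V_cl R)
      show "(z - \<mu> m) * hat (r *\<^sub>R R f) m = hat (r *\<^sub>R f) m + act bm {1..} (hat (r *\<^sub>R R f)) m" if "m \<ge> 1" for m
      proof -
        have eq: "hat (r *\<^sub>R R f) = (\<lambda>k. of_real r * hat (R f) k)"
          by (auto simp: hat_linear)
        show ?thesis
          using solves_cmult[OF R(3)[of f], of "of_real r"] that unfolding eq hat_linear by (simp add: solves_def)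
      qed
    qed
    show "norm (R f) \<le> norm f * (2 / \<delta>)" using R(2)[of f] by (simp add: mult.commute)
  qed
  moreover have "R (z *\<^sub>C u - g) = u" if "(u, g) \<in> T" for u g
  proof (rule uniq)
    have "(u, z *\<^sub>C u - (z *\<^sub>C u - g)) \<in> T" using that by simp
    then show "u \<in> V" "m \<ge> 1 \<Longrightarrow> (z - \<mu> m) * hat u m = hat (z *\<^sub>C u - g) m + act bm {1..} (hat u) m" for m
      unfolding T_shift_iff by auto
  qed
  ultimately have "is_resolvent T z R"
    using inT by (auto simp: is_resolvent_def)
  then show ?thesis using R(2) by blast
qed

end

end

lemma is_resolvent_unique: "is_resolvent T z R \<Longrightarrow> is_resolvent T z R' \<Longrightarrow> R = R'"
proof
  fix f assume R: "is_resolvent T z R" and R': "is_resolvent T z R'"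
  have "(R f, z *\<^sub>C R f - f) \<in> T"
    using R unfolding is_resolvent_def by blast
  then have "R' (z *\<^sub>C R f - (z *\<^sub>C R f - f)) = R f"
    using R' unfolding is_resolvent_def by blast
  then show "R f = R' f" by simp
qed

lemma resolvent_eq: "is_resolvent T z R \<Longrightarrow> resolvent T z = R"
  unfolding resolvent_def using is_resolvent_unique by blast

section \<open>Contour integrals of Hilbert space valued functions\<close>

text \<open>
  The parametrization of a rectangle is affine on each of four intervals; the derivative differs from a
  constant only at the endpoints, which are negligible.
\<close>

lemma affine_piece_integrable:
  fixes G :: "real \<Rightarrow> 'a::complex_hilbert"
  assumes lr: "0 \<le> l" "l < r" "r \<le> 1" and p: "\<And>t. t \<in> {l<..<r} \<Longrightarrow> p t = A + t *\<^sub>R D"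
    and G: "continuous_on {0..1} G"
  shows "(\<lambda>t. vector_derivative p (at t within {0..1}) *\<^sub>C G t) integrable_on {l..r}"
proof (rule integrable_spike_finite[where S = "{l, r}" and f = "\<lambda>t. D *\<^sub>C G t"])
  show "(\<lambda>t. D *\<^sub>C G t) integrable_on {l..r}"
    using lr by (intro integrable_continuous_interval bounded_linear.continuous_on[OF bounded_linear_scaleC_right]
        continuous_on_subset[OF G]) auto
  fix t assume "t \<in> {l..r} - {l, r}"
  then have t: "t \<in> {l<..<r}" by auto
  have "((\<lambda>t. A + t *\<^sub>R D) has_vector_derivative D) (at t)"
    by (auto intro!: derivative_eq_intros)
  then have "(p has_vector_derivative D) (at t)"
    by (rule has_vector_derivative_transform_within_open[where S = "{l<..<r}"]) (use t p in auto)
  then have "(p has_vector_derivative D) (at t within {0..1})"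
    by (rule has_vector_derivative_at_within)
  then have "vector_derivative p (at t within {0..1}) = D"
    using t lr by (intro vector_derivative_within_closed_interval) auto
  then show "vector_derivative p (at t within {0..1}) *\<^sub>C G t = D *\<^sub>C G t" by simp
qed simp

lemma rectpath_integrable:
  fixes F :: "complex \<Rightarrow> 'a::complex_hilbert"
  assumes F: "continuous_on (path_image (rectpath c d)) F"
  shows "(\<lambda>t. vector_derivative (rectpath c d) (at t within {0..1}) *\<^sub>C F (rectpath c d t)) integrable_on {0..1}"
proof -
  let ?p = "rectpath c d" and ?v = "Complex (Re d) (Im c)" and ?u = "Complex (Re c) (Im d)"
  have "continuous_on {0..1} ?p"
    using valid_path_imp_path[OF valid_path_rectpath] by (simp add: path_def)
  then have G: "continuous_on {0..1} (\<lambda>t. F (?p t))"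
    by (intro continuous_on_compose2[OF F]) (auto simp: path_image_def)
  have 1: "?p t = c + t *\<^sub>R (2 *\<^sub>R (?v - c))" if "t \<in> {0<..<1/2}" for t
    using that by (simp add: rectpath_def joinpaths_def linepath_def Let_def algebra_simps)
  have 2: "?p t = (?v - 2 *\<^sub>R (d - ?v)) + t *\<^sub>R (4 *\<^sub>R (d - ?v))" if "t \<in> {1/2<..<3/4}" for t
    using that by (simp add: rectpath_def joinpaths_def linepath_def Let_def algebra_simps)
  have 3: "?p t = (d - 6 *\<^sub>R (?u - d)) + t *\<^sub>R (8 *\<^sub>R (?u - d))" if "t \<in> {3/4<..<7/8}" for t
    using that by (simp add: rectpath_def joinpaths_def linepath_def Let_def algebra_simps)
  have 4: "?p t = (?u - 7 *\<^sub>R (c - ?u)) + t *\<^sub>R (8 *\<^sub>R (c - ?u))" if "t \<in> {7/8<..<1}" for t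
    using that by (simp add: rectpath_def joinpaths_def linepath_def Let_def algebra_simps)
  let ?f = "\<lambda>t. vector_derivative ?p (at t within {0..1}) *\<^sub>C F (?p t)"
  have "?f integrable_on {0..1/2}" "?f integrable_on {1/2..3/4}" "?f integrable_on {3/4..7/8}" "?f integrable_on {7/8..1}"
    by (rule affine_piece_integrable[OF _ _ _ 1 G] affine_piece_integrable[OF _ _ _ 2 G]
        affine_piece_integrable[OF _ _ _ 3 G] affine_piece_integrable[OF _ _ _ 4 G]; simp)+
  then have "?f integrable_on {0..3/4}" "?f integrable_on {3/4..1}"
    using Henstock_Kurzweil_Integration.integrable_combine[where a = 0 and c = "1/2" and b = "3/4" and f = ?f]
      Henstock_Kurzweil_Integration.integrable_combine[where a = "3/4" and c = "7/8" and b = 1 and f = ?f] by auto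
  then show ?thesis
    using Henstock_Kurzweil_Integration.integrable_combine[where a = 0 and c = "3/4" and b = 1 and f = ?f] by auto
qed

text \<open>
  Inner products commute with the integral, so the vector integral is computed coordinatewise by the
  scalar theory.
\<close>

lemma cinner_vec_contour_integral:
  fixes F :: "complex \<Rightarrow> 'a::complex_hilbert"
  assumes F: "continuous_on (path_image (rectpath c d)) F"
    and I: "((\<lambda>z. cinner (F z) y) has_contour_integral I) (rectpath c d)"
  shows "cinner (vec_contour_integral (rectpath c d) F) y = I"
proof -
  let ?p = "rectpath c d"
  have "cinner (vec_contour_integral ?p F) y =
      integral {0..1} ((\<lambda>x. cinner x y) \<circ> (\<lambda>t. vector_derivative ?p (at t within {0..1}) *\<^sub>C F (?p t)))"
    unfolding vec_contour_integral_def
    by (rule integral_linear[OF rectpath_integrable[OF F] bounded_linear_cinner, symmetric])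
  also have "\<dots> = integral {0..1} (\<lambda>t. cinner (F (?p t)) y * vector_derivative ?p (at t within {0..1}))"
    by (rule integral_cong) (simp add: cinner_scaleC_left mult.commute)
  also have "\<dots> = I"
    using I by (intro integral_unique) (simp add: has_contour_integral_def)
  finally show ?thesis .
qed

text \<open>The resolvent identity, in a form sufficient for continuity along the contour.\<close>

lemma resolvent_Lipschitz:
  assumes R: "is_resolvent T z R" and R': "is_resolvent T z' R'"
    and B: "\<And>f. norm (R f) \<le> B * norm f" "\<And>f. norm (R' f) \<le> B * norm f" "0 \<le> B"
  shows "norm (R f - R' f) \<le> B * (B * norm f) * cmod (z - z')"
proof -
  have lin: "bounded_linear R" using R by (simp add: is_resolvent_def)
  have "(R' f, z' *\<^sub>C R' f - f) \<in> T"
    using R' unfolding is_resolvent_def by blast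
  then have "R (z *\<^sub>C R' f - (z' *\<^sub>C R' f - f)) = R' f"
    using R unfolding is_resolvent_def by blast
  moreover have "z *\<^sub>C R' f - (z' *\<^sub>C R' f - f) = (z - z') *\<^sub>C R' f + f"
    by (simp add: complex_vector.scale_left_diff_distrib)
  ultimately have "R' f = R ((z - z') *\<^sub>C R' f) + R f"
    by (simp add: bounded_linear.linear[OF lin] linear_add)
  then have "norm (R f - R' f) = norm (R ((z - z') *\<^sub>C R' f))"
    by (metis add_diff_cancel_right' norm_minus_commute)
  also have "\<dots> \<le> B * (cmod (z - z') * (B * norm f))"
    using B(1)[of "(z - z') *\<^sub>C R' f"] B(2)[of f] B(3)
    by (intro order_trans[OF B(1)] mult_left_mono) (auto simp: norm_scaleC intro!: mult_left_mono)
  finally show ?thesis by (simp add: mult_ac)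
qed

section \<open>Eigenvectors inside the rectangles\<close>

context spectral_gap begin

lemma midpoints:
  assumes n: "N\<^sub>1 \<le> n" and z: "z \<in> Pi_rect \<kappa> \<gamma> \<mu> n"
  shows "(\<mu> (n - 1) + \<mu> n) / 2 < Re z" "Re z < (\<mu> n + \<mu> (Suc n)) / 2"
proof -
  have nN: "n \<ge> N\<^sub>0" "n - 1 \<ge> N\<^sub>0" "n \<ge> 2" using n by (auto simp: N\<^sub>1_def)
  have "\<kappa> * (real n - 1) powr (\<gamma> - 1) \<le> \<mu> n - \<mu> (n - 1)"
    using gap[OF nN(2)] nN(3) by (simp add: of_nat_diff)
  moreover have "\<mu> n - \<kappa> / 2 * (real n - 1) powr (\<gamma> - 1) < Re z" "Re z < \<mu> n + \<kappa> / 2 * real n powr (\<gamma> - 1)"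
    using z by (auto simp: mem_Pi)
  ultimately show "(\<mu> (n - 1) + \<mu> n) / 2 < Re z" "Re z < (\<mu> n + \<mu> (Suc n)) / 2"
    using gap[OF nN(1)] by (simp_all add: field_simps)
qed

lemma Pi_disjoint:
  assumes n: "N\<^sub>1 \<le> n" and m: "N\<^sub>1 \<le> m" and z: "z \<in> Pi_rect \<kappa> \<gamma> \<mu> n" "z \<in> Pi_rect \<kappa> \<gamma> \<mu> m"
  shows "n = m"
proof -
  have *: False if "N\<^sub>1 \<le> i" "i < j" "z \<in> Pi_rect \<kappa> \<gamma> \<mu> i" "z \<in> Pi_rect \<kappa> \<gamma> \<mu> j" for i j
  proof -
    have i2: "1 \<le> i" using that by (simp add: N\<^sub>1_def)
    have "\<mu> i \<le> \<mu> (j - 1)" "\<mu> (Suc i) \<le> \<mu> j"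
      using that i2 by (auto intro!: mu_mono)
    then show False
      using midpoints(2)[of i z] midpoints(1)[of j z] that by simp
  qed
  show ?thesis using *[of n m] *[of m n] assms by (metis linorder_neqE_nat)
qed

end

context perturbed_form begin

definition Phi :: "nat \<Rightarrow> 'h" where
  "Phi n = (1 / (2 * pi * \<i>)) *\<^sub>C vec_contour_integral (Gamma_contour \<kappa> \<gamma> \<mu> n) (\<lambda>z. resolvent T z (\<psi> n))"

text \<open>The left eigenvectors as functionals; there is no complex conjugation.\<close>

definition lpair :: "nat \<Rightarrow> 'h \<Rightarrow> complex" where
  "lpair n u = (\<Sum>\<^sub>\<infinity>m\<in>{1..}. hat u m * coeigv bm n m)"

lemma T_linear: "(u, f) \<in> T \<Longrightarrow> (v, g) \<in> T \<Longrightarrow> (u + v, f + g) \<in> T" "(u, f) \<in> T \<Longrightarrow> (c *\<^sub>C u, c *\<^sub>C f) \<in> T"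
  "(u, f) \<in> T \<Longrightarrow> (u, g) \<in> T \<Longrightarrow> f = g" "(0, 0) \<in> T"
proof -
  show "(u, f) \<in> T \<Longrightarrow> (u, g) \<in> T \<Longrightarrow> f = g"
    unfolding T_iff by (rule hat_inject) metis
  show add: "(u, f) \<in> T \<Longrightarrow> (v, g) \<in> T \<Longrightarrow> (u + v, f + g) \<in> T" for u v f g
  proof -
    assume uf: "(u, f) \<in> T" and vg: "(v, g) \<in> T"
    then have uv: "u \<in> V" "v \<in> V" by (auto simp: T_def form_operator_def)
    have "a (u + v) x + b (u + v) x = cinner (f + g) x" if x: "x \<in> V" for x
    proof -
      have "a u x + b u x = cinner f x" "a v x + b v x = cinner g x"
        using uf vg x by (auto simp: T_def form_operator_def)
      then show ?thesis
        unfolding form_simps(1)[OF V a(1) uv x] form_simps(1)[OF V b(1) uv x] cinner_add_left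
        by (metis add.assoc add.left_commute)
    qed
    then show "(u + v, f + g) \<in> T"
      using V_cl(2)[OF uv] by (simp add: T_def form_operator_def)
  qed
  show scale: "(u, f) \<in> T \<Longrightarrow> (c *\<^sub>C u, c *\<^sub>C f) \<in> T" for u f c
    unfolding T_def form_operator_def
    using form_simps(3)[OF V a(1)] form_simps(3)[OF V b(1)] V_cl(3)[of u c]
    by (simp add: cinner_scaleC_left distrib_left[symmetric])
  have "0 \<in> V" by (rule V_cl)
  then show "(0, 0) \<in> T"
    unfolding T_def form_operator_def
    using form_simps(5)[OF V a(1) _ \<open>0 \<in> V\<close> \<open>0 \<in> V\<close>] form_simps(5)[OF V b(1) _ \<open>0 \<in> V\<close> \<open>0 \<in> V\<close>]
      cinner_scaleC_left[of 0 "0::'h"] by (simp add: complex_vector.scale_zero_left)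
qed

lemma T_dom: "(u, f) \<in> T \<Longrightarrow> u \<in> V"
  by (simp add: T_iff)

context
  fixes n
  assumes g: "good n"
begin

lemma n1: "1 \<le> n" "N\<^sub>1 \<le> n" using g by (auto simp: good_def N\<^sub>1_def)

lemma contour_resolvent:
  assumes z: "z \<in> path_image (Gamma_contour \<kappa> \<gamma> \<mu> n)"
  shows "is_resolvent T z (resolvent T z)" "norm (resolvent T z f) \<le> 2 / \<rho> n * norm f" "z \<in> resolvent_set T"
proof -
  have z': "z \<in> R n" "z \<notin> Pi_rect \<kappa> \<gamma> \<mu> n"
    using z contour_in_R[OF bm g] by auto
  have \<delta>: "\<rho> n \<le> cmod (z - \<mu> k)" if "k \<ge> 1" for k
    using R_distance(2)[OF n1(2) z'(1) that] boundary_distance[OF n1(2), of z] z' by (cases "k = n") auto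
  obtain R where R: "is_resolvent T z R" "\<And>f. norm (R f) \<le> 2 / \<rho> n * norm f"
    using is_resolvent_exists[OF radii(1)[OF n1(2)] \<delta> good_small(2)[OF g z']] by blast
  have "resolvent T z = R" by (rule resolvent_eq[OF R(1)])
  with R show "is_resolvent T z (resolvent T z)" "norm (resolvent T z f) \<le> 2 / \<rho> n * norm f" "z \<in> resolvent_set T"
    by (auto simp: resolvent_set_def)
qed

lemma resolvent_continuous:
  "continuous_on (path_image (Gamma_contour \<kappa> \<gamma> \<mu> n)) (\<lambda>z. resolvent T z f)"
proof -
  let ?B = "2 / \<rho> n"
  have B: "0 \<le> ?B" using radii(1)[OF n1(2)] by simp
  have "(?B * (?B * norm f))-lipschitz_on (path_image (Gamma_contour \<kappa> \<gamma> \<mu> n)) (\<lambda>z. resolvent T z f)"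
  proof (rule lipschitz_onI)
    fix z z' assume z: "z \<in> path_image (Gamma_contour \<kappa> \<gamma> \<mu> n)" "z' \<in> path_image (Gamma_contour \<kappa> \<gamma> \<mu> n)"
    show "dist (resolvent T z f) (resolvent T z' f) \<le> ?B * (?B * norm f) * dist z z'"
      unfolding dist_norm
      by (rule resolvent_Lipschitz[OF contour_resolvent(1)[OF z(1)] contour_resolvent(1)[OF z(2)]
            contour_resolvent(2)[OF z(1)] contour_resolvent(2)[OF z(2)] B])
  qed (use B in auto)
  then show ?thesis by (rule lipschitz_on_continuous_on)
qed

text \<open>
  The resolvent of \<open>\<psi> n\<close> has coordinates \<open>local_vec / (pair (z - lev))\<close> on the contour, and the
  integral is taken coordinatewise.
\<close>

lemma hat_Phi: "hat (Phi n) m = eigv bm n m / pair bm n (lev bm n)"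
proof (cases "m = 0")
  case True
  then show ?thesis using eigv(4)[OF bm g] by (simp add: hat_0)
next
  case False
  let ?\<Gamma> = "Gamma_contour \<kappa> \<gamma> \<mu> n"
  have coord: "hat (resolvent T z (\<psi> n)) m = local_vec bm n (off n) z m / pair bm n z / (z - lev bm n)"
    if z: "z \<in> path_image ?\<Gamma>" for z
  proof (rule resolvent_coordinates[OF bm g])
    show "z \<in> R n" "z \<noteq> lev bm n"
      using z contour_in_R[OF bm g] lev(1)[OF bm g] by auto
    let ?u = "resolvent T z (\<psi> n)"
    have "(?u, z *\<^sub>C ?u - \<psi> n) \<in> T"
      using contour_resolvent(1)[OF z] unfolding is_resolvent_def by blast
    then have u: "?u \<in> V" "\<And>m. m \<ge> 1 \<Longrightarrow> (z - \<mu> m) * hat ?u m = hat (\<psi> n) m + act bm {1..} (hat ?u) m"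
      unfolding T_shift_iff by auto
    show "admissible {1..} (hat ?u)" by (rule admissible_hat[OF u(1)])
    show "hat ?u 0 = 0" by (rule hat_0)
    show "m \<ge> 1 \<Longrightarrow> (z - \<mu> m) * hat ?u m = of_bool (m = n) + act bm {1..} (hat ?u) m" for m
      using u(2)[of m] hat_psi[OF n1(1), of m] by simp
  qed
  have "((\<lambda>z. hat (resolvent T z (\<psi> n)) m) has_contour_integral 2 * pi * \<i> * (eigv bm n m / pair bm n (lev bm n))) ?\<Gamma>"
    by (rule has_contour_integral_eq[OF contour_integral_resolvent[OF bm g]]) (simp add: coord)
  then have "cinner (vec_contour_integral ?\<Gamma> (\<lambda>z. resolvent T z (\<psi> n))) (\<psi> m) =
      2 * pi * \<i> * (eigv bm n m / pair bm n (lev bm n))"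
    using False resolvent_continuous[of "\<psi> n"] unfolding Gamma_contour_def hat_def
    by (intro cinner_vec_contour_integral) auto
  then show ?thesis
    using False by (simp add: Phi_def hat_def cinner_scaleC_left)
qed

lemma Phi_nonzero: "Phi n \<noteq> 0"
proof
  assume "Phi n = 0"
  then have "hat (Phi n) n = 0" by (simp add: hat_0)
  then show False
    using eigv(3)[OF bm g] pair_nonzero[OF bm g lev(2)[OF bm g]] by (simp add: hat_Phi)
qed

lemma Phi_V: "Phi n \<in> V"
proof -
  let ?s = "pair bm n (lev bm n)"
  have "(\<lambda>m. (1 / cmod ?s)\<^sup>2 * (\<mu> m * (cmod (eigv bm n m))\<^sup>2)) summable_on {1..}"
    by (intro summable_on_cmult_right eigv_weighted[OF bm g])
  then show ?thesis
    unfolding V_iff hat_Phi by (simp add: norm_divide power_divide mult_ac)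
qed

lemma hat_Phi_fun: "hat (Phi n) = (\<lambda>m. (1 / pair bm n (lev bm n)) * eigv bm n m)"
  by (auto simp: hat_Phi)

lemma Phi_eigenvector: "(Phi n, lev bm n *\<^sub>C Phi n) \<in> T"
  unfolding T_iff
proof (intro conjI allI impI Phi_V)
  fix m :: nat assume m: "m \<ge> 1"
  have "(lev bm n - \<mu> m) * eigv bm n m = act bm {1..} (eigv bm n) m"
    by (rule eigv(2)[OF bm g m])
  then have "act bm {1..} (hat (Phi n)) m = (1 / pair bm n (lev bm n)) * ((lev bm n - \<mu> m) * eigv bm n m)"
    unfolding hat_Phi_fun act_cmult by simp
  then show "of_real (\<mu> m) * hat (Phi n) m + act bm {1..} (hat (Phi n)) m = hat (lev bm n *\<^sub>C Phi n) m"
    by (simp add: hat_linear hat_Phi left_diff_distrib diff_divide_distrib)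
qed

lemma eigenvector_unique:
  assumes z: "z \<in> R n" and u: "(u, z *\<^sub>C u) \<in> T" "u \<noteq> 0"
  shows "z = lev bm n" "\<exists>c. u = c *\<^sub>C Phi n"
proof -
  let ?s = "pair bm n (lev bm n)"
  have T: "u \<in> V" "\<And>m. m \<ge> 1 \<Longrightarrow> (z - \<mu> m) * hat u m = act bm {1..} (hat u) m"
    using T_shift_iff[of u z 0] u(1) by (auto simp: hat_0)
  have nz: "hat u \<noteq> (\<lambda>_. 0)"
    using u(2) hat_inject[of u 0] by (auto simp: hat_0)
  note E = eigen_unique[OF bm g z admissible_hat[OF T(1)] hat_0(1) nz T(2)]
  show "z = lev bm n" by (rule E(1))
  have "u = (hat u n * ?s) *\<^sub>C Phi n"
  proof (rule hat_inject)
    fix m :: nat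
    show "hat u m = hat ((hat u n * ?s) *\<^sub>C Phi n) m"
      using fun_cong[OF E(2), of m] pair_nonzero[OF bm g lev(2)[OF bm g]] by (simp add: hat_linear hat_Phi)
  qed
  then show "\<exists>c. u = c *\<^sub>C Phi n" by blast
qed

lemma eigenvalue_in_rect: "{z \<in> Pi_rect \<kappa> \<gamma> \<mu> n. eigenvalue T z} = {lev bm n}"
  using eigenvector_unique(1) rect_subset lev(1)[OF bm g] Phi_eigenvector Phi_nonzero
  unfolding eigenvalue_def by blast

lemma lpair_summable: "(\<lambda>m. hat u m * coeigv bm n m) summable_on {1..}"
  "cmod (lpair n u) \<le> norm u * sqrt (\<Sum>\<^sub>\<infinity>m\<in>{1..}. (cmod (coeigv bm n m))\<^sup>2)"
proof -
  have q: "(\<lambda>m. (cmod (coeigv bm n m))\<^sup>2) summable_on {1..}"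
    by (rule square_summable_of_weighted[OF coeigv_weighted[OF bm g] order_refl])
  note CS = infsum_Cauchy_Schwarz[OF hat_square_summable q, of u]
  have le: "cmod (hat u m * coeigv bm n m) \<le> 1 * \<bar>cmod (hat u m) * cmod (coeigv bm n m)\<bar>" for m
    by (simp add: norm_mult)
  note s = summable_norm_le[OF CS(1) le]
  show "(\<lambda>m. hat u m * coeigv bm n m) summable_on {1..}" by (rule s(1))
  have "cmod (lpair n u) \<le> (\<Sum>\<^sub>\<infinity>m\<in>{1..}. \<bar>cmod (hat u m) * cmod (coeigv bm n m)\<bar>)"
    using s(2) unfolding lpair_def mult_1 .
  also have "\<dots> \<le> sqrt ((norm u)\<^sup>2 * (\<Sum>\<^sub>\<infinity>m\<in>{1..}. (cmod (coeigv bm n m))\<^sup>2))"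
    using CS(2) unfolding norm_hat by (rule real_le_rsqrt)
  finally show "cmod (lpair n u) \<le> norm u * sqrt (\<Sum>\<^sub>\<infinity>m\<in>{1..}. (cmod (coeigv bm n m))\<^sup>2)"
    by (simp add: real_sqrt_mult)
qed

lemma lpair_linear: "lpair n (u + v) = lpair n u + lpair n v" "lpair n (c *\<^sub>C u) = c * lpair n u"
  "lpair n (u - v) = lpair n u - lpair n v" "lpair n 0 = 0"
proof -
  show "lpair n (u + v) = lpair n u + lpair n v"
    unfolding lpair_def hat_linear distrib_right by (rule infsum_add) (rule lpair_summable)+
  show "lpair n (u - v) = lpair n u - lpair n v"
    unfolding lpair_def hat_linear left_diff_distrib by (rule summable_on_diffI) (rule lpair_summable)+
  show "lpair n (c *\<^sub>C u) = c * lpair n u"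
    unfolding lpair_def hat_linear mult.assoc by (rule infsum_cmult_right')
  show "lpair n 0 = 0"
    unfolding lpair_def hat_0 by simp
qed

text \<open>
  Green's identity on all coordinates: the left eigenvector moves \<open>T\<close> to the other side.
\<close>

lemma lpair_T:
  assumes "(u, f) \<in> T"
  shows "lpair n f = lev bm n * lpair n u"
proof -
  have u: "u \<in> V" and eq: "\<And>m. m \<ge> 1 \<Longrightarrow> of_real (\<mu> m) * hat u m + act bm {1..} (hat u) m = hat f m"
    using assms unfolding T_iff by auto
  let ?l = "lev bm n"
  have "((\<lambda>m. (?l * hat u m - hat f m) * coeigv bm n m - 0 * hat u m) has_sum (?l - ?l) * (\<Sum>\<^sub>\<infinity>m\<in>{1..}. hat u m * coeigv bm n m)) {1..}"
  proof (rule green_identity[OF bm admissible_hat[OF u] coeigv(1)[OF bm g] lpair_summable(1)])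
    show "(?l - \<mu> m) * hat u m = ?l * hat u m - hat f m + act bm {1..} (hat u) m" if "m \<in> {1..}" for m
      using eq[of m] that by (simp add: algebra_simps)
    show "(?l - \<mu> m) * coeigv bm n m = 0 + act (\<lambda>k m. bm m k) {1..} (coeigv bm n) m" if "m \<in> {1..}" for m
      using coeigv(2)[OF bm g, of m] that by simp
  qed
  then have "(\<Sum>\<^sub>\<infinity>m\<in>{1..}. hat (?l *\<^sub>C u - f) m * coeigv bm n m) = 0"
    by (intro infsumI) (simp add: hat_linear)
  then have "lpair n (?l *\<^sub>C u - f) = 0" by (simp add: lpair_def)
  then show ?thesis by (simp add: lpair_linear)
qed

lemma lpair_Phi: "lpair n (Phi n) = 1"
proof -
  have "lpair n (Phi n) = (1 / pair bm n (lev bm n)) * pair bm n (lev bm n)"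
    unfolding pair_lev[OF bm g] lpair_def hat_Phi_fun mult.assoc
    by (subst infsum_cmult_right') (simp add: pair_lev[OF bm g])
  then show ?thesis using pair_nonzero[OF bm g lev(2)[OF bm g]] by simp
qed

text \<open>
  A Jordan chain of length two would give \<open>(T - lev) u = c Phi n\<close> with \<open>c \<noteq> 0\<close>. Applying \<open>lpair\<close>, which
  annihilates the range of \<open>T - lev\<close> and is \<open>1\<close> at \<open>Phi n\<close>, gives \<open>c = 0\<close>.
\<close>

lemma root_subspace_lev: "root_subspace T (lev bm n) = complex_vector.span {Phi n}"
proof
  let ?l = "lev bm n"
  have "(u, 0) \<in> op_shift T ?l ^^ k \<Longrightarrow> u \<in> complex_vector.span {Phi n}" for u k
  proof (induction k arbitrary: u)
    case 0
    then show ?case by (simp add: complex_vector.span_zero)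
  next
    case (Suc k)
    then obtain f where f: "(u, f) \<in> op_shift T ?l" "(f, 0) \<in> op_shift T ?l ^^ k"
      by (meson relpow_Suc_D2)
    then obtain c where c: "f = c *\<^sub>C Phi n"
      using Suc.IH[OF f(2)] by (auto simp: complex_vector.span_singleton)
    have T: "(u, f + ?l *\<^sub>C u) \<in> T"
      using f(1) by (auto simp: op_shift_def)
    have "lpair n f = 0"
      using lpair_T[OF T] by (simp add: lpair_linear)
    then have "f = 0"
      using c by (simp add: lpair_linear lpair_Phi complex_vector.scale_zero_left)
    then have Tu: "(u, ?l *\<^sub>C u) \<in> T" using T by simp
    show ?case
    proof (cases "u = 0")
      case True
      then show ?thesis by (simp add: complex_vector.span_zero)
    next
      case False
      then show ?thesis
        using eigenvector_unique(2)[OF lev(2)[OF bm g] Tu] by (auto simp: complex_vector.span_singleton)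
    qed
  qed
  then show "root_subspace T ?l \<subseteq> complex_vector.span {Phi n}"
    by (auto simp: root_subspace_def)
  show "complex_vector.span {Phi n} \<subseteq> root_subspace T ?l"
  proof
    fix u assume "u \<in> complex_vector.span {Phi n}"
    then obtain c where "u = c *\<^sub>C Phi n" by (auto simp: complex_vector.span_singleton)
    then have "(u, ?l *\<^sub>C u) \<in> T"
      using T_linear(2)[OF Phi_eigenvector, of c] by (simp add: scaleC_scaleC mult.commute)
    then have "(u, ?l *\<^sub>C u - ?l *\<^sub>C u) \<in> op_shift T ?l"
      unfolding op_shift_def by blast
    then have "(u, 0) \<in> op_shift T ?l ^^ 1" by simp
    then show "u \<in> root_subspace T ?l"
      unfolding root_subspace_def by blast
  qed
qed

lemma dim_root_subspace_lev: "complex_vector.dim (root_subspace T (lev bm n)) = 1"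
proof -
  have "complex_vector.independent {Phi n}"
    using Phi_nonzero by (simp add: complex_vector.dependent_single)
  then show ?thesis
    unfolding root_subspace_lev complex_vector.dim_span by (subst complex_vector.dim_eq_card_independent) auto
qed

end

lemma lev_distinct: "good n \<Longrightarrow> good m \<Longrightarrow> n \<noteq> m \<Longrightarrow> lev bm n \<noteq> lev bm m"
  using Pi_disjoint[of n m "lev bm n"] lev(1)[OF bm] n1(2) by metis

lemma lpair_Phi_distinct: "good n \<Longrightarrow> good m \<Longrightarrow> n \<noteq> m \<Longrightarrow> lpair n (Phi m) = 0"
  using lpair_T[of n, OF _ Phi_eigenvector[of m]] lev_distinct[of n m] by (simp add: lpair_linear)

end

section \<open>Generalized eigenvectors in finite dimension\<close>

context vector_space begin

lemma independent_indexed: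
  assumes I: "finite I"
  shows "(inj_on f I \<and> independent (f ` I)) \<longleftrightarrow> (\<forall>c. (\<Sum>i\<in>I. scale (c i) (f i)) = 0 \<longrightarrow> (\<forall>i\<in>I. c i = 0))"
proof
  assume *: "inj_on f I \<and> independent (f ` I)"
  show "\<forall>c. (\<Sum>i\<in>I. scale (c i) (f i)) = 0 \<longrightarrow> (\<forall>i\<in>I. c i = 0)"
  proof (intro allI impI ballI)
    fix c i assume c: "(\<Sum>i\<in>I. scale (c i) (f i)) = 0" and i: "i \<in> I"
    have "(\<Sum>v\<in>f ` I. scale (c (the_inv_into I f v)) v) = (\<Sum>i\<in>I. scale (c i) (f i))"
      using * by (subst sum.reindex) (auto simp: the_inv_into_f_f intro!: sum.cong)
    then have "c (the_inv_into I f (f i)) = 0"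
      using independentD[of "f ` I" "f ` I" "\<lambda>v. c (the_inv_into I f v)" "f i"] * I c i by auto
    then show "c i = 0" using * i by (simp add: the_inv_into_f_f)
  qed
next
  assume *: "\<forall>c. (\<Sum>i\<in>I. scale (c i) (f i)) = 0 \<longrightarrow> (\<forall>i\<in>I. c i = 0)"
  have inj: "inj_on f I"
  proof (rule inj_onI, rule ccontr)
    fix i j assume ij: "i \<in> I" "j \<in> I" "f i = f j" "i \<noteq> j"
    define c where "c k = (if k = i then 1 else if k = j then - 1 else (0 :: 'a))" for k
    have "(\<Sum>k\<in>I. scale (c k) (f k)) = (\<Sum>k\<in>I. (if k = i then f i else 0) - (if k = j then f i else 0))"
      by (rule sum.cong) (use ij in \<open>auto simp: c_def\<close>)
    also have "\<dots> = 0" using I ij by (simp add: sum_subtractf)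
    finally have "c i = 0" using * ij by blast
    then show False by (simp add: c_def)
  qed
  moreover have "independent (f ` I)"
  proof (rule ccontr)
    assume "\<not> independent (f ` I)"
    then obtain u v where uv: "v \<in> f ` I" "u v \<noteq> 0" "(\<Sum>v\<in>f ` I. scale (u v) v) = 0"
      using I by (auto simp: dependent_finite)
    then have "(\<Sum>i\<in>I. scale (u (f i)) (f i)) = 0"
      using inj by (simp add: sum.reindex)
    then have "\<forall>i\<in>I. u (f i) = 0" using spec[OF *, of "\<lambda>i. u (f i)"] by simp
    then show False using uv by auto
  qed
  ultimately show "inj_on f I \<and> independent (f ` I)" by simp
qed

lemma span_indexed:
  assumes "finite I" "x \<in> span (f ` I)"
  obtains c where "x = (\<Sum>i\<in>I. scale (c i) (f i))"
proof -
  have "\<exists>c. x = (\<Sum>i\<in>I. scale (c i) (f i))"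
    using assms(2)
  proof (induction x rule: span_induct_alt)
    case base
    show ?case by (intro exI[of _ "\<lambda>_. 0"]) simp
  next
    case (step r x y)
    then obtain c j where c: "y = (\<Sum>i\<in>I. scale (c i) (f i))" and j: "j \<in> I" "x = f j" by blast
    have "scale r x + y = (\<Sum>i\<in>I. (if i = j then scale r (f i) else 0) + scale (c i) (f i))"
      using assms(1) j c by (simp add: sum.distrib)
    also have "\<dots> = (\<Sum>i\<in>I. scale (if i = j then r + c i else c i) (f i))"
      by (rule sum.cong) (auto simp: scale_left_distrib)
    finally show ?case by (intro exI[of _ "\<lambda>i. if i = j then r + c i else c i"])
  qed
  then show thesis using that by blast
qed

lemma independent_spans:
  assumes "finite C" "independent B" "B \<subseteq> span C" "card C \<le> card B"
  shows "C \<subseteq> span B"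
proof (rule subsetI, rule ccontr)
  fix c assume c: "c \<in> C" "c \<notin> span B"
  have fB: "finite B" using independent_span_bound[OF assms(1-3)] by simp
  have "independent (insert c B)"
    using assms(2) c(2) by (simp add: independent_insert)
  then have "card (insert c B) \<le> card C"
    using independent_span_bound[OF assms(1), of "insert c B"] assms(3) c(1) span_base by blast
  moreover have "c \<notin> B" using c(2) span_base by blast
  ultimately show False using assms(4) fB by simp
qed

lemma spanning_independent:
  assumes "finite C" "independent B" "B \<subseteq> span C" "card C \<le> card B"
  shows "independent C"
proof (rule ccontr)
  assume "\<not> independent C"
  then obtain c where c: "c \<in> C" "c \<in> span (C - {c})"
    unfolding dependent_def by blast
  have "span C \<subseteq> span (C - {c})"
  proof (rule span_minimal)
    show "C \<subseteq> span (C - {c})"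
    proof
      fix x assume "x \<in> C"
      then show "x \<in> span (C - {c})" using c(2) span_base[of x "C - {c}"] by (cases "x = c") auto
    qed
  qed (rule subspace_span)
  then have "card B \<le> card (C - {c})"
    using independent_span_bound[of "C - {c}" B] assms by blast
  also have "\<dots> < card C"
    using c(1) assms(1) by (rule card_Diff1_less[rotated])
  finally show False using assms(4) by simp
qed

end

definition op_poly :: "('a::complex_hilbert \<Rightarrow> 'a) \<Rightarrow> complex poly \<Rightarrow> 'a \<Rightarrow> 'a" where
  "op_poly L p u = (\<Sum>i\<le>degree p. coeff p i *\<^sub>C (L ^^ i) u)"

locale linear_endo =
  fixes L :: "'a::complex_hilbert \<Rightarrow> 'a" and Y :: "'a set"
  assumes L_add: "L (u + v) = L u + L v" and L_scale: "L (c *\<^sub>C u) = c *\<^sub>C L u"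
    and Y: "complex_vector.subspace Y" and L_Y: "u \<in> Y \<Longrightarrow> L u \<in> Y"
begin

definition gen_eigen :: "complex \<Rightarrow> 'a set" where
  "gen_eigen z = {v \<in> Y. \<exists>k. ((\<lambda>x. L x - z *\<^sub>C x) ^^ k) v = 0}"

definition G :: "'a set" where
  "G = complex_vector.span (\<Union>z. gen_eigen z)"

lemma L_0: "L 0 = 0" using L_scale[of 0 0] by (simp add: complex_vector.scale_zero_left)

lemma L_diff: "L (u - v) = L u - L v"
  using L_add[of "u - v" v] by simp

lemma shift_linear: "((\<lambda>x. L x - z *\<^sub>C x) ^^ k) (u + v) = ((\<lambda>x. L x - z *\<^sub>C x) ^^ k) u + ((\<lambda>x. L x - z *\<^sub>C x) ^^ k) v"
  "((\<lambda>x. L x - z *\<^sub>C x) ^^ k) (c *\<^sub>C u) = c *\<^sub>C ((\<lambda>x. L x - z *\<^sub>C x) ^^ k) u"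
  "((\<lambda>x. L x - z *\<^sub>C x) ^^ k) 0 = 0"
proof -
  show "((\<lambda>x. L x - z *\<^sub>C x) ^^ k) (u + v) = ((\<lambda>x. L x - z *\<^sub>C x) ^^ k) u + ((\<lambda>x. L x - z *\<^sub>C x) ^^ k) v"
    by (induction k) (simp_all add: L_add complex_vector.scale_right_distrib)
  show "((\<lambda>x. L x - z *\<^sub>C x) ^^ k) (c *\<^sub>C u) = c *\<^sub>C ((\<lambda>x. L x - z *\<^sub>C x) ^^ k) u"
    by (induction k) (simp_all add: L_scale complex_vector.scale_right_diff_distrib mult.commute)
  show "((\<lambda>x. L x - z *\<^sub>C x) ^^ k) 0 = 0"
    by (induction k) (simp_all add: L_0 complex_vector.scale_zero_right)
qed

lemma gen_eigen_mono: "((\<lambda>x. L x - z *\<^sub>C x) ^^ k) v = 0 \<Longrightarrow> k \<le> j \<Longrightarrow> ((\<lambda>x. L x - z *\<^sub>C x) ^^ j) v = 0"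
proof -
  assume 0: "((\<lambda>x. L x - z *\<^sub>C x) ^^ k) v = 0" and kj: "k \<le> j"
  have "((\<lambda>x. L x - z *\<^sub>C x) ^^ ((j - k) + k)) v = 0"
    unfolding funpow_add by (simp add: 0 shift_linear)
  then show ?thesis using kj by simp
qed

lemma gen_eigen_subspace: "complex_vector.subspace (gen_eigen z)"
proof (rule complex_vector.subspaceI)
  show "0 \<in> gen_eigen z"
    unfolding gen_eigen_def using complex_vector.subspace_0[OF Y] by (auto intro: exI[of _ 0])
  show "x + y \<in> gen_eigen z" if xy: "x \<in> gen_eigen z" "y \<in> gen_eigen z" for x y
  proof -
    obtain j k where "((\<lambda>x. L x - z *\<^sub>C x) ^^ j) x = 0" "((\<lambda>x. L x - z *\<^sub>C x) ^^ k) y = 0"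
      using xy by (auto simp: gen_eigen_def)
    then have "((\<lambda>x. L x - z *\<^sub>C x) ^^ (max j k)) x = 0" "((\<lambda>x. L x - z *\<^sub>C x) ^^ (max j k)) y = 0"
      by (auto intro: gen_eigen_mono)
    then have "((\<lambda>x. L x - z *\<^sub>C x) ^^ (max j k)) (x + y) = 0"
      by (simp add: shift_linear)
    then show ?thesis
      using xy complex_vector.subspace_add[OF Y] unfolding gen_eigen_def by blast
  qed
  show "c *\<^sub>C x \<in> gen_eigen z" if x: "x \<in> gen_eigen z" for c x
  proof -
    obtain j where "((\<lambda>x. L x - z *\<^sub>C x) ^^ j) x = 0"
      using x by (auto simp: gen_eigen_def)
    then have "((\<lambda>x. L x - z *\<^sub>C x) ^^ j) (c *\<^sub>C x) = 0"
      by (simp add: shift_linear complex_vector.scale_zero_right)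
    then show ?thesis
      using x complex_vector.subspace_scale[OF Y] unfolding gen_eigen_def by blast
  qed
qed

lemma gen_eigen_G: "gen_eigen z \<subseteq> G"
  unfolding G_def using complex_vector.span_superset by fastforce

lemma G_subspace: "complex_vector.subspace G"
  unfolding G_def by (rule complex_vector.subspace_span)

text \<open>
  Induction along the chain: \<open>(L - z) x = (l - z) x + (L - l) x\<close>, and the last term has a shorter chain.
\<close>

lemma solve_other:
  assumes "l \<noteq> z" "x \<in> Y" "((\<lambda>x. L x - l *\<^sub>C x) ^^ k) x = 0"
  shows "\<exists>w\<in>G. L w - z *\<^sub>C w = x"
  using assms(2,3)
proof (induction k arbitrary: x)
  case 0
  then show ?case
    using complex_vector.subspace_0[OF G_subspace] by (intro bexI[of _ 0]) (simp_all add: L_0 complex_vector.scale_zero_right)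
next
  case (Suc k)
  define x' where "x' = L x - l *\<^sub>C x"
  have "x' \<in> Y" unfolding x'_def
    using Suc.prems(1) L_Y by (intro complex_vector.subspace_diff[OF Y] complex_vector.subspace_scale[OF Y])
  moreover have "((\<lambda>x. L x - l *\<^sub>C x) ^^ k) x' = 0"
    using Suc.prems(2) unfolding x'_def by (simp only: funpow_Suc_right o_apply)
  ultimately obtain w' where w': "w' \<in> G" "L w' - z *\<^sub>C w' = x'"
    using Suc.IH by blast
  have "x \<in> gen_eigen l" using Suc.prems unfolding gen_eigen_def by blast
  then have xG: "x \<in> G" using gen_eigen_G by blast
  define w where "w = (1 / (l - z)) *\<^sub>C (x - w')"
  have "w \<in> G"
    unfolding w_def by (intro complex_vector.subspace_scale[OF G_subspace] complex_vector.subspace_diff[OF G_subspace] xG w')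
  moreover have "L w - z *\<^sub>C w = x"
  proof -
    have "L w - z *\<^sub>C w = (1 / (l - z)) *\<^sub>C ((L x - z *\<^sub>C x) - (L w' - z *\<^sub>C w'))"
      unfolding w_def L_scale L_diff
      by (simp add: complex_vector.scale_right_diff_distrib mult.commute algebra_simps)
    also have "(L x - z *\<^sub>C x) - (L w' - z *\<^sub>C w') = (l - z) *\<^sub>C x"
      unfolding w' x'_def by (simp add: complex_vector.scale_left_diff_distrib)
    finally show ?thesis using assms(1) by (simp add: complex_vector.scale_one)
  qed
  ultimately show ?case by blast
qed

text \<open>
  Components for eigenvalues other than \<open>z\<close> are in the range of \<open>L - z\<close> on \<open>G\<close> by \<open>solve_other\<close>; the
  component for \<open>z\<close> remains.
\<close>

lemma solve_mod:
  assumes "v \<in> G"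
  shows "\<exists>w\<in>G. v - (L w - z *\<^sub>C w) \<in> gen_eigen z"
  using assms unfolding G_def
proof (induction v rule: complex_vector.span_induct_alt)
  case base
  show ?case
    using complex_vector.subspace_0[OF G_subspace] complex_vector.subspace_0[OF gen_eigen_subspace]
    unfolding G_def by (intro bexI[of _ 0]) (simp_all add: L_0 complex_vector.scale_zero_right)
next
  case (step c x y)
  obtain w where w: "w \<in> G" "y - (L w - z *\<^sub>C w) \<in> gen_eigen z"
    using step(2) unfolding G_def by blast
  obtain l where x: "x \<in> gen_eigen l" using step(1) by blast
  have "\<exists>w'\<in>G. x - (L w' - z *\<^sub>C w') \<in> gen_eigen z"
  proof (cases "l = z")
    case True
    then show ?thesis
      using x complex_vector.subspace_0[OF G_subspace] by (intro bexI[of _ 0]) (simp_all add: L_0 complex_vector.scale_zero_right)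
  next
    case False
    then obtain w' where "w' \<in> G" "L w' - z *\<^sub>C w' = x"
      using solve_other[of l z x] x unfolding gen_eigen_def by blast
    then show ?thesis
      using complex_vector.subspace_0[OF gen_eigen_subspace] by (intro bexI[of _ w']) simp_all
  qed
  then obtain w' where w': "w' \<in> G" "x - (L w' - z *\<^sub>C w') \<in> gen_eigen z" by blast
  have "c *\<^sub>C (x - (L w' - z *\<^sub>C w')) + (y - (L w - z *\<^sub>C w)) \<in> gen_eigen z"
    by (intro complex_vector.subspace_add[OF gen_eigen_subspace] complex_vector.subspace_scale[OF gen_eigen_subspace] w w')
  also have "c *\<^sub>C (x - (L w' - z *\<^sub>C w')) + (y - (L w - z *\<^sub>C w)) =
      (c *\<^sub>C x + y) - (L (c *\<^sub>C w' + w) - z *\<^sub>C (c *\<^sub>C w' + w))"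
    by (simp add: L_add L_scale complex_vector.scale_right_diff_distrib complex_vector.scale_right_distrib mult.commute algebra_simps)
  finally show ?case
    using complex_vector.subspace_add[OF G_subspace complex_vector.subspace_scale[OF G_subspace w'(1)] w(1)]
    unfolding G_def by blast
qed

lemma op_poly_factor:
  assumes "q \<noteq> 0"
  shows "op_poly L ([:- z, 1:] * q) u = op_poly L q (L u - z *\<^sub>C u)"
proof -
  let ?d = "degree q"
  have deg: "degree ([:- z, 1:] * q) = Suc ?d"
    using assms by (subst degree_mult_eq) auto
  have pow: "(L ^^ i) (L u - z *\<^sub>C u) = (L ^^ Suc i) u - z *\<^sub>C (L ^^ i) u" for i
    by (induction i) (simp_all add: L_diff L_scale)
  have p: "[:- z, 1:] * q = smult (- z) q + pCons 0 q" by simp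
  have "op_poly L ([:- z, 1:] * q) u = (\<Sum>i\<le>Suc ?d. (- z * coeff q i) *\<^sub>C (L ^^ i) u) + (\<Sum>i\<le>Suc ?d. coeff (pCons 0 q) i *\<^sub>C (L ^^ i) u)"
    unfolding op_poly_def deg unfolding p coeff_add coeff_smult complex_vector.scale_left_distrib sum.distrib ..
  also have "(\<Sum>i\<le>Suc ?d. (- z * coeff q i) *\<^sub>C (L ^^ i) u) = (\<Sum>i\<le>?d. (- z * coeff q i) *\<^sub>C (L ^^ i) u)"
    by (simp add: coeff_eq_0 complex_vector.scale_zero_left)
  also have "(\<Sum>i\<le>Suc ?d. coeff (pCons 0 q) i *\<^sub>C (L ^^ i) u) = (\<Sum>i\<le>?d. coeff q i *\<^sub>C (L ^^ Suc i) u)"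
    by (subst sum.atMost_Suc_shift) (simp add: complex_vector.scale_zero_left)
  also have "(\<Sum>i\<le>?d. (- z * coeff q i) *\<^sub>C (L ^^ i) u) + (\<Sum>i\<le>?d. coeff q i *\<^sub>C (L ^^ Suc i) u) = op_poly L q (L u - z *\<^sub>C u)"
    unfolding op_poly_def pow sum.distrib[symmetric]
    by (intro sum.cong refl) (simp add: complex_vector.scale_right_diff_distrib mult.commute)
  finally show ?thesis .
qed

text \<open>
  Induction on the degree: if \<open>z\<close> is a root of \<open>p\<close>, then \<open>v = (L - z) u\<close> is annihilated by a polynomial of
  smaller degree, hence lies in \<open>G\<close>. By \<open>solve_mod\<close> some \<open>w \<in> G\<close> satisfies \<open>(L - z)(u - w) \<in> gen_eigen z\<close>, so
  \<open>u - w\<close> is itself a generalized eigenvector.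
\<close>

lemma annihilated_in_G:
  assumes "p \<noteq> 0" "u \<in> Y" "op_poly L p u = 0"
  shows "u \<in> G"
  using assms
proof (induction "degree p" arbitrary: p u)
  case 0
  then have "coeff p 0 \<noteq> 0" by (metis leading_coeff_neq_0)
  then have "u = 0" using 0 by (simp add: op_poly_def)
  then show ?case using complex_vector.subspace_0[OF G_subspace] by simp
next
  case (Suc d)
  have "\<not> (\<exists>a l. a \<noteq> 0 \<and> l = 0 \<and> p = pCons a l)"
    using Suc(2) by auto
  then obtain z where "poly p z = 0"
    using fundamental_theorem_of_algebra_alt by blast
  then obtain q where q: "p = [:- z, 1:] * q"
    by (auto simp: poly_eq_0_iff_dvd dvd_def)
  have q0: "q \<noteq> 0" using q Suc.prems(1) by auto
  have "degree p = Suc (degree q)"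
    unfolding q using q0 by (subst degree_mult_eq) auto
  then have dq: "d = degree q" using Suc(2) by simp
  let ?v = "L u - z *\<^sub>C u"
  have "?v \<in> G"
  proof (rule Suc(1)[OF dq q0])
    show "?v \<in> Y"
      using Suc.prems(2) L_Y by (intro complex_vector.subspace_diff[OF Y] complex_vector.subspace_scale[OF Y])
    show "op_poly L q ?v = 0"
      using Suc.prems(3) unfolding q op_poly_factor[OF q0] .
  qed
  then obtain w where w: "w \<in> G" "?v - (L w - z *\<^sub>C w) \<in> gen_eigen z"
    using solve_mod by blast
  have GY: "G \<subseteq> Y"
    unfolding G_def by (rule complex_vector.span_minimal[OF _ Y]) (auto simp: gen_eigen_def)
  have "?v - (L w - z *\<^sub>C w) = L (u - w) - z *\<^sub>C (u - w)"
    by (simp add: L_diff complex_vector.scale_right_diff_distrib)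
  then obtain k where "((\<lambda>x. L x - z *\<^sub>C x) ^^ k) (L (u - w) - z *\<^sub>C (u - w)) = 0"
    using w(2) unfolding gen_eigen_def by auto
  then have "((\<lambda>x. L x - z *\<^sub>C x) ^^ Suc k) (u - w) = 0"
    by (simp only: funpow_Suc_right o_apply)
  moreover have "u - w \<in> Y"
    using Suc.prems(2) w(1) GY by (intro complex_vector.subspace_diff[OF Y]) auto
  ultimately have "u - w \<in> gen_eigen z"
    unfolding gen_eigen_def by blast
  then have "(u - w) + w \<in> G"
    using gen_eigen_G w(1) by (intro complex_vector.subspace_add[OF G_subspace]) auto
  then show ?case by simp
qed

text \<open>
  In finite dimension the iterates of \<open>u\<close> are linearly dependent, which is to say that a nonzero polynomial in \<open>L\<close>
  annihilates \<open>u\<close>.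
\<close>

lemma generalized_eigenvectors_span:
  assumes B: "finite B" "Y \<subseteq> complex_vector.span B" and u: "u \<in> Y"
  shows "u \<in> G"
proof -
  let ?f = "\<lambda>i. (L ^^ i) u" and ?I = "{..card B}"
  have fY: "?f i \<in> Y" for i by (induction i) (auto simp: u L_Y)
  have "\<not> (inj_on ?f ?I \<and> complex_vector.independent (?f ` ?I))"
  proof
    assume *: "inj_on ?f ?I \<and> complex_vector.independent (?f ` ?I)"
    then have "card (?f ` ?I) \<le> card B"
      using complex_vector.independent_span_bound[OF B(1)] fY B(2) by blast
    then show False using * by (simp add: card_image)
  qed
  then obtain c i where c: "(\<Sum>i\<in>?I. c i *\<^sub>C ?f i) = 0" and i: "i \<in> ?I" "c i \<noteq> 0"
    by (subst (asm) complex_vector.independent_indexed) auto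
  define p where "p = (\<Sum>i\<in>?I. monom (c i) i)"
  have coeff: "coeff p j = (if j \<in> ?I then c j else 0)" for j
    unfolding p_def coeff_sum coeff_monom by (simp add: sum.delta)
  have p0: "p \<noteq> 0" using i coeff[of i] by auto
  have "degree p \<le> card B"
    by (rule degree_le) (simp add: coeff)
  then have "op_poly L p u = (\<Sum>i\<in>?I. coeff p i *\<^sub>C ?f i)"
    unfolding op_poly_def by (intro sum.mono_neutral_left) (auto simp: coeff_eq_0 complex_vector.scale_zero_left)
  also have "\<dots> = (\<Sum>i\<in>?I. c i *\<^sub>C ?f i)"
    by (intro sum.cong refl) (simp add: coeff)
  also note c
  finally show ?thesis by (rule annihilated_in_G[OF p0 u])
qed

end

section \<open>The complementary subspace\<close>

context perturbed_form begin

text \<open>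
  After scaling by \<open>\<mu>\<^sup>1\<^sup>/\<^sup>2\<close>, which maps \<open>V\<close> isometrically onto the Hilbert space, the functional \<open>\<mu> n\<^sup>1\<^sup>/\<^sup>2 lpair n\<close> is
  the \<open>n\<close>-th coordinate plus the off-diagonal row \<open>E n\<close>.
\<close>

definition E :: "nat \<Rightarrow> nat \<Rightarrow> complex" where
  "E n m = (if n = m then 0 else of_real (sqrt (\<mu> n / \<mu> m)) * coeigv bm n m)"

text \<open>
  The last condition says that the rows of \<open>E\<close> beyond \<open>K\<close> form an operator of norm at most \<open>1/2\<close>.
\<close>

definition far :: "nat \<Rightarrow> bool" where
  "far K \<longleftrightarrow> K \<ge> 1 \<and> (\<forall>n>K. good n) \<and>
     (\<forall>x :: nat \<Rightarrow> complex. (\<lambda>k. (cmod (x k))\<^sup>2) summable_on {1..} \<longrightarrow>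
        (\<forall>n>K. (\<lambda>m. x m * E n m) summable_on {1..}) \<and>
        (\<lambda>n. (cmod (\<Sum>\<^sub>\<infinity>m\<in>{1..}. x m * E n m))\<^sup>2) summable_on {K<..} \<and>
        (\<Sum>\<^sub>\<infinity>n\<in>{K<..}. (cmod (\<Sum>\<^sub>\<infinity>m\<in>{1..}. x m * E n m))\<^sup>2) \<le> 1/4 * (\<Sum>\<^sub>\<infinity>k\<in>{1..}. (cmod (x k))\<^sup>2))"

lemma coeigv_kernel:
  obtains C where "C \<ge> 0"
    "\<And>n m. good n \<Longrightarrow> 1 \<le> m \<Longrightarrow> n \<noteq> m \<Longrightarrow> cmod (E n m) \<le> C * hilbert_kernel (eps / 2) n m"
    "\<And>n m. good n \<Longrightarrow> 1 \<le> m \<Longrightarrow> n \<noteq> m \<Longrightarrow> sqrt (\<mu> m / \<mu> n) * cmod (eigv bm n m) \<le> C * hilbert_kernel (eps / 2) n m"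
proof -
  obtain C where C: "C \<ge> 0"
    "\<And>n m. 1 \<le> n \<Longrightarrow> 1 \<le> m \<Longrightarrow> n \<noteq> m \<Longrightarrow> N\<^sub>1 \<le> max n m \<Longrightarrow>
       sqrt (\<mu> m / \<mu> n) * (w n * w m / \<bar>\<mu> n - \<mu> m\<bar>) \<le> C * hilbert_kernel (eps / 2) n m"
    by (rule kernel_ratio) blast
  have 1: "cmod (E n m) \<le> 4 * C * hilbert_kernel (eps / 2) n m" if g: "good n" and m: "1 \<le> m" "n \<noteq> m" for n m
  proof -
    have n: "1 \<le> n" "N\<^sub>1 \<le> n" using n1[OF g] by auto
    have "cmod (E n m) = sqrt (\<mu> n / \<mu> m) * cmod (coeigv bm n m)"
      using m mu_pos[OF n(1)] mu_pos[OF m(1)] by (simp add: E_def norm_mult)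
    also have "\<dots> \<le> sqrt (\<mu> n / \<mu> m) * (4 * (w n * w m / \<bar>\<mu> n - \<mu> m\<bar>))"
      using coeigv_offdiagonal[OF bm g m(1)] m mu_pos[OF n(1)] mu_pos[OF m(1)] by (intro mult_left_mono) auto
    also have "\<dots> = 4 * (sqrt (\<mu> n / \<mu> m) * (w m * w n / \<bar>\<mu> m - \<mu> n\<bar>))"
      by (simp add: abs_minus_commute mult.commute)
    also have "\<dots> \<le> 4 * (C * hilbert_kernel (eps / 2) m n)"
      using C(2)[OF m(1) n(1)] m n by (intro mult_left_mono) auto
    finally show ?thesis by (simp add: hilbert_kernel_sym[of _ m])
  qed
  have 2: "sqrt (\<mu> m / \<mu> n) * cmod (eigv bm n m) \<le> 4 * C * hilbert_kernel (eps / 2) n m" if g: "good n" and m: "1 \<le> m" "n \<noteq> m" for n m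
  proof -
    have n: "1 \<le> n" "N\<^sub>1 \<le> n" using n1[OF g] by auto
    have "sqrt (\<mu> m / \<mu> n) * cmod (eigv bm n m) \<le> sqrt (\<mu> m / \<mu> n) * (4 * (w n * w m / \<bar>\<mu> n - \<mu> m\<bar>))"
      using eigv_offdiagonal[OF bm g m(1)] m mu_pos[OF n(1)] mu_pos[OF m(1)] by (intro mult_left_mono) auto
    also have "\<dots> = 4 * (sqrt (\<mu> m / \<mu> n) * (w n * w m / \<bar>\<mu> n - \<mu> m\<bar>))" by simp
    also have "\<dots> \<le> 4 * (C * hilbert_kernel (eps / 2) n m)"
      using C(2)[OF n(1) m(1)] m n by (intro mult_left_mono) auto
    finally show ?thesis by simp
  qed
  show thesis using that[of "4 * C"] C(1) 1 2 by simp
qed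

lemma eventually_far: "\<forall>\<^sub>F K in sequentially. far K"
proof -
  obtain C where C: "C \<ge> 0"
    "\<And>n m. good n \<Longrightarrow> 1 \<le> m \<Longrightarrow> n \<noteq> m \<Longrightarrow> cmod (E n m) \<le> C * hilbert_kernel (eps / 2) n m"
    by (rule coeigv_kernel) blast
  have e: "eps / 2 > 0" "eps / 2 / 2 > 0" using eps by auto
  let ?Z = "3 * zeta1 (eps / 2 / 2)"
  have Z: "0 \<le> ?Z" using zeta1_nonneg by simp
  obtain Kg where Kg: "\<And>n. n \<ge> Kg \<Longrightarrow> good n"
    using eventually_good unfolding eventually_sequentially by blast
  have "\<forall>\<^sub>F K in sequentially. (C * ?Z) * real K powr (- (eps / 2 / 2)) \<le> 1/2"
    by (rule powr_decay[OF e(2)]) simp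
  then show ?thesis
    using eventually_ge_at_top[of "max 1 Kg"]
  proof eventually_elim
    case (elim K)
    have K: "K \<ge> 1" "\<And>n. n > K \<Longrightarrow> good n" using elim(2) Kg by auto
    define c where "c = C * real K powr (- (eps / 2 / 2))"
    have c: "0 \<le> c" "c * ?Z \<le> 1/2" using C(1) elim(1) by (auto simp: c_def mult_ac)
    have "(\<forall>n>K. (\<lambda>m. x m * E n m) summable_on {1..}) \<and>
        (\<lambda>n. (cmod (\<Sum>\<^sub>\<infinity>m\<in>{1..}. x m * E n m))\<^sup>2) summable_on {K<..} \<and>
        (\<Sum>\<^sub>\<infinity>n\<in>{K<..}. (cmod (\<Sum>\<^sub>\<infinity>m\<in>{1..}. x m * E n m))\<^sup>2) \<le> 1/4 * (\<Sum>\<^sub>\<infinity>k\<in>{1..}. (cmod (x k))\<^sup>2)"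
      if x: "(\<lambda>k. (cmod (x k))\<^sup>2) summable_on {1..}" for x
    proof -
      have le: "cmod (E n m) \<le> c * hilbert_kernel (eps / 2 / 2) m n" if "m \<in> {1..}" "n \<in> {K<..}" "m \<noteq> n" for n m
      proof -
        have "cmod (E n m) \<le> C * hilbert_kernel (eps / 2) n m"
          using that K by (intro C(2)) auto
        also have "\<dots> \<le> C * (real K powr (- (eps / 2 / 2)) * hilbert_kernel (eps / 2 / 2) n m)"
          using that K C(1) by (intro mult_left_mono hilbert_kernel_tail e) auto
        finally show ?thesis by (simp add: c_def hilbert_kernel_sym[of _ m] mult.assoc)
      qed
      have d: "cmod (E n n) \<le> 0" for n by (simp add: E_def)
      have sub: "{1..} \<subseteq> {1::nat..}" "{K<..} \<subseteq> {1..}" by auto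
      note S = hilbert_kernel_Schur[OF e(2) sub c(1) order_refl le d x]
      have "(\<Sum>\<^sub>\<infinity>n\<in>{K<..}. (cmod (\<Sum>\<^sub>\<infinity>m\<in>{1..}. x m * E n m))\<^sup>2) \<le> (0 + c * ?Z)\<^sup>2 * (\<Sum>\<^sub>\<infinity>k\<in>{1..}. (cmod (x k))\<^sup>2)"
        by (rule S(3))
      also have "\<dots> \<le> (1/2)\<^sup>2 * (\<Sum>\<^sub>\<infinity>k\<in>{1..}. (cmod (x k))\<^sup>2)"
        using c Z by (intro mult_right_mono power_mono infsum_nonneg) auto
      finally show ?thesis using S(1,2) by (simp add: power2_eq_square)
    qed
    then show ?case using K unfolding far_def by blast
  qed
qed

lemma far_good: "far K \<Longrightarrow> n > K \<Longrightarrow> good n" "far K \<Longrightarrow> K \<ge> 1"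
  by (auto simp: far_def)

text \<open>
  A vector annihilated by the functionals beyond \<open>K\<close> is determined by its first \<open>K\<close> coordinates, which can be
  prescribed: the other ones solve a fixed point equation with contraction constant \<open>1/2\<close>.
\<close>

lemma fixed_point:
  fixes p :: 'h
  assumes K: "far K"
  shows "\<exists>!x :: 'h. \<forall>m\<ge>1. hat x m = (if m \<le> K then hat p m else - (\<Sum>\<^sub>\<infinity>k\<in>{1..}. hat x k * E m k))"
proof -
  have F: "(\<forall>n>K. (\<lambda>m. hat x m * E n m) summable_on {1..}) \<and>
        (\<lambda>n. (cmod (\<Sum>\<^sub>\<infinity>m\<in>{1..}. hat x m * E n m))\<^sup>2) summable_on {K<..} \<and>
        (\<Sum>\<^sub>\<infinity>n\<in>{K<..}. (cmod (\<Sum>\<^sub>\<infinity>m\<in>{1..}. hat x m * E n m))\<^sup>2) \<le> 1/4 * (norm x)\<^sup>2" for x :: 'h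
    using K hat_square_summable[of x] unfolding far_def norm_hat by blast
  have U: "{1::nat..} = {K<..} \<union> {1..K}" using far_good(2)[OF K] by auto
  have "\<exists>y. \<forall>m\<ge>1. hat y m = (if m \<le> K then hat p m else - (\<Sum>\<^sub>\<infinity>k\<in>{1..}. hat x k * E m k))" for x :: 'h
  proof -
    let ?c = "\<lambda>m. if m \<le> K then hat p m else - (\<Sum>\<^sub>\<infinity>k\<in>{1..}. hat x k * E m k)"
    have 1: "(\<lambda>m. (cmod (?c m))\<^sup>2) summable_on {K<..}"
      using F[of x] by (subst summable_on_cong[where g = "\<lambda>n. (cmod (\<Sum>\<^sub>\<infinity>m\<in>{1..}. hat x m * E n m))\<^sup>2"]) auto
    have 2: "(\<lambda>m. (cmod (?c m))\<^sup>2) summable_on {1..}"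
      by (subst U, rule summable_on_Un_disjoint[OF 1]) auto
    obtain y where "\<And>m. m \<ge> 1 \<Longrightarrow> hat y m = ?c m" by (rule synthesis[OF 2]) blast
    then show ?thesis by blast
  qed
  then obtain \<Phi> where \<Phi>: "\<And>x m. m \<ge> 1 \<Longrightarrow> hat (\<Phi> x) m = (if m \<le> K then hat p m else - (\<Sum>\<^sub>\<infinity>k\<in>{1..}. hat x k * E m k))"
    by metis
  have "dist (\<Phi> x) (\<Phi> y) \<le> 1/2 * dist x y" for x y
  proof -
    have eq: "(cmod (hat (\<Phi> x - \<Phi> y) m))\<^sup>2 = (cmod (\<Sum>\<^sub>\<infinity>k\<in>{1..}. hat (x - y) k * E m k))\<^sup>2" if m: "m \<in> {K<..}" for m
    proof -
      have "(\<Sum>\<^sub>\<infinity>k\<in>{1..}. hat (x - y) k * E m k) = (\<Sum>\<^sub>\<infinity>k\<in>{1..}. hat x k * E m k) - (\<Sum>\<^sub>\<infinity>k\<in>{1..}. hat y k * E m k)"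
        unfolding hat_linear left_diff_distrib using F[of x] F[of y] m by (intro summable_on_diffI(2)) auto
      moreover have "hat (\<Phi> x - \<Phi> y) m = - ((\<Sum>\<^sub>\<infinity>k\<in>{1..}. hat x k * E m k) - (\<Sum>\<^sub>\<infinity>k\<in>{1..}. hat y k * E m k))"
        using m by (simp add: hat_linear \<Phi>)
      ultimately show ?thesis by (simp only: norm_minus_cancel)
    qed
    have "(norm (\<Phi> x - \<Phi> y))\<^sup>2 = (\<Sum>\<^sub>\<infinity>m\<in>{K<..}. (cmod (hat (\<Phi> x - \<Phi> y) m))\<^sup>2)"
      unfolding norm_hat using far_good(2)[OF K]
      by (intro infsum_cong_neutral) (auto simp: hat_linear \<Phi>)
    also have "\<dots> = (\<Sum>\<^sub>\<infinity>m\<in>{K<..}. (cmod (\<Sum>\<^sub>\<infinity>k\<in>{1..}. hat (x - y) k * E m k))\<^sup>2)"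
      by (rule infsum_cong[OF eq])
    also have "\<dots> \<le> (1/2 * norm (x - y))\<^sup>2"
      using F[of "x - y"] by (simp add: power_mult_distrib power2_eq_square)
    finally have "norm (\<Phi> x - \<Phi> y) \<le> 1/2 * norm (x - y)"
      by (rule power2_le_imp_le) simp
    then show ?thesis by (simp add: dist_norm)
  qed
  then have ex1: "\<exists>!x. \<Phi> x = x"
    by (intro banach_fix_type[of "1/2"]) auto
  have "(\<forall>m\<ge>1. hat x m = (if m \<le> K then hat p m else - (\<Sum>\<^sub>\<infinity>k\<in>{1..}. hat x k * E m k))) \<longleftrightarrow> \<Phi> x = x" for x
  proof
    assume "\<forall>m\<ge>1. hat x m = (if m \<le> K then hat p m else - (\<Sum>\<^sub>\<infinity>k\<in>{1..}. hat x k * E m k))"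
    then show "\<Phi> x = x" by (intro hat_inject) (simp add: \<Phi>)
  next
    assume "\<Phi> x = x"
    then show "\<forall>m\<ge>1. hat x m = (if m \<le> K then hat p m else - (\<Sum>\<^sub>\<infinity>k\<in>{1..}. hat x k * E m k))"
      using \<Phi>[of _ x] by simp
  qed
  then show ?thesis using ex1 by simp
qed

lemma weight:
  assumes "v \<in> V"
  obtains x where "\<And>m. hat x m = of_real (sqrt (\<mu> m)) * hat v m" "norm x = form_norm a v"
proof -
  have eq: "(cmod (of_real (sqrt (\<mu> m)) * hat v m))\<^sup>2 = \<mu> m * (cmod (hat v m))\<^sup>2" if "m \<in> {1..}" for m
    using mu_pos[of m] that by (simp add: norm_mult power_mult_distrib)
  have s: "(\<lambda>m. (cmod (of_real (sqrt (\<mu> m)) * hat v m))\<^sup>2) summable_on {1..}"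
    using weighted_if_V[OF assms] by (subst summable_on_cong[OF eq])
  obtain x where "\<And>m. m \<ge> 1 \<Longrightarrow> hat x m = of_real (sqrt (\<mu> m)) * hat v m"
    by (rule synthesis[OF s]) blast
  then have x: "hat x m = of_real (sqrt (\<mu> m)) * hat v m" for m
    by (cases "m = 0") (auto simp: hat_0)
  have "(norm x)\<^sup>2 = (form_norm a v)\<^sup>2"
    unfolding norm_hat form_norm_hat[OF assms] x by (rule infsum_cong[OF eq])
  then have "norm x = form_norm a v"
    by (rule power2_eq_imp_eq) (use form_nonneg(1)[OF V a(1,2,3) assms] in \<open>auto simp: form_norm_def\<close>)
  then show thesis using that x by blast
qed

lemma unweight:
  obtains v where "v \<in> V" "\<And>m. hat v m = hat x m / of_real (sqrt (\<mu> m))" "form_norm a v = norm x"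
proof -
  have eq: "\<mu> m * (cmod (hat x m / of_real (sqrt (\<mu> m))))\<^sup>2 = (cmod (hat x m))\<^sup>2" if "m \<in> {1..}" for m
    using mu_pos[of m] that by (simp add: norm_divide power_divide)
  have "(\<lambda>m. \<mu> m * (cmod (hat x m / of_real (sqrt (\<mu> m))))\<^sup>2) summable_on {1..}"
    using hat_square_summable[of x] by (subst summable_on_cong[OF eq])
  then obtain v where v: "v \<in> V" "hat v = (\<lambda>m. hat x m / of_real (sqrt (\<mu> m)))"
    using V_synthesis[of "\<lambda>m. hat x m / of_real (sqrt (\<mu> m))"] by (auto simp: hat_0)
  have "(form_norm a v)\<^sup>2 = (norm x)\<^sup>2"
    unfolding norm_hat form_norm_hat[OF v(1)] v(2) by (rule infsum_cong[OF eq])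
  then have "form_norm a v = norm x"
    by (rule power2_eq_imp_eq) (use form_nonneg(1)[OF V a(1,2,3) v(1)] in \<open>auto simp: form_norm_def\<close>)
  then show thesis using that[of v] v by simp
qed

lemma lpair_weight:
  assumes K: "far K" and n: "n > K" and v: "v \<in> V" and x: "\<And>m. hat x m = of_real (sqrt (\<mu> m)) * hat v m"
  shows "of_real (sqrt (\<mu> n)) * lpair n v = hat x n + (\<Sum>\<^sub>\<infinity>m\<in>{1..}. hat x m * E n m)"
proof -
  have g: "good n" by (rule far_good(1)[OF K n])
  have n1': "1 \<le> n" using n far_good(2)[OF K] by simp
  have s: "(\<lambda>m. hat x m * E n m) summable_on {1..}"
    using K n hat_square_summable[of x] unfolding far_def by blast
  have t: "((\<lambda>m. if m = n then hat x n else 0) has_sum hat x n) {1..}"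
    using n1' by (subst has_sum_cong_neutral[where T = "{n}" and g = "\<lambda>_. hat x n"]) (auto intro: has_sum_finiteI)
  have "of_real (sqrt (\<mu> n)) * lpair n v = (\<Sum>\<^sub>\<infinity>m\<in>{1..}. (if m = n then hat x n else 0) + hat x m * E n m)"
    unfolding lpair_def infsum_cmult_right'[symmetric]
  proof (rule infsum_cong)
    fix m :: nat assume "m \<in> {1..}"
    then have m: "1 \<le> m" by simp
    show "of_real (sqrt (\<mu> n)) * (hat v m * coeigv bm n m) = (if m = n then hat x n else 0) + hat x m * E n m"
    proof (cases "m = n")
      case True
      then show ?thesis using coeigv(3)[OF bm g] by (simp add: x E_def)
    next
      case False
      have "sqrt (\<mu> m) * sqrt (\<mu> n / \<mu> m) = sqrt (\<mu> n)"
        using mu_pos[OF m] mu_pos[OF n1'] by (simp add: real_sqrt_divide)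
      then have "complex_of_real (sqrt (\<mu> m)) * of_real (sqrt (\<mu> n / \<mu> m)) = of_real (sqrt (\<mu> n))"
        by (simp only: of_real_mult[symmetric])
      then show ?thesis using False by (simp add: x E_def mult_ac)
    qed
  qed
  also have "\<dots> = hat x n + (\<Sum>\<^sub>\<infinity>m\<in>{1..}. hat x m * E n m)"
    using infsum_add[OF has_sum_imp_summable[OF t] s] infsumI[OF t] by simp
  finally show ?thesis .
qed

definition Y :: "nat \<Rightarrow> 'h set" where
  "Y K = {v \<in> V. \<forall>n>K. lpair n v = 0}"

context
  fixes K
  assumes K: "far K"
begin

lemma Y_subspace: "complex_vector.subspace (Y K)"
proof (rule complex_vector.subspaceI)
  show "0 \<in> Y K"
    using V_cl(1) lpair_linear(4)[OF far_good(1)[OF K]] by (simp add: Y_def)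
  show "x + y \<in> Y K" if "x \<in> Y K" "y \<in> Y K" for x y
    using that V_cl(2)[of x y] lpair_linear(1)[OF far_good(1)[OF K]] by (simp add: Y_def)
  show "c *\<^sub>C x \<in> Y K" if "x \<in> Y K" for c x
    using that V_cl(3)[of x c] lpair_linear(2)[OF far_good(1)[OF K]] by (simp add: Y_def)
qed

lemma Y_weight_iff:
  assumes v: "v \<in> V" and x: "\<And>m. hat x m = of_real (sqrt (\<mu> m)) * hat v m"
  shows "v \<in> Y K \<longleftrightarrow> (\<forall>n>K. hat x n = - (\<Sum>\<^sub>\<infinity>m\<in>{1..}. hat x m * E n m))"
proof -
  have "lpair n v = 0 \<longleftrightarrow> hat x n = - (\<Sum>\<^sub>\<infinity>m\<in>{1..}. hat x m * E n m)" if n: "n > K" for n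
  proof -
    have "0 < \<mu> n" using n by (intro mu_pos) simp
    then show ?thesis
      using lpair_weight[OF K n v x] by (auto simp: eq_neg_iff_add_eq_0)
  qed
  then show ?thesis using v by (auto simp: Y_def)
qed

lemma Y_determined:
  assumes v: "v \<in> Y K" and 0: "\<And>m. m \<in> {1..K} \<Longrightarrow> hat v m = 0"
  shows "v = 0"
proof -
  have vV: "v \<in> V" using v by (simp add: Y_def)
  obtain x where x: "\<And>m. hat x m = of_real (sqrt (\<mu> m)) * hat v m"
    using weight[OF vV] by blast
  have "\<forall>m\<ge>1. hat x m = (if m \<le> K then hat 0 m else - (\<Sum>\<^sub>\<infinity>k\<in>{1..}. hat x k * E m k))"
    using Y_weight_iff[OF vV x] v 0 by (auto simp: hat_0 x)
  moreover have "\<forall>m\<ge>1. hat 0 m = (if m \<le> K then hat 0 m else - (\<Sum>\<^sub>\<infinity>k\<in>{1..}. hat 0 k * E m k))"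
    by (simp add: hat_0)
  ultimately have "x = 0" using fixed_point[OF K, of 0] by blast
  show ?thesis
  proof (rule hat_inject)
    fix m :: nat assume "m \<ge> 1"
    then show "hat v m = hat 0 m"
      using x[of m] mu_pos[of m] unfolding \<open>x = 0\<close> by (simp add: hat_0)
  qed
qed

lemma Y_dual_basis: "\<exists>y. \<forall>i\<in>{1..K}. y i \<in> Y K \<and> (\<forall>m\<in>{1..K}. hat (y i) m = of_bool (m = i))"
proof -
  have "\<exists>y. y \<in> Y K \<and> (\<forall>m\<in>{1..K}. hat y m = of_bool (m = i))" if i: "i \<in> {1..K}" for i
  proof -
    obtain x where x: "\<And>m. m \<ge> 1 \<Longrightarrow> hat x m = (if m \<le> K then hat (complex_of_real (sqrt (\<mu> i)) *\<^sub>C \<psi> i) m else - (\<Sum>\<^sub>\<infinity>k\<in>{1..}. hat x k * E m k))"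
      using fixed_point[OF K] by blast
    obtain v where v: "v \<in> V" "\<And>m. hat v m = hat x m / of_real (sqrt (\<mu> m))"
      using unweight by blast
    have xv: "hat x m = of_real (sqrt (\<mu> m)) * hat v m" for m
    proof (cases "m = 0")
      case True
      then show ?thesis by (simp add: hat_0)
    next
      case False
      then show ?thesis using mu_pos[of m] by (simp add: v(2))
    qed
    have "v \<in> Y K"
      unfolding Y_weight_iff[OF v(1) xv] using x by auto
    moreover have "hat v m = of_bool (m = i)" if m: "m \<in> {1..K}" for m
      using m i x[of m] mu_pos[of i] unfolding v(2) by (auto simp: hat_linear hat_psi)
    ultimately show ?thesis by blast
  qed
  then show ?thesis by metis
qed

lemma Y_coordinates:
  assumes y: "\<forall>i\<in>{1..K}. y i \<in> Y K \<and> (\<forall>m\<in>{1..K}. hat (y i) m = of_bool (m = i))" and v: "v \<in> Y K"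
  shows "v = (\<Sum>i\<in>{1..K}. hat v i *\<^sub>C y i)"
proof -
  have "v - (\<Sum>i\<in>{1..K}. hat v i *\<^sub>C y i) = 0"
  proof (rule Y_determined)
    show "v - (\<Sum>i\<in>{1..K}. hat v i *\<^sub>C y i) \<in> Y K"
      using v y by (intro complex_vector.subspace_diff[OF Y_subspace] complex_vector.subspace_sum[OF Y_subspace]
          complex_vector.subspace_scale[OF Y_subspace]) auto
    fix m assume m: "m \<in> {1..K}"
    have "hat (\<Sum>i\<in>{1..K}. hat v i *\<^sub>C y i) m = (\<Sum>i\<in>{1..K}. if i = m then hat v i else 0)"
      unfolding hat_sum hat_linear using y m by (intro sum.cong) auto
    then show "hat (v - (\<Sum>i\<in>{1..K}. hat v i *\<^sub>C y i)) m = 0"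
      using m by (simp add: hat_linear)
  qed
  then show ?thesis by simp
qed

lemma Y_basis:
  obtains y where "\<forall>i\<in>{1..K}. y i \<in> Y K \<and> (\<forall>m\<in>{1..K}. hat (y i) m = of_bool (m = i))"
    "inj_on y {1..K}" "complex_vector.independent (y ` {1..K})" "complex_vector.span (y ` {1..K}) = Y K"
proof -
  obtain y where y: "\<forall>i\<in>{1..K}. y i \<in> Y K \<and> (\<forall>m\<in>{1..K}. hat (y i) m = of_bool (m = i))"
    using Y_dual_basis by blast
  have "c m = 0" if "(\<Sum>i\<in>{1..K}. c i *\<^sub>C y i) = 0" and m: "m \<in> {1..K}" for c m
  proof -
    have "hat (\<Sum>i\<in>{1..K}. c i *\<^sub>C y i) m = (\<Sum>i\<in>{1..K}. if i = m then c i else 0)"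
      unfolding hat_sum hat_linear using y m by (intro sum.cong) auto
    then show ?thesis using that by (simp add: hat_0)
  qed
  then have ind: "inj_on y {1..K} \<and> complex_vector.independent (y ` {1..K})"
    by (subst complex_vector.independent_indexed) auto
  have "complex_vector.span (y ` {1..K}) = Y K"
  proof
    show "complex_vector.span (y ` {1..K}) \<subseteq> Y K"
      using y by (intro complex_vector.span_minimal Y_subspace) auto
    show "Y K \<subseteq> complex_vector.span (y ` {1..K})"
    proof
      fix v assume "v \<in> Y K"
      then show "v \<in> complex_vector.span (y ` {1..K})"
        by (subst Y_coordinates[OF y])
           (auto intro!: complex_vector.span_sum complex_vector.span_scale intro: complex_vector.span_base)
    qed
  qed
  then show thesis using that[OF y] ind by blast
qed

lemma dim_Y: "complex_vector.dim (Y K) = K"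
proof -
  obtain y where y: "inj_on y {1..K}" "complex_vector.independent (y ` {1..K})" "complex_vector.span (y ` {1..K}) = Y K"
    by (rule Y_basis) blast
  have "complex_vector.dim (Y K) = card (y ` {1..K})"
    unfolding y(3)[symmetric] by (rule complex_vector.dim_span_eq_card_independent[OF y(2)])
  then show ?thesis using y(1) by (simp add: card_image)
qed

end

end

lemma eigenvalue_not_resolvent:
  assumes "is_resolvent T z R" "(u, z *\<^sub>C u) \<in> T"
  shows "u = 0"
proof -
  have "R (z *\<^sub>C u - z *\<^sub>C u) = u"
    using assms unfolding is_resolvent_def by blast
  moreover have "R 0 = 0"
    using assms(1) unfolding is_resolvent_def by (simp add: linear_simps(3))
  ultimately show ?thesis by simp
qed

lemma eigenvector_in_root_subspace:
  assumes "(u, l *\<^sub>C u) \<in> T"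
  shows "u \<in> root_subspace T l"
proof -
  have "(u, l *\<^sub>C u - l *\<^sub>C u) \<in> op_shift T l"
    using assms unfolding op_shift_def by blast
  then have "(u, 0) \<in> op_shift T l ^^ 1" by simp
  then show ?thesis unfolding root_subspace_def by blast
qed

context perturbed_form begin

definition Lam :: "nat \<Rightarrow> complex set" where
  "Lam N = {z. eigenvalue T z \<and> (\<forall>n>N. z \<notin> Pi_rect \<kappa> \<gamma> \<mu> n)}"

lemma resolvent_scale:
  fixes R :: "'h \<Rightarrow> 'h"
  assumes "is_resolvent T z R"
  shows "R (c *\<^sub>C f) = c *\<^sub>C R f"
proof -
  have "(R f, z *\<^sub>C R f - f) \<in> T"
    using assms unfolding is_resolvent_def by blast
  then have "(c *\<^sub>C R f, c *\<^sub>C (z *\<^sub>C R f - f)) \<in> T"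
    by (rule T_linear(2))
  then have "R (z *\<^sub>C c *\<^sub>C R f - c *\<^sub>C (z *\<^sub>C R f - f)) = c *\<^sub>C R f"
    using assms unfolding is_resolvent_def by blast
  moreover have "z *\<^sub>C c *\<^sub>C R f - c *\<^sub>C (z *\<^sub>C R f - f) = c *\<^sub>C f"
    by (simp add: complex_vector.scale_right_diff_distrib mult.commute)
  ultimately show ?thesis by simp
qed

context
  fixes K
  assumes K: "far K"
begin

text \<open>
  The resolvent at some point of a contour maps \<open>Y K\<close> into itself, because the functionals are left
  eigenvectors for other eigenvalues. Being injective on a finite-dimensional space it is surjective, so
  \<open>Y K\<close> consists of values of the resolvent.
\<close>

lemma Y_in_domain:
  assumes v: "v \<in> Y K"
  shows "\<exists>f\<in>Y K. (v, f) \<in> T"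
proof -
  define n where "n = Suc K"
  have g: "good n" using far_good(1)[OF K] by (simp add: n_def)
  define z where "z = pathstart (Gamma_contour \<kappa> \<gamma> \<mu> n)"
  define R where "R = resolvent T z"
  have z: "z \<in> path_image (Gamma_contour \<kappa> \<gamma> \<mu> n)"
    unfolding z_def by (rule pathstart_in_path_image)
  have R: "is_resolvent T z R" unfolding R_def by (rule contour_resolvent(1)[OF g z])
  have RT: "(R u, z *\<^sub>C R u - u) \<in> T" for u
    using R unfolding is_resolvent_def by blast
  have lin: "linear R" using R by (simp add: is_resolvent_def bounded_linear.linear)
  have RY: "R u \<in> Y K" if u: "u \<in> Y K" for u
  proof -
    have "lpair m (R u) = 0" if m: "m > K" for m
    proof -
      have gm: "good m" by (rule far_good(1)[OF K m])
      have "z \<noteq> lev bm m"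
        using eigenvalue_not_resolvent[OF R, of "Phi m"] Phi_eigenvector[OF gm] Phi_nonzero[OF gm] by auto
      moreover have "z * lpair m (R u) - lpair m u = lev bm m * lpair m (R u)"
        using lpair_T[OF gm RT[of u]] by (simp add: lpair_linear[OF gm])
      moreover have "lpair m u = 0" using u m by (simp add: Y_def)
      ultimately show ?thesis by simp
    qed
    then show ?thesis using T_dom[OF RT[of u]] by (simp add: Y_def)
  qed
  obtain y where y: "\<forall>i\<in>{1..K}. y i \<in> Y K \<and> (\<forall>m\<in>{1..K}. hat (y i) m = of_bool (m = i))"
    "inj_on y {1..K}" "complex_vector.independent (y ` {1..K})" "complex_vector.span (y ` {1..K}) = Y K"
    by (rule Y_basis[OF K]) blast
  have Rsum: "R (\<Sum>i\<in>{1..K}. c i *\<^sub>C y i) = (\<Sum>i\<in>{1..K}. c i *\<^sub>C R (y i))" for c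
    by (simp add: linear_sum[OF lin] resolvent_scale[OF R])
  have "\<forall>i\<in>{1..K}. c i = 0" if c: "(\<Sum>i\<in>{1..K}. c i *\<^sub>C R (y i)) = 0" for c
  proof -
    let ?u = "\<Sum>i\<in>{1..K}. c i *\<^sub>C y i"
    have "R ?u = 0" using c Rsum by simp
    then have "(0, - ?u) \<in> T" using RT[of ?u] by (simp add: complex_vector.scale_zero_right)
    then have "?u = 0" using T_linear(3)[OF _ T_linear(4)] by fastforce
    then show ?thesis using y(2,3) complex_vector.independent_indexed[of "{1..K}" y] by simp
  qed
  then have ind: "inj_on (\<lambda>i. R (y i)) {1..K} \<and> complex_vector.independent ((\<lambda>i. R (y i)) ` {1..K})"
    by (subst complex_vector.independent_indexed) auto
  have "y ` {1..K} \<subseteq> complex_vector.span ((\<lambda>i. R (y i)) ` {1..K})"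
  proof (rule complex_vector.independent_spans)
    show "(\<lambda>i. R (y i)) ` {1..K} \<subseteq> complex_vector.span (y ` {1..K})"
      unfolding y(4) using RY y(1) by auto
    show "card (y ` {1..K}) \<le> card ((\<lambda>i. R (y i)) ` {1..K})"
      using ind y(2) by (simp add: card_image)
  qed (use ind in auto)
  then have "complex_vector.span (y ` {1..K}) \<subseteq> complex_vector.span ((\<lambda>i. R (y i)) ` {1..K})"
    by (intro complex_vector.span_minimal complex_vector.subspace_span)
  then have "v \<in> complex_vector.span ((\<lambda>i. R (y i)) ` {1..K})"
    using v y(4) by blast
  then obtain c where c: "v = (\<Sum>i\<in>{1..K}. c i *\<^sub>C R (y i))"
    using complex_vector.span_indexed[of "{1..K}" v "\<lambda>i. R (y i)"] by auto
  let ?u = "\<Sum>i\<in>{1..K}. c i *\<^sub>C y i"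
  have u: "?u \<in> Y K"
    using y(1) by (intro complex_vector.subspace_sum[OF Y_subspace[OF K]] complex_vector.subspace_scale[OF Y_subspace[OF K]]) auto
  have "(v, z *\<^sub>C v - ?u) \<in> T"
    using RT[of ?u] unfolding Rsum c[symmetric] .
  moreover have "z *\<^sub>C v - ?u \<in> Y K"
    by (intro complex_vector.subspace_diff[OF Y_subspace[OF K]] complex_vector.subspace_scale[OF Y_subspace[OF K]] u v)
  ultimately show ?thesis by blast
qed

text \<open>
  On a root vector for \<open>l\<close> the functionals satisfy \<open>(lev - l) lpair u = lpair ((T - l) u)\<close>, so by
  induction along the chain they vanish whenever \<open>lev \<noteq> l\<close>.
\<close>

lemma root_in_Y:
  assumes l: "l \<in> Lam K" and u: "u \<in> root_subspace T l"
  shows "u \<in> Y K"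
proof -
  have ne: "l \<noteq> lev bm n" if "n > K" for n
    using l that lev(1)[OF bm far_good(1)[OF K that]] unfolding Lam_def by blast
  have "(u, 0) \<in> op_shift T l ^^ k \<Longrightarrow> u \<in> Y K" for u k
  proof (induction k arbitrary: u)
    case 0
    then show ?case using complex_vector.subspace_0[OF Y_subspace[OF K]] by simp
  next
    case (Suc k)
    then obtain f where f: "(u, f) \<in> op_shift T l" "(f, 0) \<in> op_shift T l ^^ k"
      by (meson relpow_Suc_D2)
    have T: "(u, f + l *\<^sub>C u) \<in> T"
      using f(1) by (auto simp: op_shift_def)
    have "lpair n u = 0" if n: "n > K" for n
    proof -
      have gn: "good n" by (rule far_good(1)[OF K n])
      have "lpair n f = 0" using Suc.IH[OF f(2)] n by (simp add: Y_def)
      then show ?thesis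
        using lpair_T[OF gn T] ne[OF n] by (simp add: lpair_linear[OF gn])
    qed
    then show ?case using T_dom[OF T] by (simp add: Y_def)
  qed
  then show ?thesis using u unfolding root_subspace_def by blast
qed

text \<open>
  \<open>T\<close> restricts to an endomorphism of the finite-dimensional space \<open>Y K\<close>, and the generalized eigenvectors of
  the restriction are root vectors of \<open>T\<close>. None belongs to an eigenvalue \<open>lev\<close> with index beyond \<open>K\<close>:
  that eigenvector is a multiple of \<open>Phi n\<close>, where \<open>lpair n\<close> does not vanish.
\<close>

lemma span_root_subspaces: "complex_vector.span (\<Union>l\<in>Lam K. root_subspace T l) = Y K"
proof
  show "complex_vector.span (\<Union>l\<in>Lam K. root_subspace T l) \<subseteq> Y K"
    using root_in_Y by (intro complex_vector.span_minimal Y_subspace[OF K]) auto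
  obtain y where y: "\<forall>i\<in>{1..K}. y i \<in> Y K \<and> (\<forall>m\<in>{1..K}. hat (y i) m = of_bool (m = i))"
    "complex_vector.span (y ` {1..K}) = Y K"
    by (rule Y_basis[OF K]) blast
  have "\<forall>i\<in>{1..K}. \<exists>f. f \<in> Y K \<and> (y i, f) \<in> T"
    using y(1) Y_in_domain by blast
  then obtain f where f: "\<And>i. i \<in> {1..K} \<Longrightarrow> f i \<in> Y K" "\<And>i. i \<in> {1..K} \<Longrightarrow> (y i, f i) \<in> T"
    by metis
  define L where "L u = (\<Sum>i\<in>{1..K}. hat u i *\<^sub>C f i)" for u
  interpret linear_endo L "Y K"
  proof
    show "L (u + v) = L u + L v" for u v
      by (simp add: L_def hat_linear complex_vector.scale_left_distrib sum.distrib)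
    show "L (c *\<^sub>C u) = c *\<^sub>C L u" for c u
      by (simp add: L_def hat_linear complex_vector.scale_sum_right)
    show "complex_vector.subspace (Y K)" by (rule Y_subspace[OF K])
    show "L u \<in> Y K" for u
      unfolding L_def using f(1)
      by (intro complex_vector.subspace_sum[OF Y_subspace[OF K]] complex_vector.subspace_scale[OF Y_subspace[OF K]]) auto
  qed
  have T_sum: "(\<Sum>i\<in>F. c i *\<^sub>C y i, \<Sum>i\<in>F. c i *\<^sub>C f i) \<in> T" if "finite F" "F \<subseteq> {1..K}" for F c
    using that
  proof (induction F)
    case empty
    then show ?case using T_linear(4) by simp
  next
    case (insert i F)
    then have "(c i *\<^sub>C y i + (\<Sum>i\<in>F. c i *\<^sub>C y i), c i *\<^sub>C f i + (\<Sum>i\<in>F. c i *\<^sub>C f i)) \<in> T"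
      using f(2)[of i] by (intro T_linear(1) T_linear(2)) auto
    then show ?case using insert by simp
  qed
  have LT: "(u, L u) \<in> T" if u: "u \<in> Y K" for u
  proof -
    have "(\<Sum>i\<in>{1..K}. hat u i *\<^sub>C y i, L u) \<in> T"
      unfolding L_def by (rule T_sum) auto
    then show ?thesis using Y_coordinates[OF K y(1) u] by simp
  qed
  have eig: "l \<in> Lam K" if u: "u \<in> Y K" "u \<noteq> 0" "L u = l *\<^sub>C u" for u l
  proof -
    have T: "(u, l *\<^sub>C u) \<in> T" using LT[OF u(1)] u(3) by simp
    have "l \<notin> Pi_rect \<kappa> \<gamma> \<mu> n" if n: "n > K" for n
    proof
      assume l: "l \<in> Pi_rect \<kappa> \<gamma> \<mu> n"
      have gn: "good n" by (rule far_good(1)[OF K n])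
      obtain c where c: "u = c *\<^sub>C Phi n"
        using eigenvector_unique(2)[OF gn _ T u(2)] l rect_subset by blast
      have "lpair n u = 0" using u(1) n by (simp add: Y_def)
      then have "c = 0" using c by (simp add: lpair_linear[OF gn] lpair_Phi[OF gn])
      then show False using c u(2) by (simp add: complex_vector.scale_zero_left)
    qed
    then show ?thesis using T u(2) unfolding Lam_def eigenvalue_def by blast
  qed
  have gen: "v = 0 \<or> l \<in> Lam K \<and> v \<in> root_subspace T l" if v: "v \<in> gen_eigen l" for v l
  proof -
    let ?S = "\<lambda>x. L x - l *\<^sub>C x"
    have "v \<in> Y K \<Longrightarrow> (?S ^^ k) v = 0 \<Longrightarrow> v = 0 \<or> l \<in> Lam K \<and> (v, 0) \<in> op_shift T l ^^ k" for k v
    proof (induction k arbitrary: v)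
      case 0
      then show ?case by simp
    next
      case (Suc k)
      have SY: "?S v \<in> Y K"
        by (intro complex_vector.subspace_diff[OF Y_subspace[OF K]] complex_vector.subspace_scale[OF Y_subspace[OF K]] L_Y Suc.prems)
      have S0: "(?S ^^ k) (?S v) = 0"
        using Suc.prems(2) by (simp only: funpow_Suc_right o_apply)
      have step: "(v, ?S v) \<in> op_shift T l"
        using LT[OF Suc.prems(1)] unfolding op_shift_def by blast
      consider "v = 0" | "v \<noteq> 0" "?S v = 0" | "l \<in> Lam K" "(?S v, 0) \<in> op_shift T l ^^ k"
        using Suc.IH[OF SY S0] by blast
      then show ?case
      proof cases
        case 1
        then show ?thesis by simp
      next
        case 2
        have zero: "(0, 0) \<in> op_shift T l"
          using T_linear(4) complex_vector.scale_zero_right[of l] unfolding op_shift_def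
          by (metis (mono_tags, lifting) diff_zero mem_Collect_eq)
        have "(0, 0) \<in> op_shift T l ^^ k"
          by (induction k) (auto intro: zero relcompI)
        then have "(v, 0) \<in> op_shift T l ^^ Suc k"
          using step 2(2) by (intro relpow_Suc_I2) auto
        moreover have "l \<in> Lam K" using eig[OF Suc.prems(1) 2(1)] 2(2) by simp
        ultimately show ?thesis by simp
      next
        case 3
        then show ?thesis using relpow_Suc_I2[OF step] by blast
      qed
    qed
    then show ?thesis
      using v unfolding gen_eigen_def root_subspace_def by blast
  qed
  show "Y K \<subseteq> complex_vector.span (\<Union>l\<in>Lam K. root_subspace T l)"
  proof
    fix u assume u: "u \<in> Y K"
    have "u \<in> G"
      by (rule generalized_eigenvectors_span[of "y ` {1..K}"]) (use y(2) u in auto)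
    moreover have "G \<subseteq> complex_vector.span (\<Union>l\<in>Lam K. root_subspace T l)"
      unfolding G_def
    proof (rule complex_vector.span_minimal)
      show "(\<Union>z. gen_eigen z) \<subseteq> complex_vector.span (\<Union>l\<in>Lam K. root_subspace T l)"
      proof
        fix v assume "v \<in> (\<Union>z. gen_eigen z)"
        then obtain l where "v \<in> gen_eigen l" by blast
        then consider "v = 0" | "l \<in> Lam K" "v \<in> root_subspace T l" using gen by blast
        then show "v \<in> complex_vector.span (\<Union>l\<in>Lam K. root_subspace T l)"
        proof cases
          case 1
          then show ?thesis by (simp add: complex_vector.span_zero)
        next
          case 2
          then show ?thesis by (intro complex_vector.span_base) blast
        qed
      qed
    qed (rule complex_vector.subspace_span)
    ultimately show "u \<in> complex_vector.span (\<Union>l\<in>Lam K. root_subspace T l)" by blast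
  qed
qed

lemma root_system_exists: "\<exists>\<phi>. root_system T \<kappa> \<gamma> \<mu> \<psi> K \<phi>"
proof -
  obtain B where B: "B \<subseteq> (\<Union>l\<in>Lam K. root_subspace T l)" "complex_vector.independent B"
    "(\<Union>l\<in>Lam K. root_subspace T l) \<subseteq> complex_vector.span B" "card B = complex_vector.dim (\<Union>l\<in>Lam K. root_subspace T l)"
    by (rule complex_vector.basis_exists)
  have span: "complex_vector.span B = Y K"
    unfolding span_root_subspaces[symmetric]
    by (intro equalityI complex_vector.span_mono[OF B(1)] complex_vector.span_minimal[OF B(3) complex_vector.subspace_span])
  then have card: "card B = K"
    using complex_vector.dim_span_eq_card_independent[OF B(2)] dim_Y[OF K] by simp
  then have "finite B" using far_good(2)[OF K] by (intro card_ge_0_finite) simp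
  then obtain h where h: "bij_betw h {1..K} B"
    using ex_bij_betw_nat_finite_1[of B] card by blast
  define \<phi> where "\<phi> n = (if n \<in> {1..K} then h n else Phi n)" for n
  have "bij_betw \<phi> {1..K} B"
    using h by (subst bij_betw_cong[of _ _ h]) (simp_all add: \<phi>_def)
  then have im: "\<phi> ` {1..K} = B" and inj: "inj_on \<phi> {1..K}"
    unfolding bij_betw_def by simp_all
  have "root_system T \<kappa> \<gamma> \<mu> \<psi> K \<phi>"
    unfolding root_system_def Let_def Lam_def[symmetric] im
  proof (intro conjI allI impI ballI)
    fix n assume n: "n > K"
    then have gn: "good n" by (rule far_good(1)[OF K])
    have \<phi>n: "\<phi> n = Phi n" using n by (simp add: \<phi>_def)
    show "path_image (Gamma_contour \<kappa> \<gamma> \<mu> n) \<subseteq> resolvent_set T"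
      using contour_resolvent(3)[OF gn] by blast
    show "\<phi> n = (1 / (2 * pi * \<i>)) *\<^sub>C vec_contour_integral (Gamma_contour \<kappa> \<gamma> \<mu> n) (\<lambda>z. resolvent T z (\<psi> n))"
      unfolding \<phi>n Phi_def ..
    show "\<exists>l. {z \<in> Pi_rect \<kappa> \<gamma> \<mu> n. eigenvalue T z} = {l} \<and>
             complex_vector.dim (root_subspace T l) = 1 \<and> \<phi> n \<noteq> 0 \<and> (\<phi> n, l *\<^sub>C \<phi> n) \<in> T"
      unfolding \<phi>n using eigenvalue_in_rect[OF gn] dim_root_subspace_lev[OF gn] Phi_nonzero[OF gn] Phi_eigenvector[OF gn] by blast
  next
    fix n assume "n \<in> {1..K}"
    then have "\<phi> n \<in> B" using im by blast
    then show "\<exists>l\<in>Lam K. \<phi> n \<in> root_subspace T l" using B(1) by blast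
  next
    show "complex_vector.span B = complex_vector.span (\<Union>l\<in>Lam K. root_subspace T l)"
      unfolding span span_root_subspaces ..
  qed (rule inj, rule B(2))
  then show ?thesis by blast
qed

text \<open>
  For \<open>N < n \<le> K\<close> the vectors \<open>\<phi> n\<close> span the root subspaces of the eigenvalues in their rectangles, so
  \<open>\<phi> 1, \<dots>, \<phi> K\<close> span \<open>Y K\<close>. As there are only \<open>K\<close> of them and \<open>Y K\<close> has dimension \<open>K\<close>, they are independent.
\<close>

lemma root_system_shift:
  assumes rs: "root_system T \<kappa> \<gamma> \<mu> \<psi> N \<phi>" and NK: "N \<le> K"
  shows "\<And>n. n > K \<Longrightarrow> \<phi> n = Phi n" "inj_on \<phi> {1..K}" "complex_vector.independent (\<phi> ` {1..K})"
    "complex_vector.span (\<phi> ` {1..K}) = Y K"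
proof -
  have rs1: "\<phi> n = Phi n \<and> (\<exists>l. {z \<in> Pi_rect \<kappa> \<gamma> \<mu> n. eigenvalue T z} = {l} \<and>
             complex_vector.dim (root_subspace T l) = 1 \<and> \<phi> n \<noteq> 0 \<and> (\<phi> n, l *\<^sub>C \<phi> n) \<in> T)" if "n > N" for n
    using rs that unfolding root_system_def Phi_def by blast
  have rs2: "complex_vector.span (\<phi> ` {1..N}) = complex_vector.span (\<Union>l\<in>Lam N. root_subspace T l)"
    using rs unfolding root_system_def Let_def Lam_def by blast
  show "\<phi> n = Phi n" if "n > K" for n using rs1[of n] that NK by auto
  let ?C = "\<phi> ` {1..K}"
  have root: "root_subspace T l \<subseteq> complex_vector.span ?C" if l: "l \<in> Lam K" for l
  proof (cases "l \<in> Lam N")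
    case True
    then have "root_subspace T l \<subseteq> complex_vector.span (\<phi> ` {1..N})"
      unfolding rs2 by (auto intro: complex_vector.span_base)
    also have "\<dots> \<subseteq> complex_vector.span ?C"
      using NK by (intro complex_vector.span_mono image_mono) auto
    finally show ?thesis .
  next
    case False
    then obtain n where n: "n > N" "l \<in> Pi_rect \<kappa> \<gamma> \<mu> n" and eig: "eigenvalue T l"
      using l unfolding Lam_def by blast
    have nK: "n \<le> K" using l n(2) unfolding Lam_def by (auto simp: not_less[symmetric])
    obtain l' where l': "{z \<in> Pi_rect \<kappa> \<gamma> \<mu> n. eigenvalue T z} = {l'}"
      "complex_vector.dim (root_subspace T l') = 1" "\<phi> n \<noteq> 0" "(\<phi> n, l' *\<^sub>C \<phi> n) \<in> T"
      using rs1[OF n(1)] by (elim conjE exE)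
    have "l \<in> {z \<in> Pi_rect \<kappa> \<gamma> \<mu> n. eigenvalue T z}" using n(2) eig by simp
    then have "l' = l" unfolding l'(1) by simp
    then have dim: "complex_vector.dim (root_subspace T l) = 1" and \<phi>n: "\<phi> n \<noteq> 0" "(\<phi> n, l *\<^sub>C \<phi> n) \<in> T"
      using l' by simp_all
    obtain B where B: "B \<subseteq> root_subspace T l" "root_subspace T l \<subseteq> complex_vector.span B" "card B = 1"
      using complex_vector.basis_exists[of "root_subspace T l"] dim by metis
    have "B \<subseteq> complex_vector.span {\<phi> n}"
    proof (rule complex_vector.independent_spans)
      show "finite B" using B(3) by (intro card_ge_0_finite) simp
      show "complex_vector.independent {\<phi> n}" using \<phi>n by (simp add: complex_vector.dependent_single)
      show "{\<phi> n} \<subseteq> complex_vector.span B"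
        using eigenvector_in_root_subspace[OF \<phi>n(2)] B(2) by blast
    qed (simp add: B(3))
    then have "root_subspace T l \<subseteq> complex_vector.span {\<phi> n}"
      using B(2) complex_vector.span_minimal[OF _ complex_vector.subspace_span] by blast
    also have "\<dots> \<subseteq> complex_vector.span ?C"
      using n nK by (intro complex_vector.span_mono) auto
    finally show ?thesis .
  qed
  have YC: "Y K \<subseteq> complex_vector.span ?C"
    unfolding span_root_subspaces[symmetric] using root
    by (intro complex_vector.span_minimal complex_vector.subspace_span) auto
  obtain y where y: "inj_on y {1..K}" "complex_vector.independent (y ` {1..K})" "complex_vector.span (y ` {1..K}) = Y K"
    by (rule Y_basis[OF K]) blast
  have yC: "y ` {1..K} \<subseteq> complex_vector.span ?C"
    using YC y(3) complex_vector.span_superset by blast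
  have cy: "card (y ` {1..K}) = K" using y(1) by (simp add: card_image)
  have cC: "card ?C \<le> K" using card_image_le[of "{1..K}" \<phi>] by simp
  show ind: "complex_vector.independent ?C"
    by (rule complex_vector.spanning_independent[OF _ y(2) yC]) (use cy cC in auto)
  have "K \<le> card ?C"
    using complex_vector.independent_span_bound[OF _ y(2) yC] cy by simp
  then show "inj_on \<phi> {1..K}"
    using cC by (intro eq_card_imp_inj_on) auto
  have "?C \<subseteq> complex_vector.span (y ` {1..K})"
    by (rule complex_vector.independent_spans[OF _ y(2) yC]) (use cy cC in auto)
  then have "complex_vector.span ?C \<subseteq> Y K"
    using complex_vector.span_minimal[OF _ Y_subspace[OF K]] y(3) by blast
  then show "complex_vector.span ?C = Y K" using YC by blast
qed

end

end

section \<open>The Riesz basis property\<close>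

lemma riesz_basis_on_cong:
  "(\<And>i. i \<in> I \<Longrightarrow> f i = g i) \<Longrightarrow> riesz_basis_on V s I f \<Longrightarrow> riesz_basis_on V s I g"
  unfolding riesz_basis_on_def by simp

context perturbed_form begin

text \<open>On \<open>V\<close> this is \<open>A\<^sup>1\<^sup>/\<^sup>2\<close>, an isometry from \<open>V\<close> with the form norm onto the Hilbert space.\<close>

definition Wt :: "'h \<Rightarrow> 'h" where
  "Wt v = (SOME x. (\<forall>m. hat x m = of_real (sqrt (\<mu> m)) * hat v m) \<and> norm x = form_norm a v)"

lemma Wt:
  assumes "v \<in> V"
  shows "hat (Wt v) m = of_real (sqrt (\<mu> m)) * hat v m" "norm (Wt v) = form_norm a v"
proof -
  obtain x where "\<And>m. hat x m = of_real (sqrt (\<mu> m)) * hat v m" "norm x = form_norm a v"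
    by (rule weight[OF assms]) blast
  then have "\<exists>x. (\<forall>m. hat x m = of_real (sqrt (\<mu> m)) * hat v m) \<and> norm x = form_norm a v" by blast
  then have "(\<forall>m. hat (Wt v) m = of_real (sqrt (\<mu> m)) * hat v m) \<and> norm (Wt v) = form_norm a v"
    unfolding Wt_def by (rule someI_ex)
  then show "hat (Wt v) m = of_real (sqrt (\<mu> m)) * hat v m" "norm (Wt v) = form_norm a v" by auto
qed

lemma Wt_linear:
  "u \<in> V \<Longrightarrow> v \<in> V \<Longrightarrow> Wt (u + v) = Wt u + Wt v" "u \<in> V \<Longrightarrow> Wt (c *\<^sub>C u) = c *\<^sub>C Wt u"
  "u \<in> V \<Longrightarrow> v \<in> V \<Longrightarrow> Wt (u - v) = Wt u - Wt v"
  by (rule hat_inject, simp add: Wt V_cl hat_linear algebra_simps)+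

lemma form_norm_triangle: "u \<in> V \<Longrightarrow> v \<in> V \<Longrightarrow> form_norm a (u + v) \<le> form_norm a u + form_norm a v"
  "u \<in> V \<Longrightarrow> v \<in> V \<Longrightarrow> form_norm a (u - v) \<le> form_norm a u + form_norm a v"
  "u \<in> V \<Longrightarrow> form_norm a (c *\<^sub>C u) = cmod c * form_norm a u" "u \<in> V \<Longrightarrow> 0 \<le> form_norm a u"
  using norm_triangle_ineq[of "Wt u" "Wt v"] norm_triangle_ineq4[of "Wt u" "Wt v"] norm_ge_zero[of "Wt u"]
  by (simp_all add: Wt(2)[symmetric] V_cl Wt_linear norm_scaleC del: norm_ge_zero)

lemma norm_le_form_norm: "v \<in> V \<Longrightarrow> norm v \<le> form_norm a v / sqrt (\<mu> 1)"
proof -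
  assume v: "v \<in> V"
  have le: "(cmod (hat v m))\<^sup>2 \<le> 1 / \<mu> 1 * (\<mu> m * (cmod (hat v m))\<^sup>2)" if "m \<in> {1..}" for m
  proof -
    have "\<mu> 1 * (cmod (hat v m))\<^sup>2 \<le> \<mu> m * (cmod (hat v m))\<^sup>2"
      using mu_mono[of 1 m] that by (intro mult_right_mono) auto
    then show ?thesis using mu_1 by (simp add: field_simps)
  qed
  have "(norm v)\<^sup>2 \<le> 1 / \<mu> 1 * (form_norm a v)\<^sup>2"
    unfolding norm_hat form_norm_hat[OF v] by (rule summable_le(2)[OF weighted_if_V[OF v] zero_le_power2 le])
  also have "\<dots> = (form_norm a v / sqrt (\<mu> 1))\<^sup>2"
    using mu_1 by (simp add: power_divide)
  finally show ?thesis
    by (rule power2_le_imp_le) (use form_norm_triangle(4)[OF v] mu_1 in auto)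
qed

lemma norm_hat_le: "cmod (hat v m) \<le> norm v"
proof (cases "m = 0")
  case False
  have "(cmod (hat v m))\<^sup>2 = (\<Sum>k\<in>{m}. (cmod (hat v k))\<^sup>2)" by simp
  also have "\<dots> \<le> (norm v)\<^sup>2"
    unfolding norm_hat using False by (intro finite_sum_le_infsum hat_square_summable) auto
  finally show ?thesis by (rule power2_le_imp_le) simp
qed (simp add: hat_0)

definition e :: "nat \<Rightarrow> 'h" where
  "e n = (1 / sqrt (\<mu> n)) *\<^sub>R \<psi> n"

lemma e_V: "n \<ge> 1 \<Longrightarrow> e n \<in> V"
  unfolding e_def scaleC_of_real[symmetric] by (intro V_cl psi_V)

lemma Wt_e: "n \<ge> 1 \<Longrightarrow> Wt (e n) = \<psi> n"
proof (rule hat_inject)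
  fix m :: nat assume n: "n \<ge> 1"
  show "hat (Wt (e n)) m = hat (\<psi> n) m"
    unfolding Wt(1)[OF e_V[OF n]] using mu_pos[OF n] n by (cases "m = n") (auto simp: e_def hat_linear hat_psi)
qed

lemma orthonormal_basis_e: "orthonormal_basis_on V a {1..} e"
  unfolding orthonormal_basis_on_def
proof (intro conjI ballI allI impI)
  show "i \<in> {1..} \<Longrightarrow> e i \<in> V" for i using e_V by simp
next
  fix i j :: nat assume ij: "i \<in> {1..}" "j \<in> {1..}"
  have "a (e i) (e j) = (1 / sqrt (\<mu> i)) * (1 / sqrt (\<mu> j)) * a (\<psi> i) (\<psi> j)"
    using ij form_simps(3)[OF V a(1) psi_V[of i] e_V[of j] e_V[of j], of "1 / sqrt (\<mu> i)"]
      form_simps(4)[OF V a(1) psi_V[of i] psi_V[of j] psi_V[of j], of "1 / sqrt (\<mu> j)"]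
    by (simp add: e_def scaleC_of_real[symmetric])
  then show "a (e i) (e j) = of_bool (i = j)"
    using ij a_psi(1)[of i "\<psi> j"] psi_V[of j] hat_psi[of j i] mu_pos[of i]
    by (auto simp flip: of_real_mult)
next
  fix v and \<epsilon> :: real assume v: "v \<in> V" and \<epsilon>: "\<epsilon> > 0"
  have "\<forall>\<^sub>F n in sequentially. form_norm a (v - proj {1..n} v) < \<epsilon>"
    using approx(1)[OF v] \<epsilon> by (rule order_tendstoD(2))
  then obtain n where n: "form_norm a (v - proj {1..n} v) < \<epsilon>"
    by (auto simp: eventually_sequentially)
  have "proj {1..n} v \<in> complex_vector.span (e ` {1..})"
    unfolding proj_def
  proof (intro complex_vector.span_sum)
    fix k assume k: "k \<in> {1..n}"
    have "\<psi> k = complex_of_real (sqrt (\<mu> k)) *\<^sub>C e k"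
      using k mu_pos[of k] by (simp add: e_def scaleC_of_real)
    then have eq: "hat v k *\<^sub>C \<psi> k = (hat v k * complex_of_real (sqrt (\<mu> k))) *\<^sub>C e k"
      by (simp only: scaleC_scaleC)
    show "hat v k *\<^sub>C \<psi> k \<in> complex_vector.span (e ` {1..})"
      unfolding eq using k by (intro complex_vector.span_scale complex_vector.span_base) auto
  qed
  then show "\<exists>x\<in>complex_vector.span (e ` {1..}). form_norm a (v - x) < \<epsilon>"
    using n by blast
qed

text \<open>
  The bounded factors \<open>t\<close> cover both normalizations of the theorem: \<open>t = 1\<close> for the first, and for the
  second the reciprocal norms of the vectors of the first, which are bounded once that is known to be a Riesz basis.
\<close>

definition scaled :: "(nat \<Rightarrow> 'h) \<Rightarrow> (nat \<Rightarrow> real) \<Rightarrow> nat \<Rightarrow> 'h" where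
  "scaled \<phi> t n = t n *\<^sub>R (1 / sqrt (\<mu> n)) *\<^sub>R \<phi> n"

context
  fixes K :: nat and \<phi> :: "nat \<Rightarrow> 'h" and t :: "nat \<Rightarrow> real" and c\<^sub>0 C\<^sub>0 :: real
  assumes K: "far K"
    and tail: "\<And>n. n > K \<Longrightarrow> \<phi> n = Phi n"
    and inj: "inj_on \<phi> {1..K}" and ind: "complex_vector.independent (\<phi> ` {1..K})"
    and span: "complex_vector.span (\<phi> ` {1..K}) = Y K"
    and t: "0 < c\<^sub>0" "\<And>n. n \<ge> 1 \<Longrightarrow> c\<^sub>0 \<le> t n" "\<And>n. n \<ge> 1 \<Longrightarrow> t n \<le> C\<^sub>0"
begin

abbreviation sys :: "nat \<Rightarrow> 'h" where "sys \<equiv> scaled \<phi> t"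

lemma sys_scaleC: "sys n = complex_of_real (t n / sqrt (\<mu> n)) *\<^sub>C \<phi> n"
  unfolding scaled_def scaleC_of_real by simp

lemma sys_Y: "n \<in> {1..K} \<Longrightarrow> sys n \<in> Y K"
  unfolding sys_scaleC using span complex_vector.span_base[of "\<phi> n" "\<phi> ` {1..K}"]
  by (intro complex_vector.subspace_scale[OF Y_subspace[OF K]]) auto

lemma sys_V: "n \<ge> 1 \<Longrightarrow> sys n \<in> V"
proof (cases "n \<le> K")
  case False
  then show ?thesis
    unfolding sys_scaleC using tail[of n] Phi_V[OF far_good(1)[OF K]] by (intro V_cl) auto
qed (use sys_Y[of n] in \<open>auto simp: Y_def\<close>)

lemma lpair_sys:
  assumes k: "k > K" and n: "n \<ge> 1"
  shows "lpair k (sys n) = (if n = k then complex_of_real (t k / sqrt (\<mu> k)) else 0)"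
proof (cases "n \<le> K")
  case True
  then have "lpair k (sys n) = 0" using sys_Y[of n] n k by (simp add: Y_def)
  then show ?thesis using True k by simp
next
  case False
  then show ?thesis
    using lpair_Phi[OF far_good(1)[OF K k]] lpair_Phi_distinct[OF far_good(1)[OF K k] far_good(1)[OF K, of n]] tail[of n]
    unfolding sys_scaleC by (auto simp: lpair_linear(2)[OF far_good(1)[OF K k]])
qed

text \<open>
  The coordinates of the tail vectors are bounded by the Hilbert kernel off the diagonal and by a
  constant on it, so Schur's test yields the synthesis operator.
\<close>

lemma tail_synthesis:
  obtains S B where "B \<ge> 0" "\<And>x. S x \<in> V"
    "\<And>x m. m \<ge> 1 \<Longrightarrow> (\<lambda>n. hat x n * hat (sys n) m) summable_on {K<..}"
    "\<And>x m. m \<ge> 1 \<Longrightarrow> hat (S x) m = (\<Sum>\<^sub>\<infinity>n\<in>{K<..}. hat x n * hat (sys n) m)"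
    "\<And>x. (form_norm a (S x))\<^sup>2 \<le> B\<^sup>2 * (\<Sum>\<^sub>\<infinity>n\<in>{K<..}. (cmod (hat x n))\<^sup>2)"
proof -
  obtain C where C: "C \<ge> 0"
    "\<And>n m. good n \<Longrightarrow> 1 \<le> m \<Longrightarrow> n \<noteq> m \<Longrightarrow> sqrt (\<mu> m / \<mu> n) * cmod (eigv bm n m) \<le> C * hilbert_kernel (eps / 2) n m"
    by (rule coeigv_kernel) blast
  define D where "D n m = of_real (sqrt (\<mu> m)) * hat (sys n) m" for n m
  have C0: "0 \<le> C\<^sub>0" using t(1) t(2,3)[of 1] by simp
  have hatf: "cmod (D n m) \<le> 2 * C\<^sub>0 * (sqrt (\<mu> m / \<mu> n) * cmod (eigv bm n m))" if n: "n > K" and m: "m \<ge> 1" for n m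
  proof -
    have g: "good n" by (rule far_good(1)[OF K n])
    have n1: "1 \<le> n" using n by simp
    have tn: "0 \<le> t n" "t n \<le> C\<^sub>0" using t(1) t(2,3)[OF n1] by auto
    have s: "1 / cmod (pair bm n (lev bm n)) \<le> 2"
      using pair_ge[OF bm g lev(2)[OF bm g]] by (simp add: divide_le_eq split: if_splits)
    have "cmod (D n m) = t n * (1 / cmod (pair bm n (lev bm n))) * (sqrt (\<mu> m / \<mu> n) * cmod (eigv bm n m))"
      unfolding D_def sys_scaleC hat_linear tail[OF n] hat_Phi[OF g]
      using mu_pos[OF n1] mu_pos[OF m] tn by (simp add: norm_mult norm_divide real_sqrt_divide mult_ac)
    also have "\<dots> \<le> C\<^sub>0 * 2 * (sqrt (\<mu> m / \<mu> n) * cmod (eigv bm n m))"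
      using tn s C0 mu_pos[OF n1] mu_pos[OF m] by (intro mult_right_mono mult_mono) auto
    finally show ?thesis by (simp add: mult_ac)
  qed
  have e2: "eps / 2 > 0" using eps by simp
  have sub: "{K<..} \<subseteq> {1..}" "{1..} \<subseteq> {1::nat..}" by auto
  have c: "0 \<le> 2 * C\<^sub>0 * C" "0 \<le> 2 * C\<^sub>0" using C0 C(1) by auto
  have D1: "cmod (D n m) \<le> 2 * C\<^sub>0 * C * hilbert_kernel (eps / 2) n m" if "n \<in> {K<..}" "m \<in> {1..}" "n \<noteq> m" for n m
  proof -
    have "cmod (D n m) \<le> 2 * C\<^sub>0 * (sqrt (\<mu> m / \<mu> n) * cmod (eigv bm n m))"
      using hatf that by simp
    also have "\<dots> \<le> 2 * C\<^sub>0 * (C * hilbert_kernel (eps / 2) n m)"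
      using that C0 far_good(1)[OF K] by (intro mult_left_mono C(2)) auto
    finally show ?thesis by (simp add: mult_ac)
  qed
  have D2: "cmod (D n n) \<le> 2 * C\<^sub>0" if "n \<in> {K<..}" "n \<in> {1..}" for n
    using hatf[of n n] that eigv(3)[OF bm far_good(1)[OF K, of n]] mu_pos[of n] by simp
  define B where "B = 2 * C\<^sub>0 + 2 * C\<^sub>0 * C * (3 * zeta1 (eps / 2))"
  have B: "0 \<le> B" unfolding B_def by (intro add_nonneg_nonneg mult_nonneg_nonneg c zeta1_nonneg) simp
  have xs: "(\<lambda>n. (cmod (hat x n))\<^sup>2) summable_on {K<..}" for x :: 'h
    by (rule summable_on_subset_banach[OF hat_square_summable sub(1)])
  note Sch = hilbert_kernel_Schur[OF e2 sub c D1 D2 xs, folded B_def]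
  have ratio: "hat x n * D n m / of_real (sqrt (\<mu> m)) = hat x n * hat (sys n) m" if "m \<ge> 1" for x :: 'h and n m
    using mu_pos[OF that] by (simp add: D_def)
  have sm: "(\<lambda>n. hat x n * hat (sys n) m) summable_on {K<..}" if m: "m \<ge> 1" for x :: 'h and m
  proof -
    have "(\<lambda>n. hat x n * D n m) summable_on {K<..}" using Sch(1)[of m x] m by simp
    then have "(\<lambda>n. hat x n * D n m * (1 / of_real (sqrt (\<mu> m)))) summable_on {K<..}"
      by (rule summable_on_cmult_left)
    then show ?thesis using ratio[OF m, of x] by simp
  qed
  have "\<exists>v. v \<in> V \<and> (\<forall>m\<ge>1. hat v m = (\<Sum>\<^sub>\<infinity>n\<in>{K<..}. hat x n * hat (sys n) m)) \<and>
      (form_norm a v)\<^sup>2 \<le> B\<^sup>2 * (\<Sum>\<^sub>\<infinity>n\<in>{K<..}. (cmod (hat x n))\<^sup>2)" for x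
  proof -
    have Ss: "(\<lambda>m. (cmod (\<Sum>\<^sub>\<infinity>n\<in>{K<..}. hat x n * D n m))\<^sup>2) summable_on {1..}"
      using Sch(2)[of x] by blast
    obtain z where z: "\<And>m. m \<ge> 1 \<Longrightarrow> hat z m = (\<Sum>\<^sub>\<infinity>n\<in>{K<..}. hat x n * D n m)"
      by (rule synthesis[OF Ss]) (rule that)
    obtain v where v: "v \<in> V" "\<And>m. hat v m = hat z m / of_real (sqrt (\<mu> m))" "form_norm a v = norm z"
      by (rule unweight[of z]) blast
    have "hat v m = (\<Sum>\<^sub>\<infinity>n\<in>{K<..}. hat x n * hat (sys n) m)" if m: "m \<ge> 1" for m
    proof -
      have "hat v m = (\<Sum>\<^sub>\<infinity>n\<in>{K<..}. hat x n * D n m) * (1 / of_real (sqrt (\<mu> m)))"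
        unfolding v(2) z[OF m] by simp
      also have "\<dots> = (\<Sum>\<^sub>\<infinity>n\<in>{K<..}. hat x n * D n m * (1 / of_real (sqrt (\<mu> m))))"
        by (rule infsum_cmult_left'[symmetric])
      finally show ?thesis using ratio[OF m, of x] by simp
    qed
    moreover have "(form_norm a v)\<^sup>2 \<le> B\<^sup>2 * (\<Sum>\<^sub>\<infinity>n\<in>{K<..}. (cmod (hat x n))\<^sup>2)"
    proof -
      have "(norm z)\<^sup>2 = (\<Sum>\<^sub>\<infinity>m\<in>{1..}. (cmod (\<Sum>\<^sub>\<infinity>n\<in>{K<..}. hat x n * D n m))\<^sup>2)"
        unfolding norm_hat by (rule infsum_cong) (simp add: z)
      then show ?thesis using Sch(3)[of x] unfolding v(3) by simp
    qed
    ultimately show ?thesis using v(1) by blast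
  qed
  then have "\<exists>S. \<forall>x. S x \<in> V \<and> (\<forall>m\<ge>1. hat (S x) m = (\<Sum>\<^sub>\<infinity>n\<in>{K<..}. hat x n * hat (sys n) m)) \<and>
      (form_norm a (S x))\<^sup>2 \<le> B\<^sup>2 * (\<Sum>\<^sub>\<infinity>n\<in>{K<..}. (cmod (hat x n))\<^sup>2)"
    by (intro choice allI)
  then obtain S where S: "\<forall>x. S x \<in> V \<and> (\<forall>m\<ge>1. hat (S x) m = (\<Sum>\<^sub>\<infinity>n\<in>{K<..}. hat x n * hat (sys n) m)) \<and>
      (form_norm a (S x))\<^sup>2 \<le> B\<^sup>2 * (\<Sum>\<^sub>\<infinity>n\<in>{K<..}. (cmod (hat x n))\<^sup>2)"
    by (elim exE) (rule that)
  show thesis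
    by (rule that[OF B, of S]) (use S sm in simp_all)
qed

text \<open>
  The coordinates in the basis \<open>sys\<close> of \<open>Y K\<close> are linear combinations of the first \<open>K\<close> coordinates
  in the basis \<open>\<psi>\<close>, because the latter determine a vector of \<open>Y K\<close>.
\<close>

lemma finite_coordinates_bounded:
  obtains C where "C \<ge> 0"
    "\<And>c j. j \<in> {1..K} \<Longrightarrow> cmod (c j) \<le> C * form_norm a (\<Sum>n\<in>{1..K}. c n *\<^sub>C sys n)"
proof -
  have sys_ind: "c j = 0" if c: "(\<Sum>n\<in>{1..K}. c n *\<^sub>C sys n) = 0" and j: "j \<in> {1..K}" for c j
  proof -
    have "(\<Sum>n\<in>{1..K}. (c n * complex_of_real (t n / sqrt (\<mu> n))) *\<^sub>C \<phi> n) = 0"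
      using c unfolding sys_scaleC scaleC_scaleC .
    moreover have "\<forall>c. (\<Sum>i\<in>{1..K}. c i *\<^sub>C \<phi> i) = 0 \<longrightarrow> (\<forall>i\<in>{1..K}. c i = 0)"
      using complex_vector.independent_indexed[of "{1..K}" \<phi>] inj ind by simp
    ultimately have "c j * complex_of_real (t j / sqrt (\<mu> j)) = 0"
      using j by (elim allE[where x = "\<lambda>n. c n * complex_of_real (t n / sqrt (\<mu> n))"]) simp
    then show ?thesis using t(1) t(2)[of j] j mu_pos[of j] by auto
  qed
  obtain y where y: "\<forall>i\<in>{1..K}. y i \<in> Y K \<and> (\<forall>m\<in>{1..K}. hat (y i) m = of_bool (m = i))"
    by (rule Y_basis[OF K]) blast
  have fspan: "complex_vector.span (sys ` {1..K}) = Y K"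
  proof
    show "complex_vector.span (sys ` {1..K}) \<subseteq> Y K"
      using sys_Y by (intro complex_vector.span_minimal Y_subspace[OF K]) auto
    have "\<phi> n \<in> complex_vector.span (sys ` {1..K})" if n: "n \<in> {1..K}" for n
    proof -
      have "\<phi> n = complex_of_real (sqrt (\<mu> n) / t n) *\<^sub>C sys n"
        unfolding sys_scaleC scaleC_scaleC of_real_mult[symmetric]
        using t(1) t(2)[of n] n mu_pos[of n] by (simp add: complex_vector.scale_one)
      then show ?thesis
        using n by (metis complex_vector.span_base complex_vector.span_scale imageI)
    qed
    then show "Y K \<subseteq> complex_vector.span (sys ` {1..K})"
      unfolding span[symmetric] by (intro complex_vector.span_minimal complex_vector.subspace_span) auto
  qed
  have "\<exists>c. y i = (\<Sum>n\<in>{1..K}. c n *\<^sub>C sys n)" if "i \<in> {1..K}" for i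
  proof -
    have "y i \<in> complex_vector.span (sys ` {1..K})" using y that fspan by blast
    then show ?thesis using complex_vector.span_indexed[of "{1..K}" "y i" sys] by (metis finite_atLeastAtMost)
  qed
  then obtain A where A: "\<And>i. i \<in> {1..K} \<Longrightarrow> y i = (\<Sum>n\<in>{1..K}. A i n *\<^sub>C sys n)"
    by metis
  define C where "C = (\<Sum>i\<in>{1..K}. \<Sum>n\<in>{1..K}. cmod (A i n)) / sqrt (\<mu> 1)"
  have C: "C \<ge> 0" using mu_1 by (auto simp: C_def intro!: divide_nonneg_nonneg sum_nonneg)
  have "cmod (c j) \<le> C * form_norm a (\<Sum>n\<in>{1..K}. c n *\<^sub>C sys n)" if j: "j \<in> {1..K}" for c j
  proof -
    define v where "v = (\<Sum>n\<in>{1..K}. c n *\<^sub>C sys n)"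
    have vY: "v \<in> Y K"
      unfolding v_def using sys_Y
      by (intro complex_vector.subspace_sum[OF Y_subspace[OF K]] complex_vector.subspace_scale[OF Y_subspace[OF K]]) auto
    have "v = (\<Sum>i\<in>{1..K}. hat v i *\<^sub>C y i)" by (rule Y_coordinates[OF K y vY])
    also have "\<dots> = (\<Sum>i\<in>{1..K}. \<Sum>n\<in>{1..K}. (hat v i * A i n) *\<^sub>C sys n)"
      by (intro sum.cong refl) (simp add: A complex_vector.scale_sum_right)
    also have "\<dots> = (\<Sum>n\<in>{1..K}. (\<Sum>i\<in>{1..K}. hat v i * A i n) *\<^sub>C sys n)"
      by (subst sum.swap) (simp add: complex_vector.scale_sum_left)
    finally have "(\<Sum>n\<in>{1..K}. (c n - (\<Sum>i\<in>{1..K}. hat v i * A i n)) *\<^sub>C sys n) = 0"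
      by (simp add: complex_vector.scale_left_diff_distrib sum_subtractf v_def)
    then have "c j = (\<Sum>i\<in>{1..K}. hat v i * A i j)"
      using sys_ind[of "\<lambda>n. c n - (\<Sum>i\<in>{1..K}. hat v i * A i n)"] j by simp
    then have "cmod (c j) \<le> (\<Sum>i\<in>{1..K}. cmod (hat v i) * cmod (A i j))"
      using norm_sum[of "\<lambda>i. hat v i * A i j" "{1..K}"] by (simp add: norm_mult)
    also have "\<dots> \<le> (\<Sum>i\<in>{1..K}. norm v * (\<Sum>n\<in>{1..K}. cmod (A i n)))"
      using j by (intro sum_mono mult_mono norm_hat_le) (auto intro: member_le_sum sum_nonneg)
    also have "\<dots> = norm v * (\<Sum>i\<in>{1..K}. \<Sum>n\<in>{1..K}. cmod (A i n))"
      by (simp add: sum_distrib_left)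
    also have "\<dots> \<le> (form_norm a v / sqrt (\<mu> 1)) * (\<Sum>i\<in>{1..K}. \<Sum>n\<in>{1..K}. cmod (A i n))"
      using vY by (intro mult_right_mono norm_le_form_norm sum_nonneg) (auto simp: Y_def)
    finally show ?thesis by (simp add: C_def v_def mult.commute)
  qed
  then show thesis using that C by blast
qed

text \<open>
  The functionals beyond \<open>K\<close> are a perturbation of the coordinates by an operator of norm \<open>1/2\<close>, hence
  bounded from \<open>V\<close> to \<open>l\<^sup>2\<close>.
\<close>

lemma tail_coefficients:
  assumes v: "v \<in> V"
  shows "(\<lambda>n. (cmod (of_real (sqrt (\<mu> n)) * lpair n v / of_real (t n)))\<^sup>2) summable_on {K<..}"
    "(\<Sum>\<^sub>\<infinity>n\<in>{K<..}. (cmod (of_real (sqrt (\<mu> n)) * lpair n v / of_real (t n)))\<^sup>2) \<le> (2 / c\<^sub>0 * form_norm a v)\<^sup>2"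
proof -
  let ?x = "Wt v" and ?r = "\<lambda>n. \<Sum>\<^sub>\<infinity>m\<in>{1..}. hat (Wt v) m * E n m"
  have sub: "{K<..} \<subseteq> {1::nat..}" by auto
  have r: "(\<lambda>n. (cmod (?r n))\<^sup>2) summable_on {K<..}" "(\<Sum>\<^sub>\<infinity>n\<in>{K<..}. (cmod (?r n))\<^sup>2) \<le> 1/4 * (norm ?x)\<^sup>2"
    using K hat_square_summable[of ?x] unfolding far_def norm_hat by blast+
  have h: "(\<lambda>n. (cmod (hat ?x n))\<^sup>2) summable_on {K<..}" "(\<Sum>\<^sub>\<infinity>n\<in>{K<..}. (cmod (hat ?x n))\<^sup>2) \<le> (norm ?x)\<^sup>2"
    unfolding norm_hat
    by (rule summable_on_subset_banach[OF hat_square_summable sub],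
        rule infsum_mono2[OF summable_on_subset_banach[OF hat_square_summable sub] hat_square_summable sub]) auto
  have le: "(cmod (of_real (sqrt (\<mu> n)) * lpair n v / of_real (t n)))\<^sup>2 \<le> 2 / c\<^sub>0\<^sup>2 * ((cmod (hat ?x n))\<^sup>2 + (cmod (?r n))\<^sup>2)"
    if n: "n \<in> {K<..}" for n
  proof -
    have tn: "c\<^sub>0 \<le> t n" using t(2)[of n] n by simp
    have "cmod (of_real (sqrt (\<mu> n)) * lpair n v / of_real (t n)) = cmod (hat ?x n + ?r n) / t n"
      using lpair_weight[OF K _ v Wt(1)[OF v], of n] n tn t(1) by (simp add: norm_divide)
    also have "\<dots> \<le> cmod (hat ?x n + ?r n) / c\<^sub>0"
      using tn t(1) by (intro divide_left_mono mult_pos_pos) auto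
    also have "\<dots> \<le> (cmod (hat ?x n) + cmod (?r n)) / c\<^sub>0"
      using t(1) by (intro divide_right_mono norm_triangle_ineq) auto
    finally have "(cmod (of_real (sqrt (\<mu> n)) * lpair n v / of_real (t n)))\<^sup>2 \<le> ((cmod (hat ?x n) + cmod (?r n)) / c\<^sub>0)\<^sup>2"
      by (rule power_mono) simp
    also have "\<dots> \<le> 2 * ((cmod (hat ?x n))\<^sup>2 + (cmod (?r n))\<^sup>2) / c\<^sub>0\<^sup>2"
      unfolding power_divide by (intro divide_right_mono square_sum_le) simp
    finally show ?thesis by simp
  qed
  note s = summable_le[OF summable_on_add[OF h(1) r(1)] zero_le_power2 le]
  show "(\<lambda>n. (cmod (of_real (sqrt (\<mu> n)) * lpair n v / of_real (t n)))\<^sup>2) summable_on {K<..}"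
    by (rule s(1))
  have "(\<Sum>\<^sub>\<infinity>n\<in>{K<..}. (cmod (of_real (sqrt (\<mu> n)) * lpair n v / of_real (t n)))\<^sup>2) \<le>
      2 / c\<^sub>0\<^sup>2 * (\<Sum>\<^sub>\<infinity>n\<in>{K<..}. (cmod (hat ?x n))\<^sup>2 + (cmod (?r n))\<^sup>2)"
    by (rule s(2))
  also have "\<dots> \<le> 2 / c\<^sub>0\<^sup>2 * ((norm ?x)\<^sup>2 + 1/4 * (norm ?x)\<^sup>2)"
    unfolding infsum_add[OF h(1) r(1)] by (intro mult_left_mono add_mono h(2) r(2)) simp
  also have "\<dots> \<le> 4 / c\<^sub>0\<^sup>2 * (norm ?x)\<^sup>2"
    using t(1) by (simp add: field_simps)
  finally show "(\<Sum>\<^sub>\<infinity>n\<in>{K<..}. (cmod (of_real (sqrt (\<mu> n)) * lpair n v / of_real (t n)))\<^sup>2) \<le> (2 / c\<^sub>0 * form_norm a v)\<^sup>2"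
    by (simp add: Wt(2)[OF v] power_mult_distrib power_divide)
qed

text \<open>
  \<open>S\<close> maps \<open>\<psi> n\<close> to \<open>sys n\<close>, and \<open>Wt\<close> maps the orthonormal basis \<open>e\<close> of \<open>V\<close> to \<open>\<psi>\<close>. From \<open>S x\<close> the
  coordinates of \<open>x\<close> beyond \<open>K\<close> are recovered by the functionals; subtracting their contribution leaves a
  vector of \<open>Y K\<close>, whose finitely many coordinates are controlled. The same procedure produces a
  preimage of any \<open>v\<close>: the functionals beyond \<open>K\<close> vanish on \<open>v - S x\<close> if \<open>x\<close> has the right tail.
\<close>

lemma Riesz_basis_sys: "riesz_basis_on V a {1..} sys"
proof -
  obtain S2 B where B: "B \<ge> 0" and S2V: "\<And>x. S2 x \<in> V"
    and S2s: "\<And>x m. m \<ge> 1 \<Longrightarrow> (\<lambda>n. hat x n * hat (sys n) m) summable_on {K<..}"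
    and S2: "\<And>x m. m \<ge> 1 \<Longrightarrow> hat (S2 x) m = (\<Sum>\<^sub>\<infinity>n\<in>{K<..}. hat x n * hat (sys n) m)"
    and S2B: "\<And>x. (form_norm a (S2 x))\<^sup>2 \<le> B\<^sup>2 * (\<Sum>\<^sub>\<infinity>n\<in>{K<..}. (cmod (hat x n))\<^sup>2)"
    by (rule tail_synthesis) blast
  define S where "S x = (\<Sum>n\<in>{1..K}. hat x n *\<^sub>C sys n) + S2 x" for x
  have headV: "(\<Sum>n\<in>{1..K}. c n *\<^sub>C sys n) \<in> V" for c
    using sys_V by (intro V_cl) auto
  have SV: "S x \<in> V" for x unfolding S_def by (intro V_cl headV S2V)
  have S2_add: "S2 (x + y) = S2 x + S2 y" for x y
    by (rule hat_inject) (simp add: S2 S2s hat_linear distrib_right infsum_add)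
  have S2_scale: "S2 (c *\<^sub>C x) = c *\<^sub>C S2 x" for c x
    by (rule hat_inject) (simp add: S2 hat_linear mult.assoc infsum_cmult_right')
  have S_add: "S (x + y) = S x + S y" for x y
    by (simp add: S_def S2_add hat_linear complex_vector.scale_left_distrib sum.distrib)
  have S_scale: "S (c *\<^sub>C x) = c *\<^sub>C S x" for c x
    by (simp add: S_def S2_scale hat_linear complex_vector.scale_right_distrib complex_vector.scale_sum_right)
  have S_diff: "S (x - y) = S x - S y" for x y
    using S_add[of "x - y" y] by (simp add: algebra_simps)
  have S_psi: "S (\<psi> n) = sys n" if n: "n \<ge> 1" for n
  proof -
    have head: "(\<Sum>k\<in>{1..K}. hat (\<psi> n) k *\<^sub>C sys k) = (if n \<le> K then sys n else 0)"
    proof -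
      have "(\<Sum>k\<in>{1..K}. hat (\<psi> n) k *\<^sub>C sys k) = (\<Sum>k\<in>{1..K}. if k = n then sys k else 0)"
        using n by (intro sum.cong) (auto simp: hat_psi complex_vector.scale_zero_left)
      then show ?thesis using n by simp
    qed
    have "S2 (\<psi> n) = (if n \<le> K then 0 else sys n)"
    proof (rule hat_inject)
      fix m :: nat assume m: "m \<ge> 1"
      show "hat (S2 (\<psi> n)) m = hat (if n \<le> K then 0 else sys n) m"
      proof (cases "n \<le> K")
        case True
        have "hat (S2 (\<psi> n)) m = (\<Sum>\<^sub>\<infinity>k\<in>{K<..}. 0)"
          unfolding S2[OF m] by (rule infsum_cong) (use True n in \<open>auto simp: hat_psi\<close>)
        then show ?thesis using True by (simp add: hat_0)
      next
        case False
        have "hat (S2 (\<psi> n)) m = (\<Sum>\<^sub>\<infinity>k\<in>{n}. hat (sys n) m)"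
          unfolding S2[OF m] by (rule infsum_cong_neutral) (use False n in \<open>auto simp: hat_psi\<close>)
        then show ?thesis using False by simp
      qed
    qed
    then show ?thesis unfolding S_def head by simp
  qed
  have tail_le: "(\<Sum>\<^sub>\<infinity>n\<in>{K<..}. (cmod (hat x n))\<^sup>2) \<le> (norm x)\<^sup>2" for x :: 'h
    unfolding norm_hat
    by (rule infsum_mono2[OF summable_on_subset_banach[OF hat_square_summable] hat_square_summable]) auto
  have S2_bound: "form_norm a (S2 x) \<le> B * norm x" for x
  proof (rule power2_le_imp_le)
    show "(form_norm a (S2 x))\<^sup>2 \<le> (B * norm x)\<^sup>2"
      using S2B[of x] mult_left_mono[OF tail_le[of x], of "B\<^sup>2"] by (simp add: power_mult_distrib)
  qed (use B in auto)
  define B1 where "B1 = (\<Sum>n\<in>{1..K}. form_norm a (sys n)) + B"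
  have head_le: "form_norm a (\<Sum>n\<in>F. hat x n *\<^sub>C sys n) \<le> (\<Sum>n\<in>F. form_norm a (sys n)) * norm x"
    if "finite F" "F \<subseteq> {1..K}" for F x
    using that
  proof (induction F)
    case empty
    show ?case using form_norm_triangle(3)[OF V_cl(1), of 0] by (simp add: complex_vector.scale_zero_left)
  next
    case (insert i F)
    have iV: "sys i \<in> V" "(\<Sum>n\<in>F. hat x n *\<^sub>C sys n) \<in> V"
      using insert.prems sys_V by (auto intro!: V_cl)
    have "form_norm a (\<Sum>n\<in>insert i F. hat x n *\<^sub>C sys n) \<le> cmod (hat x i) * form_norm a (sys i) + form_norm a (\<Sum>n\<in>F. hat x n *\<^sub>C sys n)"
      using insert form_norm_triangle(1)[OF V_cl(3)[OF iV(1)] iV(2)] by (simp add: form_norm_triangle(3)[OF iV(1)])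
    also have "\<dots> \<le> norm x * form_norm a (sys i) + (\<Sum>n\<in>F. form_norm a (sys n)) * norm x"
      using insert by (intro add_mono mult_right_mono norm_hat_le form_norm_triangle(4) iV) auto
    finally show ?case using insert by (simp add: algebra_simps)
  qed
  have S_bound: "form_norm a (S x) \<le> B1 * norm x" for x
    using form_norm_triangle(1)[OF headV S2V[of x], of "hat x"] head_le[of "{1..K}" x] S2_bound[of x]
    unfolding S_def B1_def by (simp add: algebra_simps)
  \<comment> \<open>known for finite combinations of the \<open>\<psi> n\<close>, extended by continuity of \<open>lpair\<close> and \<open>S\<close>\<close>
  have lpair_S: "lpair k (S x) = hat x k * complex_of_real (t k / sqrt (\<mu> k))" if k: "k > K" for k x
  proof -
    have gk: "good k" by (rule far_good(1)[OF K k])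
    define Q where "Q = sqrt (\<Sum>\<^sub>\<infinity>m\<in>{1..}. (cmod (coeigv bm k m))\<^sup>2)"
    have Q: "0 \<le> Q" unfolding Q_def by (intro real_sqrt_ge_zero infsum_nonneg) auto
    have proj: "lpair k (S (proj {1..n} x)) = hat x k * complex_of_real (t k / sqrt (\<mu> k))" if n: "n \<ge> k" for n
    proof -
      have "lpair k (S (\<Sum>i\<in>F. hat x i *\<^sub>C \<psi> i)) = (\<Sum>i\<in>F. hat x i * lpair k (sys i))" if "finite F" "F \<subseteq> {1..}" for F
        using that
      proof (induction F)
        case empty
        have "S 0 = 0" using S_scale[of 0 0] by (simp add: complex_vector.scale_zero_left)
        then show ?case by (simp add: lpair_linear[OF gk])
      next
        case (insert i F)
        then show ?case by (simp add: S_add S_scale S_psi lpair_linear[OF gk])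
      qed
      then have "lpair k (S (proj {1..n} x)) = (\<Sum>i\<in>{1..n}. hat x i * lpair k (sys i))"
        unfolding proj_def by simp
      also have "\<dots> = (\<Sum>i\<in>{1..n}. if i = k then hat x k * complex_of_real (t k / sqrt (\<mu> k)) else 0)"
        by (intro sum.cong) (auto simp: lpair_sys[OF k])
      finally show ?thesis using n k by simp
    qed
    have "(\<lambda>n. lpair k (S x) - hat x k * complex_of_real (t k / sqrt (\<mu> k))) \<longlonglongrightarrow> 0"
    proof (rule Lim_null_comparison)
      show "\<forall>\<^sub>F n in sequentially. norm (lpair k (S x) - hat x k * complex_of_real (t k / sqrt (\<mu> k))) \<le>
          (B1 * norm (x - proj {1..n} x)) / sqrt (\<mu> 1) * Q"
        using eventually_ge_at_top[of k]
      proof eventually_elim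
        case (elim n)
        have "lpair k (S x) - hat x k * complex_of_real (t k / sqrt (\<mu> k)) = lpair k (S (x - proj {1..n} x))"
          unfolding S_diff lpair_linear(3)[OF gk] proj[OF elim] ..
        also have "norm \<dots> \<le> norm (S (x - proj {1..n} x)) * Q"
          unfolding Q_def by (rule lpair_summable(2)[OF gk])
        also have "\<dots> \<le> form_norm a (S (x - proj {1..n} x)) / sqrt (\<mu> 1) * Q"
          by (intro mult_right_mono norm_le_form_norm SV Q)
        also have "\<dots> \<le> (B1 * norm (x - proj {1..n} x)) / sqrt (\<mu> 1) * Q"
          using mu_1 by (intro mult_right_mono divide_right_mono S_bound Q) auto
        finally show ?case .
      qed
      have "(\<lambda>n. proj {1..n} x) \<longlonglongrightarrow> x"
        unfolding proj_def by (rule has_sum_partial_sums[OF expansion])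
      then have "(\<lambda>n. (B1 * norm (x - proj {1..n} x)) / sqrt (\<mu> 1) * Q) \<longlonglongrightarrow> (B1 * norm (x - x)) / sqrt (\<mu> 1) * Q"
        using mu_1 by (intro tendsto_intros) auto
      then show "(\<lambda>n. (B1 * norm (x - proj {1..n} x)) / sqrt (\<mu> 1) * Q) \<longlonglongrightarrow> 0" by simp
    qed
    then show ?thesis by (simp add: LIMSEQ_const_iff)
  qed
  have hat_tail: "hat x k = of_real (sqrt (\<mu> k)) * lpair k (S x) / of_real (t k)" if k: "k > K" for k x
    using lpair_S[OF k, of x] t(1) t(2)[of k] k mu_pos[of k] by auto
  obtain C where C: "C \<ge> 0"
    "\<And>c j. j \<in> {1..K} \<Longrightarrow> cmod (c j) \<le> C * form_norm a (\<Sum>n\<in>{1..K}. c n *\<^sub>C sys n)"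
    by (rule finite_coordinates_bounded) blast
  define C1 where "C1 = 2 / c\<^sub>0"
  define C2 where "C2 = real K * (C * (1 + B * C1))\<^sup>2 + C1\<^sup>2"
  have C1: "C1 > 0" using t(1) by (simp add: C1_def)
  have C2: "C2 > 0" using C1 by (auto simp: C2_def intro: add_nonneg_pos)
  have lower: "(norm x)\<^sup>2 \<le> C2 * (form_norm a (S x))\<^sup>2" for x
  proof -
    let ?v = "S x"
    have tl: "(\<Sum>\<^sub>\<infinity>n\<in>{K<..}. (cmod (hat x n))\<^sup>2) \<le> (C1 * form_norm a ?v)\<^sup>2"
    proof -
      have "(\<Sum>\<^sub>\<infinity>n\<in>{K<..}. (cmod (hat x n))\<^sup>2) = (\<Sum>\<^sub>\<infinity>n\<in>{K<..}. (cmod (of_real (sqrt (\<mu> n)) * lpair n ?v / of_real (t n)))\<^sup>2)"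
        by (rule infsum_cong) (simp add: hat_tail[symmetric])
      then show ?thesis using tail_coefficients(2)[OF SV[of x]] by (simp add: C1_def)
    qed
    have v0: "0 \<le> form_norm a ?v" by (rule form_norm_triangle(4)[OF SV])
    have "form_norm a (S2 x) \<le> B * (C1 * form_norm a ?v)"
    proof (rule power2_le_imp_le)
      show "(form_norm a (S2 x))\<^sup>2 \<le> (B * (C1 * form_norm a ?v))\<^sup>2"
        using S2B[of x] mult_left_mono[OF tl, of "B\<^sup>2"] by (simp add: power_mult_distrib)
      show "0 \<le> B * (C1 * form_norm a ?v)" using B C1 v0 by simp
    qed
    moreover have "form_norm a (\<Sum>n\<in>{1..K}. hat x n *\<^sub>C sys n) \<le> form_norm a ?v + form_norm a (S2 x)"
    proof -
      have "(\<Sum>n\<in>{1..K}. hat x n *\<^sub>C sys n) = ?v - S2 x" by (simp add: S_def)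
      then show ?thesis using form_norm_triangle(2)[OF SV S2V, of x x] by simp
    qed
    ultimately have hd: "form_norm a (\<Sum>n\<in>{1..K}. hat x n *\<^sub>C sys n) \<le> (1 + B * C1) * form_norm a ?v"
      by (simp only: distrib_right mult_1 mult.assoc)
    have "cmod (hat x j) \<le> C * (1 + B * C1) * form_norm a ?v" if "j \<in> {1..K}" for j
      using C(2)[OF that, of "hat x"] mult_left_mono[OF hd C(1)] by (simp add: mult.assoc)
    then have "(\<Sum>j\<in>{1..K}. (cmod (hat x j))\<^sup>2) \<le> (\<Sum>j\<in>{1..K}. (C * (1 + B * C1) * form_norm a ?v)\<^sup>2)"
      by (intro sum_mono power_mono) auto
    also have "\<dots> = real K * (C * (1 + B * C1))\<^sup>2 * (form_norm a ?v)\<^sup>2"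
      unfolding power_mult_distrib[of "C * (1 + B * C1)"] by simp
    finally have "(\<Sum>j\<in>{1..K}. (cmod (hat x j))\<^sup>2) \<le> real K * (C * (1 + B * C1))\<^sup>2 * (form_norm a ?v)\<^sup>2" .
    moreover have "(norm x)\<^sup>2 = (\<Sum>j\<in>{1..K}. (cmod (hat x j))\<^sup>2) + (\<Sum>\<^sub>\<infinity>n\<in>{K<..}. (cmod (hat x n))\<^sup>2)"
    proof -
      have U: "{1..} = {1..K} \<union> {K<..}" using far_good(2)[OF K] by auto
      have "(\<Sum>\<^sub>\<infinity>k\<in>{1..K} \<union> {K<..}. (cmod (hat x k))\<^sup>2) = (\<Sum>\<^sub>\<infinity>k\<in>{1..K}. (cmod (hat x k))\<^sup>2) + (\<Sum>\<^sub>\<infinity>n\<in>{K<..}. (cmod (hat x n))\<^sup>2)"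
        by (rule infsum_Un_disjoint) (auto intro: summable_on_subset_banach[OF hat_square_summable])
      then show ?thesis unfolding norm_hat U by simp
    qed
    ultimately show ?thesis
      using tl unfolding C2_def distrib_right power_mult_distrib[of C1] by linarith
  qed
  have surj: "\<exists>x. S x = v" if v: "v \<in> V" for v
  proof -
    let ?c = "\<lambda>n. if n \<le> K then 0 else of_real (sqrt (\<mu> n)) * lpair n v / of_real (t n)"
    have U: "{1..} = {1..K} \<union> {K<..}" using far_good(2)[OF K] by auto
    have "(\<lambda>n. (cmod (?c n))\<^sup>2) summable_on {K<..}"
      using tail_coefficients(1)[OF v] by (rule summable_on_cong[THEN iffD1, rotated]) auto
    then have "(\<lambda>n. (cmod (?c n))\<^sup>2) summable_on {1..K} \<union> {K<..}"
      by (intro summable_on_Un_disjoint) auto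
    then have c2: "(\<lambda>n. (cmod (?c n))\<^sup>2) summable_on {1..}" unfolding U .
    obtain x where x: "\<And>n. n \<ge> 1 \<Longrightarrow> hat x n = ?c n"
      by (rule synthesis[OF c2]) blast
    have "v - S x \<in> Y K"
    proof -
      have "lpair k (v - S x) = 0" if k: "k > K" for k
        using x[of k] k t(1) t(2)[of k] mu_pos[of k]
        unfolding lpair_linear(3)[OF far_good(1)[OF K k]] lpair_S[OF k] by auto
      then show ?thesis using V_cl(4)[OF v SV] by (simp add: Y_def)
    qed
    then obtain c where c: "v - S x = (\<Sum>n\<in>{1..K}. c n *\<^sub>C \<phi> n)"
      using complex_vector.span_indexed[of "{1..K}" "v - S x" \<phi>] span by auto
    \<comment> \<open>the head coordinates that turn the remainder in \<open>Y K\<close> into a combination of the \<open>sys n\<close>\<close>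
    let ?d = "\<lambda>n. c n * complex_of_real (sqrt (\<mu> n) / t n)"
    have "S (\<Sum>n\<in>F. ?d n *\<^sub>C \<psi> n) = (\<Sum>n\<in>F. c n *\<^sub>C \<phi> n)" if "finite F" "F \<subseteq> {1..K}" for F
      using that
    proof (induction F)
      case empty
      show ?case using S_scale[of 0 0] by (simp add: complex_vector.scale_zero_left)
    next
      case (insert i F)
      have "complex_of_real (sqrt (\<mu> i) / t i) * complex_of_real (t i / sqrt (\<mu> i)) = 1"
        unfolding of_real_mult[symmetric] using insert.prems t(1) t(2)[of i] mu_pos[of i] by simp
      then have "?d i *\<^sub>C sys i = c i *\<^sub>C \<phi> i"
        unfolding sys_scaleC scaleC_scaleC mult.assoc by simp
      then show ?case using insert by (simp add: S_add S_scale S_psi)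
    qed
    from this[of "{1..K}"] have "S (x + (\<Sum>n\<in>{1..K}. ?d n *\<^sub>C \<psi> n)) = S x + (v - S x)"
      unfolding S_add c by simp
    then show ?thesis by (metis add_diff_cancel_left' add_diff_eq)
  qed
  have S_inj: "x = y" if "S x = S y" for x y
  proof -
    have "S (x - y) = 0" using that by (simp add: S_diff)
    moreover have "form_norm a 0 = 0"
      using form_norm_triangle(3)[OF V_cl(1), of 0] by (simp add: complex_vector.scale_zero_left)
    ultimately have "(norm (x - y))\<^sup>2 \<le> 0" using lower[of "x - y"] by simp
    then show ?thesis by simp
  qed
  have Wt_inj: "u = v" if uv: "u \<in> V" "v \<in> V" "Wt u = Wt v" for u v
  proof -
    have "(norm (Wt (u - v)))\<^sup>2 = 0" using uv by (simp add: Wt_linear)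
    then have "form_norm a (u - v) = 0" using Wt(2)[OF V_cl(4)[OF uv(1,2)]] by simp
    then have "norm (u - v) \<le> 0" using norm_le_form_norm[OF V_cl(4)[OF uv(1,2)]] by simp
    then show ?thesis by simp
  qed
  have Wt_surj: "\<exists>u\<in>V. Wt u = x" for x
  proof -
    obtain v where v: "v \<in> V" "\<And>m. hat v m = hat x m / of_real (sqrt (\<mu> m))"
      by (rule unweight[of x]) blast
    have "Wt v = x"
    proof (rule hat_inject)
      show "hat (Wt v) m = hat x m" if "m \<ge> 1" for m
        using mu_pos[OF that] by (simp add: Wt v)
    qed
    then show ?thesis using v(1) by blast
  qed
  show ?thesis
    unfolding riesz_basis_on_def
  proof (intro exI conjI ballI allI)
    show "orthonormal_basis_on V a {1..} e" by (rule orthonormal_basis_e)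
    show "S (Wt (u + v)) = S (Wt u) + S (Wt v)" if "u \<in> V" "v \<in> V" for u v
      using that by (simp add: Wt_linear S_add)
    show "S (Wt (c *\<^sub>C u)) = c *\<^sub>C S (Wt u)" if "u \<in> V" for c u
      using that by (simp add: Wt_linear S_scale)
    show "bij_betw (\<lambda>u. S (Wt u)) V V"
      unfolding bij_betw_def
    proof
      show "inj_on (\<lambda>u. S (Wt u)) V"
        by (rule inj_onI) (use S_inj Wt_inj in blast)
      show "(\<lambda>u. S (Wt u)) ` V = V"
      proof
        show "(\<lambda>u. S (Wt u)) ` V \<subseteq> V" using SV by auto
        show "V \<subseteq> (\<lambda>u. S (Wt u)) ` V"
        proof
          fix v assume "v \<in> V"
          then obtain x where "S x = v" using surj by blast
          moreover obtain u where "u \<in> V" "Wt u = x" using Wt_surj by blast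
          ultimately show "v \<in> (\<lambda>u. S (Wt u)) ` V" by blast
        qed
      qed
    qed
    show "0 < 1 / sqrt C2" using C2 by simp
    show "1 / sqrt C2 * form_norm a u \<le> form_norm a (S (Wt u))" if u: "u \<in> V" for u
    proof -
      have "form_norm a u \<le> sqrt C2 * form_norm a (S (Wt u))"
      proof (rule power2_le_imp_le)
        show "(form_norm a u)\<^sup>2 \<le> (sqrt C2 * form_norm a (S (Wt u)))\<^sup>2"
          using lower[of "Wt u"] C2 by (simp add: Wt(2)[OF u] power_mult_distrib)
        show "0 \<le> sqrt C2 * form_norm a (S (Wt u))"
          using C2 form_norm_triangle(4)[OF SV] by simp
      qed
      then show ?thesis using C2 by (simp add: divide_le_eq mult.commute)
    qed
    show "form_norm a (S (Wt u)) \<le> B1 * form_norm a u" if "u \<in> V" for u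
      using S_bound[of "Wt u"] by (simp add: Wt(2)[OF that])
    show "sys i = S (Wt (e i))" if "i \<in> {1..}" for i
      using that by (simp add: Wt_e S_psi)
  qed
qed

end

text \<open>
  The first system being the image of an orthonormal basis under a map bounded above and below, its norms
  \<open>h n\<close> lie between two positive constants.
\<close>

lemma Riesz_bases:
  assumes rs: "root_system T \<kappa> \<gamma> \<mu> \<psi> N \<phi>"
  shows "riesz_basis_on V a {1..} (\<lambda>n. (1 / sqrt (\<mu> n)) *\<^sub>R \<phi> n)"
    "riesz_basis_on V a {1..} (\<lambda>n. (1 / form_norm a (\<phi> n)) *\<^sub>R \<phi> n)"
proof -
  have "\<forall>\<^sub>F K in sequentially. far K \<and> N \<le> K"
    by (intro eventually_conj eventually_far eventually_ge_at_top)
  then obtain K where K: "far K" "N \<le> K"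
    by (auto simp: eventually_sequentially)
  note sh = root_system_shift[OF K(1) rs K(2)]
  have R: "riesz_basis_on V a {1..} (scaled \<phi> t)"
    if "0 < c" "\<And>n. n \<ge> 1 \<Longrightarrow> c \<le> t n" "\<And>n. n \<ge> 1 \<Longrightarrow> t n \<le> C" for t c C
    by (rule Riesz_basis_sys[OF K(1) sh that])
  have "riesz_basis_on V a {1..} (scaled \<phi> (\<lambda>_. 1))"
    by (rule R[of 1 _ 1]) auto
  moreover have "scaled \<phi> (\<lambda>_. 1) = (\<lambda>n. (1 / sqrt (\<mu> n)) *\<^sub>R \<phi> n)"
    by (simp add: fun_eq_iff scaled_def)
  ultimately show R1: "riesz_basis_on V a {1..} (\<lambda>n. (1 / sqrt (\<mu> n)) *\<^sub>R \<phi> n)"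
    by simp
  define h where "h n = form_norm a (scaled \<phi> (\<lambda>_. 1) n)" for n
  have sV: "scaled \<phi> (\<lambda>_. 1) n \<in> V" if "n \<ge> 1" for n
    by (rule sys_V[OF K(1) sh, of 1 "\<lambda>_. 1" 1 n]) (use that in auto)
  have h: "h n = form_norm a (\<phi> n) / sqrt (\<mu> n)" if n: "n \<ge> 1" for n
  proof -
    have "\<phi> n = complex_of_real (sqrt (\<mu> n)) *\<^sub>C scaled \<phi> (\<lambda>_. 1) n"
      using mu_pos[OF n] by (simp add: scaled_def scaleC_of_real)
    then have "form_norm a (\<phi> n) = sqrt (\<mu> n) * h n"
      using form_norm_triangle(3)[OF sV[OF n], of "sqrt (\<mu> n)"] mu_pos[OF n] by (simp add: h_def)
    then show ?thesis using mu_pos[OF n] by simp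
  qed
  obtain e' S c C where S: "orthonormal_basis_on V a {1..} e'" "0 < c"
      "\<forall>u\<in>V. c * form_norm a u \<le> form_norm a (S u) \<and> form_norm a (S u) \<le> C * form_norm a u"
      "\<forall>i\<in>{1..}. (1 / sqrt (\<mu> i)) *\<^sub>R \<phi> i = S (e' i)"
    using R1 unfolding riesz_basis_on_def by (elim exE conjE) (rule that)
  have bounds: "c \<le> h n" "h n \<le> C" if n: "n \<ge> 1" for n
  proof -
    have "e' n \<in> V" "form_norm a (e' n) = 1"
      using S(1) n by (auto simp: orthonormal_basis_on_def form_norm_def)
    then show "c \<le> h n" "h n \<le> C"
      using S(3) S(4) n by (auto simp: h_def scaled_def)
  qed
  have C: "0 < C" using bounds[of 1] S(2) by simp
  have hpos: "0 < h n" if "n \<ge> 1" for n using bounds(1)[OF that] S(2) by simp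
  have "riesz_basis_on V a {1..} (scaled \<phi> (\<lambda>n. 1 / h n))"
  proof (rule R)
    show "0 < 1 / C" using C by simp
    show "1 / C \<le> 1 / h n" "1 / h n \<le> 1 / c" if "n \<ge> 1" for n
      using bounds[OF that] hpos[OF that] C S(2) by (auto intro!: divide_left_mono mult_pos_pos)
  qed
  then show "riesz_basis_on V a {1..} (\<lambda>n. (1 / form_norm a (\<phi> n)) *\<^sub>R \<phi> n)"
  proof (rule riesz_basis_on_cong[rotated])
    fix n :: nat assume "n \<in> {1..}"
    then have n: "n \<ge> 1" by simp
    show "scaled \<phi> (\<lambda>n. 1 / h n) n = (1 / form_norm a (\<phi> n)) *\<^sub>R \<phi> n"
      using mu_pos[OF n] by (simp add: scaled_def h[OF n])
  qed
qed

end

theorem theoremA12: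
  fixes V :: "'h :: {complex_hilbert, second_countable_topology} set"
    and a b :: "'h \<Rightarrow> 'h \<Rightarrow> complex"
    and \<mu> :: "nat \<Rightarrow> real" and \<psi> :: "nat \<Rightarrow> 'h"
    and \<gamma> \<kappa> \<alpha> M\<^sub>b :: real and N\<^sub>0 :: nat
  defines "A \<equiv> form_operator V a"
    and "T \<equiv> form_operator V (\<lambda>u v. a u v + b u v)"
  assumes V: "complex_vector.subspace V" "closure V = UNIV"
    and a: "sesquilinear_on V a" "hermitian_on V a" "positive_definite_on V a" "closed_form_on V a"
    and A: "has_compact_resolvent A"
    and psi: "orthonormal_basis_on UNIV cinner {1..} \<psi>"
      "\<And>k. k \<ge> 1 \<Longrightarrow> (\<psi> k, \<mu> k *\<^sub>R \<psi> k) \<in> A"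
    and mu: "0 < \<mu> 1" "\<And>k. k \<ge> 1 \<Longrightarrow> \<mu> k \<le> \<mu> (Suc k)"
    and b: "sesquilinear_on V b"
      "\<exists>C. \<forall>u\<in>V. \<forall>v\<in>V. cmod (b u v) \<le> C * form_norm a u * form_norm a v"
    and pos: "\<gamma> > 0" "\<kappa> > 0" "N\<^sub>0 > 0"
    and gap: "\<And>k. k \<ge> N\<^sub>0 \<Longrightarrow> \<mu> (Suc k) - \<mu> k \<ge> \<kappa> * real k powr (\<gamma> - 1)"
    and subord: "2 * \<alpha> + \<gamma> > 1" "M\<^sub>b > 0"
      "\<And>m n. m \<ge> 1 \<Longrightarrow> n \<ge> 1 \<Longrightarrow>
         cmod (b (\<psi> m) (\<psi> n)) \<le> M\<^sub>b * real m powr (- \<alpha>) * real n powr (- \<alpha>)"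
  shows "(\<exists>N \<phi>. root_system T \<kappa> \<gamma> \<mu> \<psi> N \<phi>) \<and>
         (\<forall>N \<phi>. root_system T \<kappa> \<gamma> \<mu> \<psi> N \<phi> \<longrightarrow>
            riesz_basis_on V a {1..} (\<lambda>n. (1 / sqrt (\<mu> n)) *\<^sub>R \<phi> n) \<and>
            riesz_basis_on V a {1..} (\<lambda>n. (1 / form_norm a (\<phi> n)) *\<^sub>R \<phi> n))"
proof -
  \<comment> \<open>the estimates are made for an exponent of at most \<open>1/2\<close>\<close>
  interpret P: perturbed_form \<mu> \<gamma> \<kappa> "min \<alpha> (1/2)" M\<^sub>b N\<^sub>0 \<psi> V a b
  proof
    show "2 * min \<alpha> (1 / 2) + \<gamma> > 1" using subord(1) pos(1) by (simp add: min_def)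
    show "min \<alpha> (1 / 2) \<le> 1 / 2" by simp
    fix m n :: nat assume mn: "m \<ge> 1" "n \<ge> 1"
    have "real m powr (- \<alpha>) \<le> real m powr (- min \<alpha> (1/2))" "real n powr (- \<alpha>) \<le> real n powr (- min \<alpha> (1/2))"
      using mn by (intro powr_mono; simp)+
    then have "M\<^sub>b * real m powr (- \<alpha>) * real n powr (- \<alpha>) \<le> M\<^sub>b * real m powr (- min \<alpha> (1/2)) * real n powr (- min \<alpha> (1/2))"
      using subord(2) by (intro mult_mono) auto
    then show "cmod (b (\<psi> m) (\<psi> n)) \<le> M\<^sub>b * real m powr (- min \<alpha> (1/2)) * real n powr (- min \<alpha> (1/2))"
      using subord(3)[OF mn] by simp
  qed (fact mu pos gap subord(2) V(1) a psi(1) psi(2)[unfolded A_def] b)+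
  have T: "T = P.T" unfolding T_def P.T_def ..
  obtain K where "P.far K"
    using P.eventually_far by (auto simp: eventually_sequentially)
  then show ?thesis
    unfolding T using P.root_system_exists P.Riesz_bases by blast
qed

end
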